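(* Let $N$ be a simply connected, connected step two nilpotent Lie group with center $Z$ which is square-integrable modulo its center and which is of the form $N=P\rtimes M$, where $P$ is a maximal commutative normal subgroup of $N$ containing $Z$, $M$ is a commutative subgroup acting non-trivially on $P$ by automorphisms, $P$ and $M$ are connected and simply connected, and $\dim(P/Z)=\dim(M)$. Let $\mathcal{H}$ be a multiplicity-free (closed, left-invariant) subspace of $L^2(N)$ with bounded spectrum. Then there exist a quasi-lattice $\Gamma\subset N$ and a function $\phi\in\mathcal{H}$ such that the system $\{L(\gamma)\phi:\gamma\in\Gamma\}$ forms a Parseval frame in $\mathcal{H}$.
   Context: $L$ is the left regular representation, $L(x)f(y)=f(x^{-1}y)$ on $L^2(N)$. A countable family $\{f_i\}_{i\in I}$ in a separable Hilbert space $\mathcal H$ is a Parseval frame in $\mathcal H$ if $\sum_i|\langle f,f_i\rangle|^2=\|f\|^2$ for all $f\in\mathcal H$. Quasi-lattice: a countable set $\Gamma\subset N$ is called a quasi-lattice if there is a relatively compact Borel set $C\subset N$ such that $\bigcup_{\gamma\in\Gamma}\gamma C=N$ and $\gamma C\cap\gamma' C$ is a Haar-null set for all distinct $\gamma,\gamma'\in\Gamma$. Plancherel transform. On the Lie algebra level, let $n=\dim\mathfrak n$ and $d=\dim M$; $\mathfrak n=\mathfrak z\oplus\mathfrak m_1\oplus\mathfrak m$ where $\mathfrak z$ is the center, with basis $Z_1,\dots,Z_{n-2d}$, $\mathfrak z\oplus\mathfrak m_1$ is the Lie algebra of $P$, with $\mathfrak m_1=\mathrm{span}\{Y_1,\dots,Y_d\}$,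 and $\mathfrak m=\mathrm{span}\{X_1,\dots,X_d\}$ is the (commutative) Lie algebra of $M$; $[\mathfrak n,\mathfrak n]\subset\mathfrak z$. For $\lambda\in\mathfrak n^*$ let $B(\lambda)=\big[-\lambda([X_i,Y_j])\big]_{1\le i,j\le d}$. Square-integrability modulo the center means that $\det B(\lambda)$ is not identically zero. Let $\Sigma=\{\lambda\in\mathfrak n^*:\lambda|_{\mathfrak m_1\oplus\mathfrak m}=0,\ \det B(\lambda)\ne0\}$, identified with an open co-null subset of $\mathbb R^{n-2d}$ via $\lambda_k=\lambda(Z_k)$. For $\lambda\in\Sigma$, $\pi_\lambda$ is the irreducible unitary representation of $N$ on $L^2(\mathbb R^d)$ given by $$\pi_\lambda\Big(\exp(\textstyle\sum z_kZ_k)\exp(\sum y_jY_j)\exp(\sum t_jX_j)\Big)F(x)=e^{2\pi i\sum_k\lambda_kz_k}e^{2\pi i\langle x,B(\lambda)y\rangle}F(x-t).$$ Haar measure on $N$ is Lebesgue measure in the coordinates $(z,y,t)$ and $d\mu(\lambda)=|\det B(\lambda)|\,d\lambda$ on $\Sigma$. The Plancherel transform $\mathcal P:L^2(N)\to\int_\Sigma^\oplus L^2(\mathbb R^d)\otimes L^2(\mathbb R^d)\,d\mu(\lambda)$ is the unitary extension of $f\mapsto\big(\int_Nf(n)\pi_\lambda(n)\,dn\big)_\lambda$, $f\in L^1(N)\cap L^2(N)$ (with $L^2(\mathbb R^d)\otimes L^2(\mathbb R^d)$ the Hilbert–Schmidt operators, $f\otimes u$ being the operator $h\mapsto\langle h,u\rangle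 f$); it intertwines $L$ with $\int^\oplus_\Sigma\pi_\lambda\otimes\mathbf 1\,d\mu(\lambda)$. Every closed left-invariant subspace $\mathcal H$ of $L^2(N)$ has the form $\mathcal P(\mathcal H)=\int^\oplus_\Sigma L^2(\mathbb R^d)\otimes P_\lambda(L^2(\mathbb R^d))\,d\mu(\lambda)$ for a measurable field of orthogonal projections $P_\lambda$. $\mathcal H$ is multiplicity-free if $\mathrm{rank}\,P_\lambda\le1$ for a.e. $\lambda$; it has bounded spectrum (is band-limited) if $P_\lambda=0$ for a.e. $\lambda$ outside some bounded measurable subset of $\Sigma$. *)

theory Defs
  imports "HOL-Analysis.Analysis" "HOL-Algebra.Coset"
begin

section \<open>Square-integrable functions\<close>

text \<open>
  Elements of an \<open>L\<^sup>2\<close> space are represented by measurable functions. A closed subspace is a set of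
  representatives; it is automatically saturated under equality almost everywhere, since constant
  sequences are allowed in the closedness condition.
\<close>

definition L2 :: "'a measure \<Rightarrow> ('a \<Rightarrow> complex) set" where
  "L2 M = {f \<in> borel_measurable M. integrable M (\<lambda>x. (cmod (f x))\<^sup>2)}"

definition L2_inner :: "'a measure \<Rightarrow> ('a \<Rightarrow> complex) \<Rightarrow> ('a \<Rightarrow> complex) \<Rightarrow> complex" where
  "L2_inner M f g = (\<integral>x. f x * cnj (g x) \<partial>M)"

definition L2_norm :: "'a measure \<Rightarrow> ('a \<Rightarrow> complex) \<Rightarrow> real" where
  "L2_norm M f = sqrt (\<integral>x. (cmod (f x))\<^sup>2 \<partial>M)"

definition L2_converges :: "'a measure \<Rightarrow> (nat \<Rightarrow> 'a \<Rightarrow> complex) \<Rightarrow> ('a \<Rightarrow> complex) \<Rightarrow> bool" where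
  "L2_converges M fs f \<longleftrightarrow> (\<lambda>n. L2_norm M (\<lambda>x. fs n x - f x)) \<longlonglongrightarrow> 0"

definition L2_closed_subspace :: "'a measure \<Rightarrow> ('a \<Rightarrow> complex) set \<Rightarrow> bool" where
  "L2_closed_subspace M H \<longleftrightarrow>
     H \<subseteq> L2 M \<and> (\<lambda>x. 0) \<in> H \<and>
     (\<forall>f\<in>H. \<forall>g\<in>H. (\<lambda>x. f x + g x) \<in> H) \<and>
     (\<forall>c. \<forall>f\<in>H. (\<lambda>x. c * f x) \<in> H) \<and>
     (\<forall>fs f. (\<forall>n. fs n \<in> H) \<and> f \<in> L2 M \<and> L2_converges M fs f \<longrightarrow> f \<in> H)"

definition parseval_frame ::
    "'a measure \<Rightarrow> ('a \<Rightarrow> complex) set \<Rightarrow> 'i set \<Rightarrow> ('i \<Rightarrow> 'a \<Rightarrow> complex) \<Rightarrow> bool" where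
  "parseval_frame M H I f \<longleftrightarrow>
     countable I \<and> (\<forall>i\<in>I. f i \<in> H) \<and>
     (\<forall>g\<in>H. ((\<lambda>i. (cmod (L2_inner M g (f i)))\<^sup>2) has_sum (L2_norm M g)\<^sup>2) I)"

definition orthogonal_projection ::
    "'a measure \<Rightarrow> (('a \<Rightarrow> complex) \<Rightarrow> 'a \<Rightarrow> complex) \<Rightarrow> bool" where
  "orthogonal_projection M T \<longleftrightarrow>
     (\<forall>F\<in>L2 M. T F \<in> L2 M) \<and>
     (\<forall>F\<in>L2 M. \<forall>G\<in>L2 M. \<forall>a b. AE x in M. T (\<lambda>y. a * F y + b * G y) x = a * T F x + b * T G x) \<and>
     (\<forall>F\<in>L2 M. AE x in M. T (T F) x = T F x) \<and>
     (\<forall>F\<in>L2 M. \<forall>G\<in>L2 M. L2_inner M (T F) G = L2_inner M F (T G))"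

definition rank_le_one :: "'a measure \<Rightarrow> (('a \<Rightarrow> complex) \<Rightarrow> 'a \<Rightarrow> complex) \<Rightarrow> bool" where
  "rank_le_one M T \<longleftrightarrow> (\<exists>u\<in>L2 M. \<forall>F\<in>L2 M. \<exists>c. AE x in M. T F x = c * u x)"

definition zero_operator :: "'a measure \<Rightarrow> (('a \<Rightarrow> complex) \<Rightarrow> 'a \<Rightarrow> complex) \<Rightarrow> bool" where
  "zero_operator M T \<longleftrightarrow> (\<forall>F\<in>L2 M. AE x in M. T F x = 0)"


section \<open>Two-step nilpotent Lie groups\<close>

text \<open>
  The Lie algebra is the type \<open>'n\<close> with the given bracket (its inner product plays no role).
  For a two-step nilpotent Lie algebra the Baker--Campbell--Hausdorff series terminates, and the
  resulting identity for \<open>exp\<close> holds globally. It determines the Lie group structure near the unit,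
  because \<open>exp\<close> is a chart there. The exponential map need be neither injective nor surjective
  on a group that is not simply connected or not connected.
\<close>

record ('a, 'n) lie_group = "'a monoid" +
  bracket :: "'n \<Rightarrow> 'n \<Rightarrow> 'n"
  lexp :: "'n \<Rightarrow> 'a"

locale two_step_nilpotent_lie_group = group N
  for N :: "('a::t2_space, 'n::euclidean_space, 'b) lie_group_scheme" (structure) +
  assumes carrier_UNIV: "carrier N = UNIV"
    and continuous_mult: "continuous_on UNIV (\<lambda>(x, y). x \<otimes> y)"
    and continuous_inverse: "continuous_on UNIV (\<lambda>x. inv\<^bsub>N\<^esub> x)"
    and bilinear_bracket: "bilinear (bracket N)"
    and bracket_self: "bracket N u u = 0"
    and jacobi: "bracket N u (bracket N v w) + bracket N v (bracket N w u)
                   + bracket N w (bracket N u v) = 0"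
    and two_step: "bracket N (bracket N u v) w = 0"
    and not_abelian: "\<exists>u v. bracket N u v \<noteq> 0"
    and continuous_exp: "continuous_on UNIV (lexp N)"
    and exp_chart: "\<exists>U V g. open U \<and> 0 \<in> U \<and> open V \<and> homeomorphism U V (lexp N) g"
    and exp_mult: "lexp N u \<otimes> lexp N v = lexp N (u + v + (1/2) *\<^sub>R bracket N u v)"

definition group_center :: "('a, 'm) monoid_scheme \<Rightarrow> 'a set" where
  "group_center N = {z \<in> carrier N. \<forall>x\<in>carrier N. z \<otimes>\<^bsub>N\<^esub> x = x \<otimes>\<^bsub>N\<^esub> z}"

definition commutative_set :: "('a, 'm) monoid_scheme \<Rightarrow> 'a set \<Rightarrow> bool" where
  "commutative_set N H \<longleftrightarrow> (\<forall>x\<in>H. \<forall>y\<in>H. x \<otimes>\<^bsub>N\<^esub> y = y \<otimes>\<^bsub>N\<^esub> x)"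

definition maximal_commutative_normal :: "('a, 'm) monoid_scheme \<Rightarrow> 'a set \<Rightarrow> bool" where
  "maximal_commutative_normal N P \<longleftrightarrow>
     normal P N \<and> commutative_set N P \<and>
     (\<forall>Q. normal Q N \<and> commutative_set N Q \<and> P \<subseteq> Q \<longrightarrow> Q = P)"

text \<open>The internal semidirect product \<open>N = P \<rtimes> M\<close> of topological groups.\<close>

definition semidirect_product ::
    "('a::topological_space, 'm) monoid_scheme \<Rightarrow> 'a set \<Rightarrow> 'a set \<Rightarrow> bool" where
  "semidirect_product N P M \<longleftrightarrow>
     normal P N \<and> subgroup M N \<and>
     (\<exists>h. homeomorphism (P \<times> M) (carrier N) (\<lambda>(p, m). p \<otimes>\<^bsub>N\<^esub> m) h)"

definition acts_nontrivially :: "('a, 'm) monoid_scheme \<Rightarrow> 'a set \<Rightarrow> 'a set \<Rightarrow> bool" where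
  "acts_nontrivially N M P \<longleftrightarrow>
     (\<exists>m\<in>M. \<exists>p\<in>P. m \<otimes>\<^bsub>N\<^esub> p \<otimes>\<^bsub>N\<^esub> inv\<^bsub>N\<^esub> m \<noteq> p)"

definition lie_algebra_of ::
    "('a, 'n::real_vector, 'b) lie_group_scheme \<Rightarrow> 'a set \<Rightarrow> 'n set" where
  "lie_algebra_of N H = {v. \<forall>s::real. lexp N (s *\<^sub>R v) \<in> H}"


section \<open>Adapted coordinates\<close>

text \<open>
  The group is equipped with a basis \<open>Z\<^sub>k, Y\<^sub>j, X\<^sub>i\<close> of its Lie algebra. The cardinality of \<open>'d\<close> is
  the dimension of \<open>M\<close>, that of \<open>'k\<close> the dimension of the center.
\<close>

record ('a, 'n, 'k, 'd) based_lie_group = "('a, 'n) lie_group" +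
  Zb :: "'k \<Rightarrow> 'n"
  Yb :: "'d \<Rightarrow> 'n"
  Xb :: "'d \<Rightarrow> 'n"

type_synonym ('k, 'd) coords = "(real^'k) \<times> (real^'d) \<times> (real^'d)"

definition lin_comb :: "('i::finite \<Rightarrow> 'n::real_vector) \<Rightarrow> real^'i \<Rightarrow> 'n" where
  "lin_comb b c = (\<Sum>i\<in>UNIV. c $ i *\<^sub>R b i)"

definition algebra_coords ::
    "('a, 'n::euclidean_space, 'k::finite, 'd::finite) based_lie_group \<Rightarrow> ('k, 'd) coords \<Rightarrow> 'n" where
  "algebra_coords N = (\<lambda>(z, y, t). lin_comb (Zb N) z + lin_comb (Yb N) y + lin_comb (Xb N) t)"

definition adapted_basis ::
    "('a, 'n::euclidean_space, 'k::finite, 'd::finite) based_lie_group \<Rightarrow> 'a set \<Rightarrow> 'a set \<Rightarrow> bool" where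
  "adapted_basis N P M \<longleftrightarrow>
     bij (algebra_coords N) \<and>
     span (range (Zb N)) = lie_algebra_of N (group_center N) \<and>
     span (range (Zb N) \<union> range (Yb N)) = lie_algebra_of N P \<and>
     span (range (Xb N)) = lie_algebra_of N M"

definition group_coords ::
    "('a, 'n::euclidean_space, 'k::finite, 'd::finite) based_lie_group \<Rightarrow> ('k, 'd) coords \<Rightarrow> 'a" where
  "group_coords N = (\<lambda>(z, y, t).
     lexp N (lin_comb (Zb N) z) \<otimes>\<^bsub>N\<^esub> lexp N (lin_comb (Yb N) y) \<otimes>\<^bsub>N\<^esub> lexp N (lin_comb (Xb N) t))"

definition haar ::
    "('a::topological_space, 'n::euclidean_space, 'k::finite, 'd::finite) based_lie_group \<Rightarrow> 'a measure" where
  "haar N = distr lborel borel (group_coords N)"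

definition Bform ::
    "('a, 'n::euclidean_space, 'k::finite, 'd::finite) based_lie_group \<Rightarrow> ('n \<Rightarrow> real) \<Rightarrow> real^'d^'d" where
  "Bform N l = (\<chi> i j. - l (bracket N (Xb N i) (Yb N j)))"

definition square_integrable_mod_center ::
    "('a, 'n::euclidean_space, 'k::finite, 'd::finite) based_lie_group \<Rightarrow> bool" where
  "square_integrable_mod_center N \<longleftrightarrow> (\<exists>l. linear l \<and> det (Bform N l) \<noteq> 0)"

text \<open>
  A point \<open>\<lambda>\<close> of \<open>real^'k\<close> stands for the functional that vanishes on all \<open>Y\<^sub>j\<close> and \<open>X\<^sub>i\<close> and takes the
  value \<open>\<lambda> $ k\<close> at \<open>Z\<^sub>k\<close>.
\<close>

definition functional ::
    "('a, 'n::euclidean_space, 'k::finite, 'd::finite) based_lie_group \<Rightarrow> real^'k \<Rightarrow> 'n \<Rightarrow> real" where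
  "functional N l v = inner l (fst (inv_into UNIV (algebra_coords N) v))"

definition Bmat ::
    "('a, 'n::euclidean_space, 'k::finite, 'd::finite) based_lie_group \<Rightarrow> real^'k \<Rightarrow> real^'d^'d" where
  "Bmat N l = Bform N (functional N l)"

definition Sigma_set ::
    "('a, 'n::euclidean_space, 'k::finite, 'd::finite) based_lie_group \<Rightarrow> (real^'k) set" where
  "Sigma_set N = {l. det (Bmat N l) \<noteq> 0}"

text \<open>The density vanishes off \<open>Sigma_set N\<close>, so this measure lives on that set.\<close>

definition plancherel_measure ::
    "('a, 'n::euclidean_space, 'k::finite, 'd::finite) based_lie_group \<Rightarrow> (real^'k) measure" where
  "plancherel_measure N = density lborel (\<lambda>l. ennreal \<bar>det (Bmat N l)\<bar>)"


section \<open>Representations and the Plancherel transform\<close>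

definition left_regular :: "('a, 'm) monoid_scheme \<Rightarrow> 'a \<Rightarrow> ('a \<Rightarrow> complex) \<Rightarrow> 'a \<Rightarrow> complex" where
  "left_regular N x f = (\<lambda>y. f (inv\<^bsub>N\<^esub> x \<otimes>\<^bsub>N\<^esub> y))"

definition rep ::
    "('a, 'n::euclidean_space, 'k::finite, 'd::finite) based_lie_group \<Rightarrow> real^'k \<Rightarrow> 'a
      \<Rightarrow> (real^'d \<Rightarrow> complex) \<Rightarrow> real^'d \<Rightarrow> complex" where
  "rep N l g F = (case inv_into UNIV (group_coords N) g of (z, y, t) \<Rightarrow>
     (\<lambda>x. cis (2 * pi * inner l z) * cis (2 * pi * inner x (Bmat N l *v y)) * F (x - t)))"

text \<open>
  Hilbert--Schmidt operators on \<open>L\<^sup>2(\<real>\<^sup>d)\<close> are represented by their square-integrable kernels; this is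
  isometric for the Hilbert--Schmidt norm. The operator \<open>h \<mapsto> \<langle>h, u\<rangle> f\<close> has kernel \<open>tensor f u\<close>.
\<close>

definition kernel_operator ::
    "((real^'d) \<times> (real^'d) \<Rightarrow> complex) \<Rightarrow> (real^'d::finite \<Rightarrow> complex) \<Rightarrow> real^'d \<Rightarrow> complex" where
  "kernel_operator k F = (\<lambda>x. \<integral>w. k (x, w) * F w \<partial>lborel)"

definition tensor ::
    "(real^'d \<Rightarrow> complex) \<Rightarrow> (real^'d \<Rightarrow> complex) \<Rightarrow> (real^'d) \<times> (real^'d) \<Rightarrow> complex" where
  "tensor f u = (\<lambda>(x, w). f x * cnj (u w))"

definition L2_tensor ::
    "(real^'d::finite \<Rightarrow> complex) set \<Rightarrow> ((real^'d) \<times> (real^'d) \<Rightarrow> complex) set" where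
  "L2_tensor V = L2_closed_subspace lborel hull {tensor f u | f u. f \<in> L2 lborel \<and> u \<in> V}"

text \<open>
  The operator \<open>\<integral> f(n) \<pi>\<^sub>\<lambda>(n) dn\<close>, understood in the weak sense, is the one with kernel \<open>k\<close>.
\<close>

definition group_fourier_kernel ::
    "('a::topological_space, 'n::euclidean_space, 'k::finite, 'd::finite) based_lie_group
      \<Rightarrow> ('a \<Rightarrow> complex) \<Rightarrow> real^'k \<Rightarrow> ((real^'d) \<times> (real^'d) \<Rightarrow> complex) \<Rightarrow> bool" where
  "group_fourier_kernel N f l k \<longleftrightarrow>
     k \<in> L2 lborel \<and>
     (\<forall>F\<in>L2 lborel. \<forall>G\<in>L2 lborel.
        (\<integral>n. f n * L2_inner lborel (rep N l n F) G \<partial>haar N) = L2_inner lborel (kernel_operator k F) G)"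

text \<open>
  The direct integral of the constant field of Hilbert--Schmidt operators over the Plancherel measure
  is the space \<open>L2 (field_measure N)\<close> of jointly measurable fields of kernels.
\<close>

definition field_measure ::
    "('a, 'n::euclidean_space, 'k::finite, 'd::finite) based_lie_group \<Rightarrow> ('k, 'd) coords measure" where
  "field_measure N = plancherel_measure N \<Otimes>\<^sub>M lborel"

text \<open>
  The graph of the Plancherel transform: the continuous extension to \<open>L\<^sup>2(N)\<close> of the operator-valued
  transform on \<open>L\<^sup>1(N) \<inter> L\<^sup>2(N)\<close>.
\<close>

definition plancherel_transform ::
    "('a::topological_space, 'n::euclidean_space, 'k::finite, 'd::finite) based_lie_group
      \<Rightarrow> ('a \<Rightarrow> complex) \<Rightarrow> (('k, 'd) coords \<Rightarrow> complex) \<Rightarrow> bool" where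
  "plancherel_transform N f K \<longleftrightarrow>
     f \<in> L2 (haar N) \<and> K \<in> L2 (field_measure N) \<and>
     (\<exists>fs Ks.
        (\<forall>n. integrable (haar N) (fs n) \<and> fs n \<in> L2 (haar N) \<and> Ks n \<in> L2 (field_measure N) \<and>
             (AE l in plancherel_measure N. group_fourier_kernel N (fs n) l (\<lambda>p. Ks n (l, p)))) \<and>
        L2_converges (haar N) fs f \<and> L2_converges (field_measure N) Ks K)"


section \<open>Left-invariant subspaces\<close>

definition left_invariant :: "('a, 'm) monoid_scheme \<Rightarrow> ('a \<Rightarrow> complex) set \<Rightarrow> bool" where
  "left_invariant N H \<longleftrightarrow> (\<forall>x\<in>carrier N. \<forall>f\<in>H. left_regular N x f \<in> H)"

definition measurable_projection_field ::
    "('a, 'n::euclidean_space, 'k::finite, 'd::finite) based_lie_group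
      \<Rightarrow> (real^'k \<Rightarrow> (real^'d \<Rightarrow> complex) \<Rightarrow> real^'d \<Rightarrow> complex) \<Rightarrow> bool" where
  "measurable_projection_field N P \<longleftrightarrow>
     (\<forall>l\<in>Sigma_set N. orthogonal_projection lborel (P l)) \<and>
     (\<forall>F\<in>L2 lborel. \<forall>G\<in>L2 lborel.
        (\<lambda>l. L2_inner lborel (P l F) G) \<in> borel_measurable (restrict_space borel (Sigma_set N)))"

text \<open>The image of \<open>H\<close> is the direct integral of the spaces \<open>L\<^sup>2(\<real>\<^sup>d) \<otimes> P\<^sub>\<lambda>(L\<^sup>2(\<real>\<^sup>d))\<close>.\<close>

definition spectral_field ::
    "('a::topological_space, 'n::euclidean_space, 'k::finite, 'd::finite) based_lie_group
      \<Rightarrow> ('a \<Rightarrow> complex) set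
      \<Rightarrow> (real^'k \<Rightarrow> (real^'d \<Rightarrow> complex) \<Rightarrow> real^'d \<Rightarrow> complex) \<Rightarrow> bool" where
  "spectral_field N H P \<longleftrightarrow>
     measurable_projection_field N P \<and>
     {K. \<exists>f\<in>H. plancherel_transform N f K} =
     {K \<in> L2 (field_measure N).
        AE l in plancherel_measure N. (\<lambda>p. K (l, p)) \<in> L2_tensor (P l ` L2 lborel)}"

definition multiplicity_free ::
    "('a::topological_space, 'n::euclidean_space, 'k::finite, 'd::finite) based_lie_group
      \<Rightarrow> ('a \<Rightarrow> complex) set \<Rightarrow> bool" where
  "multiplicity_free N H \<longleftrightarrow>
     (\<exists>P. spectral_field N H P \<and> (AE l in plancherel_measure N. rank_le_one lborel (P l)))"

definition bounded_spectrum ::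
    "('a::topological_space, 'n::euclidean_space, 'k::finite, 'd::finite) based_lie_group
      \<Rightarrow> ('a \<Rightarrow> complex) set \<Rightarrow> bool" where
  "bounded_spectrum N H \<longleftrightarrow>
     (\<exists>P. spectral_field N H P \<and>
        (\<exists>E. E \<in> sets lebesgue \<and> bounded E \<and> E \<subseteq> Sigma_set N \<and>
             (AE l in plancherel_measure N. l \<notin> E \<longrightarrow> zero_operator lborel (P l))))"


section \<open>Quasi-lattices\<close>

definition quasi_lattice ::
    "('a::topological_space, 'n::euclidean_space, 'k::finite, 'd::finite) based_lie_group
      \<Rightarrow> 'a set \<Rightarrow> bool" where
  "quasi_lattice N \<Gamma> \<longleftrightarrow>
     countable \<Gamma> \<and> \<Gamma> \<subseteq> carrier N \<and>
     (\<exists>C. C \<in> sets borel \<and> compact (closure C) \<and>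
        (\<Union>\<gamma>\<in>\<Gamma>. (\<lambda>c. \<gamma> \<otimes>\<^bsub>N\<^esub> c) ` C) = carrier N \<and>
        (\<forall>\<gamma>\<in>\<Gamma>. \<forall>\<gamma>'\<in>\<Gamma>. \<gamma> \<noteq> \<gamma>' \<longrightarrow>
           ((\<lambda>c. \<gamma> \<otimes>\<^bsub>N\<^esub> c) ` C) \<inter> ((\<lambda>c. \<gamma>' \<otimes>\<^bsub>N\<^esub> c) ` C) \<in> null_sets (haar N)))"

end

(*
  On the Plancherel side a multiplicity-free space is the set of fields of kernels v_l(x) * cnj (u_l(w))
  with a fixed measurable field of unit (or zero) vectors u_l, supported on a bounded set of l. With
  the normalised indicator f_0 of a small cube as window, take phi with transform
  1_ball(l) f_0(x) * cnj (u_l(w)). In coordinates (z, y, t), pairing with the translate of phi by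
  (a m, j, c n), for integer vectors m, j, n, gives the m-th Fourier coefficient in l (scaled by a) of

      |det B(l)| 1_ball(l) * (integral of v_l(x) f_0(x - c n) exp(-2 pi i <x, B(l) j>) dx).

  Parseval for Fourier series in l sums over m, Parseval in the variable B(l)^T x sums over j (the
  change of variables produces the factor 1 / |det B(l)|), and the translates of the cube by c n tile
  the space. The group elements with coordinates (a m, j, c n) form a quasi-lattice because the group
  law in these coordinates is a sheared translation.
*)

theory Submission
  imports Defs
begin

section \<open>Square-integrable functions\<close>

text \<open>The squared Fourier coefficients in l carry |det B(l)| twice, since the Plancherel
  density enters before squaring. The substitution B(l)^T x absorbs one factor for every l at once,
  and the other is the density in the norm of the transform. Fixed steps a and c are possible
  because B(l) is linear in l, hence bounded on the ball. The amplitude of the window, the square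
  root of a to the dimension of the center, cancels the factor left by Parseval in l, so the frame
  constant is exactly 1. Global coordinates have to be constructed, because exp is given only as a
  local chart: simple connectedness enters by lifting a contraction of a loop through exp. The
  Plancherel transform is given as the closure of a relation; its kernel is computed explicitly,
  which turns it into an isometry defined on all of L2(N). That the chosen field is the transform of
  an element of H comes from the description of the image of H in \<open>spectral_field\<close>.
  Projection fields are only weakly measurable and act on representatives, so a jointly measurable
  choice of the u_l is a construction of its own.\<close>

lemma borel_measurable_cnj[measurable (raw)]:
  "f \<in> borel_measurable M \<Longrightarrow> (\<lambda>x. cnj (f x)) \<in> borel_measurable M"
  by (rule measurable_compose[of f M borel cnj])
    (auto intro: borel_measurable_continuous_onI continuous_intros)

lemma L2_measurable[measurable_dest]: "f \<in> L2 M \<Longrightarrow> f \<in> borel_measurable M"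
  by (simp add: L2_def)

lemma L2I:
  assumes "f \<in> borel_measurable M" "(\<integral>\<^sup>+x. ennreal ((cmod (f x))\<^sup>2) \<partial>M) < \<infinity>"
  shows "f \<in> L2 M"
  unfolding L2_def using assms by (auto intro!: integrableI_bounded)

lemma L2_norm_nonneg[simp]: "0 \<le> L2_norm M f"
  by (simp add: L2_norm_def)

lemma L2_norm_sq: "(L2_norm M f)\<^sup>2 = (\<integral>x. (cmod (f x))\<^sup>2 \<partial>M)"
  by (simp add: L2_norm_def)

lemma nn_integral_L2:
  assumes "f \<in> L2 M"
  shows "(\<integral>\<^sup>+x. ennreal ((cmod (f x))\<^sup>2) \<partial>M) = ennreal ((L2_norm M f)\<^sup>2)"
  unfolding L2_norm_sq using assms by (intro nn_integral_eq_integral) (auto simp: L2_def)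

lemma L2_norm_leI:
  assumes "f \<in> borel_measurable M" "(\<integral>\<^sup>+x. ennreal ((cmod (f x))\<^sup>2) \<partial>M) \<le> ennreal (C\<^sup>2)" "0 \<le> C"
  shows "f \<in> L2 M" "L2_norm M f \<le> C"
proof -
  show "f \<in> L2 M" using assms by (intro L2I) (auto intro: le_less_trans)
  then have "ennreal ((L2_norm M f)\<^sup>2) \<le> ennreal (C\<^sup>2)" using assms nn_integral_L2 by metis
  then have "(L2_norm M f)\<^sup>2 \<le> C\<^sup>2" by (simp add: ennreal_le_iff)
  then show "L2_norm M f \<le> C" using assms(3) power2_le_imp_le by blast
qed

lemma L2_cong_AE:
  assumes "f \<in> L2 M" "g \<in> borel_measurable M" "AE x in M. f x = g x"
  shows "g \<in> L2 M"
proof (rule L2I[OF assms(2)])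
  have "(\<integral>\<^sup>+x. ennreal ((cmod (g x))\<^sup>2) \<partial>M) = (\<integral>\<^sup>+x. ennreal ((cmod (f x))\<^sup>2) \<partial>M)"
    by (rule nn_integral_cong_AE) (use assms(3) in auto)
  then show "(\<integral>\<^sup>+x. ennreal ((cmod (g x))\<^sup>2) \<partial>M) < \<infinity>" using nn_integral_L2[OF assms(1)] by simp
qed

lemma L2_norm_cong_AE:
  assumes "f \<in> borel_measurable M" "g \<in> borel_measurable M" "AE x in M. f x = g x"
  shows "L2_norm M f = L2_norm M g"
  unfolding L2_norm_def by (intro arg_cong[of _ _ sqrt] integral_cong_AE) (use assms in auto)

lemma L2_inner_cong_AE:
  assumes "f \<in> borel_measurable M" "g \<in> borel_measurable M" "AE x in M. f x = g x"
    and "f' \<in> borel_measurable M" "g' \<in> borel_measurable M" "AE x in M. f' x = g' x"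
  shows "L2_inner M f f' = L2_inner M g g'"
  unfolding L2_inner_def by (intro integral_cong_AE) (use assms in auto)

lemma L2_zero[simp]: "(\<lambda>x. 0) \<in> L2 M"
  by (rule L2I) auto

lemma L2_scale[intro]:
  assumes "f \<in> L2 M" shows "(\<lambda>x. c * f x) \<in> L2 M"
  using assms by (auto simp: L2_def norm_mult power_mult_distrib)

lemma L2_add[intro]:
  assumes f: "f \<in> L2 M" and g: "g \<in> L2 M" shows "(\<lambda>x. f x + g x) \<in> L2 M"
proof -
  have "integrable M (\<lambda>x. 2 * (cmod (f x))\<^sup>2 + 2 * (cmod (g x))\<^sup>2)"
    using f g by (auto simp: L2_def)
  moreover have "(cmod (a + b))\<^sup>2 \<le> 2 * (cmod a)\<^sup>2 + 2 * (cmod b)\<^sup>2" for a b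
  proof -
    have "(cmod (a + b))\<^sup>2 \<le> (cmod a + cmod b)\<^sup>2" by (intro power_mono norm_triangle_ineq) auto
    also have "\<dots> \<le> 2 * (cmod a)\<^sup>2 + 2 * (cmod b)\<^sup>2"
      using sum_squares_bound[of "cmod a" "cmod b"] by (simp add: power2_sum)
    finally show ?thesis .
  qed
  ultimately show ?thesis
    using f g unfolding L2_def by (auto intro: Bochner_Integration.integrable_bound[where f="\<lambda>x. 2 * (cmod (f x))\<^sup>2 + 2 * (cmod (g x))\<^sup>2"])
qed

lemma L2_uminus[intro]: "f \<in> L2 M \<Longrightarrow> (\<lambda>x. - f x) \<in> L2 M"
  using L2_scale[of f M "-1"] by simp

lemma L2_diff[intro]: "f \<in> L2 M \<Longrightarrow> g \<in> L2 M \<Longrightarrow> (\<lambda>x. f x - g x) \<in> L2 M"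
  using L2_add[OF _ L2_uminus, of f M g] by simp

lemma L2_sum[intro]: "(\<And>i. i \<in> I \<Longrightarrow> f i \<in> L2 M) \<Longrightarrow> (\<lambda>x. \<Sum>i\<in>I. f i x) \<in> L2 M"
  by (induction I rule: infinite_finite_induct) auto

lemma L2_bound:
  assumes "f \<in> L2 M" "g \<in> borel_measurable M" "\<And>x. cmod (g x) \<le> cmod (f x)"
  shows "g \<in> L2 M" "L2_norm M g \<le> L2_norm M f"
proof -
  have "(\<integral>\<^sup>+x. ennreal ((cmod (g x))\<^sup>2) \<partial>M) \<le> (\<integral>\<^sup>+x. ennreal ((cmod (f x))\<^sup>2) \<partial>M)"
    by (intro nn_integral_mono ennreal_leI power_mono) (use assms in auto)
  also have "\<dots> = ennreal ((L2_norm M f)\<^sup>2)" by (rule nn_integral_L2) fact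
  finally show "g \<in> L2 M" "L2_norm M g \<le> L2_norm M f" using L2_norm_leI[OF assms(2)] by auto
qed

lemma L2_nn_Cauchy_Schwarz:
  assumes f: "f \<in> L2 M" and g: "g \<in> L2 M"
  shows "(\<integral>\<^sup>+x. ennreal (cmod (f x) * cmod (g x)) \<partial>M) \<le> ennreal (L2_norm M f * L2_norm M g)"
proof -
  have "(\<integral>\<^sup>+x. ennreal (cmod (f x) * cmod (g x)) \<partial>M)\<^sup>2
        = (\<integral>\<^sup>+x. ennreal (cmod (f x)) * ennreal (cmod (g x)) \<partial>M)\<^sup>2" by (simp add: ennreal_mult)
  also have "\<dots> \<le> (\<integral>\<^sup>+x. (ennreal (cmod (f x)))\<^sup>2 \<partial>M) * (\<integral>\<^sup>+x. (ennreal (cmod (g x)))\<^sup>2 \<partial>M)"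
    by (rule Cauchy_Schwarz_nn_integral) (use f g in auto)
  also have "\<dots> = ennreal ((L2_norm M f)\<^sup>2) * ennreal ((L2_norm M g)\<^sup>2)"
    using nn_integral_L2[OF f] nn_integral_L2[OF g] by (simp add: ennreal_power)
  also have "\<dots> = (ennreal (L2_norm M f * L2_norm M g))\<^sup>2"
    by (simp add: ennreal_mult' ennreal_power power_mult_distrib)
  finally have sq: "(\<integral>\<^sup>+x. ennreal (cmod (f x) * cmod (g x)) \<partial>M)\<^sup>2 \<le> (ennreal (L2_norm M f * L2_norm M g))\<^sup>2" .
  show ?thesis
  proof (cases "\<integral>\<^sup>+x. ennreal (cmod (f x) * cmod (g x)) \<partial>M")
    case (real r)
    then have "r\<^sup>2 \<le> (L2_norm M f * L2_norm M g)\<^sup>2" using sq by (simp add: ennreal_power ennreal_le_iff)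
    then have "r \<le> L2_norm M f * L2_norm M g" by (rule power2_le_imp_le) simp
    then show ?thesis using real by (simp add: ennreal_leI)
  next
    case top
    then show ?thesis using sq by (simp add: ennreal_power top_unique)
  qed
qed

lemma L2_mult_integrable:
  assumes f: "f \<in> L2 M" and g: "g \<in> L2 M"
  shows "integrable M (\<lambda>x. f x * cnj (g x))" "integrable M (\<lambda>x. f x * g x)"
proof -
  have "(\<integral>\<^sup>+x. ennreal (cmod (f x) * cmod (g x)) \<partial>M) < \<infinity>"
    using L2_nn_Cauchy_Schwarz[OF f g] le_less_trans by fastforce
  then show "integrable M (\<lambda>x. f x * cnj (g x))" "integrable M (\<lambda>x. f x * g x)"
    using f g by (auto intro!: integrableI_bounded simp: norm_mult)
qed

lemma L2_Cauchy_Schwarz: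
  assumes f: "f \<in> L2 M" and g: "g \<in> L2 M"
  shows "cmod (L2_inner M f g) \<le> L2_norm M f * L2_norm M g"
proof -
  have "ennreal (cmod (L2_inner M f g)) \<le> (\<integral>\<^sup>+x. ennreal (cmod (f x * cnj (g x))) \<partial>M)"
    unfolding L2_inner_def by (rule integral_norm_bound_ennreal) (rule L2_mult_integrable[OF f g])
  also have "\<dots> \<le> ennreal (L2_norm M f * L2_norm M g)"
    using L2_nn_Cauchy_Schwarz[OF f g] by (simp add: norm_mult)
  finally show ?thesis by (simp add: ennreal_le_iff)
qed

lemma L2_inner_add_left:
  "f \<in> L2 M \<Longrightarrow> g \<in> L2 M \<Longrightarrow> h \<in> L2 M \<Longrightarrow>
    L2_inner M (\<lambda>x. f x + g x) h = L2_inner M f h + L2_inner M g h"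
  unfolding L2_inner_def by (simp add: ring_distribs L2_mult_integrable Bochner_Integration.integral_add)

lemma L2_inner_scale_left: "L2_inner M (\<lambda>x. c * f x) h = c * L2_inner M f h"
  unfolding L2_inner_def by (simp add: mult.assoc)

lemma L2_inner_commute: "L2_inner M f g = cnj (L2_inner M g f)"
  unfolding L2_inner_def by (simp flip: Bochner_Integration.integral_cnj add: mult.commute)

lemma L2_inner_scale_right: "L2_inner M f (\<lambda>x. c * h x) = cnj c * L2_inner M f h"
  unfolding L2_inner_def by (simp add: mult_ac)

lemma L2_inner_add_right:
  "f \<in> L2 M \<Longrightarrow> g \<in> L2 M \<Longrightarrow> h \<in> L2 M \<Longrightarrow>
    L2_inner M h (\<lambda>x. f x + g x) = L2_inner M h f + L2_inner M h g"
  unfolding L2_inner_def by (simp add: ring_distribs L2_mult_integrable Bochner_Integration.integral_add)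

lemma L2_inner_diff_left:
  "f \<in> L2 M \<Longrightarrow> g \<in> L2 M \<Longrightarrow> h \<in> L2 M \<Longrightarrow>
    L2_inner M (\<lambda>x. f x - g x) h = L2_inner M f h - L2_inner M g h"
  unfolding L2_inner_def by (simp add: ring_distribs L2_mult_integrable Bochner_Integration.integral_diff)

lemma L2_inner_sum_left:
  "(\<And>i. i \<in> I \<Longrightarrow> f i \<in> L2 M) \<Longrightarrow> h \<in> L2 M \<Longrightarrow>
    L2_inner M (\<lambda>x. \<Sum>i\<in>I. f i x) h = (\<Sum>i\<in>I. L2_inner M (f i) h)"
proof (induction I rule: infinite_finite_induct)
  case (insert a I)
  then show ?case by (simp add: L2_inner_add_left L2_sum)
qed (auto simp: L2_inner_def)

lemma L2_inner_self: "L2_inner M f f = complex_of_real ((L2_norm M f)\<^sup>2)"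
  unfolding L2_inner_def L2_norm_sq integral_complex_of_real[symmetric] complex_norm_square ..

lemma L2_norm_scale: "L2_norm M (\<lambda>x. c * f x) = cmod c * L2_norm M f"
  unfolding L2_norm_def by (simp add: norm_mult power_mult_distrib real_sqrt_mult)

lemma L2_norm_minus: "L2_norm M (\<lambda>x. f x - g x) = L2_norm M (\<lambda>x. g x - f x)"
  unfolding L2_norm_def by (simp add: norm_minus_commute)

lemma L2_norm_add_sq:
  assumes f: "f \<in> L2 M" and g: "g \<in> L2 M"
  shows "(L2_norm M (\<lambda>x. f x + g x))\<^sup>2 = (L2_norm M f)\<^sup>2 + 2 * Re (L2_inner M f g) + (L2_norm M g)\<^sup>2"
proof -
  have "L2_inner M (\<lambda>x. f x + g x) (\<lambda>x. f x + g x)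
      = L2_inner M f f + L2_inner M f g + cnj (L2_inner M f g) + L2_inner M g g"
    using f g L2_inner_commute[of M g f]
    by (simp add: L2_inner_add_left L2_inner_add_right L2_add)
  then have "Re (L2_inner M (\<lambda>x. f x + g x) (\<lambda>x. f x + g x))
      = Re (L2_inner M f f) + 2 * Re (L2_inner M f g) + Re (L2_inner M g g)" by simp
  then show ?thesis unfolding L2_inner_self by simp
qed

lemma L2_norm_triangle:
  assumes f: "f \<in> L2 M" and g: "g \<in> L2 M"
  shows "L2_norm M (\<lambda>x. f x + g x) \<le> L2_norm M f + L2_norm M g"
proof -
  have "Re (L2_inner M f g) \<le> L2_norm M f * L2_norm M g"
    using L2_Cauchy_Schwarz[OF f g] complex_Re_le_cmod order_trans by blast
  then have "(L2_norm M (\<lambda>x. f x + g x))\<^sup>2 \<le> (L2_norm M f + L2_norm M g)\<^sup>2"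
    unfolding L2_norm_add_sq[OF f g] by (simp add: power2_sum)
  then show ?thesis by (rule power2_le_imp_le) simp
qed

lemma L2_norm_triangle_diff:
  assumes "f \<in> L2 M" "g \<in> L2 M" "h \<in> L2 M"
  shows "L2_norm M (\<lambda>x. f x - h x) \<le> L2_norm M (\<lambda>x. f x - g x) + L2_norm M (\<lambda>x. g x - h x)"
  using L2_norm_triangle[of "\<lambda>x. f x - g x" M "\<lambda>x. g x - h x"] assms by (simp add: L2_diff)

lemma L2_norm_diff_abs:
  assumes "f \<in> L2 M" "g \<in> L2 M"
  shows "\<bar>L2_norm M f - L2_norm M g\<bar> \<le> L2_norm M (\<lambda>x. f x - g x)"
  using L2_norm_triangle[of "\<lambda>x. f x - g x" M g] L2_norm_triangle[of "\<lambda>x. g x - f x" M f] assms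
    L2_norm_minus[of M f g] by (simp add: L2_diff)

lemma L2_norm_zero_AE:
  assumes "f \<in> L2 M" "L2_norm M f = 0"
  shows "AE x in M. f x = 0"
proof -
  have "(\<integral>\<^sup>+x. ennreal ((cmod (f x))\<^sup>2) \<partial>M) = 0" using nn_integral_L2[OF assms(1)] assms(2) by simp
  then have "AE x in M. ennreal ((cmod (f x))\<^sup>2) = 0"
    using assms(1) by (subst (asm) nn_integral_0_iff_AE) auto
  then show ?thesis by (auto simp: ennreal_eq_0_iff)
qed

lemma L2_norm_limit:
  assumes "\<And>n. fs n \<in> L2 M" "f \<in> L2 M" "L2_converges M fs f"
  shows "(\<lambda>n. L2_norm M (fs n)) \<longlonglongrightarrow> L2_norm M f"
proof -
  have "(\<lambda>n. L2_norm M (fs n) - L2_norm M f) \<longlonglongrightarrow> 0"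
    by (rule Lim_null_comparison[OF _ assms(3)[unfolded L2_converges_def]])
      (simp add: L2_norm_diff_abs assms)
  then show ?thesis by (simp add: LIM_zero_iff)
qed

lemma L2_inner_limit:
  assumes "\<And>n. fs n \<in> L2 M" "f \<in> L2 M" "L2_converges M fs f" "g \<in> L2 M"
  shows "(\<lambda>n. L2_inner M (fs n) g) \<longlonglongrightarrow> L2_inner M f g"
proof -
  have "(\<lambda>n. L2_norm M (\<lambda>x. fs n x - f x) * L2_norm M g) \<longlonglongrightarrow> 0"
    using tendsto_mult[OF assms(3)[unfolded L2_converges_def] tendsto_const[of "L2_norm M g"]] by simp
  then have "(\<lambda>n. L2_inner M (fs n) g - L2_inner M f g) \<longlonglongrightarrow> 0"
    by (rule Lim_null_comparison[rotated])
      (use L2_Cauchy_Schwarz[of "\<lambda>x. fs n x - f x" M g for n] assms in \<open>auto simp: L2_inner_diff_left L2_diff\<close>)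
  then show ?thesis by (simp add: LIM_zero_iff)
qed

lemma L2_limit_unique:
  assumes "\<And>n. fs n \<in> L2 M" "f \<in> L2 M" "L2_converges M fs f" "g \<in> L2 M" "L2_converges M fs g"
  shows "AE x in M. f x = g x"
proof -
  have "(\<lambda>n. L2_norm M (\<lambda>x. fs n x - f x) + L2_norm M (\<lambda>x. fs n x - g x)) \<longlonglongrightarrow> 0 + 0"
    using assms(3,5) unfolding L2_converges_def by (rule tendsto_add)
  moreover have "L2_norm M (\<lambda>x. f x - g x) \<le> L2_norm M (\<lambda>x. fs n x - f x) + L2_norm M (\<lambda>x. fs n x - g x)" for n
    using L2_norm_triangle_diff[of f M "fs n" g] L2_norm_minus[of M f "fs n"] assms by auto
  ultimately have "L2_norm M (\<lambda>x. f x - g x) \<le> 0" by (intro LIMSEQ_le_const) auto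
  then have "L2_norm M (\<lambda>x. f x - g x) = 0" using L2_norm_nonneg by (simp add: order_antisym)
  from L2_norm_zero_AE[OF _ this] show ?thesis using assms by (auto simp: L2_diff)
qed

lemma L2_converges_add:
  assumes "\<And>n. fs n \<in> L2 M" "f \<in> L2 M" "L2_converges M fs f"
    and "\<And>n. gs n \<in> L2 M" "g \<in> L2 M" "L2_converges M gs g"
  shows "L2_converges M (\<lambda>n x. fs n x + gs n x) (\<lambda>x. f x + g x)"
  unfolding L2_converges_def
proof (rule Lim_null_comparison)
  show "(\<lambda>n. L2_norm M (\<lambda>x. fs n x - f x) + L2_norm M (\<lambda>x. gs n x - g x)) \<longlonglongrightarrow> 0"
    using tendsto_add[OF assms(3,6)[unfolded L2_converges_def]] by simp
  have "L2_norm M (\<lambda>x. fs n x + gs n x - (f x + g x)) \<le> L2_norm M (\<lambda>x. fs n x - f x) + L2_norm M (\<lambda>x. gs n x - g x)" for n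
    using L2_norm_triangle[of "\<lambda>x. fs n x - f x" M "\<lambda>x. gs n x - g x"] assms
    by (simp add: L2_diff algebra_simps)
  then show "\<forall>\<^sub>F n in sequentially. norm (L2_norm M (\<lambda>x. fs n x + gs n x - (f x + g x)))
      \<le> L2_norm M (\<lambda>x. fs n x - f x) + L2_norm M (\<lambda>x. gs n x - g x)" by auto
qed

lemma L2_converges_scale:
  assumes "L2_converges M fs f"
  shows "L2_converges M (\<lambda>n x. c * fs n x) (\<lambda>x. c * f x)"
  using tendsto_mult[OF tendsto_const[of "cmod c"] assms[unfolded L2_converges_def]]
  unfolding L2_converges_def right_diff_distrib[symmetric] L2_norm_scale by simp

section \<open>Fatou's lemma and completeness of L2\<close>

text \<open>Fatou's lemma for the squared moduli. It yields membership in L2 together with the norm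
  bound, and so serves wherever a limit is known only pointwise: in completeness, in Plancherel's
  theorem and in the choice of measurable sections.\<close>

lemma L2_Fatou:
  assumes g: "\<And>k. g k \<in> L2 M" and f[measurable]: "f \<in> borel_measurable M"
    and lim: "AE x in M. (\<lambda>k. g k x) \<longlonglongrightarrow> f x" and "\<forall>\<^sub>F k in sequentially. L2_norm M (g k) \<le> C"
  shows "f \<in> L2 M" "L2_norm M f \<le> C"
proof -
  have [measurable]: "g k \<in> borel_measurable M" for k using g by auto
  have "\<exists>k. L2_norm M (g k) \<le> C" using eventually_happens'[OF sequentially_bot assms(4)] .
  then have "0 \<le> C" using order_trans[OF L2_norm_nonneg] by blast
  have "(\<integral>\<^sup>+x. ennreal ((cmod (f x))\<^sup>2) \<partial>M) = (\<integral>\<^sup>+x. liminf (\<lambda>k. ennreal ((cmod (g k x))\<^sup>2)) \<partial>M)"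
  proof (rule nn_integral_cong_AE, use lim in eventually_elim)
    case (elim x)
    then have "(\<lambda>k. ennreal ((cmod (g k x))\<^sup>2)) \<longlonglongrightarrow> ennreal ((cmod (f x))\<^sup>2)" by (intro tendsto_intros)
    from lim_imp_Liminf[OF sequentially_bot this] show ?case by simp
  qed
  also have "\<dots> \<le> liminf (\<lambda>k. \<integral>\<^sup>+x. ennreal ((cmod (g k x))\<^sup>2) \<partial>M)" by (rule nn_integral_liminf) simp
  also have "\<dots> \<le> liminf (\<lambda>k. ennreal (C\<^sup>2))"
  proof (rule Liminf_mono)
    show "\<forall>\<^sub>F k in sequentially. (\<integral>\<^sup>+x. ennreal ((cmod (g k x))\<^sup>2) \<partial>M) \<le> ennreal (C\<^sup>2)"
      using assms(4) by eventually_elim (auto simp: nn_integral_L2[OF g] intro!: ennreal_leI power_mono)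
  qed
  finally have "(\<integral>\<^sup>+x. ennreal ((cmod (f x))\<^sup>2) \<partial>M) \<le> ennreal (C\<^sup>2)" by (simp add: Liminf_const)
  from L2_norm_leI[OF f this \<open>0 \<le> C\<close>] show "f \<in> L2 M" "L2_norm M f \<le> C" by auto
qed

text \<open>The partial sums of the absolute increments have norm at most 2 by the triangle
  inequality. Monotone convergence makes the square of their limit integrable, hence finite almost
  everywhere, and there the telescoping series converges absolutely.\<close>

lemma L2_fast_AE_convergent:
  assumes g: "\<And>k. g k \<in> L2 M" and d: "\<And>k. L2_norm M (\<lambda>x. g (Suc k) x - g k x) \<le> (1/2)^k"
  shows "AE x in M. convergent (\<lambda>k. g k x)"
proof -
  have [measurable]: "g k \<in> borel_measurable M" for k using g by auto
  define G where "G n x = (\<Sum>k<n. complex_of_real (cmod (g (Suc k) x - g k x)))" for n x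
  have dl: "(\<lambda>x. complex_of_real (cmod (g (Suc k) x - g k x))) \<in> L2 M" for k
    by (rule L2_bound(1)[OF L2_diff[OF g[of "Suc k"] g[of k]]]) auto
  have dn: "L2_norm M (\<lambda>x. complex_of_real (cmod (g (Suc k) x - g k x))) \<le> (1/2)^k" for k
    using d[of k] by (simp add: L2_norm_def)
  have Gl: "G n \<in> L2 M" for n unfolding G_def by (intro L2_sum dl)
  have Gn: "L2_norm M (G n) \<le> (\<Sum>k<n. (1/2)^k)" for n
  proof (induction n)
    case (Suc n)
    have "G (Suc n) = (\<lambda>x. G n x + complex_of_real (cmod (g (Suc n) x - g n x)))" by (rule ext) (simp add: G_def)
    then show ?case using L2_norm_triangle[OF Gl[of n] dl[of n]] dn[of n] Suc by simp
  qed (simp add: G_def L2_norm_def)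
  have Gn2: "L2_norm M (G n) \<le> 2" for n
  proof -
    have "(\<Sum>k<n. (1/2::real)^k) \<le> (\<Sum>k. (1/2)^k)" by (intro sum_le_suminf) auto
    also have "\<dots> = 2" by (simp add: suminf_geometric)
    finally show ?thesis using Gn[of n] by linarith
  qed
  define H where "H x = (SUP n. ennreal ((cmod (G n x))\<^sup>2))" for x
  have cG: "cmod (G n x) = (\<Sum>k<n. cmod (g (Suc k) x - g k x))" for n x
    unfolding G_def of_real_sum[symmetric] norm_of_real by (simp add: sum_nonneg)
  have "incseq (\<lambda>n x. ennreal ((cmod (G n x))\<^sup>2))"
    unfolding cG by (intro incseq_SucI le_funI ennreal_leI power_mono) (auto intro: sum_nonneg)
  then have "(\<integral>\<^sup>+x. H x \<partial>M) = (SUP n. \<integral>\<^sup>+x. ennreal ((cmod (G n x))\<^sup>2) \<partial>M)"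
    unfolding H_def using Gl by (intro nn_integral_monotone_convergence_SUP) auto
  also have "\<dots> \<le> ennreal 4"
  proof (rule SUP_least)
    fix n
    have "(L2_norm M (G n))\<^sup>2 \<le> 2\<^sup>2" using Gn2 by (intro power_mono) auto
    then have "ennreal ((L2_norm M (G n))\<^sup>2) \<le> ennreal 4" by (intro ennreal_leI) simp
    then show "(\<integral>\<^sup>+x. ennreal ((cmod (G n x))\<^sup>2) \<partial>M) \<le> ennreal 4" unfolding nn_integral_L2[OF Gl] .
  qed
  finally have "(\<integral>\<^sup>+x. H x \<partial>M) \<noteq> \<infinity>" by (auto simp: top_unique)
  then have "AE x in M. H x \<noteq> \<infinity>"
    using Gl unfolding H_def by (intro nn_integral_PInf_AE) auto
  then show ?thesis
  proof eventually_elim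
    case (elim x)
    then obtain B where B: "H x = ennreal B" "0 \<le> B" by (cases "H x") auto
    have "(\<Sum>k<n. cmod (g (Suc k) x - g k x)) \<le> sqrt B" for n
    proof -
      have "ennreal ((cmod (G n x))\<^sup>2) \<le> ennreal B" unfolding B(1)[symmetric] H_def by (rule SUP_upper) simp
      then have "(cmod (G n x))\<^sup>2 \<le> B" using B by (simp add: ennreal_le_iff)
      then show ?thesis unfolding cG[symmetric] by (simp add: real_le_rsqrt)
    qed
    then have "summable (\<lambda>k. cmod (g (Suc k) x - g k x))"
      by (intro summableI_nonneg_bounded[where x="sqrt B"]) auto
    then have "summable (\<lambda>k. g (Suc k) x - g k x)" by (rule summable_norm_cancel)
    then have "convergent (\<lambda>n. \<Sum>k<n. g (Suc k) x - g k x)" by (simp add: summable_iff_convergent)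
    then have "convergent (\<lambda>n. g n x - g 0 x)" using sum_lessThan_telescope[of "\<lambda>k. g k x"] by simp
    from convergent_add[OF this convergent_const[of "g 0 x"]] show ?case by simp
  qed
qed

text \<open>Riesz-Fischer: a rapidly Cauchy subsequence converges almost everywhere, and Fatou
  applied to \<open>g m - g (r k)\<close> with \<open>m\<close> fixed upgrades this to convergence
  in norm of the whole sequence.\<close>

lemma L2_complete:
  assumes g: "\<And>k. g k \<in> L2 M"
    and cauchy: "\<And>e. 0 < e \<Longrightarrow> \<exists>N. \<forall>m\<ge>N. \<forall>n\<ge>N. L2_norm M (\<lambda>x. g m x - g n x) \<le> e"
  obtains f where "f \<in> L2 M" "L2_converges M g f"
proof -
  have [measurable]: "g k \<in> borel_measurable M" for k using g by auto
  have "\<forall>k. \<exists>N. \<forall>m\<ge>N. \<forall>n\<ge>N. L2_norm M (\<lambda>x. g m x - g n x) \<le> (1/2)^k"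
    by (intro allI cauchy) simp
  then obtain N where N: "\<And>k m n. N k \<le> m \<Longrightarrow> N k \<le> n \<Longrightarrow> L2_norm M (\<lambda>x. g m x - g n x) \<le> (1/2)^k"
    by (drule_tac choice) blast
  \<comment> \<open>Summing the thresholds gives an index that is nondecreasing in \<open>k\<close>
    and dominates \<open>N j\<close> for every \<open>j \<le> k\<close>.\<close>
  define r where "r k = (\<Sum>j\<le>k. N j)" for k
  have r: "N k \<le> r k" "r k \<le> r (Suc k)" for k unfolding r_def by (auto intro: member_le_sum)
  have rn: "N j \<le> r k" if "j \<le> k" for j k unfolding r_def using that by (intro member_le_sum) auto
  have "L2_norm M (\<lambda>x. g (r (Suc k)) x - g (r k) x) \<le> (1/2)^k" for k
    using r[of k] by (intro N) auto
  then have conv: "AE x in M. convergent (\<lambda>k. g (r k) x)"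
    using g by (intro L2_fast_AE_convergent) auto
  define f where "f x = lim (\<lambda>k. g (r k) x)" for x
  have [measurable]: "f \<in> borel_measurable M" unfolding f_def by (intro borel_measurable_lim_metric) simp
  have lim: "AE x in M. (\<lambda>k. g (r k) x) \<longlonglongrightarrow> f x"
    using conv unfolding f_def by eventually_elim (simp add: convergent_LIMSEQ_iff)
  have *: "(\<lambda>x. g m x - f x) \<in> L2 M" "L2_norm M (\<lambda>x. g m x - f x) \<le> (1/2)^j" if "N j \<le> m" for m j
  proof -
    have "AE x in M. (\<lambda>k. g m x - g (r k) x) \<longlonglongrightarrow> g m x - f x" using lim by eventually_elim (intro tendsto_intros)
    moreover have "\<forall>\<^sub>F k in sequentially. L2_norm M (\<lambda>x. g m x - g (r k) x) \<le> (1/2)^j"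
      unfolding eventually_sequentially using that rn N by blast
    ultimately show "(\<lambda>x. g m x - f x) \<in> L2 M" "L2_norm M (\<lambda>x. g m x - f x) \<le> (1/2)^j"
      using L2_Fatou[of "\<lambda>k x. g m x - g (r k) x" M "\<lambda>x. g m x - f x"] g by auto
  qed
  have "f \<in> L2 M" using L2_diff[OF g *(1)[of 0 "N 0"], of "N 0"] by simp
  moreover have "L2_converges M g f" unfolding L2_converges_def
  proof (rule LIMSEQ_I)
    fix e :: real assume "0 < e"
    then obtain j where "(1/2)^j < e" using real_arch_pow_inv[of e "1/2"] by auto
    then show "\<exists>no. \<forall>n\<ge>no. norm (L2_norm M (\<lambda>x. g n x - f x) - 0) < e"
      using *(2)[of j] by (intro exI[of _ "N j"]) (auto intro: le_less_trans)
  qed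
  ultimately show ?thesis by (rule that)
qed

section \<open>Orthonormal sequences\<close>

text \<open>Pythagoras, one coefficient at a time. The coefficients are a separate parameter matched
  only for \<open>i < n\<close>, so that a longer partial sum can later be put in place of
  \<open>h\<close>.\<close>

lemma L2_orthonormal_partial_sum:
  assumes e: "\<And>i::nat. e i \<in> L2 M" and on: "\<And>i j. L2_inner M (e i) (e j) = (if i = j then 1 else 0)"
    and h: "h \<in> L2 M" and c: "\<And>i. i < n \<Longrightarrow> L2_inner M h (e i) = c i"
  shows "(L2_norm M (\<lambda>x. h x - (\<Sum>i<n. c i * e i x)))\<^sup>2 = (L2_norm M h)\<^sup>2 - (\<Sum>i<n. (cmod (c i))\<^sup>2)"
proof (insert c, induction n)
  case (Suc n)
  let ?S = "\<lambda>x. h x - (\<Sum>i<n. c i * e i x)"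
  have S: "?S \<in> L2 M" using h e by (intro L2_diff L2_sum L2_scale) auto
  have "L2_inner M ?S (e n) = c n"
    using h e Suc.prems[of n]
    by (simp add: L2_inner_diff_left L2_sum L2_scale L2_inner_sum_left L2_inner_scale_left on)
  then have "L2_inner M ?S (\<lambda>x. - c n * e n x) = - complex_of_real ((cmod (c n))\<^sup>2)"
    using L2_inner_scale_right[of M ?S "- c n" "e n"] by (simp add: complex_norm_square mult.commute del: of_real_power)
  moreover have "(L2_norm M (\<lambda>x. - c n * e n x))\<^sup>2 = (cmod (c n))\<^sup>2"
  proof -
    have "complex_of_real ((L2_norm M (e n))\<^sup>2) = 1" using L2_inner_self[of M "e n"] on[of n n] by simp
    then have "(L2_norm M (e n))\<^sup>2 = 1" unfolding of_real_eq_1_iff .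
    then show ?thesis by (simp only: L2_norm_scale power_mult_distrib norm_minus_cancel)
  qed
  ultimately have "(L2_norm M (\<lambda>x. ?S x + - c n * e n x))\<^sup>2 = (L2_norm M ?S)\<^sup>2 - (cmod (c n))\<^sup>2"
    using L2_norm_add_sq[OF S L2_scale[OF e], of "- c n" n] by simp
  then show ?case using Suc by (simp add: algebra_simps)
qed simp

text \<open>Bessel's inequality makes the partial sums Cauchy; their limit \<open>s\<close> is the
  projection of \<open>h\<close> onto the closed span of the \<open>e i\<close>. Completeness of the
  system is not assumed, so \<open>s\<close> may differ from \<open>h\<close>.\<close>

lemma L2_orthonormal_expansion:
  assumes e: "\<And>i::nat. e i \<in> L2 M" and on: "\<And>i j. L2_inner M (e i) (e j) = (if i = j then 1 else 0)"
    and h: "h \<in> L2 M"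
  obtains s where "s \<in> L2 M" "L2_converges M (\<lambda>n x. \<Sum>i<n. L2_inner M h (e i) * e i x) s"
    "\<And>i. L2_inner M s (e i) = L2_inner M h (e i)"
    "(\<lambda>i. (cmod (L2_inner M h (e i)))\<^sup>2) sums (L2_norm M s)\<^sup>2"
proof -
  define c where "c i = L2_inner M h (e i)" for i
  define S where "S n = (\<lambda>x. \<Sum>i<n. c i * e i x)" for n
  have S: "S n \<in> L2 M" for n unfolding S_def using e by (intro L2_sum L2_scale)
  have inS: "L2_inner M (S n) (e j) = (if j < n then c j else 0)" for n j
    unfolding S_def using e by (simp add: L2_inner_sum_left L2_scale L2_inner_scale_left on if_distrib cong: if_cong)
  have bessel: "(\<Sum>i<n. (cmod (c i))\<^sup>2) \<le> (L2_norm M h)\<^sup>2" for n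
  proof -
    have "(L2_norm M (\<lambda>x. h x - (\<Sum>i<n. c i * e i x)))\<^sup>2 = (L2_norm M h)\<^sup>2 - (\<Sum>i<n. (cmod (c i))\<^sup>2)"
      by (rule L2_orthonormal_partial_sum[OF e on h]) (simp add: c_def)
    then show ?thesis using zero_le_power2[of "L2_norm M (\<lambda>x. h x - (\<Sum>i<n. c i * e i x))"] by linarith
  qed
  have summ: "summable (\<lambda>i. (cmod (c i))\<^sup>2)"
    by (rule summableI_nonneg_bounded) (use bessel in auto)
  have nS: "(L2_norm M (\<lambda>x. S n x - S m x))\<^sup>2 = (L2_norm M (S n))\<^sup>2 - (\<Sum>i<m. (cmod (c i))\<^sup>2)" if "m \<le> n" for m n
  proof -
    have "L2_inner M (S n) (e i) = c i" if "i < m" for i using that \<open>m \<le> n\<close> by (simp add: inS)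
    from L2_orthonormal_partial_sum[OF e on S this] show ?thesis by (simp only: S_def)
  qed
  have nS': "(L2_norm M (S n))\<^sup>2 = (\<Sum>i<n. (cmod (c i))\<^sup>2)" for n
  proof -
    \<comment> \<open>The case \<open>m = n\<close> of the identity above has left side zero and
      thus computes the norm of \<open>S n\<close>.\<close>
    have "L2_norm M (\<lambda>x. S n x - S n x) = 0" by (simp add: L2_norm_def)
    then show ?thesis using nS[of n n] by simp
  qed
  have C: "\<exists>N. \<forall>m\<ge>N. \<forall>n\<ge>N. L2_norm M (\<lambda>x. S m x - S n x) \<le> d" if "0 < d" for d
  proof -
    have "Cauchy (\<lambda>n. \<Sum>i<n. (cmod (c i))\<^sup>2)" using summ by (simp add: summable_iff_convergent convergent_Cauchy)
    then have "\<exists>N. \<forall>m\<ge>N. \<forall>n\<ge>N. dist (\<Sum>i<m. (cmod (c i))\<^sup>2) (\<Sum>i<n. (cmod (c i))\<^sup>2) < d\<^sup>2"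
      by (rule metric_CauchyD) (use \<open>0 < d\<close> in simp)
    then obtain N where N: "\<forall>m\<ge>N. \<forall>n\<ge>N. dist (\<Sum>i<m. (cmod (c i))\<^sup>2) (\<Sum>i<n. (cmod (c i))\<^sup>2) < d\<^sup>2" ..
    have *: "L2_norm M (\<lambda>x. S m x - S n x) \<le> d" if "n \<le> m" "m \<ge> N" "n \<ge> N" for m n
    proof (rule power2_le_imp_le)
      have "dist (\<Sum>i<m. (cmod (c i))\<^sup>2) (\<Sum>i<n. (cmod (c i))\<^sup>2) < d\<^sup>2" using N that by blast
      then show "(L2_norm M (\<lambda>x. S m x - S n x))\<^sup>2 \<le> d\<^sup>2"
        using nS[OF that(1)] nS'[of m] unfolding dist_real_def by linarith
    qed (use \<open>0 < d\<close> in simp)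
    then have "L2_norm M (\<lambda>x. S m x - S n x) \<le> d" if "m \<ge> N" "n \<ge> N" for m n
      using that *[of n m] *[of m n] L2_norm_minus[of M "S m" "S n"] by (cases "n \<le> m") auto
    then show ?thesis by blast
  qed
  obtain s where s: "s \<in> L2 M" "L2_converges M S s" using L2_complete[of S M] S C by blast
  have "L2_inner M s (e i) = c i" for i
  proof -
    have "(\<lambda>n. L2_inner M (S n) (e i)) \<longlonglongrightarrow> L2_inner M s (e i)" by (rule L2_inner_limit) (use S s e in auto)
    moreover have "\<forall>\<^sub>F n in sequentially. L2_inner M (S n) (e i) = c i"
      unfolding inS using eventually_gt_at_top[of i] by eventually_elim simp
    then have "(\<lambda>n. L2_inner M (S n) (e i)) \<longlonglongrightarrow> c i" by (rule tendsto_eventually)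
    ultimately show ?thesis by (rule LIMSEQ_unique)
  qed
  moreover have "(\<lambda>n. (L2_norm M (S n))\<^sup>2) \<longlonglongrightarrow> (L2_norm M s)\<^sup>2"
    by (intro tendsto_power L2_norm_limit) (use S s in auto)
  ultimately show ?thesis using s unfolding nS' by (intro that[of s]) (simp_all add: sums_def c_def S_def[abs_def])
qed

section \<open>The integer lattice and the unit cube\<close>

definition int_lattice :: "'a::euclidean_space set" where
  "int_lattice = {m. \<forall>b\<in>Basis. m \<bullet> b \<in> \<int>}"

text \<open>Half-open, so that the integer translates tile without overlap; centred at 0, so that it
  contains a ball around 0 into which bounded sets can be scaled.\<close>

definition unit_cube :: "'a::euclidean_space set" where
  "unit_cube = {x. \<forall>b\<in>Basis. - 1/2 \<le> x \<bullet> b \<and> x \<bullet> b < 1/2}"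

lemma countable_int_lattice: "countable (int_lattice :: 'a::euclidean_space set)"
proof (rule countable_subset)
  show "(int_lattice :: 'a set) \<subseteq> (\<lambda>f. \<Sum>b\<in>Basis. real_of_int (f b) *\<^sub>R b) ` (PiE Basis (\<lambda>_. UNIV))"
  proof
    fix m :: 'a assume m: "m \<in> int_lattice"
    have "m = (\<Sum>b\<in>Basis. real_of_int (restrict (\<lambda>b. \<lfloor>m \<bullet> b\<rfloor>) Basis b) *\<^sub>R b)"
      by (subst euclidean_representation[of m, symmetric], rule sum.cong)
        (use m in \<open>auto simp: int_lattice_def elim!: Ints_cases\<close>)
    then show "m \<in> (\<lambda>f. \<Sum>b\<in>Basis. real_of_int (f b) *\<^sub>R b) ` (PiE Basis (\<lambda>_. UNIV))"
      by (intro image_eqI[where x="restrict (\<lambda>b. \<lfloor>m \<bullet> b\<rfloor>) Basis"]) simp_all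
  qed
  show "countable ((\<lambda>f. \<Sum>b\<in>Basis. real_of_int (f b) *\<^sub>R b) ` (PiE Basis (\<lambda>_. UNIV)) :: 'a set)"
    by (intro countable_image countable_PiE) auto
qed

lemma int_lattice_zero[simp]: "0 \<in> int_lattice"
  and int_lattice_add: "m \<in> int_lattice \<Longrightarrow> n \<in> int_lattice \<Longrightarrow> m + n \<in> int_lattice"
  and int_lattice_diff: "m \<in> int_lattice \<Longrightarrow> n \<in> int_lattice \<Longrightarrow> m - n \<in> int_lattice"
  and int_lattice_uminus: "m \<in> int_lattice \<Longrightarrow> - m \<in> int_lattice"
  and int_lattice_Basis: "b \<in> Basis \<Longrightarrow> b \<in> int_lattice"
  by (auto simp: int_lattice_def inner_add_left inner_diff_left inner_Basis)

lemma borel_unit_cube[measurable]: "unit_cube \<in> sets borel"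
  unfolding unit_cube_def by measurable

lemma bounded_unit_cube: "bounded (unit_cube :: 'a::euclidean_space set)"
  by (rule bounded_subset[OF bounded_cbox[of "(-1/2) *\<^sub>R One" "(1/2) *\<^sub>R One :: 'a"]])
    (force simp: unit_cube_def mem_box)

lemma box_subset_unit_cube: "box ((-1/2) *\<^sub>R One) ((1/2) *\<^sub>R One) \<subseteq> unit_cube"
  by (force simp: unit_cube_def mem_box)

lemma AE_unit_cube_box:
  "AE x in lborel. x \<in> unit_cube \<longrightarrow> x \<in> box ((-1/2) *\<^sub>R One) ((1/2) *\<^sub>R One :: 'a::euclidean_space)"
proof (rule AE_I'[OF null_sets_cbox_Diff_box[of "(-1/2) *\<^sub>R One" "(1/2) *\<^sub>R One :: 'a"]])
  show "{x \<in> space lborel. \<not> (x \<in> unit_cube \<longrightarrow> x \<in> box ((-1/2) *\<^sub>R One) ((1/2) *\<^sub>R One :: 'a))}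
        \<subseteq> cbox ((-1/2) *\<^sub>R One) ((1/2) *\<^sub>R One) - box ((-1/2) *\<^sub>R One) ((1/2) *\<^sub>R One)"
    by (force simp: unit_cube_def mem_box)
qed

lemma emeasure_unit_cube: "emeasure lborel (unit_cube :: 'a::euclidean_space set) = 1"
proof -
  have "emeasure lborel (unit_cube :: 'a set) = emeasure lborel (box ((-1/2) *\<^sub>R One) ((1/2) *\<^sub>R One :: 'a))"
    by (rule emeasure_eq_AE) (use AE_unit_cube_box box_subset_unit_cube in \<open>auto elim!: eventually_mono\<close>)
  also have "\<dots> = 1" by (subst emeasure_lborel_box) (auto simp: inner_simps intro!: prod.neutral)
  finally show ?thesis .
qed

text \<open>Coordinatewise rounding. Ties are rounded up, which matches the half-open side [-1/2,
  1/2) of \<open>unit_cube\<close>.\<close>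

definition nearest_lattice_point :: "'a::euclidean_space \<Rightarrow> 'a" where
  "nearest_lattice_point x = (\<Sum>b\<in>Basis. real_of_int \<lfloor>x \<bullet> b + 1/2\<rfloor> *\<^sub>R b)"

lemma nearest_lattice_point: "nearest_lattice_point x \<in> int_lattice"
  by (simp add: nearest_lattice_point_def int_lattice_def inner_sum_left_Basis)

text \<open>Existence and uniqueness of the tile containing a point in one equivalence. Sums of
  indicators over the lattice collapse to one term by it, and covering and disjointness of the
  quasi-lattice tiles follow from it as well.\<close>

lemma diff_in_unit_cube_iff:
  assumes "m \<in> int_lattice"
  shows "x - m \<in> unit_cube \<longleftrightarrow> m = nearest_lattice_point x"
proof -
  have "(- 1/2 \<le> x \<bullet> b - m \<bullet> b \<and> x \<bullet> b - m \<bullet> b < 1/2) \<longleftrightarrow> m \<bullet> b = nearest_lattice_point x \<bullet> b"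
    if "b \<in> Basis" for b
  proof -
    have "m \<bullet> b \<in> \<int>" using assms that unfolding int_lattice_def by blast
    then obtain k where k: "m \<bullet> b = real_of_int k" by (auto elim!: Ints_cases)
    show ?thesis unfolding nearest_lattice_point_def inner_sum_left_Basis[OF that] k of_int_eq_iff
      by linarith
  qed
  then show ?thesis by (auto simp: unit_cube_def inner_diff_left euclidean_eq_iff[of m])
qed

lemma nn_integral_count_space_single:
  assumes "a \<in> A"
  shows "(\<integral>\<^sup>+i. (if i = a then c else 0) \<partial>count_space A) = (c :: ennreal)"
  using assms by (subst nn_integral_count_space'[where A="{a}"]) auto

text \<open>For each \<open>x\<close> exactly one lattice point contributes, so the indicators sum
  to 1, and sum and integral may be exchanged because everything is nonnegative. The tiles are cubes
  of side \<open>r\<close>.\<close>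

lemma nn_integral_tiling:
  fixes g :: "'a::euclidean_space \<Rightarrow> ennreal"
  assumes [measurable]: "g \<in> borel_measurable borel" and "r > 0"
  shows "(\<integral>\<^sup>+x. g x \<partial>lborel)
       = (\<integral>\<^sup>+m. (\<integral>\<^sup>+x. g x * indicator unit_cube ((1/r) *\<^sub>R x - m) \<partial>lborel) \<partial>count_space int_lattice)"
proof -
  have "g x = (\<integral>\<^sup>+m. g x * indicator unit_cube ((1/r) *\<^sub>R x - m) \<partial>count_space int_lattice)" for x
  proof -
    have "(\<integral>\<^sup>+m. g x * indicator unit_cube ((1/r) *\<^sub>R x - m) \<partial>count_space int_lattice)
        = (\<integral>\<^sup>+m. (if m = nearest_lattice_point ((1/r) *\<^sub>R x) then g x else 0) \<partial>count_space int_lattice)"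
      by (rule nn_integral_cong) (auto simp: indicator_def diff_in_unit_cube_iff)
    also have "\<dots> = g x" by (rule nn_integral_count_space_single[OF nearest_lattice_point])
    finally show ?thesis by simp
  qed
  then have "(\<integral>\<^sup>+x. g x \<partial>lborel)
      = (\<integral>\<^sup>+x. (\<integral>\<^sup>+m. g x * indicator unit_cube ((1/r) *\<^sub>R x - m) \<partial>count_space int_lattice) \<partial>lborel)" by simp
  also have "\<dots> = (\<integral>\<^sup>+m. (\<integral>\<^sup>+x. g x * indicator unit_cube ((1/r) *\<^sub>R x - m) \<partial>lborel) \<partial>count_space int_lattice)"
    by (rule nn_integral_count_space_nn_integral[OF countable_int_lattice]) measurable
  finally show ?thesis .
qed

section \<open>Functions with vanishing integrals over boxes\<close>

text \<open>The positive and the negative part of \<open>h\<close> are densities of two finite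
  measures that agree on boxes. Boxes form an intersection-stable generator of the Borel sets, so
  the measures coincide, and densities are unique almost everywhere.\<close>

lemma AE_zero_if_box_integrals_zero_real:
  fixes h :: "'a::euclidean_space \<Rightarrow> real"
  assumes h: "integrable lborel h" and z: "\<And>a b. (\<integral>x. indicator (box a b) x * h x \<partial>lborel) = 0"
  shows "AE x in lborel. h x = 0"
proof -
  have [measurable]: "h \<in> borel_measurable borel" using h by auto
  let ?p = "\<lambda>x. max 0 (h x)" and ?n = "\<lambda>x. max 0 (- h x)"
  have ibox: "integrable lborel (\<lambda>x. indicator (box a b) x * f x)" if "integrable lborel f" for f :: "'a \<Rightarrow> real" and a b
    using integrable_real_mult_indicator[OF _ that, of "box a b"] by (simp add: mult.commute)
  have ip: "integrable lborel ?p" and im: "integrable lborel ?n" using h by auto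
  have fin: "(\<integral>\<^sup>+x. ennreal (?p x) \<partial>lborel) \<noteq> \<infinity>"
    using nn_integral_eq_integral[OF ip] by simp
  have "density lborel ?p = density lborel ?n"
  proof (rule measure_eqI_generator_eq)
    let ?E = "range (\<lambda>(a, b). box a b::'a set)"
    show "Int_stable ?E" by (auto simp: Int_stable_def box_Int_box)
    show "?E \<subseteq> Pow UNIV" by simp
    show "sets (density lborel ?p) = sigma_sets UNIV ?E" "sets (density lborel ?n) = sigma_sets UNIV ?E"
      by (simp_all add: borel_eq_box)
    let ?A = "\<lambda>n::nat. box (- (real n *\<^sub>R One)) (real n *\<^sub>R One) :: 'a set"
    show "range ?A \<subseteq> ?E" "(\<Union>i. ?A i) = UNIV" unfolding UN_box_eq_UNIV by auto
    show "emeasure (density lborel ?p) (?A i) \<noteq> \<infinity>" for i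
    proof -
      have "emeasure (density lborel ?p) (?A i) \<le> (\<integral>\<^sup>+x. ennreal (?p x) \<partial>lborel)"
        by (subst emeasure_density) (auto intro!: nn_integral_mono simp: indicator_def)
      then show ?thesis using fin by (auto simp: top_unique)
    qed
    fix X assume "X \<in> ?E"
    then obtain a b where X: "X = box a b" by auto
    have "(\<integral>x. indicator (box a b) x * h x \<partial>lborel)
        = (\<integral>x. indicator (box a b) x * ?p x - indicator (box a b) x * ?n x \<partial>lborel)"
      by (rule Bochner_Integration.integral_cong) (auto simp: indicator_def)
    also have "\<dots> = (\<integral>x. indicator (box a b) x * ?p x \<partial>lborel) - (\<integral>x. indicator (box a b) x * ?n x \<partial>lborel)"
      by (intro Bochner_Integration.integral_diff ibox ip im)
    finally have eq: "(\<integral>x. indicator (box a b) x * ?p x \<partial>lborel) = (\<integral>x. indicator (box a b) x * ?n x \<partial>lborel)" using z[of a b] by simp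
    have em: "emeasure (density lborel f) X = ennreal (\<integral>x. indicator (box a b) x * f x \<partial>lborel)"
      if "integrable lborel f" "\<And>x. 0 \<le> f x" for f :: "'a \<Rightarrow> real"
    proof -
      have [measurable]: "f \<in> borel_measurable borel" using that by auto
      have "emeasure (density lborel f) X = (\<integral>\<^sup>+x. ennreal (indicator (box a b) x * f x) \<partial>lborel)"
        unfolding X by (subst emeasure_density) (auto intro!: nn_integral_cong simp: indicator_def)
      also have "\<dots> = ennreal (\<integral>x. indicator (box a b) x * f x \<partial>lborel)"
        using that by (intro nn_integral_eq_integral) (auto intro!: ibox)
      finally show ?thesis .
    qed
    show "emeasure (density lborel ?p) X = emeasure (density lborel ?n) X"
      using em[OF ip] em[OF im] eq by simp
  qed
  then have "AE x in lborel. ennreal (?p x) = ennreal (?n x)"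
    by (subst (asm) finite_density_unique) (use fin in auto)
  then show ?thesis by eventually_elim (auto simp: max_def split: if_splits)
qed

lemma AE_zero_if_box_integrals_zero:
  fixes h :: "'a::euclidean_space \<Rightarrow> complex"
  assumes h: "integrable lborel h" and z: "\<And>a b. (\<integral>x. indicator (box a b) x * h x \<partial>lborel) = 0"
  shows "AE x in lborel. h x = 0"
proof -
  have i: "integrable lborel (\<lambda>x. indicator (box a b) x * h x)" for a b
  proof (rule Bochner_Integration.integrable_bound[OF h])
    show "(\<lambda>x. indicator (box a b) x * h x) \<in> borel_measurable lborel" using h by measurable
  qed (auto simp: indicator_def)
  have "AE x in lborel. Re (h x) = 0"
  proof (rule AE_zero_if_box_integrals_zero_real)
    fix a b
    have "Re (indicator (box a b) x * h x) = indicator (box a b) x * Re (h x)" for x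
      by (auto simp: indicator_def)
    then show "(\<integral>x. indicator (box a b) x * Re (h x) \<partial>lborel) = 0"
      using z[of a b] integral_Re[OF i[of a b]] by simp
  qed (use h in auto)
  moreover have "AE x in lborel. Im (h x) = 0"
  proof (rule AE_zero_if_box_integrals_zero_real)
    fix a b
    have "Im (indicator (box a b) x * h x) = indicator (box a b) x * Im (h x)" for x
      by (auto simp: indicator_def)
    then show "(\<integral>x. indicator (box a b) x * Im (h x) \<partial>lborel) = 0"
      using z[of a b] integral_Im[OF i[of a b]] by simp
  qed (use h in auto)
  ultimately show ?thesis by eventually_elim (simp add: complex_eq_iff)
qed

lemma L2_indicator:
  assumes "A \<in> sets M" "emeasure M A < \<infinity>"
  shows "(\<lambda>x. indicator A x :: complex) \<in> L2 M"
proof (rule L2I)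
  have "(\<integral>\<^sup>+x. ennreal ((cmod (indicator A x))\<^sup>2) \<partial>M) = (\<integral>\<^sup>+x. indicator A x \<partial>M)"
    by (rule nn_integral_cong) (auto simp: indicator_def)
  then show "(\<integral>\<^sup>+x. ennreal ((cmod (indicator A x))\<^sup>2) \<partial>M) < \<infinity>" using assms by simp
qed (use assms in measurable)

text \<open>An L2 function need not be integrable, so it is cut to a large box; the hypothesis
  survives because the intersection of two boxes is a box.\<close>

lemma L2_AE_zero_if_box_integrals_zero:
  fixes h :: "'a::euclidean_space \<Rightarrow> complex"
  assumes h: "h \<in> L2 lborel" and z: "\<And>a b. (\<integral>x. indicator (box a b) x * h x \<partial>lborel) = 0"
  shows "AE x in lborel. h x = 0"
proof -
  let ?A = "\<lambda>n::nat. box (- (real n *\<^sub>R One)) (real n *\<^sub>R One) :: 'a set"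
  have "AE x in lborel. indicator (?A n) x * h x = 0" for n
  proof (rule AE_zero_if_box_integrals_zero)
    show "integrable lborel (\<lambda>x. indicator (?A n) x * h x)"
      by (rule L2_mult_integrable(2)[OF L2_indicator h]) (auto simp: emeasure_lborel_box_finite)
    show "(\<integral>x. indicator (box a b) x * (indicator (?A n) x * h x) \<partial>lborel) = 0" for a b
      unfolding mult.assoc[symmetric] indicator_inter_arith[symmetric] box_Int_box by (rule z)
  qed
  then have "AE x in lborel. \<forall>n. indicator (?A n) x * h x = 0" unfolding AE_all_countable by blast
  then show ?thesis
  proof eventually_elim
    case (elim x)
    have "x \<in> (\<Union>n. ?A n)" unfolding UN_box_eq_UNIV by simp
    then show ?case using elim by (auto simp: indicator_def)
  qed
qed

section \<open>Completeness of the trigonometric system\<close>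

text \<open>The torus embedded in Euclidean space by the cosines and sines of its angles.
  Polynomials in this point are trigonometric polynomials in \<open>x\<close>, which opens the way
  to Stone-Weierstrass on a compact image.\<close>

definition torus_map :: "'a::euclidean_space \<Rightarrow> 'a \<times> 'a" where
  "torus_map x = (\<Sum>b\<in>Basis. cos (2 * pi * (x \<bullet> b)) *\<^sub>R b, \<Sum>b\<in>Basis. sin (2 * pi * (x \<bullet> b)) *\<^sub>R b)"

lemma continuous_torus_map: "continuous_on A torus_map"
  unfolding torus_map_def by (intro continuous_intros)

lemma borel_torus_map[measurable]: "torus_map \<in> borel_measurable borel"
  by (intro borel_measurable_continuous_onI continuous_torus_map)

text \<open>The torus map identifies opposite faces of the closed cube, but an interior point with
  no other point. Hence the asymmetric hypotheses: one point in the open box, the other in the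
  closed one. The coordinates differ by an integer of modulus less than 1.\<close>

lemma torus_map_eq_imp:
  fixes x y :: "'a::euclidean_space"
  assumes "torus_map x = torus_map y"
    and x: "x \<in> box ((-1/2) *\<^sub>R One) ((1/2) *\<^sub>R One)" and y: "y \<in> cbox ((-1/2) *\<^sub>R One) ((1/2) *\<^sub>R One)"
  shows "x = y"
proof (rule euclidean_eqI)
  fix b :: 'a assume b: "b \<in> Basis"
  have "cos (2 * pi * (x \<bullet> b)) = cos (2 * pi * (y \<bullet> b))" "sin (2 * pi * (x \<bullet> b)) = sin (2 * pi * (y \<bullet> b))"
    using arg_cong[OF assms(1), of "\<lambda>w. fst w \<bullet> b"] arg_cong[OF assms(1), of "\<lambda>w. snd w \<bullet> b"] b
    by (simp_all add: torus_map_def)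
  then have "\<exists>n::int. 2 * pi * (x \<bullet> b) = 2 * pi * (y \<bullet> b) + 2 * pi * n"
    by (subst sin_cos_eq_iff[symmetric]) simp
  then obtain n :: int where "2 * pi * (x \<bullet> b) = 2 * pi * (y \<bullet> b) + 2 * pi * n" ..
  then have "2 * pi * (x \<bullet> b) = 2 * pi * (y \<bullet> b + n)" by (simp add: algebra_simps)
  then have n: "x \<bullet> b = y \<bullet> b + n" by simp
  have "- 1/2 < x \<bullet> b" "x \<bullet> b < 1/2" "- 1/2 \<le> y \<bullet> b" "y \<bullet> b \<le> 1/2"
    using x y b by (auto simp: mem_box)
  then have "n = 0" using n by linarith
  then show "x \<bullet> b = y \<bullet> b" using n by simp
qed

text \<open>Products are not generated but derived, so that a linear statement such as the vanishing
  of an integral can be proved by induction from the characters alone.\<close>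

inductive trig_polynomial :: "('a::euclidean_space \<Rightarrow> complex) \<Rightarrow> bool" where
  character: "m \<in> int_lattice \<Longrightarrow> trig_polynomial (\<lambda>x. cis (2 * pi * (m \<bullet> x)))"
| scale: "trig_polynomial p \<Longrightarrow> trig_polynomial (\<lambda>x. c * p x)"
| add: "trig_polynomial p \<Longrightarrow> trig_polynomial q \<Longrightarrow> trig_polynomial (\<lambda>x. p x + q x)"

lemma trig_polynomial_const: "trig_polynomial (\<lambda>x. c)"
  using trig_polynomial.scale[OF trig_polynomial.character[of 0], of c] by simp

lemma trig_polynomial_sum:
  "(\<And>i. i \<in> I \<Longrightarrow> trig_polynomial (p i)) \<Longrightarrow> trig_polynomial (\<lambda>x. \<Sum>i\<in>I. p i x)"
  by (induction I rule: infinite_finite_induct) (auto intro: trig_polynomial.add trig_polynomial_const)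

lemma trig_polynomial_mult:
  assumes "trig_polynomial p" "trig_polynomial q" shows "trig_polynomial (\<lambda>x. p x * q x)"
  using assms(1)
proof induction
  case (character m)
  show ?case using assms(2)
  proof induction
    case (character n)
    have "cis (2 * pi * (m \<bullet> x)) * cis (2 * pi * (n \<bullet> x)) = cis (2 * pi * ((m + n) \<bullet> x))" for x
      by (simp add: cis_mult inner_add_left algebra_simps)
    then show ?case
      using trig_polynomial.character[OF int_lattice_add[OF \<open>m \<in> int_lattice\<close> character]] by simp
  next
    case (scale p c)
    have "(\<lambda>x. cis (2 * pi * (m \<bullet> x)) * (c * p x)) = (\<lambda>x. c * (cis (2 * pi * (m \<bullet> x)) * p x))"
      by (simp add: mult_ac)
    then show ?case using trig_polynomial.scale[OF scale.IH, of c] by simp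
  qed (simp add: distrib_left trig_polynomial.add)
next
  case (scale p c)
  show ?case using trig_polynomial.scale[OF scale.IH, of c] by (simp add: mult.assoc)
qed (simp add: distrib_right trig_polynomial.add)

lemma trig_polynomial_cos_sin:
  assumes b: "b \<in> Basis"
  shows "trig_polynomial (\<lambda>x. complex_of_real (cos (2 * pi * (x \<bullet> b))))"
    and "trig_polynomial (\<lambda>x. complex_of_real (sin (2 * pi * (x \<bullet> b))))"
proof -
  note p = trig_polynomial.character[OF int_lattice_Basis[OF b]]
    and m = trig_polynomial.character[OF int_lattice_uminus[OF int_lattice_Basis[OF b]]]
  have "(\<lambda>x. complex_of_real (cos (2 * pi * (x \<bullet> b))))
      = (\<lambda>x. (1/2) * cis (2 * pi * (b \<bullet> x)) + (1/2) * cis (2 * pi * (- b \<bullet> x)))"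
    by (auto simp: fun_eq_iff complex_eq_iff inner_commute)
  then show "trig_polynomial (\<lambda>x. complex_of_real (cos (2 * pi * (x \<bullet> b))))"
    using trig_polynomial.add[OF trig_polynomial.scale[OF p, of "1/2"] trig_polynomial.scale[OF m, of "1/2"]]
    by simp
  have "(\<lambda>x. complex_of_real (sin (2 * pi * (x \<bullet> b))))
      = (\<lambda>x. (- \<i>/2) * cis (2 * pi * (b \<bullet> x)) + (\<i>/2) * cis (2 * pi * (- b \<bullet> x)))"
    by (auto simp: fun_eq_iff complex_eq_iff inner_commute)
  then show "trig_polynomial (\<lambda>x. complex_of_real (sin (2 * pi * (x \<bullet> b))))"
    using trig_polynomial.add[OF trig_polynomial.scale[OF p, of "- \<i>/2"] trig_polynomial.scale[OF m, of "\<i>/2"]]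
    by simp
qed

text \<open>A linear functional of the torus point is a combination of cosines and sines of the
  single coordinates; constants, sums and products are closure properties of trigonometric
  polynomials.\<close>

lemma trig_polynomial_torus:
  assumes "real_polynomial_function g"
  shows "trig_polynomial (\<lambda>x::'a::euclidean_space. complex_of_real (g (torus_map x)))"
  using assms
proof induction
  case (linear f)
  have "f (torus_map x) = (\<Sum>b\<in>Basis. f (b, 0) * cos (2 * pi * (x \<bullet> b))) + (\<Sum>b\<in>Basis. f (0, b) * sin (2 * pi * (x \<bullet> b)))"
    for x
  proof -
    interpret linear f using linear by (rule bounded_linear.linear)
    have "torus_map x = (\<Sum>b\<in>Basis. cos (2 * pi * (x \<bullet> b)) *\<^sub>R (b, 0)) + (\<Sum>b\<in>Basis. sin (2 * pi * (x \<bullet> b)) *\<^sub>R (0, b))"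
      unfolding torus_map_def by (simp add: prod_eq_iff fst_sum snd_sum)
    then show ?thesis by (simp only: add sum scale real_scaleR_def mult.commute)
  qed
  then have "(\<lambda>x. complex_of_real (f (torus_map x)))
      = (\<lambda>x. (\<Sum>b\<in>Basis. complex_of_real (f (b, 0)) * complex_of_real (cos (2 * pi * (x \<bullet> b))))
           + (\<Sum>b\<in>Basis. complex_of_real (f (0, b)) * complex_of_real (sin (2 * pi * (x \<bullet> b)))))" by simp
  then show ?case
    by (auto intro!: trig_polynomial.add trig_polynomial_sum trig_polynomial.scale trig_polynomial_cos_sin)
next
  case (const c)
  then show ?case by (rule trig_polynomial_const)
next
  case (add f g)
  then show ?case using trig_polynomial.add by simp
next
  case (mult f g)
  then show ?case using trig_polynomial_mult by simp
qed

lemma trig_polynomial_bounded_measurable: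
  "trig_polynomial p \<Longrightarrow> p \<in> borel_measurable borel \<and> (\<exists>B. \<forall>x. cmod (p x) \<le> B)"
proof (induction rule: trig_polynomial.induct)
  case (character m)
  have "(\<lambda>x. cis (2 * pi * (m \<bullet> x))) \<in> borel_measurable borel"
    by (intro borel_measurable_continuous_onI continuous_intros)
  then show ?case by (auto intro: exI[of _ 1])
next
  case (scale p c)
  then show ?case by (auto simp: norm_mult intro!: exI[of _ "cmod c * _"] mult_left_mono)
next
  case (add p q)
  then obtain B C where "\<forall>x. cmod (p x) \<le> B" "\<forall>x. cmod (q x) \<le> C" by blast
  then have "\<forall>x. cmod (p x + q x) \<le> B + C" by (meson norm_triangle_mono)
  with add show ?case by auto
qed

lemma integrable_mult_bounded:
  fixes h p :: "'b \<Rightarrow> complex"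
  assumes h: "integrable M h" and p: "p \<in> borel_measurable M" "\<And>x. cmod (p x) \<le> B"
  shows "integrable M (\<lambda>x. h x * p x)"
proof (rule Bochner_Integration.integrable_bound)
  show "integrable M (\<lambda>x. complex_of_real B * h x)" using h by simp
  show "(\<lambda>x. h x * p x) \<in> borel_measurable M" using h p by measurable
  have "cmod (h x) * cmod (p x) \<le> \<bar>B\<bar> * cmod (h x)" for x
    using p(2)[of x] by (subst mult.commute) (intro mult_right_mono, auto)
  then show "AE x in M. norm (h x * p x) \<le> norm (complex_of_real B * h x)" by (simp add: norm_mult)
qed

lemma trig_polynomial_integral_zero:
  fixes h :: "'a::euclidean_space \<Rightarrow> complex"
  assumes h: "integrable lborel h" and z: "\<And>m. m \<in> int_lattice \<Longrightarrow> (\<integral>x. h x * cis (2 * pi * (m \<bullet> x)) \<partial>lborel) = 0"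
    and p: "trig_polynomial p"
  shows "(\<integral>x. h x * p x \<partial>lborel) = 0"
  using p
proof induction
  case (scale p c)
  then show ?case by (simp add: mult.left_commute[of _ c])
next
  case (add p q)
  have "integrable lborel (\<lambda>x. h x * p x)" "integrable lborel (\<lambda>x. h x * q x)"
    using trig_polynomial_bounded_measurable[OF add.hyps(1)] trig_polynomial_bounded_measurable[OF add.hyps(2)] h
    by (auto intro: integrable_mult_bounded)
  then show ?case using add.IH by (simp add: distrib_left)
qed (rule z)

text \<open>Stone-Weierstrass approximates \<open>g\<close> uniformly on the compact torus by a
  polynomial, against which \<open>h\<close> integrates to zero. Since \<open>h\<close> vanishes
  outside the cube, the error is at most \<open>e\<close> times the L1 norm of
  \<open>h\<close>.\<close>

lemma torus_continuous_integral_zero: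
  fixes h :: "'a::euclidean_space \<Rightarrow> complex" and g :: "'a \<times> 'a \<Rightarrow> real"
  assumes h: "integrable lborel h" and z: "\<And>m. m \<in> int_lattice \<Longrightarrow> (\<integral>x. h x * cis (2 * pi * (m \<bullet> x)) \<partial>lborel) = 0"
    and v: "\<And>x. x \<notin> unit_cube \<Longrightarrow> h x = 0" and g: "continuous_on UNIV g"
    and gb: "\<And>x. \<bar>g x\<bar> \<le> B"
  shows "(\<integral>x. h x * complex_of_real (g (torus_map x)) \<partial>lborel) = 0"
proof -
  let ?K = "cbox ((-1/2) *\<^sub>R One) ((1/2) *\<^sub>R One) :: 'a set"
  let ?I = "\<integral>x. h x * complex_of_real (g (torus_map x)) \<partial>lborel"
  have cK: "compact (torus_map ` ?K)" by (intro compact_continuous_image continuous_torus_map compact_cbox)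
  have [measurable]: "g \<in> borel_measurable borel" by (intro borel_measurable_continuous_onI g)
  have [measurable]: "h \<in> borel_measurable borel" using h by auto
  have ig: "integrable lborel (\<lambda>x. h x * complex_of_real (g (torus_map x)))"
    by (rule integrable_mult_bounded[OF h, where B=B]) (use gb in auto)
  have bound: "cmod ?I \<le> e * (\<integral>x. cmod (h x) \<partial>lborel)" if "0 < e" for e
  proof -
    obtain q where q: "real_polynomial_function q" "\<And>x. x \<in> torus_map ` ?K \<Longrightarrow> \<bar>g x - q x\<bar> < e"
      using Stone_Weierstrass_real_polynomial_function[OF cK continuous_on_subset[OF g] \<open>0 < e\<close>] by auto
    note t = trig_polynomial_torus[OF q(1)]
    have iq: "integrable lborel (\<lambda>x. h x * complex_of_real (q (torus_map x)))"
    proof -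
      obtain C where C: "\<And>x. cmod (complex_of_real (q (torus_map x))) \<le> C"
        using trig_polynomial_bounded_measurable[OF t] by blast
      show ?thesis
        by (rule integrable_mult_bounded[OF h _ C]) (use trig_polynomial_bounded_measurable[OF t] in simp)
    qed
    have "?I = (\<integral>x. h x * complex_of_real (g (torus_map x)) - h x * complex_of_real (q (torus_map x)) \<partial>lborel)"
      using trig_polynomial_integral_zero[OF h z t] ig iq by simp
    also have "cmod \<dots> \<le> (\<integral>x. norm (h x * complex_of_real (g (torus_map x)) - h x * complex_of_real (q (torus_map x))) \<partial>lborel)"
      by (rule integral_norm_bound)
    also have "\<dots> \<le> (\<integral>x. e * cmod (h x) \<partial>lborel)"
    proof (rule Bochner_Integration.integral_mono)
      show "norm (h x * complex_of_real (g (torus_map x)) - h x * complex_of_real (q (torus_map x))) \<le> e * cmod (h x)" for x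
      proof (cases "x \<in> unit_cube")
        case True
        then have "x \<in> ?K" by (force simp: unit_cube_def mem_box)
        then have "\<bar>g (torus_map x) - q (torus_map x)\<bar> \<le> e" using q(2)[of "torus_map x"] by auto
        then have "cmod (h x) * \<bar>g (torus_map x) - q (torus_map x)\<bar> \<le> cmod (h x) * e" by (intro mult_left_mono) auto
        then show ?thesis
          by (simp add: right_diff_distrib[symmetric] norm_mult mult.commute of_real_diff[symmetric] del: of_real_diff)
      qed (simp add: v)
    qed (use h ig iq in auto)
    finally show ?thesis by simp
  qed
  have "cmod ?I \<le> 0"
  proof (rule field_le_epsilon)
    fix e :: real assume "0 < e"
    let ?J = "\<integral>x. cmod (h x) \<partial>lborel"
    have J: "0 \<le> ?J" by simp
    then have J1: "?J / (?J + 1) \<le> 1" by (subst divide_le_eq_1_pos) linarith+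
    \<comment> \<open>The denominator is the L1 norm of \<open>h\<close> plus 1, because the norm
      itself may be zero.\<close>
    have "cmod ?I \<le> e / (?J + 1) * ?J" using J \<open>0 < e\<close> by (intro bound) (simp add: add_nonneg_pos)
    also have "\<dots> = e * (?J / (?J + 1))" by simp
    also have "\<dots> \<le> e * 1" using J1 \<open>0 < e\<close> by (intro mult_left_mono) auto
    finally show "cmod ?I \<le> 0 + e" by simp
  qed
  then show ?thesis by simp
qed

text \<open>It suffices to integrate over boxes. On the cube the indicator of a box is, up to a null
  set, one minus the indicator of a closed subset of the torus, and the latter is a bounded
  pointwise limit of continuous functions on the torus.\<close>

lemma AE_zero_if_Fourier_coefficients_zero:
  fixes h :: "'a::euclidean_space \<Rightarrow> complex"
  assumes h: "integrable lborel h" and z: "\<And>m. m \<in> int_lattice \<Longrightarrow> (\<integral>x. h x * cis (2 * pi * (m \<bullet> x)) \<partial>lborel) = 0"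
    and v: "\<And>x. x \<notin> unit_cube \<Longrightarrow> h x = 0"
  shows "AE x in lborel. h x = 0"
proof (rule AE_zero_if_box_integrals_zero[OF h])
  fix a b :: 'a
  let ?K = "cbox ((-1/2) *\<^sub>R One) ((1/2) *\<^sub>R One) :: 'a set"
  let ?O = "box ((-1/2) *\<^sub>R One) ((1/2) *\<^sub>R One) :: 'a set"
  \<comment> \<open>Removing only the part of the box inside the open cube keeps the remainder
    compact and puts the whole boundary, where the torus map fails to be injective, on one side. The
    corner of the cube shows that \<open>A\<close> is nonempty, so its distance function separates
    points from it.\<close>
  define A where "A = torus_map ` (?K - box a b \<inter> ?O)"
  have "?K - box a b \<inter> ?O = ?K \<inter> (- (box a b \<inter> ?O))" by auto
  then have "compact (?K - box a b \<inter> ?O)" by (auto intro!: compact_Int_closed closed_Compl)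
  then have "compact A" unfolding A_def by (intro compact_continuous_image continuous_torus_map)
  then have cA: "closed A" by (rule compact_imp_closed)
  have "((-1/2) *\<^sub>R One :: 'a) \<in> ?K - box a b \<inter> ?O" by (auto simp: mem_box)
  then have nA: "A \<noteq> {}" unfolding A_def by blast
  \<comment> \<open>Continuous cutoffs that equal 1 on \<open>A\<close> and vanish at distance
    \<open>1/n\<close> and beyond.\<close>
  define g where "g n w = max 0 (1 - real n * infdist w A)" for n w
  have g01: "0 \<le> g n w" "g n w \<le> 1" for n w by (auto simp: g_def infdist_nonneg)
  have gabs: "\<bar>g n w\<bar> \<le> 1" for n w using g01[of n w] by linarith
  have gc: "continuous_on UNIV (g n)" for n
    unfolding g_def by (intro continuous_intros)
  have [measurable]: "g n \<in> borel_measurable borel" for n by (intro borel_measurable_continuous_onI gc)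
  have [measurable]: "h \<in> borel_measurable borel" using h by auto
  have [measurable]: "A \<in> sets borel" using cA by (rule borel_closed)
  have lim: "(\<lambda>n. g n w) \<longlonglongrightarrow> indicator A w" for w
  proof (cases "w \<in> A")
    case True
    then show ?thesis by (simp add: g_def)
  next
    case False
    then have d: "0 < infdist w A" using cA nA by (simp add: infdist_pos_not_in_closed)
    obtain n where n: "1 < real n * infdist w A" using reals_Archimedean3[OF d] by blast
    have "g k w = 0" if "k \<ge> n" for k
    proof -
      have "real n * infdist w A \<le> real k * infdist w A" using that d by (intro mult_right_mono) auto
      then show ?thesis using n by (simp add: g_def)
    qed
    then have "\<forall>\<^sub>F k in sequentially. g k w = 0" unfolding eventually_sequentially by blast
    then show ?thesis using False by (simp add: tendsto_eventually)
  qed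
  have "(\<lambda>n. \<integral>x. h x * complex_of_real (g n (torus_map x)) \<partial>lborel)
      \<longlonglongrightarrow> (\<integral>x. h x * complex_of_real (indicator A (torus_map x)) \<partial>lborel)"
  proof (rule integral_dominated_convergence[where w="\<lambda>x. cmod (h x)"])
    show "AE x in lborel. norm (h x * complex_of_real (g n (torus_map x))) \<le> cmod (h x)" for n
      by (intro AE_I2) (simp add: norm_mult mult_left_le gabs)
    show "AE x in lborel. (\<lambda>n. h x * complex_of_real (g n (torus_map x))) \<longlonglongrightarrow> h x * complex_of_real (indicator A (torus_map x))"
      by (intro AE_I2 tendsto_intros lim)
  qed (use h in auto)
  moreover have "(\<integral>x. h x * complex_of_real (g n (torus_map x)) \<partial>lborel) = 0" for n
    by (rule torus_continuous_integral_zero[OF h z v gc, where B=1]) (assumption | rule gabs)+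
  ultimately have A0: "(\<integral>x. h x * complex_of_real (indicator A (torus_map x)) \<partial>lborel) = 0"
    by (simp add: LIMSEQ_const_iff)
  have h0: "(\<integral>x. h x \<partial>lborel) = 0" using z[of 0] by simp
  have iA: "integrable lborel (\<lambda>x. h x * complex_of_real (indicator A (torus_map x)))"
    by (rule integrable_mult_bounded[OF h, where B=1]) (auto simp: indicator_def)
  have "(\<integral>x. indicator (box a b) x * h x \<partial>lborel)
      = (\<integral>x. h x - h x * complex_of_real (indicator A (torus_map x)) \<partial>lborel)"
  proof (rule integral_cong_AE)
    show "AE x in lborel. indicator (box a b) x * h x = h x - h x * complex_of_real (indicator A (torus_map x))"
      using AE_unit_cube_box
    proof eventually_elim
      case (elim x)
      show ?case
      proof (cases "x \<in> unit_cube")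
        case True
        then have x: "x \<in> ?O" using elim by blast
        then have xK: "x \<in> ?K" using box_subset_cbox by blast
        have "torus_map x \<in> A \<longleftrightarrow> x \<notin> box a b"
        proof
          assume "torus_map x \<in> A"
          then obtain y where "y \<in> ?K - box a b \<inter> ?O" "torus_map x = torus_map y" unfolding A_def by blast
          with torus_map_eq_imp[OF _ x, of y] show "x \<notin> box a b" using x by blast
        qed (use x xK in \<open>auto simp: A_def\<close>)
        then show ?thesis by (auto simp: indicator_def)
      qed (simp add: v)
    qed
  qed measurable
  also have "\<dots> = 0" using A0 h0 h iA by simp
  finally show "(\<integral>x. indicator (box a b) x * h x \<partial>lborel) = 0" .
qed

lemma L2_lborel_borel_measurable: "f \<in> L2 lborel \<Longrightarrow> f \<in> borel_measurable borel"
  by (drule L2_measurable) simp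

lemma cis_sum: "cis (sum f A) = (\<Prod>x\<in>A. cis (f x))"
  by (induction A rule: infinite_finite_induct) (auto simp: cis_mult[symmetric])

lemma integral_character_interval:
  fixes a :: real
  assumes "a \<in> \<int>"
  shows "(\<integral>t. indicator {-1/2..<1/2} t * cis (2 * pi * (a * t)) \<partial>lborel) = (if a = 0 then 1 else 0)"
proof -
  \<comment> \<open>An antiderivative of the character. For \<open>a = 0\<close> the quotient would
    divide by zero, so that case has its own formula. For other integers both end points give the
    same value.\<close>
  define F where "F t = (if a = 0 then complex_of_real t else cis (2 * pi * (a * t)) / (\<i> * complex_of_real (2 * pi * a)))" for t
  have "(\<integral>t. indicator {-1/2..<1/2} t * cis (2 * pi * (a * t)) \<partial>lborel)
      = (\<integral>t. indicator {-1/2..1/2} t *\<^sub>R cis (2 * pi * (a * t)) \<partial>lborel)"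
  proof (rule integral_cong_AE)
    show "AE t in lborel. indicator {-1/2..<1/2} t * cis (2 * pi * (a * t)) = indicator {-1/2..1/2} t *\<^sub>R cis (2 * pi * (a * t))"
      using AE_lborel_singleton[of "1/2::real"] by eventually_elim (auto simp: indicator_def)
    have [measurable]: "(\<lambda>t. cis (2 * pi * (a * t))) \<in> borel_measurable borel"
      by (intro borel_measurable_continuous_onI continuous_intros)
    show "(\<lambda>t. indicator {-1/2..<1/2} t * cis (2 * pi * (a * t))) \<in> borel_measurable lborel"
      "(\<lambda>t. indicator {-1/2..1/2} t *\<^sub>R cis (2 * pi * (a * t))) \<in> borel_measurable lborel" by measurable
  qed
  also have "\<dots> = F (1/2) - F (-1/2)"
  proof (rule integral_FTC_Icc)
    show "continuous_on {-1/2..1/2} (\<lambda>t. cis (2 * pi * (a * t)))" by (intro continuous_intros)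
    show "(F has_vector_derivative cis (2 * pi * (a * t))) (at t within {-1/2..1/2})" for t
    proof (cases "a = 0")
      case True
      then show ?thesis unfolding F_def by (auto intro!: derivative_eq_intros simp: has_vector_derivative_def scaleR_conv_of_real)
    next
      case False
      have "((\<lambda>t. cis (2 * pi * (a * t))) has_vector_derivative (2 * pi * a) *\<^sub>R (\<i> * cis (2 * pi * (a * t)))) (at t within {-1/2..1/2})"
        by (auto simp: has_vector_derivative_def intro!: derivative_eq_intros)
      from has_vector_derivative_mult_right[OF this, of "1 / (\<i> * complex_of_real (2 * pi * a))"]
      show ?thesis using False unfolding F_def by (simp add: scaleR_conv_of_real field_simps)
    qed
  qed simp
  also have "\<dots> = (if a = 0 then 1 else 0)"
  proof -
    have "cis (pi * a) = cis (- (pi * a))"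
    proof -
      obtain k where "a = of_int k" using assms by (auto elim: Ints_cases)
      then have "sin (pi * a) = 0" by (simp add: sin_integer_2pi sin_zero_iff_int2 mult.commute)
      then show ?thesis by (simp add: complex_eq_iff)
    qed
    then show ?thesis by (auto simp: F_def diff_divide_distrib[symmetric])
  qed
  finally show ?thesis .
qed

lemma indicator_unit_cube_prod:
  "(indicator unit_cube x :: complex) = (\<Prod>b\<in>Basis. indicator {-1/2..<1/2} (x \<bullet> b))"
proof (cases "x \<in> unit_cube")
  case True
  then have "(\<Prod>b\<in>Basis. indicator {-1/2..<1/2} (x \<bullet> b) :: complex) = 1"
    by (intro prod.neutral) (auto simp: unit_cube_def indicator_def)
  then show ?thesis using True by simp
next
  case False
  then obtain b where "b \<in> Basis" "x \<bullet> b \<notin> {-1/2..<1/2}" by (auto simp: unit_cube_def)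
  then have "(\<Prod>b\<in>Basis. indicator {-1/2..<1/2} (x \<bullet> b) :: complex) = 0"
    by (intro prod_zero) (auto intro!: bexI[of _ b])
  then show ?thesis using False by simp
qed

text \<open>Indicator and character both factor over the coordinates, and Lebesgue measure is the
  image of a product measure, so the integral is a product of one-dimensional ones.\<close>

lemma integral_character_unit_cube:
  fixes m :: "'a::euclidean_space"
  assumes m: "m \<in> int_lattice"
  shows "(\<integral>x. indicator unit_cube x * cis (2 * pi * (m \<bullet> x)) \<partial>lborel) = (if m = 0 then 1 else 0)"
proof -
  interpret product_sigma_finite "\<lambda>b::'a. lborel :: real measure" by standard
  define \<phi> :: "'a \<Rightarrow> real \<Rightarrow> complex" where "\<phi> b t = indicator {-1/2..<1/2} t * cis (2 * pi * ((m \<bullet> b) * t))" for b t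
  have int: "integrable lborel (\<phi> b)" for b
  proof -
    have [measurable]: "(\<lambda>t. cis (2 * pi * ((m \<bullet> b) * t))) \<in> borel_measurable borel"
      by (intro borel_measurable_continuous_onI continuous_intros)
    have "integrable lborel (\<lambda>t. complex_of_real (indicat_real {-1/2..<1/2::real} t))"
      by (intro integrable_of_real integrable_real_indicator) auto
    then have "integrable lborel (\<lambda>t. complex_of_real (indicat_real {-1/2..<1/2::real} t) * cis (2 * pi * ((m \<bullet> b) * t)))"
      by (rule integrable_mult_bounded[where B=1]) auto
    then show ?thesis unfolding \<phi>_def by (rule Bochner_Integration.integrable_cong[THEN iffD1, rotated -1]) (auto simp: indicator_def)
  qed
  have "indicator unit_cube x * cis (2 * pi * (m \<bullet> x)) = (\<Prod>b\<in>Basis. \<phi> b (x \<bullet> b))" for x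
  proof -
    have "2 * pi * (m \<bullet> x) = (\<Sum>b\<in>Basis. 2 * pi * ((m \<bullet> b) * (x \<bullet> b)))"
      by (subst euclidean_inner[of m]) (simp add: sum_distrib_left mult.assoc)
    then show ?thesis unfolding \<phi>_def prod.distrib by (simp add: cis_sum indicator_unit_cube_prod)
  qed
  then have "(\<integral>x. indicator unit_cube x * cis (2 * pi * (m \<bullet> x)) \<partial>lborel)
      = (\<integral>x. (\<Prod>b\<in>Basis. \<phi> b (x \<bullet> b)) \<partial>(lborel :: 'a measure))" by simp
  also have "\<dots> = (\<integral>f. (\<Prod>b\<in>Basis. \<phi> b ((\<Sum>b\<in>Basis. f b *\<^sub>R b) \<bullet> b)) \<partial>(\<Pi>\<^sub>M b\<in>Basis. lborel))"
  proof (subst lborel_eq, rule integral_distr)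
    have [measurable]: "\<phi> b \<in> borel_measurable borel" for b using int[of b] by auto
    show "(\<lambda>x. \<Prod>b\<in>Basis. \<phi> b (x \<bullet> b)) \<in> borel_measurable borel" by measurable
    show "(\<lambda>f. \<Sum>b\<in>Basis. f b *\<^sub>R b) \<in> (\<Pi>\<^sub>M b\<in>(Basis::'a set). lborel) \<rightarrow>\<^sub>M borel" by measurable
  qed
  also have "\<dots> = (\<integral>f. (\<Prod>b\<in>Basis. \<phi> b (f b)) \<partial>(\<Pi>\<^sub>M b\<in>Basis. lborel))"
    by (intro Bochner_Integration.integral_cong prod.cong) auto
  also have "\<dots> = (\<Prod>b\<in>Basis. \<integral>t. \<phi> b t \<partial>lborel)"
    by (rule product_integral_prod) (auto intro: int)
  also have "\<dots> = (\<Prod>b\<in>Basis. if m \<bullet> b = 0 then 1 else 0)"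
    unfolding \<phi>_def using m by (intro prod.cong integral_character_interval) (auto simp: int_lattice_def)
  also have "\<dots> = (if m = 0 then 1 else 0)"
  proof (cases "m = 0")
    case False
    then obtain b where "b \<in> Basis" "m \<bullet> b \<noteq> 0" using euclidean_all_zero_iff by blast
    then have "(\<Prod>b\<in>Basis. if m \<bullet> b = 0 then 1 else 0 :: complex) = 0"
      by (intro prod_zero) (auto intro!: bexI[of _ b])
    then show ?thesis using False by simp
  qed simp
  finally show ?thesis .
qed

section \<open>Parseval's identity on cubes\<close>

lemma infinite_int_lattice: "infinite (int_lattice :: 'a::euclidean_space set)"
proof -
  obtain b :: 'a where b: "b \<in> Basis" using nonempty_Basis by blast
  have "inj (\<lambda>n::nat. real n *\<^sub>R b)" using b by (auto simp: inj_on_def)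
  then have "infinite (range (\<lambda>n::nat. real n *\<^sub>R b))" by (rule range_inj_infinite)
  moreover have "range (\<lambda>n::nat. real n *\<^sub>R b) \<subseteq> int_lattice" using b by (auto simp: int_lattice_def inner_Basis)
  ultimately show ?thesis using finite_subset by blast
qed

lemma borel_measurable_character[measurable]:
  "(\<lambda>x. cis (2 * pi * (m \<bullet> x))) \<in> borel_measurable (borel :: 'a::euclidean_space measure)"
  by (intro borel_measurable_continuous_onI continuous_intros)

lemma emeasure_unit_cube_translate: "emeasure lborel ((\<lambda>x. x - q) -` unit_cube :: 'a::euclidean_space set) = 1"
proof -
  have "lborel = distr lborel borel ((+) (-q))" using lborel_distr_plus[of "-q"] by simp
  then have "emeasure lborel (unit_cube :: 'a set) = emeasure (distr lborel borel ((+) (-q))) unit_cube" by simp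
  also have "\<dots> = emeasure lborel ((\<lambda>x. x - q) -` unit_cube)" by (subst emeasure_distr) (auto simp: vimage_def add.commute[of "- q"])
  finally show ?thesis by (simp add: emeasure_unit_cube)
qed

lemma L2_times_indicator:
  assumes "f \<in> L2 M" "A \<in> sets M"
  shows "(\<lambda>x. indicator A x * f x) \<in> L2 M" "L2_norm M (\<lambda>x. indicator A x * f x) \<le> L2_norm M f"
  by (rule L2_bound[OF assms(1)]; use assms in \<open>auto simp: indicator_def\<close>)+

text \<open>The difference between \<open>h\<close> and its orthonormal expansion, restricted to the
  cube, has no Fourier coefficients, hence vanishes. The sum is written as a nonnegative integral
  over the counting measure so that later exchanges of sums and integrals need no summability
  argument.\<close>

lemma parseval_unit_cube:
  fixes h :: "'a::euclidean_space \<Rightarrow> complex"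
  assumes h: "h \<in> L2 lborel" and v: "\<And>x. x \<notin> unit_cube \<Longrightarrow> h x = 0"
  shows "(\<integral>\<^sup>+m. ennreal ((cmod (\<integral>x. h x * cis (2 * pi * (m \<bullet> x)) \<partial>lborel))\<^sup>2) \<partial>count_space int_lattice)
       = ennreal ((L2_norm lborel h)\<^sup>2)"
proof -
  define s where "s = from_nat_into (int_lattice :: 'a set)"
  have bij: "bij_betw s UNIV int_lattice"
    unfolding s_def by (rule bij_betw_from_nat_into[OF countable_int_lattice infinite_int_lattice])
  have sl: "s i \<in> int_lattice" for i using bij by (auto simp: bij_betw_def)
  \<comment> \<open>The minus sign is undone by the conjugation in \<open>L2_inner\<close>, so the
    coefficients have the sign used in the statement.\<close>
  define e where "e i x = indicator unit_cube x * cis (2 * pi * (- s i \<bullet> x))" for i x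
  have e: "e i \<in> L2 lborel" for i unfolding e_def
  proof (rule L2_bound(1)[of "indicator unit_cube :: 'a \<Rightarrow> complex"])
    show "(indicator unit_cube :: 'a \<Rightarrow> complex) \<in> L2 lborel" by (rule L2_indicator) (auto simp: emeasure_unit_cube)
    show "(\<lambda>x. indicator unit_cube x * cis (2 * pi * (- s i \<bullet> x))) \<in> borel_measurable lborel" by measurable
  qed (auto simp: norm_mult)
  have on: "L2_inner lborel (e i) (e j) = (if i = j then 1 else 0)" for i j
  proof -
    have "e i x * cnj (e j x) = indicator unit_cube x * cis (2 * pi * ((s j - s i) \<bullet> x))" for x
      unfolding e_def by (simp add: cis_cnj cis_mult indicator_def inner_diff_left algebra_simps)
    then have "L2_inner lborel (e i) (e j) = (if s j - s i = 0 then 1 else 0)"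
      unfolding L2_inner_def using integral_character_unit_cube[OF int_lattice_diff[OF sl sl]] by simp
    then show ?thesis using bij by (auto simp: bij_betw_def inj_on_def)
  qed
  have inner_e: "L2_inner lborel f (e i) = (\<integral>x. (indicator unit_cube x * f x) * cis (2 * pi * (s i \<bullet> x)) \<partial>lborel)" for f i
    unfolding L2_inner_def e_def by (intro Bochner_Integration.integral_cong) (auto simp: cis_cnj indicator_def)
  have hind: "indicator unit_cube x * h x = h x" for x using v by (auto simp: indicator_def)
  obtain t where t: "t \<in> L2 lborel" "L2_converges lborel (\<lambda>n x. \<Sum>i<n. L2_inner lborel h (e i) * e i x) t"
    "\<And>i. L2_inner lborel t (e i) = L2_inner lborel h (e i)"
    "(\<lambda>i. (cmod (L2_inner lborel h (e i)))\<^sup>2) sums (L2_norm lborel t)\<^sup>2"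
    by (rule L2_orthonormal_expansion[OF e on h]) blast
  let ?S = "\<lambda>n x. \<Sum>i<n. L2_inner lborel h (e i) * e i x"
  let ?t = "\<lambda>x. indicator unit_cube x * t x"
  have t': "?t \<in> L2 lborel" by (rule L2_times_indicator) (use t in auto)
  have SL: "?S n \<in> L2 lborel" for n by (intro L2_sum L2_scale e)
  \<comment> \<open>All partial sums live on the cube, so cutting the limit to the cube does not
    increase the distance to them; by uniqueness of limits \<open>t\<close> vanishes almost
    everywhere outside.\<close>
  have "L2_converges lborel ?S ?t"
    unfolding L2_converges_def
  proof (rule Lim_null_comparison[OF _ t(2)[unfolded L2_converges_def]], rule always_eventually, rule allI)
    fix n
    have "?S n x - ?t x = indicator unit_cube x * (?S n x - t x)" for x
      by (auto simp: e_def indicator_def)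
    then have "L2_norm lborel (\<lambda>x. ?S n x - ?t x) = L2_norm lborel (\<lambda>x. indicator unit_cube x * (?S n x - t x))" by simp
    also have "\<dots> \<le> L2_norm lborel (\<lambda>x. ?S n x - t x)"
      by (rule L2_times_indicator(2)[OF L2_diff[OF SL t(1)]]) simp
    finally show "norm (L2_norm lborel (\<lambda>x. ?S n x - ?t x)) \<le> L2_norm lborel (\<lambda>x. ?S n x - t x)" by simp
  qed
  from L2_limit_unique[OF SL t(1,2) t' this] have tt: "AE x in lborel. t x = ?t x" .
  have d: "(\<lambda>x. h x - t x) \<in> L2 lborel" using h t by blast
  have "AE x in lborel. indicator unit_cube x * (h x - t x) = 0"
  proof (rule AE_zero_if_Fourier_coefficients_zero)
    show "integrable lborel (\<lambda>x. indicator unit_cube x * (h x - t x))"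
      by (rule L2_mult_integrable(2)[OF L2_indicator d]) (auto simp: emeasure_unit_cube)
    fix m :: 'a assume "m \<in> int_lattice"
    then obtain i where i: "m = s i" using bij by (auto simp: bij_betw_def)
    have "L2_inner lborel (\<lambda>x. h x - t x) (e i) = 0" by (simp add: L2_inner_diff_left h t e)
    then show "(\<integral>x. indicator unit_cube x * (h x - t x) * cis (2 * pi * (m \<bullet> x)) \<partial>lborel) = 0"
      unfolding inner_e i .
  qed simp
  with tt have ht: "AE x in lborel. h x = t x"
    by eventually_elim (use hind in \<open>auto simp: right_diff_distrib\<close>)
  have "(\<integral>\<^sup>+m. ennreal ((cmod (\<integral>x. h x * cis (2 * pi * (m \<bullet> x)) \<partial>lborel))\<^sup>2) \<partial>count_space int_lattice)
      = (\<integral>\<^sup>+i. ennreal ((cmod (L2_inner lborel h (e i)))\<^sup>2) \<partial>count_space UNIV)"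
    unfolding inner_e hind by (rule nn_integral_bij_count_space[OF bij, symmetric])
  also have "\<dots> = (\<Sum>i. ennreal ((cmod (L2_inner lborel h (e i)))\<^sup>2))" by (rule nn_integral_count_space_nat)
  also have "\<dots> = ennreal ((L2_norm lborel t)\<^sup>2)"
    using t(4) by (intro suminf_ennreal_eq) auto
  also have "L2_norm lborel t = L2_norm lborel h"
    by (rule L2_norm_cong_AE) (use L2_measurable[OF h] L2_measurable[OF t(1)] ht in auto)
  finally show ?thesis .
qed

section \<open>Changes of variables in Lebesgue measure and Parseval in transformed
  coordinates\<close>

text \<open>\<open>D\<close> is the constant Jacobian of \<open>L\<close>. Stated through the
  pushed-forward measure, the notion covers dilations, matrices, reflections, shears and left
  translations of the group alike.\<close>

definition scales_lborel :: "('a::euclidean_space \<Rightarrow> 'a) \<Rightarrow> real \<Rightarrow> bool" where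
  "scales_lborel L D \<longleftrightarrow> L \<in> borel_measurable borel \<and> 0 < D \<and>
     lborel = density (distr lborel borel L) (\<lambda>_. ennreal D)"

lemma scales_lborel_nn_integral:
  assumes "scales_lborel L D" and [measurable]: "g \<in> borel_measurable borel"
  shows "(\<integral>\<^sup>+x. g x \<partial>lborel) = ennreal D * (\<integral>\<^sup>+x. g (L x) \<partial>lborel)"
proof -
  have [measurable]: "L \<in> borel_measurable borel" using assms by (simp add: scales_lborel_def)
  have "(\<integral>\<^sup>+x. g x \<partial>lborel) = (\<integral>\<^sup>+x. g x \<partial>density (distr lborel borel L) (\<lambda>_. ennreal D))"
    using assms(1) unfolding scales_lborel_def by metis
  also have "\<dots> = ennreal D * (\<integral>\<^sup>+x. g (L x) \<partial>lborel)"
    by (subst nn_integral_density) (simp_all add: nn_integral_distr nn_integral_cmult)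
  finally show ?thesis .
qed

lemma scales_lborel_integral:
  fixes g :: "'a::euclidean_space \<Rightarrow> complex"
  assumes "scales_lborel L D" and [measurable]: "g \<in> borel_measurable borel"
  shows "(\<integral>x. g x \<partial>lborel) = complex_of_real D * (\<integral>x. g (L x) \<partial>lborel)"
proof -
  have [measurable]: "L \<in> borel_measurable borel" and D: "0 < D" using assms by (simp_all add: scales_lborel_def)
  have "(\<integral>x. g x \<partial>lborel) = (\<integral>x. g x \<partial>density (distr lborel borel L) (\<lambda>_. ennreal D))"
    using assms(1) unfolding scales_lborel_def by metis
  also have "\<dots> = complex_of_real D * (\<integral>x. g (L x) \<partial>lborel)"
    using D by (subst integral_density) (simp_all add: integral_distr scaleR_conv_of_real)
  finally show ?thesis .
qed

lemma scales_lborel_scaleR: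
  assumes "0 < r" shows "scales_lborel (\<lambda>x::'a::euclidean_space. r *\<^sub>R x) (r ^ DIM('a))"
  using assms lborel_affine[of r "0::'a"] by (simp add: scales_lborel_def)

text \<open>Substituting \<open>u = L x\<close> multiplies the squared norm by \<open>D\<close> and
  each coefficient by \<open>D\<close>, hence the sum of squares by \<open>D\<close> squared; one
  factor \<open>D\<close> remains on the left.\<close>

lemma parseval_scaled:
  fixes h :: "'a::euclidean_space \<Rightarrow> complex"
  assumes L: "scales_lborel L D" and L': "L' \<in> borel_measurable borel" "\<And>x. L' (L x) = x" "\<And>x. L (L' x) = x"
    and h: "h \<in> L2 lborel" and v: "\<And>x. L x \<notin> unit_cube \<Longrightarrow> h x = 0"
  shows "ennreal D * (\<integral>\<^sup>+m. ennreal ((cmod (\<integral>x. h x * cis (2 * pi * (m \<bullet> L x)) \<partial>lborel))\<^sup>2) \<partial>count_space int_lattice)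
       = ennreal ((L2_norm lborel h)\<^sup>2)"
proof -
  have D: "0 < D" using L by (simp add: scales_lborel_def)
  have [measurable]: "h \<in> borel_measurable borel" "L' \<in> borel_measurable borel" using L2_lborel_borel_measurable[OF h] L' by auto
  define k where "k u = h (L' u)" for u
  have [measurable]: "k \<in> borel_measurable borel" unfolding k_def by measurable
  have "(\<integral>\<^sup>+u. ennreal ((cmod (k u))\<^sup>2) \<partial>lborel) = ennreal D * (\<integral>\<^sup>+x. ennreal ((cmod (k (L x)))\<^sup>2) \<partial>lborel)"
    by (rule scales_lborel_nn_integral[OF L]) measurable
  also have "\<dots> = ennreal (D * (L2_norm lborel h)\<^sup>2)"
    unfolding k_def L'(2) nn_integral_L2[OF h] using D by (simp add: ennreal_mult)
  finally have nk: "(\<integral>\<^sup>+u. ennreal ((cmod (k u))\<^sup>2) \<partial>lborel) = ennreal (D * (L2_norm lborel h)\<^sup>2)" .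
  then have kL: "k \<in> L2 lborel" by (intro L2I) auto
  have "k u = 0" if "u \<notin> unit_cube" for u using v[of "L' u"] that by (simp add: k_def L'(3))
  from parseval_unit_cube[OF kL this]
  have "(\<integral>\<^sup>+m. ennreal ((cmod (\<integral>u. k u * cis (2 * pi * (m \<bullet> u)) \<partial>lborel))\<^sup>2) \<partial>count_space int_lattice) = ennreal (D * (L2_norm lborel h)\<^sup>2)"
    using nn_integral_L2[OF kL] nk by simp
  moreover have "(\<integral>u. k u * cis (2 * pi * (m \<bullet> u)) \<partial>lborel) = complex_of_real D * (\<integral>x. h x * cis (2 * pi * (m \<bullet> L x)) \<partial>lborel)" for m
    by (subst scales_lborel_integral[OF L]) (simp_all add: k_def L'(2))
  ultimately have "ennreal (D\<^sup>2) * (\<integral>\<^sup>+m. ennreal ((cmod (\<integral>x. h x * cis (2 * pi * (m \<bullet> L x)) \<partial>lborel))\<^sup>2) \<partial>count_space int_lattice)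
      = ennreal (D * (L2_norm lborel h)\<^sup>2)"
    using D by (simp add: norm_mult power_mult_distrib ennreal_mult nn_integral_cmult)
  then have "ennreal (1/D) * (ennreal (D * D) * (\<integral>\<^sup>+m. ennreal ((cmod (\<integral>x. h x * cis (2 * pi * (m \<bullet> L x)) \<partial>lborel))\<^sup>2) \<partial>count_space int_lattice))
      = ennreal (1/D) * ennreal (D * (L2_norm lborel h)\<^sup>2)" by (simp add: power2_eq_square)
  then show ?thesis using D by (simp add: mult.assoc[symmetric] ennreal_mult[symmetric])
qed

lemma scales_lborelI:
  assumes [measurable]: "L \<in> borel_measurable borel" and D: "0 < D"
    and g: "\<And>g::'a::euclidean_space \<Rightarrow> ennreal. g \<in> borel_measurable borel \<Longrightarrow>
      (\<integral>\<^sup>+x. g x \<partial>lborel) = ennreal D * (\<integral>\<^sup>+x. g (L x) \<partial>lborel)"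
  shows "scales_lborel L D"
  unfolding scales_lborel_def
proof (intro conjI measure_eqI)
  fix A :: "'a set" assume "A \<in> sets lborel"
  then have [measurable]: "A \<in> sets borel" by simp
  have "emeasure lborel A = (\<integral>\<^sup>+x. indicator A x \<partial>lborel)" by simp
  also have "\<dots> = ennreal D * (\<integral>\<^sup>+x. indicator A (L x) \<partial>lborel)" by (rule g) measurable
  also have "(\<integral>\<^sup>+x. indicator A (L x) \<partial>lborel) = emeasure (distr lborel borel L) A"
    by (subst nn_integral_distr[of L lborel borel "indicator A", symmetric]) auto
  finally show "emeasure lborel A = emeasure (density (distr lborel borel L) (\<lambda>_. ennreal D)) A"
    by (simp add: emeasure_density_const)
qed (use D in auto)

lemma scales_lborel_comp:
  assumes L: "scales_lborel L D" and L': "scales_lborel L' D'"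
  shows "scales_lborel (L \<circ> L') (D * D')"
proof (rule scales_lborelI)
  have [measurable]: "L \<in> borel_measurable borel" "L' \<in> borel_measurable borel" and D: "0 < D" "0 < D'"
    using assms by (auto simp: scales_lborel_def)
  show "L \<circ> L' \<in> borel_measurable borel" by simp
  show "0 < D * D'" using D by simp
  fix g :: "'a \<Rightarrow> ennreal" assume [measurable]: "g \<in> borel_measurable borel"
  have "(\<integral>\<^sup>+x. g x \<partial>lborel) = ennreal D * (\<integral>\<^sup>+x. g (L x) \<partial>lborel)"
    by (rule scales_lborel_nn_integral[OF L]) measurable
  also have "(\<integral>\<^sup>+x. g (L x) \<partial>lborel) = ennreal D' * (\<integral>\<^sup>+x. g (L (L' x)) \<partial>lborel)"
    by (rule scales_lborel_nn_integral[OF L']) measurable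
  finally show "(\<integral>\<^sup>+x. g x \<partial>lborel) = ennreal (D * D') * (\<integral>\<^sup>+x. g ((L \<circ> L') x) \<partial>lborel)"
    using D by (simp add: ennreal_mult mult.assoc)
qed

lemma scales_lborel_translate: "scales_lborel (\<lambda>x. x + t) 1"
  using lborel_distr_plus[of t] by (simp add: scales_lborel_def density_1 add.commute[of t] fun_eq_iff cong: distr_cong)

lemmas nn_integral_translate = scales_lborel_nn_integral[OF scales_lborel_translate, simplified]
lemmas integral_translate = scales_lborel_integral[OF scales_lborel_translate, simplified]

lemma scales_lborel_shear:
  fixes e :: "'a::euclidean_space"
  assumes e: "e \<in> Basis" and [measurable]: "\<phi> \<in> borel_measurable borel" and \<phi>: "\<And>x s. \<phi> (x + s *\<^sub>R e) = \<phi> x"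
  shows "scales_lborel (\<lambda>x. x + \<phi> x *\<^sub>R e) 1"
proof (rule scales_lborelI)
  have ee: "e \<bullet> e = 1" using e by (simp add: inner_Basis)
  \<comment> \<open>Averaging over translations along \<open>e\<close> turns the shear into a one-dimensional translation.\<close>
  have key: "(\<integral>\<^sup>+x. g (x + \<psi> x *\<^sub>R e) \<partial>lborel)
      = (\<integral>\<^sup>+x. indicator {0..<1} (x \<bullet> e) * (\<integral>\<^sup>+s. g (x + s *\<^sub>R e) \<partial>lborel) \<partial>lborel)"
    if [measurable]: "g \<in> borel_measurable borel" "\<psi> \<in> borel_measurable borel" and \<psi>: "\<And>x s. \<psi> (x + s *\<^sub>R e) = \<psi> x"
    for g :: "'a \<Rightarrow> ennreal" and \<psi> :: "'a \<Rightarrow> real"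
  proof -
    have one: "(\<integral>\<^sup>+s. indicator {0..<1} (c + s) \<partial>lborel) = (1::ennreal)" for c :: real
    proof -
      have "(\<integral>\<^sup>+s. indicator {0..<1} (c + s) \<partial>lborel) = (\<integral>\<^sup>+s. indicator {0..<1::real} s \<partial>lborel)"
        using nn_integral_translate[of "indicator {0..<1::real}" c] by (simp add: add.commute)
      also have "\<dots> = 1" by (subst nn_integral_indicator) auto
      finally show ?thesis .
    qed
    have "(\<integral>\<^sup>+x. g (x + \<psi> x *\<^sub>R e) \<partial>lborel)
        = (\<integral>\<^sup>+x. (\<integral>\<^sup>+s. g (x + \<psi> x *\<^sub>R e) * indicator {0..<1} (x \<bullet> e + s) \<partial>lborel) \<partial>lborel)"
      by (simp add: nn_integral_cmult one)
    also have "\<dots> = (\<integral>\<^sup>+s. (\<integral>\<^sup>+x. g (x + \<psi> x *\<^sub>R e) * indicator {0..<1} (x \<bullet> e + s) \<partial>lborel) \<partial>lborel)"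
      by (rule lborel_pair.Fubini') measurable
    also have "\<dots> = (\<integral>\<^sup>+s. (\<integral>\<^sup>+x. g (x + (\<psi> x - s) *\<^sub>R e) * indicator {0..<1} (x \<bullet> e) \<partial>lborel) \<partial>lborel)"
    proof (rule nn_integral_cong)
      fix s :: real
      have "(\<integral>\<^sup>+x. g (x + \<psi> x *\<^sub>R e) * indicator {0..<1} (x \<bullet> e + s) \<partial>lborel)
         = (\<integral>\<^sup>+x. g ((x + (- s) *\<^sub>R e) + \<psi> (x + (- s) *\<^sub>R e) *\<^sub>R e) * indicator {0..<1} ((x + (- s) *\<^sub>R e) \<bullet> e + s) \<partial>lborel)"
        by (rule nn_integral_translate) measurable
      also have "\<dots> = (\<integral>\<^sup>+x. g (x + (\<psi> x - s) *\<^sub>R e) * indicator {0..<1} (x \<bullet> e) \<partial>lborel)"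
        unfolding \<psi> by (simp add: inner_add_left ee algebra_simps)
      finally show "(\<integral>\<^sup>+x. g (x + \<psi> x *\<^sub>R e) * indicator {0..<1} (x \<bullet> e + s) \<partial>lborel)
         = (\<integral>\<^sup>+x. g (x + (\<psi> x - s) *\<^sub>R e) * indicator {0..<1} (x \<bullet> e) \<partial>lborel)" .
    qed
    also have "\<dots> = (\<integral>\<^sup>+x. (\<integral>\<^sup>+s. g (x + (\<psi> x - s) *\<^sub>R e) * indicator {0..<1} (x \<bullet> e) \<partial>lborel) \<partial>lborel)"
      by (rule lborel_pair.Fubini') measurable
    also have "\<dots> = (\<integral>\<^sup>+x. indicator {0..<1} (x \<bullet> e) * (\<integral>\<^sup>+s. g (x + s *\<^sub>R e) \<partial>lborel) \<partial>lborel)"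
    proof (rule nn_integral_cong)
      fix x
      have "(\<integral>\<^sup>+s. g (x + (\<psi> x - s) *\<^sub>R e) \<partial>lborel) = (\<integral>\<^sup>+s. g (x + s *\<^sub>R e) \<partial>lborel)"
        using nn_integral_real_affine[of "\<lambda>s. g (x + s *\<^sub>R e)" "-1" "\<psi> x"] by simp
      then show "(\<integral>\<^sup>+s. g (x + (\<psi> x - s) *\<^sub>R e) * indicator {0..<1} (x \<bullet> e) \<partial>lborel)
          = indicator {0..<1} (x \<bullet> e) * (\<integral>\<^sup>+s. g (x + s *\<^sub>R e) \<partial>lborel)"
        by (simp add: nn_integral_cmult mult.commute)
    qed
    finally show ?thesis .
  qed
  fix g :: "'a \<Rightarrow> ennreal" assume [measurable]: "g \<in> borel_measurable borel"
  show "(\<integral>\<^sup>+x. g x \<partial>lborel) = ennreal 1 * (\<integral>\<^sup>+x. g (x + \<phi> x *\<^sub>R e) \<partial>lborel)"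
    \<comment> \<open>The average in \<open>key\<close> does not involve the shift, so the shears
      along \<open>\<phi>\<close> and along 0 give the same integral.\<close>
    using key[of g \<phi>] key[of g "\<lambda>_. 0"] \<phi> by simp
qed auto

text \<open>Induction over elementary matrices: the property is multiplicative like the determinant,
  a zero row is excluded by the determinant, and there remain diagonal matrices, transpositions of
  coordinates and shears.\<close>

lemma scales_lborel_matrix:
  fixes A :: "real^'n^'n"
  shows "det A \<noteq> 0 \<Longrightarrow> scales_lborel ((*v) A) \<bar>det A\<bar>"
proof (induction A rule: induct_matrix_elementary)
  case (1 A B)
  then have "scales_lborel ((*v) A \<circ> (*v) B) (\<bar>det A\<bar> * \<bar>det B\<bar>)"
    by (intro scales_lborel_comp) (auto simp: det_mul)
  then show ?case by (simp only: matrix_vector_mult_matrix_matrix_mult_compose det_mul abs_mult)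
next
  case (2 A i)
  then show ?case by (simp add: det_zero_row)
next
  case (3 A)
  have dA: "det A = (\<Prod>i\<in>UNIV. A $ i $ i)" using 3(1) by (rule det_diagonal)
  define c where "c b = (A *v b) \<bullet> b" for b
  have cA: "c (axis i 1) = A $ i $ i" for i
    by (simp add: c_def inner_axis matrix_vector_mul_component inner_vec_def axis_def if_distrib cong: if_cong)
  have nz: "c j \<noteq> 0" if "j \<in> Basis" for j
    using that 3(2) unfolding dA by (auto simp: Basis_vec_def cA)
  have eqA: "(*v) A = (\<lambda>x. 0 + (\<Sum>j\<in>Basis. (c j * (x \<bullet> j)) *\<^sub>R j))"
  proof
    fix x
    have "(A *v x) $ i = A $ i $ i * x $ i" for i
    proof -
      have "(A *v x) $ i = (\<Sum>j\<in>UNIV. if j = i then A $ i $ i * x $ i else 0)"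
        unfolding matrix_vector_mult_def vec_lambda_beta by (intro sum.cong) (auto simp: 3(1))
      then show ?thesis by simp
    qed
    then have Ax: "(A *v x) \<bullet> axis i 1 = c (axis i 1) * (x \<bullet> axis i 1)" for i
      unfolding cA by (simp add: inner_axis)
    show "A *v x = 0 + (\<Sum>j\<in>Basis. (c j * (x \<bullet> j)) *\<^sub>R j)"
    proof (rule euclidean_eqI)
      fix b :: "real^'n" assume b: "b \<in> Basis"
      then obtain i where "b = axis i 1" by (auto simp: Basis_vec_def)
      then show "(A *v x) \<bullet> b = (0 + (\<Sum>j\<in>Basis. (c j * (x \<bullet> j)) *\<^sub>R j)) \<bullet> b"
        unfolding add_0 inner_sum_left_Basis[OF b] using Ax by simp
    qed
  qed
  have R: "Basis = range (\<lambda>i::'n. axis i (1::real))" and inj: "inj (\<lambda>i::'n. axis i (1::real))"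
    by (auto simp: Basis_vec_def inj_on_def axis_eq_axis)
  have pr: "(\<Prod>j\<in>Basis. \<bar>c j\<bar>) = \<bar>det A\<bar>"
    unfolding R prod.reindex[OF inj] by (simp add: cA dA abs_prod)
  have "(*v) A \<in> borel_measurable borel"
    by (intro borel_measurable_continuous_onI matrix_vector_mult_linear_continuous_on)
  then show ?case
    using lborel_affine_euclidean[of c 0, OF nz] 3(2) unfolding scales_lborel_def eqA[symmetric] pr by simp
next
  case (4 m n)
  let ?\<sigma> = "Transposition.transpose m n"
  let ?A = "(\<chi> i j. mat 1 $ i $ ?\<sigma> j) :: real^'n^'n"
  define T where "T v = (\<chi> i. v $ ?\<sigma> i)" for v :: "real^'n"
  have AT: "(*v) ?A = T"
  proof
    fix v :: "real^'n"
    have "(?A *v v) $ i = v $ ?\<sigma> i" for i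
    proof -
      have "(?A *v v) $ i = (\<Sum>j\<in>UNIV. if j = ?\<sigma> i then v $ j else 0)"
        unfolding matrix_vector_mult_def mat_def vec_lambda_beta
        by (intro sum.cong) (auto simp: transpose_eq_iff)
      then show ?thesis by simp
    qed
    then show "?A *v v = T v" by (simp add: vec_eq_iff T_def)
  qed
  have d: "\<bar>det ?A\<bar> = 1"
    using det_permute_columns[of ?\<sigma> "mat 1 :: real^'n^'n"]
    by (simp add: permutes_swap_id sign_def)
  have [measurable]: "T \<in> borel_measurable borel"
    unfolding AT[symmetric] by (intro borel_measurable_continuous_onI matrix_vector_mult_linear_continuous_on)
  have R: "Basis = range (\<lambda>i::'n. axis i (1::real))" and inj: "inj (\<lambda>i::'n. axis i (1::real))"
    by (auto simp: Basis_vec_def inj_on_def axis_eq_axis)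
  \<comment> \<open>The preimage of a box under a transposition is the box with transposed corners,
    whose volume is the same product in another order.\<close>
  have "lborel = distr lborel borel T"
  proof (rule lborel_eqI)
    fix l u :: "real^'n" assume le: "\<And>b. b \<in> Basis \<Longrightarrow> l \<bullet> b \<le> u \<bullet> b"
    have "T -` box l u = box (T l) (T u)"
    proof -
      have "(\<forall>i. l $ i < v $ ?\<sigma> i \<and> v $ ?\<sigma> i < u $ i) \<longleftrightarrow> (\<forall>i. l $ ?\<sigma> i < v $ i \<and> v $ i < u $ ?\<sigma> i)" for v :: "real^'n"
      proof (intro iffI allI)
        fix i assume "\<forall>i. l $ i < v $ ?\<sigma> i \<and> v $ ?\<sigma> i < u $ i"
        then show "l $ ?\<sigma> i < v $ i \<and> v $ i < u $ ?\<sigma> i" by (drule_tac x="?\<sigma> i" in spec) simp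
      next
        fix i assume "\<forall>i. l $ ?\<sigma> i < v $ i \<and> v $ i < u $ ?\<sigma> i"
        then show "l $ i < v $ ?\<sigma> i \<and> v $ ?\<sigma> i < u $ i" by (drule_tac x="?\<sigma> i" in spec) simp
      qed
      then show ?thesis by (auto simp: mem_box_cart T_def)
    qed
    then have "emeasure (distr lborel borel T) (box l u) = emeasure lborel (box (T l) (T u))"
      by (simp add: emeasure_distr)
    also have "\<dots> = ennreal (\<Prod>b\<in>Basis. (T u - T l) \<bullet> b)"
    proof (rule emeasure_lborel_box)
      fix b :: "real^'n" assume "b \<in> Basis"
      then obtain i where b: "b = axis i 1" by (auto simp: R)
      show "T l \<bullet> b \<le> T u \<bullet> b"
        using le[of "axis (?\<sigma> i) 1"] unfolding b by (simp add: R T_def inner_axis)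
    qed
    also have "(\<Prod>b\<in>Basis. (T u - T l) \<bullet> b) = (\<Prod>i\<in>UNIV. (u - l) $ ?\<sigma> i)"
      unfolding R prod.reindex[OF inj] by (simp add: T_def inner_axis)
    also have "\<dots> = (\<Prod>i\<in>UNIV. (u - l) $ i)"
      by (rule prod.permute[of ?\<sigma> UNIV "\<lambda>i. (u - l) $ i", unfolded o_def, symmetric]) (simp add: permutes_swap_id)
    also have "\<dots> = (\<Prod>b\<in>Basis. (u - l) \<bullet> b)"
      unfolding R prod.reindex[OF inj] by (simp add: inner_axis)
    finally show "emeasure (distr lborel borel T) (box l u) = ennreal (\<Prod>b\<in>Basis. (u - l) \<bullet> b)" .
  qed simp
  then show ?case unfolding d AT scales_lborel_def by (simp add: density_1)
next
  case (5 m n c)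
  let ?A = "(\<chi> i j. if i = m \<and> j = n then c else of_bool (i = j)) :: real^'n^'n"
  have "(*v) ?A = (\<lambda>v. v + (c * v $ n) *\<^sub>R axis m 1)"
  proof
    fix v :: "real^'n"
    have "(?A *v v) $ i = (v + (c * v $ n) *\<^sub>R axis m 1) $ i" for i
    proof (cases "i = m")
      case True
      then have "(?A *v v) $ i = (\<Sum>j\<in>UNIV. (if j = n then c * v $ j else 0) + (if j = m then v $ j else 0))"
        unfolding matrix_vector_mult_def vec_lambda_beta using 5(1) by (intro sum.cong) auto
      also have "\<dots> = c * v $ n + v $ m" by (simp add: sum.distrib)
      finally show ?thesis using True by (simp add: axis_def)
    next
      case False
      then have "(?A *v v) $ i = (\<Sum>j\<in>UNIV. if j = i then v $ j else 0)"
        unfolding matrix_vector_mult_def vec_lambda_beta by (intro sum.cong) auto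
      then show ?thesis using False by (simp add: axis_def)
    qed
    then show "?A *v v = v + (c * v $ n) *\<^sub>R axis m 1" by (simp add: vec_eq_iff)
  qed
  moreover have "scales_lborel (\<lambda>v::real^'n. v + (c * v $ n) *\<^sub>R axis m 1) 1"
  proof (rule scales_lborel_shear)
    show "(\<lambda>v::real^'n. c * v $ n) \<in> borel_measurable borel"
      by (intro borel_measurable_continuous_onI continuous_intros)
    show "axis m 1 \<in> (Basis :: (real^'n) set)" by simp
    show "c * (x + s *\<^sub>R axis m 1) $ n = c * x $ n" for x :: "real^'n" and s
      using 5(1) by (simp add: axis_def)
  qed
  moreover have "det ?A = 1"
  proof -
    have "?A = (\<chi> k. if k = m then row m (mat 1) + c *s row n (mat 1) else row k (mat 1))"
      using 5(1) by (auto simp: vec_eq_iff row_def mat_def)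
    then show ?thesis using det_row_operation[OF 5(1), of "mat 1 :: real^'n^'n" c] by simp
  qed
  ultimately show ?case by simp
qed

lemma borel_measurable_cis[measurable (raw)]:
  "f \<in> borel_measurable M \<Longrightarrow> (\<lambda>x. cis (f x)) \<in> borel_measurable M"
  by (rule measurable_compose[of f M borel cis])
    (auto intro!: borel_measurable_continuous_onI continuous_on_cis)

lemma nn_integral_count_space_Times:
  "(\<integral>\<^sup>+p. f p \<partial>count_space (A \<times> B)) = (\<integral>\<^sup>+a. (\<integral>\<^sup>+b. f (a, b) \<partial>count_space B) \<partial>count_space A)"
proof -
  have "(\<integral>\<^sup>+p. f p \<partial>count_space (A \<times> B)) = (\<integral>\<^sup>+p. f p * indicator (A \<times> B) p \<partial>count_space UNIV)"
    by (simp add: nn_integral_restrict_space[symmetric] restrict_count_space)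
  also have "\<dots> = (\<integral>\<^sup>+a. (\<integral>\<^sup>+b. f (a, b) * indicator (A \<times> B) (a, b) \<partial>count_space UNIV) \<partial>count_space UNIV)"
    by (rule nn_integral_fst_count_space[symmetric])
  also have "\<dots> = (\<integral>\<^sup>+a. (\<integral>\<^sup>+b. f (a, b) * indicator B b \<partial>count_space UNIV) * indicator A a \<partial>count_space UNIV)"
    by (intro nn_integral_cong) (auto simp: indicator_def)
  also have "\<dots> = (\<integral>\<^sup>+a. (\<integral>\<^sup>+b. f (a, b) \<partial>count_space B) \<partial>count_space A)"
    by (simp add: nn_integral_restrict_space[symmetric] restrict_count_space)
  finally show ?thesis .
qed

lemma L2_lborel_translate:
  fixes f :: "'a::euclidean_space \<Rightarrow> complex"
  assumes f: "f \<in> L2 lborel"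
  shows "(\<lambda>x. f (x + t)) \<in> L2 lborel" "L2_norm lborel (\<lambda>x. f (x + t)) = L2_norm lborel f"
proof -
  have [measurable]: "f \<in> borel_measurable borel" using f by (rule L2_lborel_borel_measurable)
  have eq: "(\<integral>\<^sup>+x. ennreal ((cmod (f (x + t)))\<^sup>2) \<partial>lborel) = ennreal ((L2_norm lborel f)\<^sup>2)"
    using nn_integral_translate[of "\<lambda>x. ennreal ((cmod (f x))\<^sup>2)" t] nn_integral_L2[OF f] by simp
  then show L: "(\<lambda>x. f (x + t)) \<in> L2 lborel" by (intro L2I) auto
  have "ennreal ((L2_norm lborel (\<lambda>x. f (x + t)))\<^sup>2) = ennreal ((L2_norm lborel f)\<^sup>2)"
    using nn_integral_L2[OF L] eq by simp
  then have "(L2_norm lborel (\<lambda>x. f (x + t)))\<^sup>2 = (L2_norm lborel f)\<^sup>2"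
    by (subst (asm) ennreal_inj) auto
  then show "L2_norm lborel (\<lambda>x. f (x + t)) = L2_norm lborel f"
    by (simp add: power2_eq_iff_nonneg)
qed

text \<open>The basis consists of the integer characters cut to the integer translates of the unit
  cube, indexed by a pair of tile \<open>q\<close> and frequency \<open>m\<close>. Different tiles
  are disjoint, Parseval holds on each tile, and the tiling adds these identities up. Such a basis
  replaces a field of vectors by countably many scalar functions.\<close>

lemma L2_lborel_orthonormal_basis:
  obtains e :: "nat \<Rightarrow> 'a::euclidean_space \<Rightarrow> complex" where
    "\<And>i. e i \<in> L2 lborel"
    "\<And>i j. L2_inner lborel (e i) (e j) = (if i = j then 1 else 0)"
    "\<And>f. f \<in> L2 lborel \<Longrightarrow> (\<lambda>i. (cmod (L2_inner lborel f (e i)))\<^sup>2) sums (L2_norm lborel f)\<^sup>2"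
proof -
  let ?J = "int_lattice \<times> int_lattice :: ('a \<times> 'a) set"
  define s where "s = from_nat_into ?J"
  have bij: "bij_betw s UNIV ?J"
    unfolding s_def using infinite_int_lattice[where 'a='a]
    by (intro bij_betw_from_nat_into) (auto intro!: countable_SIGMA countable_int_lattice simp: finite_cartesian_product_iff)
  have sl: "s i \<in> ?J" for i using bij by (auto simp: bij_betw_def)
  define g where "g p x = indicator unit_cube (x - fst p) * cis (2 * pi * (- snd p \<bullet> x))" for p :: "'a \<times> 'a" and x
  have g: "g p \<in> L2 lborel" for p
  proof (rule L2_bound(1)[of "indicator ((\<lambda>x. x - fst p) -` unit_cube) :: 'a \<Rightarrow> complex"])
    show "(indicator ((\<lambda>x. x - fst p) -` unit_cube) :: 'a \<Rightarrow> complex) \<in> L2 lborel"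
      by (rule L2_indicator) (auto simp: emeasure_unit_cube_translate intro!: measurable_sets_borel[OF _ borel_unit_cube])
    show "g p \<in> borel_measurable lborel" unfolding g_def[abs_def] by measurable
  qed (auto simp: norm_mult g_def indicator_def)
  have inner_g: "L2_inner lborel f (g (q, m)) = cis (2 * pi * (m \<bullet> q)) *
      (\<integral>x. (indicator unit_cube x * f (x + q)) * cis (2 * pi * (m \<bullet> x)) \<partial>lborel)" if f: "f \<in> L2 lborel" for f q m
  proof -
    have [measurable]: "f \<in> borel_measurable borel" using f by (rule L2_lborel_borel_measurable)
    have "L2_inner lborel f (g (q, m)) = (\<integral>x. f x * (indicator unit_cube (x - q) * cis (2 * pi * (m \<bullet> x))) \<partial>lborel)"
      unfolding L2_inner_def g_def by (intro Bochner_Integration.integral_cong) (auto simp: cis_cnj indicator_def)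
    also have "\<dots> = (\<integral>x. f (x + q) * (indicator unit_cube (x + q - q) * cis (2 * pi * (m \<bullet> (x + q)))) \<partial>lborel)"
      by (rule integral_translate) measurable
    also have "\<dots> = (\<integral>x. cis (2 * pi * (m \<bullet> q)) * ((indicator unit_cube x * f (x + q)) * cis (2 * pi * (m \<bullet> x))) \<partial>lborel)"
      by (intro Bochner_Integration.integral_cong)
        (simp_all add: inner_add_right distrib_left cis_mult[symmetric] mult_ac)
    finally show ?thesis by simp
  qed
  have on: "L2_inner lborel (g (q, m)) (g (q', m')) = (if q = q' \<and> m = m' then 1 else 0)"
    if l: "q \<in> int_lattice" "m \<in> int_lattice" "q' \<in> int_lattice" "m' \<in> int_lattice" for q m q' m'
  proof (cases "q = q'")
    case True
    have eq: "indicator unit_cube x * g (q', m) (x + q') * cis (2 * pi * (m' \<bullet> x))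
        = cis (2 * pi * (- m \<bullet> q')) * (indicator unit_cube x * cis (2 * pi * ((m' - m) \<bullet> x)))" for x
      unfolding g_def by (auto simp: indicator_def inner_add_right inner_diff_left cis_mult algebra_simps)
    have "L2_inner lborel (g (q, m)) (g (q', m'))
      = cis (2 * pi * (m' \<bullet> q')) * (cis (2 * pi * (- m \<bullet> q')) * (if m' - m = 0 then 1 else 0))"
      unfolding True inner_g[OF g] eq integral_mult_right_zero integral_character_unit_cube[OF int_lattice_diff[OF l(4,2)]] ..
    then show ?thesis using True by (auto simp: cis_mult)
  next
    case False
    have gz: "g (q, m) x * cnj (g (q', m') x) = 0" for x
    proof -
      have "\<not> (x - q \<in> unit_cube \<and> x - q' \<in> unit_cube)"
        using False l by (auto simp: diff_in_unit_cube_iff)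
      then show ?thesis by (auto simp: g_def)
    qed
    show ?thesis using False unfolding L2_inner_def gz by simp
  qed
  have pars: "(\<lambda>i. (cmod (L2_inner lborel f (g (s i))))\<^sup>2) sums (L2_norm lborel f)\<^sup>2" if f: "f \<in> L2 lborel" for f
  proof -
    have [measurable]: "f \<in> borel_measurable borel" using f by (rule L2_lborel_borel_measurable)
    have "(\<Sum>i. ennreal ((cmod (L2_inner lborel f (g (s i))))\<^sup>2))
        = (\<integral>\<^sup>+i. ennreal ((cmod (L2_inner lborel f (g (s i))))\<^sup>2) \<partial>count_space UNIV)"
      by (rule nn_integral_count_space_nat[symmetric])
    also have "\<dots> = (\<integral>\<^sup>+p. ennreal ((cmod (L2_inner lborel f (g p)))\<^sup>2) \<partial>count_space ?J)"
      by (rule nn_integral_bij_count_space[OF bij])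
    also have "\<dots> = (\<integral>\<^sup>+q. (\<integral>\<^sup>+m. ennreal ((cmod (L2_inner lborel f (g (q, m))))\<^sup>2) \<partial>count_space int_lattice) \<partial>count_space int_lattice)"
      by (rule nn_integral_count_space_Times)
    also have "\<dots> = (\<integral>\<^sup>+q. (\<integral>\<^sup>+x. ennreal ((cmod (f x))\<^sup>2) * indicator unit_cube ((1/1) *\<^sub>R x - q) \<partial>lborel) \<partial>count_space int_lattice)"
    proof (rule nn_integral_cong)
      fix q :: 'a
      let ?h = "\<lambda>x. indicator unit_cube x * f (x + q)"
      have h: "?h \<in> L2 lborel" by (rule L2_times_indicator[OF L2_lborel_translate(1)[OF f]]) simp
      have "(\<integral>\<^sup>+m. ennreal ((cmod (L2_inner lborel f (g (q, m))))\<^sup>2) \<partial>count_space int_lattice)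
          = (\<integral>\<^sup>+m. ennreal ((cmod (\<integral>x. ?h x * cis (2 * pi * (m \<bullet> x)) \<partial>lborel))\<^sup>2) \<partial>count_space int_lattice)"
        by (simp add: inner_g[OF f] norm_mult)
      also have "\<dots> = (\<integral>\<^sup>+x. ennreal ((cmod (?h x))\<^sup>2) \<partial>lborel)"
        unfolding nn_integral_L2[OF h] by (rule parseval_unit_cube[OF h]) simp
      also have "\<dots> = (\<integral>\<^sup>+x. ennreal ((cmod (f (x + q)))\<^sup>2) * indicator unit_cube ((1/1) *\<^sub>R (x + q) - q) \<partial>lborel)"
        by (intro nn_integral_cong) (auto simp: indicator_def)
      also have "\<dots> = (\<integral>\<^sup>+x. ennreal ((cmod (f x))\<^sup>2) * indicator unit_cube ((1/1) *\<^sub>R x - q) \<partial>lborel)"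
        by (rule nn_integral_translate[symmetric]) measurable
      finally show "(\<integral>\<^sup>+m. ennreal ((cmod (L2_inner lborel f (g (q, m))))\<^sup>2) \<partial>count_space int_lattice)
        = (\<integral>\<^sup>+x. ennreal ((cmod (f x))\<^sup>2) * indicator unit_cube ((1/1) *\<^sub>R x - q) \<partial>lborel)" .
    qed
    also have "\<dots> = ennreal ((L2_norm lborel f)\<^sup>2)"
      unfolding nn_integral_L2[OF f, symmetric] by (rule nn_integral_tiling[symmetric]) auto
    finally have *: "(\<Sum>i. ennreal ((cmod (L2_inner lborel f (g (s i))))\<^sup>2)) = ennreal ((L2_norm lborel f)\<^sup>2)" .
    then have "summable (\<lambda>i. (cmod (L2_inner lborel f (g (s i))))\<^sup>2)"
      by (intro summable_suminf_not_top) auto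
    with * show ?thesis by (simp add: suminf_ennreal2 sums_iff ennreal_inj suminf_nonneg)
  qed
  show ?thesis
  proof (rule that[of "\<lambda>i. g (s i)"])
    show "L2_inner lborel (g (s i)) (g (s j)) = (if i = j then 1 else 0)" for i j
    proof -
      obtain q m q' m' where p: "s i = (q, m)" "s j = (q', m')" by (metis surj_pair)
      have "s i = s j \<longleftrightarrow> i = j" using bij by (auto simp: bij_betw_def inj_on_def)
      then show ?thesis using on[of q m q' m'] sl[of i] sl[of j] unfolding p by auto
    qed
  qed (use g pars in auto)
qed

section \<open>Plancherel's theorem\<close>

text \<open>The exponent has a plus sign, in agreement with the phases of \<open>rep\<close>, so
  that the group transform becomes this one in the coordinates of P.\<close>

definition fourier :: "('a::euclidean_space \<Rightarrow> complex) \<Rightarrow> 'a \<Rightarrow> complex" where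
  "fourier f \<xi> = (\<integral>x. f x * cis (2 * pi * (\<xi> \<bullet> x)) \<partial>lborel)"

lemma borel_measurable_fourier:
  assumes [measurable]: "f \<in> borel_measurable borel"
  shows "fourier f \<in> borel_measurable borel"
  unfolding fourier_def by measurable

lemma L2_converges_truncate:
  assumes f: "f \<in> L2 M" and A[measurable]: "\<And>n. A n \<in> sets M"
    and ev: "\<And>x. x \<in> space M \<Longrightarrow> \<forall>\<^sub>F n in sequentially. x \<in> A n"
  shows "L2_converges M (\<lambda>n x. indicator (A n) x * f x) f"
proof -
  have [measurable]: "f \<in> borel_measurable M" using f by auto
  have "(\<lambda>n. \<integral>x. (cmod (indicator (A n) x * f x - f x))\<^sup>2 \<partial>M) \<longlonglongrightarrow> (\<integral>x. 0 \<partial>M)"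
  proof (rule integral_dominated_convergence[where w="\<lambda>x. (cmod (f x))\<^sup>2"])
    show "integrable M (\<lambda>x. (cmod (f x))\<^sup>2)" using f by (simp add: L2_def)
    show "AE x in M. (\<lambda>n. (cmod (indicator (A n) x * f x - f x))\<^sup>2) \<longlonglongrightarrow> 0"
    proof (rule AE_I2)
      fix x assume "x \<in> space M"
      from ev[OF this] have "\<forall>\<^sub>F n in sequentially. (cmod (indicator (A n) x * f x - f x))\<^sup>2 = 0"
        by eventually_elim simp
      then show "(\<lambda>n. (cmod (indicator (A n) x * f x - f x))\<^sup>2) \<longlonglongrightarrow> 0" by (rule tendsto_eventually)
    qed
    show "AE x in M. norm ((cmod (indicator (A n) x * f x - f x))\<^sup>2) \<le> (cmod (f x))\<^sup>2" for n
      by (rule AE_I2) (auto simp: indicator_def)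
  qed measurable
  then have "(\<lambda>n. sqrt (\<integral>x. (cmod (indicator (A n) x * f x - f x))\<^sup>2 \<partial>M)) \<longlonglongrightarrow> sqrt 0"
    by (intro tendsto_real_sqrt) simp
  then show ?thesis by (simp add: L2_converges_def L2_norm_def)
qed

text \<open>For every \<open>\<xi>\<close>, Parseval on the cube of side \<open>r\<close>, applied
  to \<open>f\<close> modulated by \<open>\<xi>\<close>, gives the sum of the squared transform over
  \<open>\<xi>\<close> plus the lattice of step \<open>1/r\<close>: it is \<open>r ^ DIM('a)\<close>
  times the squared norm, independently of \<open>\<xi>\<close>. Integrating \<open>\<xi>\<close>
  over one cube of side \<open>1/r\<close> finishes.\<close>

lemma plancherel_cube:
  fixes f :: "'a::euclidean_space \<Rightarrow> complex"
  assumes f: "f \<in> L2 lborel" and r: "0 < r" and v: "\<And>x. (1/r) *\<^sub>R x \<notin> unit_cube \<Longrightarrow> f x = 0"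
  shows "(\<integral>\<^sup>+\<xi>. ennreal ((cmod (fourier f \<xi>))\<^sup>2) \<partial>lborel) = ennreal ((L2_norm lborel f)\<^sup>2)"
proof -
  let ?n = "DIM('a)"
  let ?F = "\<lambda>\<xi>. ennreal ((cmod (fourier f \<xi>))\<^sup>2)"
  have [measurable]: "f \<in> borel_measurable borel" using f by (rule L2_lborel_borel_measurable)
  note [measurable] = borel_measurable_fourier
  have sum: "(\<integral>\<^sup>+m. ?F (\<xi> + (1/r) *\<^sub>R m) \<partial>count_space int_lattice) = ennreal (r ^ ?n) * ennreal ((L2_norm lborel f)\<^sup>2)" for \<xi>
  proof -
    let ?h = "\<lambda>x. f x * cis (2 * pi * (\<xi> \<bullet> x))"
    have hn: "cmod (?h x) = cmod (f x)" for x by (simp add: norm_mult)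
    have h: "?h \<in> L2 lborel" by (rule L2_bound(1)[OF f]) (simp_all add: hn)
    have "L2_norm lborel ?h = L2_norm lborel f" unfolding L2_norm_def hn ..
    moreover have "ennreal ((1/r) ^ ?n) * (\<integral>\<^sup>+m. ennreal ((cmod (\<integral>x. ?h x * cis (2 * pi * (m \<bullet> ((1/r) *\<^sub>R x))) \<partial>lborel))\<^sup>2) \<partial>count_space int_lattice)
        = ennreal ((L2_norm lborel ?h)\<^sup>2)"
      by (rule parseval_scaled[where L="\<lambda>x. (1/r) *\<^sub>R x" and L'="\<lambda>x. r *\<^sub>R x" and D="(1/r) ^ ?n"])
        (use r v h in \<open>auto intro!: scales_lborel_scaleR\<close>)
    moreover have "(\<integral>x. ?h x * cis (2 * pi * (m \<bullet> ((1/r) *\<^sub>R x))) \<partial>lborel) = fourier f (\<xi> + (1/r) *\<^sub>R m)" for m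
      unfolding fourier_def by (intro Bochner_Integration.integral_cong)
        (simp_all add: inner_add_left distrib_left cis_mult[symmetric] mult.assoc)
    ultimately have "ennreal ((1/r) ^ ?n) * (\<integral>\<^sup>+m. ?F (\<xi> + (1/r) *\<^sub>R m) \<partial>count_space int_lattice) = ennreal ((L2_norm lborel f)\<^sup>2)"
      by simp
    then have "ennreal (r ^ ?n) * (ennreal ((1/r) ^ ?n) * (\<integral>\<^sup>+m. ?F (\<xi> + (1/r) *\<^sub>R m) \<partial>count_space int_lattice))
        = ennreal (r ^ ?n) * ennreal ((L2_norm lborel f)\<^sup>2)" by simp
    moreover have "ennreal (r ^ ?n) * ennreal ((1/r) ^ ?n) = 1"
      using r by (simp add: ennreal_mult[symmetric] power_mult_distrib[symmetric] del: power_one_over)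
    ultimately show ?thesis by (simp add: mult.assoc[symmetric])
  qed
  have "(\<integral>\<^sup>+\<xi>. ?F \<xi> \<partial>lborel)
      = (\<integral>\<^sup>+m. (\<integral>\<^sup>+\<xi>. ?F \<xi> * indicator unit_cube ((1/(1/r)) *\<^sub>R \<xi> - m) \<partial>lborel) \<partial>count_space int_lattice)"
    by (rule nn_integral_tiling) (use r in auto)
  also have "\<dots> = (\<integral>\<^sup>+m. (\<integral>\<^sup>+\<xi>. ?F (\<xi> + (1/r) *\<^sub>R m) * indicator unit_cube (r *\<^sub>R \<xi>) \<partial>lborel) \<partial>count_space int_lattice)"
  proof (rule nn_integral_cong)
    fix m :: 'a
    have "(\<integral>\<^sup>+\<xi>. ?F \<xi> * indicator unit_cube ((1/(1/r)) *\<^sub>R \<xi> - m) \<partial>lborel)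
        = (\<integral>\<^sup>+\<xi>. ?F (\<xi> + (1/r) *\<^sub>R m) * indicator unit_cube ((1/(1/r)) *\<^sub>R (\<xi> + (1/r) *\<^sub>R m) - m) \<partial>lborel)"
      by (rule nn_integral_translate) measurable
    then show "(\<integral>\<^sup>+\<xi>. ?F \<xi> * indicator unit_cube ((1/(1/r)) *\<^sub>R \<xi> - m) \<partial>lborel)
        = (\<integral>\<^sup>+\<xi>. ?F (\<xi> + (1/r) *\<^sub>R m) * indicator unit_cube (r *\<^sub>R \<xi>) \<partial>lborel)"
      using r by (simp add: scaleR_add_right)
  qed
  also have "\<dots> = (\<integral>\<^sup>+\<xi>. (\<integral>\<^sup>+m. ?F (\<xi> + (1/r) *\<^sub>R m) * indicator unit_cube (r *\<^sub>R \<xi>) \<partial>count_space int_lattice) \<partial>lborel)"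
    by (rule nn_integral_count_space_nn_integral[OF countable_int_lattice, symmetric]) measurable
  also have "\<dots> = (\<integral>\<^sup>+\<xi>. ennreal (r ^ ?n) * ennreal ((L2_norm lborel f)\<^sup>2) * indicator unit_cube (r *\<^sub>R \<xi>) \<partial>(lborel :: 'a measure))"
    by (simp add: nn_integral_multc sum)
  also have "\<dots> = ennreal ((L2_norm lborel f)\<^sup>2) * (ennreal (r ^ ?n) * (\<integral>\<^sup>+\<xi>. indicator unit_cube (r *\<^sub>R \<xi>) \<partial>(lborel :: 'a measure)))"
    by (subst nn_integral_cmult) (simp_all add: mult_ac)
  also have "ennreal (r ^ ?n) * (\<integral>\<^sup>+\<xi>. indicator unit_cube (r *\<^sub>R \<xi>) \<partial>(lborel :: 'a measure)) = (\<integral>\<^sup>+\<xi>. indicator (unit_cube :: 'a set) \<xi> \<partial>lborel)"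
    by (rule scales_lborel_nn_integral[OF scales_lborel_scaleR[OF r], symmetric]) measurable
  also have "\<dots> = 1" by (simp add: emeasure_unit_cube)
  finally show ?thesis by simp
qed

lemma eventually_in_cubes:
  fixes x :: "'a::euclidean_space"
  shows "\<forall>\<^sub>F n in sequentially. (1 / real (Suc n)) *\<^sub>R x \<in> unit_cube"
proof -
  have "\<forall>\<^sub>F n in sequentially. 2 * norm x < real n" using filterlim_real_sequentially by (rule filterlim_at_top_dense[THEN iffD1, rule_format])
  then show ?thesis
  proof eventually_elim
    case (elim n)
    have small: "\<bar>(1 / real (Suc n)) *\<^sub>R x \<bullet> b\<bar> < 1/2" if "b \<in> Basis" for b
    proof -
      have "\<bar>x \<bullet> b\<bar> \<le> norm x" using that by (rule Basis_le_norm)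
      then have "2 * \<bar>x \<bullet> b\<bar> < real (Suc n)" using elim by simp
      then show ?thesis by (simp add: abs_mult divide_less_eq field_simps)
    qed
    show ?case unfolding unit_cube_def
    proof (intro CollectI ballI)
      fix b :: 'a assume "b \<in> Basis"
      from small[OF this] show "- 1/2 \<le> (1 / real (Suc n)) *\<^sub>R x \<bullet> b \<and> (1 / real (Suc n)) *\<^sub>R x \<bullet> b < 1/2"
        by linarith
    qed
  qed
qed

text \<open>Truncation to growing cubes reduces to compact support. Integrability makes the
  transforms of the truncations converge pointwise, the isometry on cubes controls their
  differences, and Fatou carries the estimate over to \<open>fourier f\<close>.\<close>

theorem plancherel_fourier:
  fixes f :: "'a::euclidean_space \<Rightarrow> complex"
  assumes f1: "integrable lborel f" and f: "f \<in> L2 lborel"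
  shows "fourier f \<in> L2 lborel" "L2_norm lborel (fourier f) = L2_norm lborel f"
proof -
  have [measurable]: "f \<in> borel_measurable borel" using f by (rule L2_lborel_borel_measurable)
  note [measurable] = borel_measurable_fourier
  define A where "A n = {x::'a. (1 / real (Suc n)) *\<^sub>R x \<in> unit_cube}" for n
  have [measurable]: "A n \<in> sets borel" for n unfolding A_def by measurable
  have A_mono: "A n \<subseteq> A k" if "n \<le> k" for n k
  proof
    fix x assume x: "x \<in> A n"
    have "\<bar>c\<bar> / real (Suc k) \<le> \<bar>c\<bar> / real (Suc n)" for c :: real
      using that by (intro divide_left_mono) auto
    show "x \<in> A k"
    proof -
      have *: "- 1/2 \<le> t / real (Suc k) \<and> t / real (Suc k) < 1/2" if "- 1/2 \<le> t / real (Suc n)" "t / real (Suc n) < 1/2" for t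
        using that \<open>n \<le> k\<close> by (auto simp: divide_simps split: if_splits)
      show ?thesis using x * by (auto simp: A_def unit_cube_def)
    qed
  qed
  define g where "g n x = indicator (A n) x * f x" for n x
  have g: "g n \<in> L2 lborel" for n unfolding g_def[abs_def] by (rule L2_times_indicator[OF f]) simp
  have g1: "integrable lborel (g n)" for n unfolding g_def
    by (rule Bochner_Integration.integrable_bound[OF f1]) (auto simp: indicator_def)
  have [measurable]: "g n \<in> borel_measurable borel" for n using g by (rule L2_lborel_borel_measurable)
  have conv: "L2_converges lborel g f"
    unfolding g_def[abs_def]
    by (rule L2_converges_truncate[OF f]) (use eventually_in_cubes in \<open>auto simp: A_def\<close>)
  have plan: "(\<integral>\<^sup>+\<xi>. ennreal ((cmod (fourier h \<xi>))\<^sup>2) \<partial>lborel) = ennreal ((L2_norm lborel h)\<^sup>2)"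
    if "h \<in> L2 lborel" "\<And>x. x \<notin> A n \<Longrightarrow> h x = 0" for h n
    by (rule plancherel_cube[OF that(1), of "real (Suc n)"]) (use that(2) in \<open>auto simp: A_def\<close>)
  have planL: "fourier h \<in> L2 lborel" "L2_norm lborel (fourier h) = L2_norm lborel h"
    if h: "h \<in> L2 lborel" "\<And>x. x \<notin> A n \<Longrightarrow> h x = 0" for h n
  proof -
    have [measurable]: "h \<in> borel_measurable borel" using h by (intro L2_lborel_borel_measurable)
    show F: "fourier h \<in> L2 lborel" by (rule L2I) (use plan[OF h] in auto)
    have "ennreal ((L2_norm lborel (fourier h))\<^sup>2) = ennreal ((L2_norm lborel h)\<^sup>2)"
      using nn_integral_L2[OF F] plan[OF h] by simp
    then have "(L2_norm lborel (fourier h))\<^sup>2 = (L2_norm lborel h)\<^sup>2" by (subst (asm) ennreal_inj) auto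
    then show "L2_norm lborel (fourier h) = L2_norm lborel h" by (simp add: power2_eq_iff_nonneg)
  qed
  \<comment> \<open>The difference of two truncations is again supported in one cube, so the
    isometry applies to it and not only to each truncation.\<close>
  have g0: "g k x - g n x = 0" if "x \<notin> A (max k n)" for k n x
  proof -
    have "x \<notin> A k" "x \<notin> A n" using that A_mono[of k "max k n"] A_mono[of n "max k n"] by auto
    then show ?thesis by (simp add: g_def)
  qed
  have Fg: "fourier (g n) \<in> L2 lborel" for n by (rule planL(1)[OF g, of n n]) (simp add: g_def)
  have Fgn: "L2_norm lborel (fourier (g n)) = L2_norm lborel (g n)" for n
    by (rule planL(2)[OF g, of n n]) (simp add: g_def)
  have i: "integrable lborel (\<lambda>x. h x * cis (2 * pi * (\<xi> \<bullet> x)))" if "integrable lborel h" for h and \<xi> :: 'a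
    using that by (rule integrable_mult_bounded[where B=1]) auto
  have Fdiff: "L2_norm lborel (\<lambda>\<xi>. fourier (g k) \<xi> - fourier (g n) \<xi>) = L2_norm lborel (\<lambda>x. g k x - g n x)" for k n
  proof -
    have "(\<lambda>\<xi>. fourier (g k) \<xi> - fourier (g n) \<xi>) = fourier (\<lambda>x. g k x - g n x)"
      unfolding fourier_def by (simp add: left_diff_distrib i g1)
    then show ?thesis using planL(2)[OF L2_diff[OF g g] g0] by simp
  qed
  have lim: "(\<lambda>n. fourier (g n) \<xi>) \<longlonglongrightarrow> fourier f \<xi>" for \<xi>
    unfolding fourier_def
  proof (rule integral_dominated_convergence[where w="\<lambda>x. cmod (f x)"])
    show "AE x in lborel. (\<lambda>n. g n x * cis (2 * pi * (\<xi> \<bullet> x))) \<longlonglongrightarrow> f x * cis (2 * pi * (\<xi> \<bullet> x))"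
    proof (intro AE_I2 tendsto_intros tendsto_eventually)
      show "\<forall>\<^sub>F n in sequentially. g n x = f x" for x
        using eventually_in_cubes[of x] by eventually_elim (simp add: g_def A_def)
    qed
    show "AE x in lborel. norm (g n x * cis (2 * pi * (\<xi> \<bullet> x))) \<le> cmod (f x)" for n
      by (rule AE_I2) (auto simp: g_def indicator_def norm_mult)
  qed (use f1 in auto)
  \<comment> \<open>The slack \<open>d\<close> is there because the distance of \<open>g k\<close>
    to \<open>f\<close> drops below it only for large \<open>k\<close>, which is all that Fatou asks
    for.\<close>
  have bound: "(\<lambda>\<xi>. fourier f \<xi> - fourier (g n) \<xi>) \<in> L2 lborel \<and>
      L2_norm lborel (\<lambda>\<xi>. fourier f \<xi> - fourier (g n) \<xi>) \<le> L2_norm lborel (\<lambda>x. g n x - f x) + d" if "0 < d" for n d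
  proof -
    have "\<forall>\<^sub>F k in sequentially. L2_norm lborel (\<lambda>x. g k x - f x) < d"
      using conv \<open>0 < d\<close> unfolding L2_converges_def by (auto dest!: order_tendstoD(2))
    then have "\<forall>\<^sub>F k in sequentially. L2_norm lborel (\<lambda>\<xi>. fourier (g k) \<xi> - fourier (g n) \<xi>) \<le> L2_norm lborel (\<lambda>x. g n x - f x) + d"
    proof eventually_elim
      case (elim k)
      have "L2_norm lborel (\<lambda>x. g k x - g n x) \<le> L2_norm lborel (\<lambda>x. g k x - f x) + L2_norm lborel (\<lambda>x. f x - g n x)"
        by (rule L2_norm_triangle_diff[OF g f g])
      then show ?case using elim L2_norm_minus[of lborel f "g n"] unfolding Fdiff by linarith
    qed
    moreover have "AE \<xi> in lborel. (\<lambda>k. fourier (g k) \<xi> - fourier (g n) \<xi>) \<longlonglongrightarrow> fourier f \<xi> - fourier (g n) \<xi>"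
      by (intro AE_I2 tendsto_intros lim)
    ultimately show ?thesis
      using L2_Fatou[of "\<lambda>k \<xi>. fourier (g k) \<xi> - fourier (g n) \<xi>" lborel "\<lambda>\<xi>. fourier f \<xi> - fourier (g n) \<xi>"] Fg
      by auto
  qed
  show Ff: "fourier f \<in> L2 lborel"
    using L2_add[OF conjunct1[OF bound[of 1 0]] Fg[of 0]] by simp
  have "L2_converges lborel (\<lambda>n. fourier (g n)) (fourier f)"
    unfolding L2_converges_def
  proof (rule Lim_null_comparison[OF always_eventually, OF allI])
    show "norm (L2_norm lborel (\<lambda>\<xi>. fourier (g n) \<xi> - fourier f \<xi>)) \<le> L2_norm lborel (\<lambda>x. g n x - f x)" for n
    proof -
      have "L2_norm lborel (\<lambda>\<xi>. fourier f \<xi> - fourier (g n) \<xi>) \<le> L2_norm lborel (\<lambda>x. g n x - f x)"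
        by (rule field_le_epsilon) (use bound in blast)
      then show ?thesis using L2_norm_minus[of lborel "fourier f" "fourier (g n)"] by simp
    qed
    show "(\<lambda>n. L2_norm lborel (\<lambda>x. g n x - f x)) \<longlonglongrightarrow> 0" using conv by (simp add: L2_converges_def)
  qed
  from L2_norm_limit[OF Fg Ff this] have "(\<lambda>n. L2_norm lborel (g n)) \<longlonglongrightarrow> L2_norm lborel (fourier f)" by (simp add: Fgn)
  then show "L2_norm lborel (fourier f) = L2_norm lborel f"
    using L2_norm_limit[OF g f conv] LIMSEQ_unique by blast
qed

section \<open>Simply connected two-step nilpotent groups\<close>

context two_step_nilpotent_lie_group
begin

abbreviation bch :: "'n \<Rightarrow> 'n \<Rightarrow> 'n" where
  "bch u v \<equiv> u + v + (1/2) *\<^sub>R bracket N u v"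

lemma in_carrier[simp]: "x \<in> carrier N"
  using carrier_UNIV by simp

sublocale bracket: bounded_bilinear "bracket N"
  using bilinear_bracket by (rule bilinear_conv_bounded_bilinear[THEN iffD1])

lemma bracket_antisym: "bracket N u v = - bracket N v u"
proof -
  have "bracket N (u + v) (u + v) = bracket N u u + bracket N v u + (bracket N u v + bracket N v v)"
    by (simp only: bracket.add_left bracket.add_right)
  then have "bracket N u v + bracket N v u = 0" by (simp add: bracket_self add.commute)
  then show ?thesis by (rule eq_neg_iff_add_eq_0[THEN iffD2])
qed

lemma two_step': "bracket N w (bracket N u v) = 0"
  using two_step[of u v w] bracket_antisym[of w "bracket N u v"] by simp

lemma lexp_0: "lexp N 0 = \<one>"
proof -
  have "lexp N 0 \<otimes> lexp N 0 = lexp N 0" by (simp add: exp_mult bracket.zero_left)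
  then show ?thesis using l_cancel_one[of "lexp N 0" "lexp N 0"] by simp
qed

lemma lexp_minus: "lexp N (- u) = inv (lexp N u)"
proof (rule inv_equality[symmetric])
  show "lexp N (- u) \<otimes> lexp N u = \<one>"
    by (simp add: exp_mult bracket.minus_left bracket_self lexp_0)
qed auto

lemma continuous_left_mult: "continuous_on A (\<lambda>x. a \<otimes> x)"
proof -
  have "continuous_on A ((\<lambda>(x, y). x \<otimes> y) \<circ> (\<lambda>x. (a, x)))"
    by (intro continuous_on_compose continuous_intros continuous_on_subset[OF continuous_mult]) auto
  then show ?thesis by (simp add: o_def)
qed

lemma open_left_mult: "open V \<Longrightarrow> open ((\<lambda>x. a \<otimes> x) ` V)"
proof -
  assume V: "open V"
  have "(\<lambda>x. a \<otimes> x) ` V = (\<lambda>x. inv a \<otimes> x) -` V"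
  proof safe
    fix x assume "inv a \<otimes> x \<in> V"
    then have "a \<otimes> (inv a \<otimes> x) \<in> (\<lambda>x. a \<otimes> x) ` V" by blast
    then show "x \<in> (\<lambda>x. a \<otimes> x) ` V" by (simp add: m_assoc[symmetric])
  qed (simp add: m_assoc[symmetric])
  then show ?thesis using open_vimage[OF V continuous_left_mult] by simp
qed

lemma lexp_chart:
  obtains U V g where "open U" "0 \<in> U" "open V" "\<one> \<in> V" "continuous_on V g"
    "\<And>x. x \<in> V \<Longrightarrow> lexp N (g x) = x" "\<And>u. u \<in> U \<Longrightarrow> g (lexp N u) = u" "\<And>u. u \<in> U \<Longrightarrow> lexp N u \<in> V"
proof -
  obtain U V g where "open U" "0 \<in> U" "open V" "homeomorphism U V (lexp N) g" using exp_chart by blast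
  then show ?thesis using lexp_0 by (intro that[of U V g]) (auto simp: homeomorphism_def intro: rev_image_eqI)
qed

text \<open>The image of exp is closed under products by \<open>exp_mult\<close> and contains a
  neighbourhood of the unit, so it is an open subgroup; its complement is a union of open cosets,
  and connectedness leaves only the whole group.\<close>

lemma surj_lexp:
  assumes "connected (UNIV :: 'a set)"
  shows "surj (lexp N)"
proof -
  obtain U V g where c: "open V" "\<one> \<in> V" "\<And>x. x \<in> V \<Longrightarrow> lexp N (g x) = x" by (rule lexp_chart) blast
  let ?R = "range (lexp N)"
  have "open ?R"
  proof (subst open_subopen, rule ballI)
    fix x assume "x \<in> ?R"
    then obtain u where u: "x = lexp N u" by blast
    have "(\<lambda>y. x \<otimes> y) ` V \<subseteq> ?R"
    proof safe
      fix y assume "y \<in> V"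
      then have "x \<otimes> y = lexp N u \<otimes> lexp N (g y)" using c u by simp
      then show "x \<otimes> y \<in> ?R" by (simp add: exp_mult)
    qed
    moreover have "x \<in> (\<lambda>y. x \<otimes> y) ` V" using c(2) by (intro image_eqI[of _ _ \<one>]) auto
    ultimately show "\<exists>T. open T \<and> x \<in> T \<and> T \<subseteq> ?R" using open_left_mult[OF c(1)] by blast
  qed
  moreover have "open (- ?R)"
  proof (subst open_subopen, rule ballI)
    fix x assume x: "x \<in> - ?R"
    have "(\<lambda>y. x \<otimes> y) ` V \<subseteq> - ?R"
    proof safe
      fix y u assume "y \<in> V" "x \<otimes> y = lexp N u"
      then have "x \<otimes> lexp N (g y) = lexp N u" using c by simp
      then have "x = lexp N u \<otimes> inv (lexp N (g y))" by (simp add: inv_solve_right)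
      then show False using x by (simp add: lexp_minus[symmetric] exp_mult)
    qed
    moreover have "x \<in> (\<lambda>y. x \<otimes> y) ` V" using c(2) by (intro image_eqI[of _ _ \<one>]) auto
    ultimately show "\<exists>T. open T \<and> x \<in> T \<and> T \<subseteq> - ?R" using open_left_mult[OF c(1)] by blast
  qed
  ultimately have "?R = {} \<or> ?R = UNIV"
    using assms unfolding connected_clopen by (auto simp: closed_def)
  then show ?thesis by auto
qed

text \<open>Conjugating \<open>lexp N w\<close> by \<open>lexp N (s u)\<close> gives exp of
  \<open>w + s [u, w]\<close>. As the conjugate of the unit is the unit, exp of
  \<open>s [u, w]\<close> is the unit for all \<open>s\<close>, and injectivity of the chart near 0
  forces the bracket to vanish.\<close>

lemma lexp_kernel_central:
  assumes w: "lexp N w = \<one>"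
  shows "bracket N u w = 0"
proof -
  obtain U V g where c: "open U" "0 \<in> U" "\<And>u. u \<in> U \<Longrightarrow> g (lexp N u) = u" by (rule lexp_chart) blast
  have one: "lexp N (s *\<^sub>R bracket N u w) = \<one>" for s
  proof -
    have "lexp N (s *\<^sub>R u) \<otimes> lexp N w \<otimes> lexp N (- (s *\<^sub>R u)) = \<one>" using w by (simp add: lexp_minus)
    also have "lexp N (s *\<^sub>R u) \<otimes> lexp N w \<otimes> lexp N (- (s *\<^sub>R u)) = lexp N (w + s *\<^sub>R bracket N u w)"
      using bracket_antisym[of w u]
      by (simp add: exp_mult bracket.add_left bracket.minus_right bracket.scaleR_left bracket.scaleR_right bracket_self two_step algebra_simps)
        (simp flip: scaleR_add_left)
    finally have "lexp N (- w) \<otimes> lexp N (w + s *\<^sub>R bracket N u w) = \<one>" using w by (simp add: lexp_minus)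
    then show ?thesis
      by (simp add: exp_mult bracket.add_right bracket.minus_left bracket.scaleR_right bracket_self two_step')
  qed
  obtain e where e: "0 < e" "ball 0 e \<subseteq> U" using c(1,2) open_contains_ball by blast
  \<comment> \<open>Small enough to place the multiple of the bracket in the ball of radius
    \<open>e\<close>; the added 1 covers a vanishing bracket.\<close>
  define s where "s = e / (2 * (norm (bracket N u w) + 1))"
  have n: "0 < norm (bracket N u w) + 1" by (simp add: add_nonneg_pos)
  then have s: "0 < s" using e by (simp add: s_def)
  have "norm (s *\<^sub>R bracket N u w) = e / 2 * (norm (bracket N u w) / (norm (bracket N u w) + 1))"
    using e s by (simp add: s_def)
  also have "\<dots> \<le> e / 2 * 1" using e n by (intro mult_left_mono) (auto simp: divide_le_eq)
  also have "\<dots> < e" using e by simp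
  finally have "s *\<^sub>R bracket N u w \<in> U" using e by auto
  from c(3)[OF this] c(3)[OF c(2)] have "s *\<^sub>R bracket N u w = 0" by (simp add: one lexp_0)
  then show ?thesis using s by simp
qed

text \<open>By centrality the difference of two kernel elements lies in the kernel, so distinct ones
  are at least \<open>e\<close> apart, where \<open>ball 0 e\<close> lies inside the chart. A
  continuous map from a connected set into such a set is constant.\<close>

lemma lexp_kernel_constant:
  fixes c :: "'c::topological_space \<Rightarrow> 'n"
  assumes "connected S" "continuous_on S c" and k: "\<And>p. p \<in> S \<Longrightarrow> lexp N (c p) = \<one>" and "p \<in> S" "q \<in> S"
  shows "c p = c q"
proof -
  obtain U V g where ch: "open U" "0 \<in> U" "\<And>u. u \<in> U \<Longrightarrow> g (lexp N u) = u" by (rule lexp_chart) blast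
  obtain e where e: "0 < e" "ball 0 e \<subseteq> U" using ch(1,2) open_contains_ball by blast
  have "e \<le> norm (c y - c x)" if "x \<in> S" "y \<in> S" "c y \<noteq> c x" for x y
  proof (rule ccontr)
    assume "\<not> e \<le> norm (c y - c x)"
    then have U: "c y - c x \<in> U" using e by auto
    have "lexp N (c y) \<otimes> lexp N (- c x) = \<one>" using k that by (simp add: lexp_minus)
    then have "lexp N (c y - c x) = \<one>"
      using lexp_kernel_central[OF k[OF that(1)]] by (simp add: exp_mult bracket.minus_right)
    with ch(3)[OF U] ch(3)[OF ch(2)] have "c y - c x = 0" by (simp add: lexp_0)
    then show False using that by simp
  qed
  then have "S \<inter> c -` {c p} = S \<inter> c -` ball (c p) e"
    using e \<open>p \<in> S\<close> by (force simp: dist_norm norm_minus_commute)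
  moreover have "openin (top_of_set S) (S \<inter> c -` ball (c p) e)"
    by (rule continuous_openin_preimage_gen[OF assms(2)]) simp
  moreover have "closedin (top_of_set S) (S \<inter> c -` {c p})"
    by (rule continuous_closedin_preimage[OF assms(2)]) simp
  ultimately have "S \<inter> c -` {c p} = {} \<or> S \<inter> c -` {c p} = S"
    using assms(1) unfolding connected_clopen by metis
  then have "q \<in> S \<inter> c -` {c p}" using \<open>p \<in> S\<close> \<open>q \<in> S\<close> by blast
  then show ?thesis by simp
qed

text \<open>The equation reads u = v + [v,u]/2; bracketing it with v kills the right side by the
  two-step property, so the correction vanishes.\<close>

lemma bch_neg_eq_0: "bch (- v) u = 0 \<Longrightarrow> u = v"
proof -
  assume "bch (- v) u = 0"
  then have u: "u = v + (1/2) *\<^sub>R bracket N v u" by (simp add: bracket.minus_left algebra_simps)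
  have "bracket N v u = bracket N v (v + (1/2) *\<^sub>R bracket N v u)" using u by simp
  then have "bracket N v u = 0" by (simp add: bracket.add_right bracket.scaleR_right bracket_self two_step')
  then show "u = v" using u by simp
qed

lemma lexp_eq_imp_kernel: "lexp N u = lexp N v \<Longrightarrow> lexp N (bch (- v) u) = \<one>"
  unfolding exp_mult[symmetric] lexp_minus by simp

text \<open>The quotient of two lifts, formed with the group law on the algebra, is a continuous
  kernel-valued map, hence constant; at \<open>q\<close> it is 0.\<close>

lemma lexp_lift_unique:
  assumes "connected S" "continuous_on S a" "continuous_on S b"
    and eq: "\<And>p. p \<in> S \<Longrightarrow> lexp N (a p) = lexp N (b p)" and q: "q \<in> S" "a q = b q" and p: "p \<in> S"
  shows "a p = b p"
proof -
  have "bch (- b p) (a p) = bch (- b q) (a q)"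
  proof (rule lexp_kernel_constant[OF assms(1) _ _ p q(1)])
    show "continuous_on S (\<lambda>p. bch (- b p) (a p))"
      by (intro continuous_intros bracket.continuous_on assms)
    show "lexp N (bch (- b p) (a p)) = \<one>" if "p \<in> S" for p
      by (rule lexp_eq_imp_kernel[OF eq[OF that]])
  qed
  also have "\<dots> = 0" using q by (simp add: bracket.minus_left bracket_self)
  finally show ?thesis by (rule bch_neg_eq_0)
qed

text \<open>Since the square is star-shaped, a lift is given explicitly as the product of the logarithms
  of the increments of \<open>h\<close> along the rays from the origin.\<close>

lemma lexp_lift_square:
  fixes h :: "real \<times> real \<Rightarrow> 'a"
  assumes h: "continuous_on ({0..1} \<times> {0..1}) h" and h0: "h (0, 0) = \<one>"
  obtains H where "continuous_on ({0..1} \<times> {0..1}) H" "H (0, 0) = 0"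
    "\<And>p. p \<in> {0..1} \<times> {0..1} \<Longrightarrow> lexp N (H p) = h p"
proof -
  let ?S = "{0..1} \<times> {0..1} :: (real \<times> real) set"
  obtain U V g where c: "open U" "0 \<in> U" "open V" "\<one> \<in> V" "continuous_on V g"
    "\<And>x. x \<in> V \<Longrightarrow> lexp N (g x) = x" "\<And>u. u \<in> U \<Longrightarrow> g (lexp N u) = u"
    by (rule lexp_chart) blast
  have g1: "g \<one> = 0" using c(7)[OF c(2)] by (simp add: lexp_0)
  have sS: "s *\<^sub>R p \<in> ?S" if "s \<in> {0..1}" "p \<in> ?S" for s :: real and p
    using that by (auto simp: mem_Times_iff mult_le_one)
  have cinc: "continuous_on T (\<lambda>q. inv (h (a q)) \<otimes> h (b q))"
    if "continuous_on T a" "continuous_on T b" "a ` T \<subseteq> ?S" "b ` T \<subseteq> ?S"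
    for T :: "'c::topological_space set" and a b
  proof -
    have ha: "continuous_on T (\<lambda>q. h (a q))" and hb: "continuous_on T (\<lambda>q. h (b q))"
      by (rule continuous_on_compose2[OF h that(1,3)], rule continuous_on_compose2[OF h that(2,4)])
    have "continuous_on T (\<lambda>q. inv (h (a q)))"
      by (rule continuous_on_compose2[OF continuous_inverse ha]) simp
    then have "continuous_on T (\<lambda>q. (inv (h (a q)), h (b q)))" using hb by (intro continuous_on_Pair)
    from continuous_on_compose2[OF continuous_mult this subset_UNIV] show ?thesis by (simp only: case_prod_conv)
  qed
  let ?T = "?S \<times> ({0..1} \<times> {0..1} :: (real \<times> real) set)"
  \<comment> \<open>The increment of \<open>h\<close> along the ray through the point
    \<open>fst q\<close>, between the two parameters in \<open>snd q\<close>. It is the unit when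
    these agree.\<close>
  define \<Phi> where "\<Phi> q = inv (h (fst (snd q) *\<^sub>R fst q)) \<otimes> h (snd (snd q) *\<^sub>R fst q)" for q :: "(real \<times> real) \<times> real \<times> real"
  have \<Phi>: "continuous_on ?T \<Phi>" unfolding \<Phi>_def
  proof (rule cinc)
    show "(\<lambda>q. fst (snd q) *\<^sub>R fst q) ` ?T \<subseteq> ?S"
    proof (rule image_subsetI)
      fix q assume "q \<in> ?T"
      then show "fst (snd q) *\<^sub>R fst q \<in> ?S" by (intro sS) (simp_all add: mem_Times_iff)
    qed
    show "(\<lambda>q. snd (snd q) *\<^sub>R fst q) ` ?T \<subseteq> ?S"
    proof (rule image_subsetI)
      fix q assume "q \<in> ?T"
      then show "snd (snd q) *\<^sub>R fst q \<in> ?S" by (intro sS) (simp_all add: mem_Times_iff)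
    qed
  qed (intro continuous_intros)+
  \<comment> \<open>Uniform continuity by compactness, phrased without a metric on the group: the
    arguments whose increment leaves \<open>V\<close> form a compact set disjoint from the diagonal,
    on which the distance of the two parameters attains a positive minimum.\<close>
  have "\<exists>d>0. \<forall>q\<in>?T. \<bar>fst (snd q) - snd (snd q)\<bar> < d \<longrightarrow> \<Phi> q \<in> V"
  proof (cases "?T \<inter> \<Phi> -` (- V) = {}")
    case True
    then show ?thesis by (intro exI[of _ 1]) auto
  next
    case False
    have cT: "compact ?T" by (intro compact_Times compact_Icc)
    have "closed (\<Phi> -` (- V) \<inter> ?T)"
      by (rule continuous_on_closed_vimage[THEN iffD1, rule_format, OF _ \<Phi>])
        (use cT c(3) in \<open>auto simp: compact_imp_closed closed_Compl\<close>)
    then have "compact (?T \<inter> \<Phi> -` (- V))"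
      using compact_Int_closed[OF cT, of "\<Phi> -` (- V) \<inter> ?T"] by (simp add: Int_ac)
    then have "\<exists>x\<in>?T \<inter> \<Phi> -` (- V). \<forall>y\<in>?T \<inter> \<Phi> -` (- V). \<bar>fst (snd x) - snd (snd x)\<bar> \<le> \<bar>fst (snd y) - snd (snd y)\<bar>"
      using False by (rule continuous_attains_inf) (intro continuous_intros)
    then obtain q0 where q0: "q0 \<in> ?T \<inter> \<Phi> -` (- V)"
      "\<And>q. q \<in> ?T \<inter> \<Phi> -` (- V) \<Longrightarrow> \<bar>fst (snd q0) - snd (snd q0)\<bar> \<le> \<bar>fst (snd q) - snd (snd q)\<bar>"
      by blast
    have "fst (snd q0) \<noteq> snd (snd q0)"
    proof
      assume "fst (snd q0) = snd (snd q0)"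
      then have "\<Phi> q0 = \<one>" by (simp add: \<Phi>_def)
      then show False using q0(1) c(4) by simp
    qed
    then have "0 < \<bar>fst (snd q0) - snd (snd q0)\<bar>" by simp
    moreover have "\<Phi> q \<in> V" if "q \<in> ?T" "\<bar>fst (snd q) - snd (snd q)\<bar> < \<bar>fst (snd q0) - snd (snd q0)\<bar>" for q
    proof (rule ccontr)
      assume "\<Phi> q \<notin> V"
      then have "q \<in> ?T \<inter> \<Phi> -` (- V)" using that(1) by blast
      from q0(2)[OF this] show False using that(2) by simp
    qed
    ultimately show ?thesis by blast
  qed
  then obtain d where d: "0 < d" "\<And>q. q \<in> ?T \<Longrightarrow> \<bar>fst (snd q) - snd (snd q)\<bar> < d \<Longrightarrow> \<Phi> q \<in> V" by blast
  obtain n where n: "1 / real (Suc n) < d" using d(1) nat_approx_posE by blast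
  define r where "r i = real i / real (Suc n)" for i
  have r01: "r i \<in> {0..1}" if "i \<le> Suc n" for i using that by (auto simp: r_def divide_le_eq)
  have rS: "r i *\<^sub>R p \<in> ?S" if "i \<le> Suc n" "p \<in> ?S" for i p by (rule sS[OF r01[OF that(1)] that(2)])
  have inc: "inv (h (r i *\<^sub>R p)) \<otimes> h (r (Suc i) *\<^sub>R p) \<in> V" if "i < Suc n" "p \<in> ?S" for i p
  proof -
    have "\<Phi> (p, r i, r (Suc i)) \<in> V"
    proof (rule d(2))
      show "(p, r i, r (Suc i)) \<in> ?T" using r01[of i] r01[of "Suc i"] that by simp
      have "r i - r (Suc i) = - (1 / real (Suc n))" by (simp add: r_def diff_divide_distrib[symmetric] del: of_nat_Suc) simp
      then show "\<bar>fst (snd (p, r i, r (Suc i))) - snd (snd (p, r i, r (Suc i)))\<bar> < d" using n by simp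
    qed
    then show ?thesis by (simp add: \<Phi>_def)
  qed
  define L where "L = rec_nat (\<lambda>p. 0) (\<lambda>i l p. bch (l p) (g (inv (h (r i *\<^sub>R p)) \<otimes> h (r (Suc i) *\<^sub>R p))))"
  have L0: "L 0 p = 0" and LS: "L (Suc i) p = bch (L i p) (g (inv (h (r i *\<^sub>R p)) \<otimes> h (r (Suc i) *\<^sub>R p)))" for i p
    by (simp_all add: L_def)
  have lift: "lexp N (L i p) = h (r i *\<^sub>R p)" if "i \<le> Suc n" "p \<in> ?S" for i p
    using that(1)
  proof (induction i)
    case 0
    have "r 0 *\<^sub>R p = (0, 0)" by (simp add: r_def zero_prod_def)
    then show ?case by (simp add: L0 lexp_0 h0)
  next
    case (Suc i)
    then have "lexp N (L (Suc i) p) = h (r i *\<^sub>R p) \<otimes> (inv (h (r i *\<^sub>R p)) \<otimes> h (r (Suc i) *\<^sub>R p))"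
      unfolding LS exp_mult[symmetric] using c(6)[OF inc[of i p]] that(2) by simp
    then show ?case by (simp add: m_assoc[symmetric])
  qed
  have cont: "continuous_on ?S (L i)" if "i \<le> Suc n" for i
    using that
  proof (induction i)
    case 0
    then show ?case unfolding L0[abs_def] by (simp add: L_def)
  next
    case (Suc i)
    have "continuous_on ?S (\<lambda>p. inv (h (r i *\<^sub>R p)) \<otimes> h (r (Suc i) *\<^sub>R p))"
    proof (rule cinc)
      show "(\<lambda>p. r i *\<^sub>R p) ` ?S \<subseteq> ?S" by (rule image_subsetI, rule rS) (use Suc.prems in auto)
      show "(\<lambda>p. r (Suc i) *\<^sub>R p) ` ?S \<subseteq> ?S" by (rule image_subsetI, rule rS) (use Suc.prems in auto)
    qed (intro continuous_intros)+
    then have "continuous_on ?S (\<lambda>p. g (inv (h (r i *\<^sub>R p)) \<otimes> h (r (Suc i) *\<^sub>R p)))"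
      by (rule continuous_on_compose2[OF c(5)]) (use inc Suc.prems in auto)
    moreover have "L (Suc i) = (\<lambda>p. bch (L i p) (g (inv (h (r i *\<^sub>R p)) \<otimes> h (r (Suc i) *\<^sub>R p))))"
      by (rule ext) (rule LS)
    ultimately show ?case using Suc by (auto intro!: continuous_intros bracket.continuous_on)
  qed
  have "L i (0, 0) = 0" for i
  proof (induction i)
    case (Suc i)
    have "r j *\<^sub>R (0, 0) = (0, 0 :: real)" for j by simp
    then show ?case unfolding LS using Suc by (simp add: g1 bracket.zero_right h0)
  qed (simp add: L0)
  moreover have "r (Suc n) *\<^sub>R p = p" for p :: "real \<times> real" by (simp add: r_def)
  ultimately show ?thesis using cont[of "Suc n"] lift[of "Suc n"] by (intro that[of "L (Suc n)"]) auto
qed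

text \<open>The path of multiples of \<open>w\<close> maps to a loop, which can be contracted. The
  contraction lifts to the algebra, where the initial loop lifts to a path ending at
  \<open>w\<close> and the final constant loop to a constant path. The gap between the end points of
  a lifted loop is constant during the contraction, so \<open>w\<close> is 0.\<close>

lemma lexp_kernel_trivial:
  assumes sc: "simply_connected (UNIV :: 'a set)" and w: "lexp N w = \<one>"
  shows "w = 0"
proof -
  define p where "p s = lexp N (s *\<^sub>R w)" for s :: real
  have p: "continuous_on {0..1} p" unfolding p_def
    by (rule continuous_on_compose2[OF continuous_exp]) (auto intro!: continuous_intros)
  have p01: "p 0 = \<one>" "p 1 = \<one>" by (simp_all add: p_def lexp_0 w)
  have "homotopic_loops UNIV p (\<lambda>_. \<one>)"
    using sc p p01 unfolding simply_connected_def
    by (auto simp: path_def pathfinish_def pathstart_def)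
  then obtain h where h: "continuous_on ({0..1::real} \<times> {0..1::real}) h" and h0: "\<forall>x\<in>{0..1}. h (0, x) = p x"
    and h1: "\<forall>x\<in>{0..1}. h (1, x) = \<one>"
    and hl: "\<forall>t\<in>{0..1}. pathfinish (h \<circ> Pair t) = pathstart (h \<circ> Pair t)"
    unfolding homotopic_loops by blast
  note h0 = h0[rule_format] and h1 = h1[rule_format] and hl = hl[rule_format]
  have "h (0, 0) = \<one>" using h0[of 0] p01 by simp
  from lexp_lift_square[OF h this] obtain H where H: "continuous_on ({0..1} \<times> {0..1}) H" "H (0, 0) = 0"
    "\<And>q. q \<in> {0..1} \<times> {0..1} \<Longrightarrow> lexp N (H q) = h q" by blast
  have cont: "continuous_on {0..1} (\<lambda>s. H (t, s))" "continuous_on {0..1} (\<lambda>s. H (s, t))" if "t \<in> {0..1}" for t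
    by (rule continuous_on_compose2[OF H(1)]; use that in \<open>auto intro!: continuous_intros\<close>)+
  have "H (0, 1) = 1 *\<^sub>R w"
    by (rule lexp_lift_unique[of "{0..1::real}" "\<lambda>s. H (0, s)" "\<lambda>s. s *\<^sub>R w" 0 1])
      (use cont(1)[of 0] H h0 in \<open>auto intro!: continuous_intros simp: p_def\<close>)
  moreover have "H (1, 1) = H (1, 0)"
    by (rule lexp_kernel_constant[of "{0..1::real}" "\<lambda>s. H (1, s)"])
      (use cont(1)[of 1] H h1 in auto)
  \<comment> \<open>The gap between the end points of the lift of the loop at time \<open>t\<close>.
    Each stage is closed, so the gap lies in the kernel of exp and cannot move; it is
    \<open>w\<close> at time 0 and 0 at time 1.\<close>
  moreover have "bch (- H (0, 0)) (H (0, 1)) = bch (- H (1, 0)) (H (1, 1))"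
  proof (rule lexp_kernel_constant[of "{0..1::real}" "\<lambda>t. bch (- H (t, 0)) (H (t, 1))"])
    show "continuous_on {0..1} (\<lambda>t. bch (- H (t, 0)) (H (t, 1)))"
      using cont(2)[of 0] cont(2)[of 1] by (auto intro!: continuous_intros bracket.continuous_on)
    show "lexp N (bch (- H (t, 0)) (H (t, 1))) = \<one>" if "t \<in> {0..1}" for t
      using hl[OF that] H(3)[of "(t, 0)"] H(3)[of "(t, 1)"] that
      by (intro lexp_eq_imp_kernel) (auto simp: pathfinish_def pathstart_def)
  qed auto
  ultimately show ?thesis by (simp add: H(2) bracket.minus_left bracket_self bracket.zero_left)
qed

lemma inj_lexp:
  assumes "simply_connected (UNIV :: 'a set)"
  shows "inj (lexp N)"
proof (rule injI)
  fix u v assume "lexp N u = lexp N v"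
  from lexp_kernel_trivial[OF assms lexp_eq_imp_kernel[OF this]] show "u = v" by (rule bch_neg_eq_0)
qed

text \<open>Near x = exp u the logarithm of y is the product, in the algebra, of u and the chart
  logarithm of the increment from x to y, which is continuous.\<close>

lemma continuous_lexp_inverse:
  assumes con: "connected (UNIV :: 'a set)" and sc: "simply_connected (UNIV :: 'a set)"
  shows "continuous_on UNIV (inv_into UNIV (lexp N))"
proof -
  obtain U V g where c: "open V" "\<one> \<in> V" "continuous_on V g" "\<And>x. x \<in> V \<Longrightarrow> lexp N (g x) = x"
    by (rule lexp_chart) blast
  note inj = inj_lexp[OF sc] and surj = surj_lexp[OF con]
  have "isCont (inv_into UNIV (lexp N)) x" for x
  proof -
    obtain u where u: "x = lexp N u" using surj by (auto simp: surj_def)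
    let ?W = "(\<lambda>y. x \<otimes> y) ` V"
    have W: "open ?W" "x \<in> ?W" using open_left_mult[OF c(1)] c(2) by (auto intro!: image_eqI[of _ _ \<one>])
    have inW: "inv x \<otimes> y \<in> V" if "y \<in> ?W" for y using that by (auto simp: m_assoc[symmetric])
    have "inv_into UNIV (lexp N) y = bch u (g (inv x \<otimes> y))" if "y \<in> ?W" for y
    proof (rule inv_into_f_eq[OF inj])
      show "lexp N (bch u (g (inv x \<otimes> y))) = y"
        unfolding exp_mult[symmetric] u[symmetric] c(4)[OF inW[OF that]] by (simp add: m_assoc[symmetric])
    qed simp
    moreover have "continuous_on ?W (\<lambda>y. bch u (g (inv x \<otimes> y)))"
      by (intro continuous_intros bracket.continuous_on continuous_on_compose2[OF c(3) continuous_left_mult])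
        (use inW in auto)
    ultimately have "continuous_on ?W (inv_into UNIV (lexp N))" by (simp cong: continuous_on_cong)
    then show ?thesis using W continuous_on_eq_continuous_at by blast
  qed
  then show ?thesis by (simp add: continuous_on_eq_continuous_at)
qed

end

section \<open>Adapted coordinates\<close>

lemma linear_lin_comb: "linear (lin_comb b)"
  unfolding lin_comb_def
  by (rule linearI) (simp_all add: scaleR_add_left sum.distrib scaleR_sum_right)

lemma lin_comb_axis: "lin_comb b (axis i 1) = b i"
proof -
  have "lin_comb b (axis i 1) = (\<Sum>j\<in>UNIV. if j = i then b j else 0)"
    unfolding lin_comb_def axis_def by (intro sum.cong) auto
  then show ?thesis by simp
qed

lemma span_range_lin_comb: "span (range b) = range (lin_comb b)"
proof
  show "span (range b) \<subseteq> range (lin_comb b)"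
  proof (rule span_minimal)
    show "range b \<subseteq> range (lin_comb b)" using lin_comb_axis[of b] by (metis image_subsetI rangeI)
    show "subspace (range (lin_comb b))" by (rule linear_subspace_image[OF linear_lin_comb subspace_UNIV])
  qed
  show "range (lin_comb b) \<subseteq> span (range b)"
    unfolding lin_comb_def by (intro image_subsetI span_sum span_scale span_base rangeI)
qed

lemma linear_algebra_coords: "linear (algebra_coords N)"
  unfolding algebra_coords_def
  by (rule linearI) (auto simp: linear_add[OF linear_lin_comb] linear_scale[OF linear_lin_comb] scaleR_add_right)

locale adapted_nilpotent_group = two_step_nilpotent_lie_group N
  for N :: "('a::t2_space, 'n::euclidean_space, 'k::finite, 'd::finite) based_lie_group" (structure) +
  fixes P M :: "'a set"
  assumes connected_UNIV: "connected (UNIV :: 'a set)"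
    and simply_connected_UNIV: "simply_connected (UNIV :: 'a set)"
    and commP: "commutative_set N P" and commM: "commutative_set N M"
    and adapted: "adapted_basis N P M"
    and sqint: "square_integrable_mod_center N"
begin

lemmas inj_exp = inj_lexp[OF simply_connected_UNIV]
  and surj_exp = surj_lexp[OF connected_UNIV]

abbreviation "lcZ \<equiv> lin_comb (Zb N)"
abbreviation "lcY \<equiv> lin_comb (Yb N)"
abbreviation "lcX \<equiv> lin_comb (Xb N)"
abbreviation "acoord \<equiv> algebra_coords N"
abbreviation "gcoord \<equiv> group_coords N"

text \<open>By injectivity of exp, commuting exponentials give [u,v] = [v,u], so the antisymmetric
  bracket is its own negative. This carries commutativity of P, of M and of the center over to the
  algebra.\<close>

lemma lexp_commute_imp_bracket:
  assumes "lexp N u \<otimes> lexp N v = lexp N v \<otimes> lexp N u"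
  shows "bracket N u v = 0"
proof -
  have "bch u v = bch v u" using assms inj_exp by (simp add: exp_mult inj_eq)
  then have "(1/2) *\<^sub>R bracket N u v = (1/2) *\<^sub>R bracket N v u" by (simp add: algebra_simps)
  then have "bracket N u v = bracket N v u" by (simp only: scaleR_cancel_left) simp
  then have "bracket N u v = - bracket N u v" using bracket_antisym[of u v] by simp
  then have "bracket N u v + bracket N u v = 0" by (rule eq_neg_iff_add_eq_0[THEN iffD1])
  then show ?thesis by (simp flip: scaleR_2)
qed

lemma bracket_Z: "bracket N (lcZ z) v = 0" "bracket N v (lcZ z) = 0"
proof -
  have "lcZ z \<in> lie_algebra_of N (group_center N)"
    using adapted span_range_lin_comb[of "Zb N"] unfolding adapted_basis_def by blast
  then have "lexp N (1 *\<^sub>R lcZ z) \<in> group_center N" unfolding lie_algebra_of_def by blast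
  then have "lexp N (lcZ z) \<otimes> lexp N v = lexp N v \<otimes> lexp N (lcZ z)" by (simp add: group_center_def)
  then show "bracket N (lcZ z) v = 0" by (rule lexp_commute_imp_bracket)
  then show "bracket N v (lcZ z) = 0" using bracket_antisym[of v "lcZ z"] by simp
qed

lemma bracket_YY: "bracket N (lcY y) (lcY y') = 0"
proof -
  have "lcY y \<in> lie_algebra_of N P" for y
  proof -
    have "lcY y \<in> span (range (Yb N))" unfolding span_range_lin_comb by blast
    then have "lcY y \<in> span (range (Zb N) \<union> range (Yb N))" using span_mono[of "range (Yb N)" "range (Zb N) \<union> range (Yb N)"] by blast
    then show ?thesis using adapted unfolding adapted_basis_def by blast
  qed
  then have "lexp N (1 *\<^sub>R lcY y) \<in> P" for y unfolding lie_algebra_of_def by blast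
  then show ?thesis using commP unfolding commutative_set_def by (intro lexp_commute_imp_bracket) simp
qed

lemma bracket_XX: "bracket N (lcX t) (lcX t') = 0"
proof -
  have "lcX t \<in> lie_algebra_of N M" for t
    using adapted span_range_lin_comb[of "Xb N"] unfolding adapted_basis_def by blast
  then have "lexp N (1 *\<^sub>R lcX t) \<in> M" for t unfolding lie_algebra_of_def by blast
  then show ?thesis using commM unfolding commutative_set_def by (intro lexp_commute_imp_bracket) simp
qed

text \<open>By two-step nilpotency the exponential of any multiple of a bracket commutes with all
  exponentials, and exp is onto.\<close>

lemma bracket_in_center: "bracket N u v \<in> range lcZ"
proof -
  have "lexp N (s *\<^sub>R bracket N u v) \<in> group_center N" for s
  proof -
    have "lexp N (s *\<^sub>R bracket N u v) \<otimes> x = x \<otimes> lexp N (s *\<^sub>R bracket N u v)" for x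
    proof -
      obtain w where "x = lexp N w" using surj_exp by (auto simp: surj_def)
      then show ?thesis
        by (simp add: exp_mult bracket.scaleR_left bracket.scaleR_right two_step two_step' add.commute)
    qed
    then show ?thesis by (simp add: group_center_def)
  qed
  then have "bracket N u v \<in> lie_algebra_of N (group_center N)" by (simp add: lie_algebra_of_def)
  then show ?thesis using adapted span_range_lin_comb[of "Zb N"] unfolding adapted_basis_def by blast
qed

lemma bij_acoord: "bij acoord"
  using adapted by (simp add: adapted_basis_def)

lemma linear_inv_acoord: "linear (inv_into UNIV acoord)"
proof -
  have A: "acoord (inv_into UNIV acoord v) = v" for v using bij_acoord by (simp add: bij_is_surj surj_f_inv_f)
  have i: "inv_into UNIV acoord v = p" if "acoord p = v" for p v
    using that bij_acoord by (intro inv_into_f_eq) (auto simp: bij_is_inj)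
  show ?thesis
    by (rule linearI; rule i)
      (simp_all add: linear_add[OF linear_algebra_coords] linear_scale[OF linear_algebra_coords] A)
qed

lemma inv_acoord[simp]: "inv_into UNIV acoord (acoord p) = p"
  using bij_acoord by (simp add: bij_is_inj)

lemma acoord_Pair: "acoord (z, y, t) = lcZ z + lcY y + lcX t"
  by (simp add: algebra_coords_def)

text \<open>The bracket of X with Y in central coordinates. All other brackets of basis vectors
  vanish, up to antisymmetry, so this bilinear map carries the entire Lie structure;
  \<open>fst\<close> loses nothing because brackets are central.\<close>

definition \<omega> :: "real^'d \<Rightarrow> real^'d \<Rightarrow> real^'k" where
  "\<omega> t y = fst (inv_into UNIV acoord (bracket N (lcX t) (lcY y)))"

lemma bracket_XY: "bracket N (lcX t) (lcY y) = lcZ (\<omega> t y)"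
proof -
  obtain z where z: "bracket N (lcX t) (lcY y) = lcZ z" using bracket_in_center by (metis imageE)
  have "lcZ z = acoord (z, 0, 0)" by (simp add: acoord_Pair linear_0[OF linear_lin_comb])
  then have "\<omega> t y = z" unfolding \<omega>_def z by simp
  then show ?thesis using z by simp
qed

lemma bracket_YX: "bracket N (lcY y) (lcX t) = - lcZ (\<omega> t y)"
  using bracket_antisym[of "lcY y" "lcX t"] bracket_XY by simp

lemma bounded_bilinear_\<omega>: "bounded_bilinear \<omega>"
proof (rule bilinear_conv_bounded_bilinear[THEN iffD1], unfold bilinear_def, intro conjI allI)
  have f: "linear (\<lambda>v. fst (inv_into UNIV acoord v))"
    using linear_compose[OF linear_inv_acoord linear_fst] by (simp add: o_def)
  note simps = linear_add[OF linear_lin_comb] linear_scale[OF linear_lin_comb]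
    bracket.add_left bracket.add_right bracket.scaleR_left bracket.scaleR_right
    linear_add[OF f] linear_scale[OF f]
  show "linear (\<omega> t)" for t by (rule linearI) (simp_all only: \<omega>_def simps)
  show "linear (\<lambda>t. \<omega> t y)" for y by (rule linearI) (simp_all only: \<omega>_def simps)
qed

sublocale \<omega>: bounded_bilinear \<omega> by (rule bounded_bilinear_\<omega>)

text \<open>Passage from coordinates of the second kind to those of the first kind. The only
  correction is half the bracket of Y with X, which is minus \<open>\<omega>\<close>.\<close>

lemma gcoord_eq: "gcoord (z, y, t) = lexp N (acoord (z - (1/2) *\<^sub>R \<omega> t y, y, t))"
proof -
  have "gcoord (z, y, t) = lexp N (lcZ z + lcY y + lcX t - (1/2) *\<^sub>R lcZ (\<omega> t y))"
    unfolding group_coords_def case_prod_conv exp_mult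
    by (simp add: bracket_Z bracket_YX bracket.add_left)
  also have "lcZ z + lcY y + lcX t - (1/2) *\<^sub>R lcZ (\<omega> t y) = acoord (z - (1/2) *\<^sub>R \<omega> t y, y, t)"
    by (simp add: acoord_Pair linear_diff[OF linear_lin_comb] linear_scale[OF linear_lin_comb])
  finally show ?thesis .
qed

text \<open>The group law in the coordinates (z, y, t): moving the X-factor of \<open>p\<close> past
  the Y-factor of \<open>q\<close> costs exactly one commutator. For fixed \<open>p\<close> it is a
  translation sheared along the center.\<close>

definition coord_mult :: "('k, 'd) coords \<Rightarrow> ('k, 'd) coords \<Rightarrow> ('k, 'd) coords" where
  "coord_mult p q = (fst p + fst q + \<omega> (snd (snd p)) (fst (snd q)),
     fst (snd p) + fst (snd q), snd (snd p) + snd (snd q))"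

lemma gcoord_mult: "gcoord p \<otimes> gcoord q = gcoord (coord_mult p q)"
proof -
  obtain z y t z' y' t' where p: "p = (z, y, t)" "q = (z', y', t')" by (metis surj_pair)
  let ?u = "acoord (z - (1/2) *\<^sub>R \<omega> t y, y, t)" and ?v = "acoord (z' - (1/2) *\<^sub>R \<omega> t' y', y', t')"
  have "bracket N ?u ?v = lcZ (\<omega> t y') - lcZ (\<omega> t' y)"
    by (simp add: acoord_Pair bracket.add_left bracket.add_right bracket_Z bracket_YY bracket_XX bracket_XY bracket_YX)
  also have "\<dots> = lcZ (\<omega> t y' - \<omega> t' y)" by (simp add: linear_diff[OF linear_lin_comb])
  also have "\<dots> = acoord (\<omega> t y' - \<omega> t' y, 0, 0)"
    by (simp add: acoord_Pair linear_0[OF linear_lin_comb])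
  finally have "bch ?u ?v = acoord ((z - (1/2) *\<^sub>R \<omega> t y, y, t) + (z' - (1/2) *\<^sub>R \<omega> t' y', y', t')
      + (1/2) *\<^sub>R (\<omega> t y' - \<omega> t' y, 0, 0))"
    by (simp only: linear_add[OF linear_algebra_coords] linear_scale[OF linear_algebra_coords])
  also have "(z - (1/2) *\<^sub>R \<omega> t y, y, t) + (z' - (1/2) *\<^sub>R \<omega> t' y', y', t') + (1/2) *\<^sub>R (\<omega> t y' - \<omega> t' y, 0, 0)
      = (z + z' + \<omega> t y' - (1/2) *\<^sub>R \<omega> (t + t') (y + y'), y + y', t + t')"
  proof -
    have h: "(1/2) *\<^sub>R a + (1/2) *\<^sub>R a = a" for a :: "real^'k" by (simp flip: scaleR_add_left)
    have "z + z' + \<omega> t y' - (1/2) *\<^sub>R \<omega> (t + t') (y + y')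
        = z + z' + ((1/2) *\<^sub>R \<omega> t y' + (1/2) *\<^sub>R \<omega> t y') - (1/2) *\<^sub>R \<omega> (t + t') (y + y')" unfolding h ..
    then show ?thesis
      by (simp add: \<omega>.add_left \<omega>.add_right scaleR_add_right scaleR_diff_right)
  qed
  finally show ?thesis unfolding p gcoord_eq exp_mult coord_mult_def by (simp add: gcoord_eq)
qed

definition gcoord_inv :: "'a \<Rightarrow> ('k, 'd) coords" where
  "gcoord_inv x = (let (z, y, t) = inv_into UNIV acoord (inv_into UNIV (lexp N) x) in (z + (1/2) *\<^sub>R \<omega> t y, y, t))"

lemma gcoord_inv_gcoord[simp]: "gcoord_inv (gcoord p) = p"
proof -
  obtain z y t where p: "p = (z, y, t)" by (metis surj_pair)
  show ?thesis unfolding p gcoord_eq gcoord_inv_def by (simp add: inj_exp)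
qed

lemma gcoord_gcoord_inv[simp]: "gcoord (gcoord_inv x) = x"
proof -
  obtain z y t where p: "inv_into UNIV acoord (inv_into UNIV (lexp N) x) = (z, y, t)" by (metis surj_pair)
  have "acoord (z, y, t) = inv_into UNIV (lexp N) x"
    unfolding p[symmetric] using bij_acoord by (simp add: bij_is_surj surj_f_inv_f)
  then show ?thesis unfolding gcoord_inv_def p using surj_exp by (simp add: gcoord_eq surj_f_inv_f)
qed

lemma bij_gcoord: "bij gcoord"
  by (rule o_bij[of gcoord_inv]) auto

lemma inv_gcoord: "inv_into UNIV gcoord = gcoord_inv"
  by (rule inv_unique_comp) auto

lemma continuous_gcoord: "continuous_on A gcoord"
proof -
  have "gcoord = (\<lambda>p. lexp N (acoord (fst p - (1/2) *\<^sub>R \<omega> (snd (snd p)) (fst (snd p)), fst (snd p), snd (snd p))))"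
    by (auto simp: fun_eq_iff gcoord_eq)
  moreover have "continuous_on A (\<lambda>p. lexp N (acoord (fst p - (1/2) *\<^sub>R \<omega> (snd (snd p)) (fst (snd p)), fst (snd p), snd (snd p))))"
    by (intro continuous_on_compose2[OF continuous_exp] continuous_on_compose2[OF linear_continuous_on[OF linear_algebra_coords[THEN linear_conv_bounded_linear[THEN iffD1]]]]
        continuous_intros \<omega>.continuous_on) auto
  ultimately show ?thesis by simp
qed

lemma continuous_gcoord_inv: "continuous_on A gcoord_inv"
proof -
  let ?a = "\<lambda>x. inv_into UNIV acoord (inv_into UNIV (lexp N) x)"
  have a: "continuous_on UNIV ?a"
    by (rule continuous_on_compose2[OF linear_continuous_on[OF linear_inv_acoord[THEN linear_conv_bounded_linear[THEN iffD1]]]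
        continuous_lexp_inverse[OF connected_UNIV simply_connected_UNIV] subset_UNIV])
  have "gcoord_inv = (\<lambda>x. (fst (?a x) + (1/2) *\<^sub>R \<omega> (snd (snd (?a x))) (fst (snd (?a x))), fst (snd (?a x)), snd (snd (?a x))))"
    by (auto simp: fun_eq_iff gcoord_inv_def split: prod.split)
  moreover have "continuous_on UNIV (\<lambda>x. (fst (?a x) + (1/2) *\<^sub>R \<omega> (snd (snd (?a x))) (fst (snd (?a x))), fst (snd (?a x)), snd (snd (?a x))))"
    by (intro continuous_intros \<omega>.continuous_on a)
  ultimately show ?thesis by (metis continuous_on_subset subset_UNIV)
qed

lemma borel_gcoord[measurable]: "gcoord \<in> borel_measurable borel"
  and borel_gcoord_inv[measurable]: "gcoord_inv \<in> borel_measurable borel"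
  by (intro borel_measurable_continuous_onI continuous_gcoord continuous_gcoord_inv)+

lemma functional_bracket: "functional N l (bracket N (lcX t) (lcY y)) = inner l (\<omega> t y)"
  by (simp add: functional_def \<omega>_def)

lemma linear_functional: "linear (functional N l)"
proof -
  have "functional N l = (\<lambda>v. inner l v) \<circ> (fst \<circ> inv_into UNIV acoord)"
    by (auto simp: functional_def fun_eq_iff)
  then show ?thesis
    by (simp add: linear_compose linear_inv_acoord linear_fst bounded_linear.linear[OF bounded_linear_inner_right])
qed

lemma Bform_bilinear:
  assumes "linear l"
  shows "l (bracket N (lcX t) (lcY y)) = - inner t (Bform N l *v y)"
proof -
  have "l (bracket N (lcX t) (lcY y)) = (\<Sum>i\<in>UNIV. \<Sum>j\<in>UNIV. t $ i * (y $ j * l (bracket N (Xb N i) (Yb N j))))"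
    unfolding lin_comb_def
    by ((simp add: bracket.sum_left bracket.sum_right bracket.scaleR_left bracket.scaleR_right
        linear_sum[OF assms] linear_scale[OF assms] scaleR_sum_right sum_distrib_left),
        (subst sum.swap), (simp add: mult_ac))
  also have "\<dots> = - inner t (Bform N l *v y)"
    unfolding inner_vec_def Bform_def matrix_vector_mult_def
    by (simp add: sum_distrib_left sum_negf mult_ac)
  finally show ?thesis .
qed

text \<open>The sign is the one in the definition of \<open>Bform\<close>. The identity lets the
  phases of \<open>rep\<close> be read as bilinear expressions in \<open>x\<close> and
  \<open>y\<close>, linear in \<open>l\<close>.\<close>

lemma inner_\<omega>: "inner l (\<omega> t y) = - inner t (Bmat N l *v y)"
  using Bform_bilinear[OF linear_functional[of l], of t y] by (simp add: functional_bracket Bmat_def)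

text \<open>The functional given by square integrability need not vanish on the vectors X and Y, but
  brackets are central, so its matrix depends only on its values on the Z-basis; these define
  \<open>l\<close>.\<close>

lemma exists_regular: "\<exists>l. det (Bmat N l) \<noteq> 0"
proof -
  obtain f where f: "linear f" "det (Bform N f) \<noteq> 0" using sqint by (auto simp: square_integrable_mod_center_def)
  define l where "l = (\<chi> k. f (Zb N k))"
  have "f (lcZ z) = inner l z" for z
    unfolding lin_comb_def l_def inner_vec_def by (simp add: linear_sum[OF f(1)] linear_scale[OF f(1)] mult.commute)
  then have "f (bracket N (lcX t) (lcY y)) = functional N l (bracket N (lcX t) (lcY y))" for t y
    using functional_bracket[of l t y] by (simp add: bracket_XY)
  from this[of "axis i 1" "axis j 1" for i j] have "Bform N f = Bmat N l"
    by (simp add: Bmat_def Bform_def lin_comb_axis)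
  then show ?thesis using f by auto
qed

lemma Bmat_nth: "Bmat N l $ i $ j = - inner l (\<omega> (axis i 1) (axis j 1))"
  using functional_bracket[of l "axis i 1" "axis j 1"] by (simp add: Bmat_def Bform_def lin_comb_axis)

lemma Bmat_add: "Bmat N (l + l') = Bmat N l + Bmat N l'"
  and Bmat_scaleR: "Bmat N (c *\<^sub>R l) = c *\<^sub>R Bmat N l"
  by (simp_all add: vec_eq_iff Bmat_nth inner_add_left)

lemma continuous_Bmat: "continuous_on A (Bmat N)"
proof -
  have "Bmat N = (\<lambda>l. \<chi> i j. - inner l (\<omega> (axis i 1) (axis j 1)))" by (simp add: fun_eq_iff vec_eq_iff Bmat_nth)
  then show ?thesis by (simp add: continuous_intros)
qed

lemma continuous_det_Bmat: "continuous_on A (\<lambda>l. det (Bmat N l))"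
  unfolding det_def by (intro continuous_intros continuous_Bmat)

lemma borel_det_Bmat[measurable]: "(\<lambda>l. det (Bmat N l)) \<in> borel_measurable borel"
  by (intro borel_measurable_continuous_onI continuous_det_Bmat)

lemma Sigma_set_borel[measurable]: "Sigma_set N \<in> sets borel"
  unfolding Sigma_set_def by measurable

text \<open>Along the line the determinant is a polynomial in \<open>s\<close>. Were it zero,
  homogeneity would give a vanishing determinant at \<open>u l + l0\<close> for all nonzero
  \<open>u\<close>, and continuity as \<open>u\<close> tends to 0 would make \<open>l0\<close>
  singular.\<close>

lemma finite_singular_line:
  assumes "det (Bmat N l0) \<noteq> 0"
  shows "finite {s. det (Bmat N (l + s *\<^sub>R l0)) = 0}"
proof -
  define p where "p = (\<Sum>\<sigma>\<in>{\<sigma>. \<sigma> permutes (UNIV :: 'd set)}. smult (of_int (sign \<sigma>)) (\<Prod>i\<in>UNIV. [:Bmat N l $ i $ \<sigma> i, Bmat N l0 $ i $ \<sigma> i:]))"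
  have p: "poly p s = det (Bmat N (l + s *\<^sub>R l0))" for s
    unfolding p_def det_def by (simp add: poly_sum poly_prod Bmat_add Bmat_scaleR)
  have "p \<noteq> 0"
  proof
    assume "p = 0"
    then have z: "det (Bmat N l + s *\<^sub>R Bmat N l0) = 0" for s using p[of s] by (simp add: Bmat_add Bmat_scaleR)
    have "det (Bmat N (u *\<^sub>R l + l0)) = 0" if "u \<noteq> 0" for u
    proof -
      have "u *\<^sub>R l + l0 = u *\<^sub>R (l + (1/u) *\<^sub>R l0)" using that by (simp add: scaleR_add_right)
      then have "Bmat N (u *\<^sub>R l + l0) = u *\<^sub>R (Bmat N l + (1/u) *\<^sub>R Bmat N l0)"
        by (simp add: Bmat_add Bmat_scaleR)
      moreover have "det (u *\<^sub>R A) = u ^ CARD('d) * det A" for A :: "real^'d^'d"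
        by (simp add: det_def prod.distrib sum_distrib_left mult.left_commute)
      ultimately show ?thesis using z[of "1/u"] by (simp only: mult_zero_right)
    qed
    then have "\<forall>\<^sub>F u in at 0. det (Bmat N (u *\<^sub>R l + l0)) = 0" by (auto simp: eventually_at intro: exI[of _ 1])
    then have "((\<lambda>u. det (Bmat N (u *\<^sub>R l + l0))) \<longlongrightarrow> 0) (at 0)" by (rule tendsto_eventually)
    moreover have "((\<lambda>u. det (Bmat N (u *\<^sub>R l + l0))) \<longlongrightarrow> det (Bmat N (0 *\<^sub>R l + l0))) (at (0::real))"
    proof -
      have "continuous_on UNIV (\<lambda>u::real. det (Bmat N (u *\<^sub>R l + l0)))"
        by (intro continuous_on_compose2[OF continuous_det_Bmat] continuous_intros) auto
      then show ?thesis unfolding continuous_on_def by blast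
    qed
    ultimately have "det (Bmat N (0 *\<^sub>R l + l0)) = 0" using tendsto_unique by (metis at_neq_bot)
    then show False using assms by simp
  qed
  then have "finite {s. poly p s = 0}" by (rule poly_roots_finite)
  then show ?thesis by (simp add: p)
qed

text \<open>Every line in a regular direction \<open>l0\<close> meets the singular set in finitely
  many points. By translation invariance its measure equals the average over \<open>s\<close> in
  [0,1] of the measures of its translates along \<open>l0\<close>; exchanging the integrals leaves
  only null sets on lines.\<close>

lemma AE_regular: "AE l in lborel. det (Bmat N l) \<noteq> 0"
proof -
  obtain l0 where l0: "det (Bmat N l0) \<noteq> 0" using exists_regular by blast
  let ?S = "{l. det (Bmat N l) = 0}"
  have [measurable]: "?S \<in> sets borel" by measurable
  have "emeasure lborel ?S = (\<integral>\<^sup>+l. indicator ?S l \<partial>lborel)" by simp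
  also have "\<dots> = (\<integral>\<^sup>+s. indicator {0..1} s * emeasure lborel ?S \<partial>(lborel :: real measure))"
    by (subst nn_integral_multc) auto
  also have "\<dots> = (\<integral>\<^sup>+s. (\<integral>\<^sup>+l. indicator {0..1} s * indicator ?S (l + s *\<^sub>R l0) \<partial>lborel) \<partial>lborel)"
  proof (rule nn_integral_cong)
    fix s :: real
    have "(\<integral>\<^sup>+l. indicator ?S l \<partial>lborel) = (\<integral>\<^sup>+l. indicator ?S (l + s *\<^sub>R l0) \<partial>lborel)"
      by (rule nn_integral_translate) measurable
    then have e: "emeasure lborel ?S = (\<integral>\<^sup>+l. indicator ?S (l + s *\<^sub>R l0) \<partial>lborel)" by simp
    show "indicator {0..1} s * emeasure lborel ?S = (\<integral>\<^sup>+l. indicator {0..1} s * indicator ?S (l + s *\<^sub>R l0) \<partial>lborel)"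
      unfolding e by (rule nn_integral_cmult[symmetric]) measurable
  qed
  also have "\<dots> = (\<integral>\<^sup>+l. (\<integral>\<^sup>+s. indicator {0..1} s * indicator ?S (l + s *\<^sub>R l0) \<partial>lborel) \<partial>lborel)"
    by (rule lborel_pair.Fubini') measurable
  also have "\<dots> = 0"
  proof -
    have "(\<integral>\<^sup>+s. indicator {0..1} s * indicator ?S (l + s *\<^sub>R l0) \<partial>lborel) = 0" for l
    proof -
      have "{s. det (Bmat N (l + s *\<^sub>R l0)) = 0} \<in> null_sets lborel"
        by (rule finite_imp_null_set_lborel[OF finite_singular_line[OF l0]])
      then have "AE s in lborel. det (Bmat N (l + s *\<^sub>R l0)) \<noteq> 0" using AE_not_in by fastforce
      then have "AE s in lborel. indicator {0..1} s * indicator ?S (l + s *\<^sub>R l0) = (0::ennreal)"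
        by eventually_elim simp
      from nn_integral_cong_AE[OF this] show ?thesis by simp
    qed
    then show ?thesis by simp
  qed
  finally have "?S \<in> null_sets lborel" by (intro null_setsI) auto
  then show ?thesis using AE_not_in by fastforce
qed

end

section \<open>The Plancherel transform in coordinates\<close>

lemma borel_compose_continuous:
  assumes "g \<in> borel_measurable borel" "continuous_on UNIV T"
  shows "(\<lambda>x. g (T x)) \<in> borel_measurable borel"
  by (rule measurable_compose[OF borel_measurable_continuous_onI[OF assms(2)] assms(1)])

lemma borel_measurable_pairI:
  fixes g :: "'a::euclidean_space \<times> 'b::euclidean_space \<Rightarrow> 'c::topological_space"
  assumes "g \<in> borel_measurable borel"
  shows "g \<in> borel_measurable (borel \<Otimes>\<^sub>M lborel)" "g \<in> borel_measurable (lborel \<Otimes>\<^sub>M lborel)"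
proof -
  show *: "g \<in> borel_measurable (lborel \<Otimes>\<^sub>M lborel)" unfolding lborel_prod using assms by simp
  have "sets (borel \<Otimes>\<^sub>M lborel :: ('a \<times> 'b) measure) = sets (lborel \<Otimes>\<^sub>M lborel)"
    by (rule sets_pair_measure_cong) simp_all
  then show "g \<in> borel_measurable (borel \<Otimes>\<^sub>M lborel)" using * measurable_cong_sets[OF _ refl] by blast
qed

lemma borel_measurable_section:
  fixes g :: "'a::euclidean_space \<times> 'b::euclidean_space \<Rightarrow> 'c::topological_space"
  assumes "g \<in> borel_measurable borel"
  shows "(\<lambda>b. g (a, b)) \<in> borel_measurable borel" "(\<lambda>a. g (a, b)) \<in> borel_measurable borel"
  by (rule borel_compose_continuous[OF assms], intro continuous_intros)+

lemma borel_measurable_swap: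
  fixes g :: "'a::euclidean_space \<times> 'b::euclidean_space \<Rightarrow> 'c::topological_space"
  assumes "g \<in> borel_measurable borel"
  shows "(\<lambda>p. g (snd p, fst p)) \<in> borel_measurable borel"
  by (rule borel_compose_continuous[OF assms], intro continuous_intros)

lemma borel_measurable_nn_integral_param:
  fixes g :: "'a::euclidean_space \<times> 'b::euclidean_space \<Rightarrow> ennreal"
  assumes "g \<in> borel_measurable borel"
  shows "(\<lambda>a. \<integral>\<^sup>+b. g (a, b) \<partial>lborel) \<in> borel_measurable borel"
    and "(\<lambda>b. \<integral>\<^sup>+a. g (a, b) \<partial>lborel) \<in> borel_measurable borel"
  using borel_measurable_pairI(1)[OF assms] borel_measurable_pairI(1)[OF borel_measurable_swap[OF assms]]
  by (auto intro!: lborel.borel_measurable_nn_integral simp: split_beta')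

lemma borel_measurable_integral_param:
  fixes g :: "'a::euclidean_space \<times> 'b::euclidean_space \<Rightarrow> complex"
  assumes "g \<in> borel_measurable borel"
  shows "(\<lambda>a. \<integral>b. g (a, b) \<partial>lborel) \<in> borel_measurable borel"
    and "(\<lambda>b. \<integral>a. g (a, b) \<partial>lborel) \<in> borel_measurable borel"
  using borel_measurable_pairI(1)[OF assms] borel_measurable_pairI(1)[OF borel_measurable_swap[OF assms]]
  by (auto intro!: lborel.borel_measurable_lebesgue_integral simp: split_beta')

lemma nn_integral_lborel_pair:
  fixes g :: "'a::euclidean_space \<times> 'b::euclidean_space \<Rightarrow> ennreal"
  assumes "g \<in> borel_measurable borel"
  shows "(\<integral>\<^sup>+p. g p \<partial>lborel) = (\<integral>\<^sup>+a. (\<integral>\<^sup>+b. g (a, b) \<partial>lborel) \<partial>lborel)"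
    and "(\<integral>\<^sup>+p. g p \<partial>lborel) = (\<integral>\<^sup>+b. (\<integral>\<^sup>+a. g (a, b) \<partial>lborel) \<partial>lborel)"
proof -
  note g = borel_measurable_pairI(2)[OF assms]
  show "(\<integral>\<^sup>+p. g p \<partial>lborel) = (\<integral>\<^sup>+a. (\<integral>\<^sup>+b. g (a, b) \<partial>lborel) \<partial>lborel)"
    unfolding lborel_prod[symmetric] using g by (rule lborel.nn_integral_fst[symmetric])
  show "(\<integral>\<^sup>+p. g p \<partial>lborel) = (\<integral>\<^sup>+b. (\<integral>\<^sup>+a. g (a, b) \<partial>lborel) \<partial>lborel)"
    unfolding lborel_prod[symmetric] using g by (rule lborel_pair.nn_integral_snd[symmetric])
qed

text \<open>With the second component fixed, the first is merely translated, so Tonelli applies.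
  This is the shape of left translation on N, and also of the substitution that moves a translate
  through the Fourier transform.\<close>

lemma scales_lborel_skew:
  fixes \<phi> :: "'b::euclidean_space \<Rightarrow> 'a::euclidean_space"
  assumes \<phi>: "continuous_on UNIV \<phi>"
  shows "scales_lborel (\<lambda>p. (fst p + \<phi> (snd p), snd p + c)) 1"
proof (rule scales_lborelI)
  have T: "continuous_on UNIV (\<lambda>p. (fst p + \<phi> (snd p), snd p + c))"
    by (intro continuous_intros continuous_on_compose2[OF \<phi>]) auto
  then show "(\<lambda>p. (fst p + \<phi> (snd p), snd p + c)) \<in> borel_measurable borel"
    by (rule borel_measurable_continuous_onI)
  fix g :: "'a \<times> 'b \<Rightarrow> ennreal" assume g: "g \<in> borel_measurable borel"
  have "(\<integral>\<^sup>+p. g p \<partial>lborel) = (\<integral>\<^sup>+b. (\<integral>\<^sup>+a. g (a, b) \<partial>lborel) \<partial>lborel)" by (rule nn_integral_lborel_pair(2)[OF g])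
  also have "\<dots> = (\<integral>\<^sup>+b. (\<integral>\<^sup>+a. g (a, b + c) \<partial>lborel) \<partial>lborel)"
    by (rule nn_integral_translate[OF borel_measurable_nn_integral_param(2)[OF g]])
  also have "\<dots> = (\<integral>\<^sup>+b. (\<integral>\<^sup>+a. g (a + \<phi> b, b + c) \<partial>lborel) \<partial>lborel)"
    by (intro nn_integral_cong nn_integral_translate borel_measurable_section[OF g])
  also have "\<dots> = (\<integral>\<^sup>+p. g (fst p + \<phi> (snd p), snd p + c) \<partial>lborel)"
    unfolding nn_integral_lborel_pair(2)[OF borel_compose_continuous[OF g T]] by simp
  finally show "(\<integral>\<^sup>+p. g p \<partial>lborel) = ennreal 1 * (\<integral>\<^sup>+p. g (fst p + \<phi> (snd p), snd p + c) \<partial>lborel)" by simp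
qed simp

lemma scales_lborel_reflect: "scales_lborel (\<lambda>w. x - w) 1"
  using lborel_affine[of "-1" x] by (simp add: scales_lborel_def)

lemmas nn_integral_reflect = scales_lborel_nn_integral[OF scales_lborel_reflect, simplified]
lemmas integral_reflect = scales_lborel_integral[OF scales_lborel_reflect, simplified]

text \<open>Brackets the coordinates as ((z, y), t): the Fourier transform acts on the pair (z, y),
  which parametrises P, while t in M stays a parameter.\<close>

definition reassoc :: "('a \<times> 'b) \<times> 'c \<Rightarrow> 'a \<times> 'b \<times> 'c" where
  "reassoc p = (fst (fst p), snd (fst p), snd p)"

lemma reassoc_measurable[measurable]:
  "reassoc \<in> borel_measurable (borel :: (('a::euclidean_space \<times> 'b::euclidean_space) \<times> 'c::euclidean_space) measure)"
  unfolding reassoc_def by (intro borel_measurable_continuous_onI continuous_intros)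

lemma distr_reassoc:
  "distr lborel borel reassoc = (lborel :: ('a::euclidean_space \<times> 'b::euclidean_space \<times> 'c::euclidean_space) measure)"
proof (rule measure_eqI)
  fix A :: "('a \<times> 'b \<times> 'c) set" assume "A \<in> sets (distr lborel borel reassoc)"
  then have A[measurable]: "A \<in> sets borel" by simp
  have A2: "(\<lambda>p. indicator A (reassoc p) :: ennreal) \<in> borel_measurable borel" by measurable
  have A1: "(indicator A :: _ \<Rightarrow> ennreal) \<in> borel_measurable borel" by measurable
  note A3 = borel_measurable_section(1)[OF A1]
  note A4 = borel_measurable_nn_integral_param(1)[OF A2]
  have "emeasure (distr lborel borel reassoc) A = (\<integral>\<^sup>+p. indicator A p \<partial>distr lborel borel reassoc)" by simp
  also have "\<dots> = (\<integral>\<^sup>+p. indicator A (reassoc p) \<partial>lborel)" by (rule nn_integral_distr) auto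
  also have "\<dots> = (\<integral>\<^sup>+a. (\<integral>\<^sup>+b. (\<integral>\<^sup>+c. indicator A (a, b, c) \<partial>lborel) \<partial>lborel) \<partial>lborel)"
    unfolding nn_integral_lborel_pair(1)[OF A2] nn_integral_lborel_pair(1)[OF A4] by (simp add: reassoc_def)
  also have "\<dots> = (\<integral>\<^sup>+p. indicator A p \<partial>lborel)"
    unfolding nn_integral_lborel_pair(1)[OF A1] nn_integral_lborel_pair(1)[OF A3] ..
  finally show "emeasure (distr lborel borel reassoc) A = emeasure lborel A" by simp
qed simp

lemma nn_integral_reassoc:
  fixes g :: "'a::euclidean_space \<times> 'b::euclidean_space \<times> 'c::euclidean_space \<Rightarrow> ennreal"
  assumes g: "g \<in> borel_measurable borel"
  shows "(\<integral>\<^sup>+p. g (reassoc p) \<partial>lborel) = (\<integral>\<^sup>+p. g p \<partial>lborel)"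
  using nn_integral_distr[of reassoc lborel borel g] g unfolding distr_reassoc by simp

lemma integrable_reassoc:
  fixes g :: "'a::euclidean_space \<times> 'b::euclidean_space \<times> 'c::euclidean_space \<Rightarrow> complex"
  assumes g: "g \<in> borel_measurable borel"
  shows "integrable lborel (\<lambda>p. g (reassoc p)) \<longleftrightarrow> integrable lborel g"
  using integrable_distr_eq[of reassoc lborel borel g] g unfolding distr_reassoc by simp

lemma integral_reassoc:
  fixes g :: "'a::euclidean_space \<times> 'b::euclidean_space \<times> 'c::euclidean_space \<Rightarrow> complex"
  assumes g: "g \<in> borel_measurable borel"
  shows "(\<integral>p. g (reassoc p) \<partial>lborel) = (\<integral>p. g p \<partial>lborel)"
  using integral_distr[of reassoc lborel borel g] g unfolding distr_reassoc by simp

lemma borel_measurable_fourier_param: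
  fixes F :: "'a::euclidean_space \<times> 'b::euclidean_space \<Rightarrow> complex"
  assumes F: "F \<in> borel_measurable borel"
  shows "(\<lambda>p. fourier (\<lambda>q. F (q, snd p)) (fst p)) \<in> borel_measurable borel"
proof -
  have "(\<lambda>r :: ('a \<times> 'b) \<times> 'a. F (snd r, snd (fst r)) * cis (2 * pi * (fst (fst r) \<bullet> snd r))) \<in> borel_measurable borel"
    by (intro borel_measurable_times borel_measurable_cis borel_compose_continuous[OF F] borel_measurable_continuous_onI continuous_intros)
  from borel_measurable_integral_param(1)[OF this] show ?thesis unfolding fourier_def by simp
qed

lemma sections_of_integrable_L2:
  fixes F :: "'a::euclidean_space \<times> 'b::euclidean_space \<Rightarrow> complex"
  assumes F1: "integrable lborel F" and F2: "F \<in> L2 lborel"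
  shows "AE t in lborel. integrable lborel (\<lambda>q. F (q, t)) \<and> (\<lambda>q. F (q, t)) \<in> L2 lborel"
proof -
  have Fm: "F \<in> borel_measurable borel" using F2 by (rule L2_lborel_borel_measurable)
  have Fs: "(\<lambda>q. F (q, t)) \<in> borel_measurable borel" for t
    by (rule borel_compose_continuous[OF Fm]) (intro continuous_intros)
  have "AE t in lborel. (\<integral>\<^sup>+q. g (F (q, t)) \<partial>lborel) \<noteq> \<infinity>"
    if g: "g \<in> borel_measurable borel" and i: "(\<integral>\<^sup>+p. g (F p) \<partial>lborel) \<noteq> \<infinity>" for g :: "complex \<Rightarrow> ennreal"
  proof (rule nn_integral_PInf_AE)
    have m: "(\<lambda>p. g (F p)) \<in> borel_measurable borel" by (rule measurable_compose[OF Fm g])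
    show "(\<integral>\<^sup>+t. (\<integral>\<^sup>+q. g (F (q, t)) \<partial>lborel) \<partial>lborel) \<noteq> \<infinity>"
      using i unfolding nn_integral_lborel_pair(2)[OF m] .
    show "(\<lambda>t. \<integral>\<^sup>+q. g (F (q, t)) \<partial>lborel) \<in> borel_measurable lborel"
      using borel_measurable_nn_integral_param(2)[OF m] by simp
  qed
  note A = this
  have "AE t in lborel. (\<integral>\<^sup>+q. ennreal (cmod (F (q, t))) \<partial>lborel) \<noteq> \<infinity>"
    by (rule A) (use F1 in \<open>auto simp: integrable_iff_bounded\<close>)
  moreover have "AE t in lborel. (\<integral>\<^sup>+q. ennreal ((cmod (F (q, t)))\<^sup>2) \<partial>lborel) \<noteq> \<infinity>"
    by (rule A) (use nn_integral_L2[OF F2] in auto)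
  ultimately show ?thesis
  proof eventually_elim
    case (elim t)
    then show ?case using Fs[of t] by (auto intro!: integrableI_bounded L2I simp: less_top)
  qed
qed

text \<open>Plancherel in the first variable is applied to the sections, which are integrable and
  square-integrable for almost every \<open>t\<close> only; Tonelli collects them.\<close>

lemma partial_plancherel:
  fixes F :: "'a::euclidean_space \<times> 'b::euclidean_space \<Rightarrow> complex"
  assumes F1: "integrable lborel F" and F2: "F \<in> L2 lborel"
  shows "(\<integral>\<^sup>+p. ennreal ((cmod (fourier (\<lambda>q. F (q, snd p)) (fst p)))\<^sup>2) \<partial>lborel) = ennreal ((L2_norm lborel F)\<^sup>2)"
proof -
  have Fm: "F \<in> borel_measurable borel" using F2 by (rule L2_lborel_borel_measurable)
  have m: "(\<lambda>p. ennreal ((cmod (fourier (\<lambda>q. F (q, snd p)) (fst p)))\<^sup>2)) \<in> borel_measurable borel"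
    using borel_measurable_fourier_param[OF Fm] by measurable
  have m2: "(\<lambda>p. ennreal ((cmod (F p))\<^sup>2)) \<in> borel_measurable borel" using Fm by measurable
  have "(\<integral>\<^sup>+p. ennreal ((cmod (fourier (\<lambda>q. F (q, snd p)) (fst p)))\<^sup>2) \<partial>lborel)
      = (\<integral>\<^sup>+t. (\<integral>\<^sup>+\<xi>. ennreal ((cmod (fourier (\<lambda>q. F (q, t)) \<xi>))\<^sup>2) \<partial>lborel) \<partial>lborel)"
    unfolding nn_integral_lborel_pair(2)[OF m] by simp
  also have "\<dots> = (\<integral>\<^sup>+t. (\<integral>\<^sup>+q. ennreal ((cmod (F (q, t)))\<^sup>2) \<partial>lborel) \<partial>lborel)"
  proof (rule nn_integral_cong_AE, use sections_of_integrable_L2[OF assms] in eventually_elim)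
    case (elim t)
    then have i: "integrable lborel (\<lambda>q. F (q, t))" and L: "(\<lambda>q. F (q, t)) \<in> L2 lborel" by auto
    show ?case unfolding nn_integral_L2[OF plancherel_fourier(1)[OF i L]] nn_integral_L2[OF L] plancherel_fourier(2)[OF i L] ..
  qed
  also have "\<dots> = (\<integral>\<^sup>+p. ennreal ((cmod (F p))\<^sup>2) \<partial>lborel)" unfolding nn_integral_lborel_pair(2)[OF m2] ..
  also have "\<dots> = ennreal ((L2_norm lborel F)\<^sup>2)" by (rule nn_integral_L2[OF F2])
  finally show ?thesis .
qed

lemma continuous_on_matrix_vector:
  "continuous_on A f \<Longrightarrow> continuous_on A (\<lambda>x. (B :: real^'n^'m) *v f x)"
  by (rule continuous_on_compose2[OF matrix_vector_mult_linear_continuous_on _ subset_UNIV])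

section \<open>The integral kernel of the group Fourier transform and the Plancherel formula of
  N\<close>

context adapted_nilpotent_group
begin

lemma sets_haar[simp, measurable_cong]: "sets (haar N) = sets borel"
  and space_haar[simp]: "space (haar N) = UNIV"
  by (simp_all add: haar_def)

lemma integral_haar:
  fixes g :: "'a \<Rightarrow> 'c::{banach, second_countable_topology}"
  shows "g \<in> borel_measurable borel \<Longrightarrow> (\<integral>x. g x \<partial>haar N) = (\<integral>p. g (gcoord p) \<partial>lborel)"
  unfolding haar_def by (subst integral_distr) simp_all

lemma integrable_haar:
  fixes g :: "'a \<Rightarrow> 'c::{banach, second_countable_topology}"
  shows "g \<in> borel_measurable borel \<Longrightarrow> integrable (haar N) g \<longleftrightarrow> integrable lborel (\<lambda>p. g (gcoord p))"
  unfolding haar_def by (subst integrable_distr_eq) simp_all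

lemma borel_measurable_gcoord_iff:
  "(\<lambda>p. g (gcoord p)) \<in> borel_measurable borel \<longleftrightarrow> g \<in> borel_measurable borel"
proof
  assume "(\<lambda>p. g (gcoord p)) \<in> borel_measurable borel"
  from measurable_compose[OF borel_gcoord_inv this] show "g \<in> borel_measurable borel" by simp
qed (rule measurable_compose[OF borel_gcoord])

lemma L2_haar_iff: "f \<in> L2 (haar N) \<longleftrightarrow> (\<lambda>p. f (gcoord p)) \<in> L2 lborel"
proof -
  have "integrable (haar N) (\<lambda>x. (cmod (f x))\<^sup>2) \<longleftrightarrow> integrable lborel (\<lambda>p. (cmod (f (gcoord p)))\<^sup>2)"
    if "f \<in> borel_measurable borel" using that by (intro integrable_haar) simp
  then show ?thesis by (auto simp: L2_def borel_measurable_gcoord_iff)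
qed

lemma L2_norm_haar:
  "f \<in> borel_measurable borel \<Longrightarrow> L2_norm (haar N) f = L2_norm lborel (\<lambda>p. f (gcoord p))"
  unfolding L2_norm_def by (simp add: integral_haar)

lemma L2_haar_borel: "f \<in> L2 (haar N) \<Longrightarrow> f \<in> borel_measurable borel"
  using L2_measurable[of f "haar N"] unfolding measurable_cong_sets[OF sets_haar refl] .

lemma field_measure_density:
  "field_measure N = density lborel (\<lambda>p. ennreal \<bar>det (Bmat N (fst p))\<bar>)"
proof -
  have "field_measure N = density lborel (\<lambda>l. ennreal \<bar>det (Bmat N l)\<bar>) \<Otimes>\<^sub>M density lborel (\<lambda>_. 1)"
    by (simp add: field_measure_def plancherel_measure_def density_1)
  also have "\<dots> = density (lborel \<Otimes>\<^sub>M lborel) (\<lambda>(l, p). ennreal \<bar>det (Bmat N l)\<bar> * 1)"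
    by (rule pair_measure_density) (simp_all add: density_1 sigma_finite_lborel)
  finally show ?thesis by (simp add: lborel_prod split_beta')
qed

lemma sets_field[simp, measurable_cong]: "sets (field_measure N) = sets borel"
  and space_field[simp]: "space (field_measure N) = UNIV"
  by (simp_all add: field_measure_density)

lemma sets_plancherel[simp, measurable_cong]: "sets (plancherel_measure N) = sets borel"
  and space_plancherel[simp]: "space (plancherel_measure N) = UNIV"
  by (simp_all add: plancherel_measure_def)

lemma borel_det_fst: "(\<lambda>p. ennreal \<bar>det (Bmat N (fst p))\<bar>) \<in> borel_measurable (borel :: ((real^'k) \<times> 'c::euclidean_space) measure)"
proof -
  have "(\<lambda>p :: (real^'k) \<times> 'c. det (Bmat N (fst p))) \<in> borel_measurable borel"
    by (rule borel_compose_continuous[OF borel_det_Bmat]) (intro continuous_intros)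
  then show ?thesis by measurable
qed

lemma nn_integral_field:
  assumes g: "g \<in> borel_measurable borel"
  shows "(\<integral>\<^sup>+p. g p \<partial>field_measure N) = (\<integral>\<^sup>+l. ennreal \<bar>det (Bmat N l)\<bar> * (\<integral>\<^sup>+p. g (l, p) \<partial>lborel) \<partial>lborel)"
proof -
  have m: "(\<lambda>p. ennreal \<bar>det (Bmat N (fst p))\<bar> * g p) \<in> borel_measurable borel"
    using borel_det_fst g by measurable
  have "(\<integral>\<^sup>+p. g p \<partial>field_measure N) = (\<integral>\<^sup>+p. ennreal \<bar>det (Bmat N (fst p))\<bar> * g p \<partial>lborel)"
    unfolding field_measure_density using borel_det_fst g by (subst nn_integral_density) simp_all
  also have "\<dots> = (\<integral>\<^sup>+l. (\<integral>\<^sup>+p. ennreal \<bar>det (Bmat N (fst (l, p)))\<bar> * g (l, p) \<partial>lborel) \<partial>lborel)"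
    by (rule nn_integral_lborel_pair(1)[OF m])
  also have "\<dots> = (\<integral>\<^sup>+l. ennreal \<bar>det (Bmat N l)\<bar> * (\<integral>\<^sup>+p. g (l, p) \<partial>lborel) \<partial>lborel)"
    using borel_measurable_section(1)[OF g] by (simp add: nn_integral_cmult)
  finally show ?thesis .
qed

text \<open>The density is nonzero almost everywhere by \<open>AE_regular\<close>, so both measures
  have the same null sets.\<close>

lemma AE_plancherel_eq: "(AE l in plancherel_measure N. Q l) \<longleftrightarrow> (AE l in lborel. Q l)"
proof -
  have "(AE l in plancherel_measure N. Q l) \<longleftrightarrow> (AE l in lborel. 0 < ennreal \<bar>det (Bmat N l)\<bar> \<longrightarrow> Q l)"
    unfolding plancherel_measure_def by (rule AE_density) measurable
  also have "\<dots> \<longleftrightarrow> (AE l in lborel. Q l)"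
    using AE_regular by (auto elim!: eventually_rev_mp)
  finally show ?thesis .
qed

text \<open>The kernel of the integral of F(n) \<open>rep\<close> (n). In that integral the argument
  of the vector is w = x - t, hence t = x - w, and the phase in y is the pairing of B^T x with y;
  what is left is the Fourier transform of F in (z, y) at (l, B^T x).\<close>

definition ker :: "(('k, 'd) coords \<Rightarrow> complex) \<Rightarrow> ('k, 'd) coords \<Rightarrow> complex" where
  "ker F p = fourier (\<lambda>q. F (fst q, snd q, fst (snd p) - snd (snd p))) (fst p, transpose (Bmat N (fst p)) *v fst (snd p))"

text \<open>The same partial transform before the substitutions of B^T x for the frequency and x - w
  for t. All measure theory is done on it, and \<open>ker\<close> is obtained by composing with a
  continuous map.\<close>

definition pfourier :: "(('k, 'd) coords \<Rightarrow> complex) \<Rightarrow> ((real^'k) \<times> (real^'d)) \<times> (real^'d) \<Rightarrow> complex" where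
  "pfourier F r = fourier (\<lambda>q. F (reassoc (q, snd r))) (fst r)"

lemma ker_eq: "ker F (l, x, w) = pfourier F ((l, transpose (Bmat N l) *v x), x - w)"
  by (simp add: ker_def pfourier_def reassoc_def)

lemma borel_pfourier:
  assumes "F \<in> borel_measurable borel" shows "pfourier F \<in> borel_measurable borel"
proof -
  have "(\<lambda>p. F (reassoc p)) \<in> borel_measurable borel" using assms by measurable
  from borel_measurable_fourier_param[OF this] show ?thesis unfolding pfourier_def[abs_def] .
qed

lemma continuous_transpose_Bmat:
  fixes f :: "'c::topological_space \<Rightarrow> real^'k"
  assumes "continuous_on A f" "continuous_on A g"
  shows "continuous_on A (\<lambda>p. transpose (Bmat N (f p)) *v g p)"
proof -
  have "continuous_on A (\<lambda>p. \<chi> j. \<Sum>i\<in>UNIV. Bmat N (f p) $ i $ j * g p $ i)"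
    by (intro continuous_intros assms continuous_on_compose2[OF continuous_Bmat assms(1) subset_UNIV])
  then show ?thesis by (simp add: matrix_vector_mult_def transpose_def)
qed

lemma borel_ker: assumes F: "F \<in> borel_measurable borel" shows "ker F \<in> borel_measurable borel"
proof -
  have "ker F = (\<lambda>p. pfourier F ((fst p, transpose (Bmat N (fst p)) *v fst (snd p)), fst (snd p) - snd (snd p)))"
    by (auto simp: fun_eq_iff ker_eq)
  moreover have "(\<lambda>p. pfourier F ((fst p, transpose (Bmat N (fst p)) *v fst (snd p)), fst (snd p) - snd (snd p))) \<in> borel_measurable borel"
    by (rule borel_compose_continuous[OF borel_pfourier[OF F]]) (intro continuous_intros continuous_transpose_Bmat)
  ultimately show ?thesis by simp
qed

text \<open>Reflecting w to x - w preserves the measure, and substituting B(l)^T x for x produces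
  the inverse of |det B(l)|, which cancels the Plancherel density. What remains is Plancherel's
  theorem in (z, y).\<close>

lemma nn_integral_ker:
  assumes F1: "integrable lborel F" and F2: "F \<in> L2 lborel"
  shows "(\<integral>\<^sup>+p. ennreal ((cmod (ker F p))\<^sup>2) \<partial>field_measure N) = ennreal ((L2_norm lborel F)\<^sup>2)"
proof -
  have Fm: "F \<in> borel_measurable borel" using F2 by (rule L2_lborel_borel_measurable)
  define G where "G r = ennreal ((cmod (pfourier F r))\<^sup>2)" for r
  have G: "G \<in> borel_measurable borel" unfolding G_def[abs_def] using borel_pfourier[OF Fm] by measurable
  define J where "J \<zeta> = (\<integral>\<^sup>+t. G (\<zeta>, t) \<partial>lborel)" for \<zeta>
  have J: "J \<in> borel_measurable borel" unfolding J_def[abs_def] by (rule borel_measurable_nn_integral_param(1)[OF G])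
  have km: "(\<lambda>p. ennreal ((cmod (ker F p))\<^sup>2)) \<in> borel_measurable borel" using borel_ker[OF Fm] by measurable
  have "(\<integral>\<^sup>+p. ennreal ((cmod (ker F p))\<^sup>2) \<partial>field_measure N)
      = (\<integral>\<^sup>+l. ennreal \<bar>det (Bmat N l)\<bar> * (\<integral>\<^sup>+p. ennreal ((cmod (ker F (l, p)))\<^sup>2) \<partial>lborel) \<partial>lborel)"
    by (rule nn_integral_field[OF km])
  also have "\<dots> = (\<integral>\<^sup>+l. (\<integral>\<^sup>+\<xi>. J (l, \<xi>) \<partial>lborel) \<partial>lborel)"
  proof (rule nn_integral_cong_AE, use AE_regular in eventually_elim)
    case (elim l)
    have "(\<integral>\<^sup>+p. ennreal ((cmod (ker F (l, p)))\<^sup>2) \<partial>lborel)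
        = (\<integral>\<^sup>+x. (\<integral>\<^sup>+w. ennreal ((cmod (ker F (l, x, w)))\<^sup>2) \<partial>lborel) \<partial>lborel)"
      by (rule nn_integral_lborel_pair(1)[OF borel_measurable_section(1)[OF km]])
    also have "\<dots> = (\<integral>\<^sup>+x. J (l, transpose (Bmat N l) *v x) \<partial>lborel)"
    proof (rule nn_integral_cong)
      fix x
      have "J (l, transpose (Bmat N l) *v x) = (\<integral>\<^sup>+w. G ((l, transpose (Bmat N l) *v x), x - w) \<partial>lborel)"
        unfolding J_def by (rule nn_integral_reflect[OF borel_measurable_section(1)[OF G]])
      then show "(\<integral>\<^sup>+w. ennreal ((cmod (ker F (l, x, w)))\<^sup>2) \<partial>lborel) = J (l, transpose (Bmat N l) *v x)"
        by (simp add: G_def ker_eq)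
    qed
    also have "ennreal \<bar>det (Bmat N l)\<bar> * \<dots> = (\<integral>\<^sup>+\<xi>. J (l, \<xi>) \<partial>lborel)"
      using scales_lborel_nn_integral[OF scales_lborel_matrix borel_measurable_section(1)[OF J], of "transpose (Bmat N l)" l] elim
      by (simp add: det_transpose)
    finally show ?case .
  qed
  also have "\<dots> = (\<integral>\<^sup>+\<zeta>. J \<zeta> \<partial>lborel)" by (rule nn_integral_lborel_pair(1)[OF J, symmetric])
  also have "\<dots> = (\<integral>\<^sup>+r. G r \<partial>lborel)" unfolding J_def by (rule nn_integral_lborel_pair(1)[OF G, symmetric])
  also have "\<dots> = ennreal ((L2_norm lborel (\<lambda>p. F (reassoc p)))\<^sup>2)"
    unfolding G_def pfourier_def
  proof (rule partial_plancherel)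
    show "integrable lborel (\<lambda>p. F (reassoc p))" using integrable_reassoc[OF Fm] F1 by simp
    have "(\<integral>\<^sup>+p. ennreal ((cmod (F (reassoc p)))\<^sup>2) \<partial>lborel) = ennreal ((L2_norm lborel F)\<^sup>2)"
      unfolding nn_integral_L2[OF F2, symmetric]
      by (rule nn_integral_reassoc[of "\<lambda>p. ennreal ((cmod (F p))\<^sup>2)"]) (use Fm in measurable)
    then show "(\<lambda>p. F (reassoc p)) \<in> L2 lborel" using Fm by (intro L2I) auto
  qed
  also have "L2_norm lborel (\<lambda>p. F (reassoc p)) = L2_norm lborel F"
  proof -
    have "(\<lambda>p. complex_of_real ((cmod (F p))\<^sup>2)) \<in> borel_measurable borel" using Fm by measurable
    from integral_reassoc[OF this] have "complex_of_real (\<integral>p. (cmod (F (reassoc p)))\<^sup>2 \<partial>lborel) = complex_of_real (\<integral>p. (cmod (F p))\<^sup>2 \<partial>lborel)"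
      by (simp only: integral_complex_of_real)
    then show ?thesis unfolding L2_norm_def by simp
  qed
  finally show ?thesis .
qed

lemma L2_ker:
  assumes F1: "integrable lborel F" and F2: "F \<in> L2 lborel"
  shows "ker F \<in> L2 (field_measure N)" "L2_norm (field_measure N) (ker F) = L2_norm lborel F"
proof -
  have m: "ker F \<in> borel_measurable (field_measure N)" using borel_ker[OF L2_lborel_borel_measurable[OF F2]] by simp
  show k: "ker F \<in> L2 (field_measure N)" by (rule L2I[OF m]) (simp add: nn_integral_ker[OF assms])
  have "ennreal ((L2_norm (field_measure N) (ker F))\<^sup>2) = ennreal ((L2_norm lborel F)\<^sup>2)"
    unfolding nn_integral_L2[OF k, symmetric] by (rule nn_integral_ker[OF assms])
  then have "(L2_norm (field_measure N) (ker F))\<^sup>2 = (L2_norm lborel F)\<^sup>2" by (subst (asm) ennreal_inj) auto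
  then show "L2_norm (field_measure N) (ker F) = L2_norm lborel F" by (simp add: power2_eq_iff_nonneg)
qed

lemma rep_gcoord:
  "rep N l (gcoord (z, y, t)) F x = cis (2 * pi * (l \<bullet> z)) * cis (2 * pi * (x \<bullet> (Bmat N l *v y))) * F (x - t)"
  by (simp add: rep_def inv_gcoord)

text \<open>Fubini, after the substitution w = x - t. Absolute integrability of the whole integrand
  comes from Cauchy-Schwarz in x, with a bound independent of the group element, and integrability
  of \<open>f\<close>.\<close>

lemma group_fourier_ker:
  assumes f: "f \<in> borel_measurable borel" and f1: "integrable (haar N) f"
    and k: "(\<lambda>p. ker (\<lambda>p. f (gcoord p)) (l, p)) \<in> L2 lborel"
  shows "group_fourier_kernel N f l (\<lambda>p. ker (\<lambda>p. f (gcoord p)) (l, p))"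
  unfolding group_fourier_kernel_def
proof (intro conjI ballI k)
  fix F G :: "real^'d \<Rightarrow> complex" assume F: "F \<in> L2 lborel" and G: "G \<in> L2 lborel"
  have Fm: "F \<in> borel_measurable borel" and Gm: "G \<in> borel_measurable borel"
    using F G by (auto intro: L2_lborel_borel_measurable)
  let ?B = "Bmat N l"
  define f' where "f' r = f (gcoord (reassoc r))" for r
  have f'm: "f' \<in> borel_measurable borel" unfolding f'_def[abs_def] using f by measurable
  have fg: "(\<lambda>p. f (gcoord p)) \<in> borel_measurable borel" using f by measurable
  have f'1: "integrable lborel f'"
    unfolding f'_def[abs_def] using f1 integrable_haar[OF f] integrable_reassoc[OF fg] by simp
  define e where "e q x = cis (2 * pi * (l \<bullet> fst q)) * cis (2 * pi * (x \<bullet> (?B *v snd q)))" for q :: "(real^'k) \<times> (real^'d)" and x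
  have cm: "cmod (e q x) = 1" for q x by (simp add: e_def norm_mult)
  \<comment> \<open>The integrand as a function of the group coordinates and x together; its two
    iterated integrals are the weak group integral and the kernel operator.\<close>
  define \<Psi> where "\<Psi> s = f' (fst s) * (e (fst (fst s)) (snd s) * F (snd s - snd (fst s)) * cnj (G (snd s)))"
    for s :: "(((real^'k) \<times> (real^'d)) \<times> (real^'d)) \<times> (real^'d)"
  have \<Psi>m: "\<Psi> \<in> borel_measurable borel"
    unfolding \<Psi>_def[abs_def] e_def
    by (intro borel_measurable_times borel_measurable_cnj borel_compose_continuous[OF f'm] borel_compose_continuous[OF Fm]
        borel_compose_continuous[OF Gm] borel_measurable_cis borel_measurable_continuous_onI continuous_intros
        continuous_on_matrix_vector)
  have inner: "L2_inner lborel (rep N l (gcoord (reassoc r)) F) G = (\<integral>x. e (fst r) x * F (x - snd r) * cnj (G x) \<partial>lborel)" for r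
    unfolding L2_inner_def reassoc_def rep_gcoord e_def ..
  have \<Psi>i: "integrable lborel \<Psi>"
  proof (rule integrableI_bounded)
    show "\<Psi> \<in> borel_measurable lborel" using \<Psi>m by simp
    have nm: "(\<lambda>s. ennreal (norm (\<Psi> s))) \<in> borel_measurable borel" using \<Psi>m by measurable
    have "(\<integral>\<^sup>+s. ennreal (norm (\<Psi> s)) \<partial>lborel) = (\<integral>\<^sup>+r. (\<integral>\<^sup>+x. ennreal (norm (\<Psi> (r, x))) \<partial>lborel) \<partial>lborel)"
      by (rule nn_integral_lborel_pair(1)[OF nm])
    also have "\<dots> \<le> (\<integral>\<^sup>+r. ennreal (norm (f' r)) * ennreal (L2_norm lborel F * L2_norm lborel G) \<partial>lborel)"
    proof (rule nn_integral_mono)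
      fix r :: "((real^'k) \<times> (real^'d)) \<times> (real^'d)"
      have Ft: "(\<lambda>x. F (x - snd r)) \<in> L2 lborel" "L2_norm lborel (\<lambda>x. F (x - snd r)) = L2_norm lborel F"
        using L2_lborel_translate[OF F, of "- snd r"] by simp_all
      have Fs: "(\<lambda>x. F (x - snd r)) \<in> borel_measurable borel" by (rule L2_lborel_borel_measurable[OF Ft(1)])
      have "(\<integral>\<^sup>+x. ennreal (norm (\<Psi> (r, x))) \<partial>lborel)
          = ennreal (norm (f' r)) * (\<integral>\<^sup>+x. ennreal (cmod (F (x - snd r)) * cmod (G x)) \<partial>lborel)"
        using Fs Gm by (subst nn_integral_cmult[symmetric]) (auto simp: \<Psi>_def norm_mult cm ennreal_mult mult_ac)
      also have "\<dots> \<le> ennreal (norm (f' r)) * ennreal (L2_norm lborel F * L2_norm lborel G)"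
        using L2_nn_Cauchy_Schwarz[OF Ft(1) G] unfolding Ft(2) by (intro mult_left_mono) auto
      finally show "(\<integral>\<^sup>+x. ennreal (norm (\<Psi> (r, x))) \<partial>lborel) \<le> ennreal (norm (f' r)) * ennreal (L2_norm lborel F * L2_norm lborel G)" .
    qed
    also have "\<dots> = (\<integral>\<^sup>+r. ennreal (norm (f' r)) \<partial>lborel) * ennreal (L2_norm lborel F * L2_norm lborel G)"
      using f'm by (intro nn_integral_multc) simp
    also have "\<dots> < \<infinity>" using f'1 by (simp add: integrable_iff_bounded ennreal_mult_less_top)
    finally show "(\<integral>\<^sup>+s. ennreal (norm (\<Psi> s)) \<partial>lborel) < \<infinity>" .
  qed
  then have \<Psi>i': "integrable (lborel \<Otimes>\<^sub>M lborel) (\<lambda>(r, x). \<Psi> (r, x))" by (simp add: lborel_prod)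
  have hm: "(\<lambda>n. f n * L2_inner lborel (rep N l n F) G) \<in> borel_measurable borel"
  proof -
    have "(\<lambda>r. f' r * (\<integral>x. e (fst r) x * F (x - snd r) * cnj (G x) \<partial>lborel)) = (\<lambda>r. \<integral>x. \<Psi> (r, x) \<partial>lborel)"
      unfolding \<Psi>_def by simp
    then have "(\<lambda>r. f' r * L2_inner lborel (rep N l (gcoord (reassoc r)) F) G) \<in> borel_measurable borel"
      unfolding inner using borel_measurable_integral_param(1)[OF \<Psi>m] by simp
    then have "(\<lambda>p. f' ((fst p, fst (snd p)), snd (snd p)) * L2_inner lborel (rep N l (gcoord (reassoc ((fst p, fst (snd p)), snd (snd p)))) F) G) \<in> borel_measurable borel"
      by (rule borel_compose_continuous) (intro continuous_intros)
    then have "(\<lambda>p. f (gcoord p) * L2_inner lborel (rep N l (gcoord p) F) G) \<in> borel_measurable borel"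
      by (simp add: f'_def reassoc_def)
    then show ?thesis using borel_measurable_gcoord_iff[of "\<lambda>n. f n * L2_inner lborel (rep N l n F) G"] by simp
  qed
  have "(\<integral>n. f n * L2_inner lborel (rep N l n F) G \<partial>haar N)
      = (\<integral>p. f (gcoord p) * L2_inner lborel (rep N l (gcoord p) F) G \<partial>lborel)"
    by (rule integral_haar[OF hm])
  also have "\<dots> = (\<integral>r. f' r * L2_inner lborel (rep N l (gcoord (reassoc r)) F) G \<partial>lborel)"
    unfolding f'_def by (rule integral_reassoc[symmetric]) (use hm borel_gcoord measurable_compose in blast)
  also have "\<dots> = (\<integral>r. (\<integral>x. \<Psi> (r, x) \<partial>lborel) \<partial>lborel)" unfolding inner \<Psi>_def by simp
  also have "\<dots> = (\<integral>x. (\<integral>r. \<Psi> (r, x) \<partial>lborel) \<partial>lborel)"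
    by (rule lborel_pair.Fubini_integral[OF \<Psi>i', symmetric])
  also have "\<dots> = (\<integral>x. (\<integral>w. ker (\<lambda>p. f (gcoord p)) (l, x, w) * F w \<partial>lborel) * cnj (G x) \<partial>lborel)"
  proof (rule integral_cong_AE)
    show "(\<lambda>x. \<integral>r. \<Psi> (r, x) \<partial>lborel) \<in> borel_measurable lborel"
      using borel_measurable_integral_param(2)[OF \<Psi>m] by simp
    have km: "(\<lambda>p. ker (\<lambda>p. f (gcoord p)) (l, p)) \<in> borel_measurable borel"
      by (rule borel_measurable_section(1)[OF borel_ker[OF fg]])
    have "(\<lambda>p. ker (\<lambda>p. f (gcoord p)) (l, p) * F (snd p)) \<in> borel_measurable borel"
      by (intro borel_measurable_times km borel_compose_continuous[OF Fm] continuous_intros)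
    from borel_measurable_integral_param(1)[OF this]
    show "(\<lambda>x. (\<integral>w. ker (\<lambda>p. f (gcoord p)) (l, x, w) * F w \<partial>lborel) * cnj (G x)) \<in> borel_measurable lborel"
      using Gm by simp
    have "AE x in lborel. integrable lborel (\<lambda>r. \<Psi> (r, x))"
      using lborel_pair.AE_integrable_snd[OF \<Psi>i'] by simp
    then show "AE x in lborel. (\<integral>r. \<Psi> (r, x) \<partial>lborel) = (\<integral>w. ker (\<lambda>p. f (gcoord p)) (l, x, w) * F w \<partial>lborel) * cnj (G x)"
    proof eventually_elim
      case (elim x)
      then have i: "integrable (lborel \<Otimes>\<^sub>M lborel) (\<lambda>(q, t). \<Psi> ((q, t), x))" by (simp add: lborel_prod split_beta')
      have "(\<integral>r. \<Psi> (r, x) \<partial>lborel) = (\<integral>r. (case r of (q, t) \<Rightarrow> \<Psi> ((q, t), x)) \<partial>(lborel \<Otimes>\<^sub>M lborel))"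
        by (simp add: lborel_prod split_beta')
      also have "\<dots> = (\<integral>t. (\<integral>q. \<Psi> ((q, t), x) \<partial>lborel) \<partial>lborel)"
        by (rule lborel_pair.integral_snd[OF i, symmetric])
      also have "\<dots> = (\<integral>t. pfourier (\<lambda>p. f (gcoord p)) ((l, transpose ?B *v x), t) * F (x - t) * cnj (G x) \<partial>lborel)"
      proof (rule Bochner_Integration.integral_cong[OF refl])
        fix t
        have "(\<integral>q. \<Psi> ((q, t), x) \<partial>lborel) = (\<integral>q. (f' (q, t) * e q x) * (F (x - t) * cnj (G x)) \<partial>lborel)"
          by (simp add: \<Psi>_def mult_ac)
        also have "\<dots> = (\<integral>q. f' (q, t) * e q x \<partial>lborel) * (F (x - t) * cnj (G x))" by simp
        also have "(\<integral>q. f' (q, t) * e q x \<partial>lborel) = pfourier (\<lambda>p. f (gcoord p)) ((l, transpose ?B *v x), t)"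
          unfolding pfourier_def fourier_def f'_def e_def
          by (simp add: inner_prod_def dot_lmul_matrix cis_mult distrib_left)
        finally show "(\<integral>q. \<Psi> ((q, t), x) \<partial>lborel) = pfourier (\<lambda>p. f (gcoord p)) ((l, transpose ?B *v x), t) * F (x - t) * cnj (G x)"
          by simp
      qed
      also have "\<dots> = (\<integral>w. pfourier (\<lambda>p. f (gcoord p)) ((l, transpose ?B *v x), x - w) * F (x - (x - w)) * cnj (G x) \<partial>lborel)"
        by (rule integral_reflect)
          (intro borel_measurable_times borel_measurable_section(1)[OF borel_pfourier[OF fg]] borel_compose_continuous[OF Fm] continuous_intros borel_measurable_const)
      also have "\<dots> = (\<integral>w. ker (\<lambda>p. f (gcoord p)) (l, x, w) * F w \<partial>lborel) * cnj (G x)"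
        by (simp add: ker_eq)
      finally show ?case .
    qed
  qed
  also have "\<dots> = L2_inner lborel (kernel_operator (\<lambda>p. ker (\<lambda>p. f (gcoord p)) (l, p)) F) G"
    unfolding L2_inner_def kernel_operator_def ..
  finally show "(\<integral>n. f n * L2_inner lborel (rep N l n F) G \<partial>haar N)
      = L2_inner lborel (kernel_operator (\<lambda>p. ker (\<lambda>p. f (gcoord p)) (l, p)) F) G" .
qed

end

section \<open>Uniqueness of kernels and the Plancherel transform as an isometry\<close>

lemma kernel_operator_indicator:
  fixes k :: "(real^'d::finite) \<times> (real^'d) \<Rightarrow> complex"
  assumes k: "k \<in> L2 lborel"
  shows "L2_inner lborel (kernel_operator k (indicator (box a' b'))) (indicator (box a b))
      = (\<integral>p. indicator (box (a, a') (b, b')) p * k p \<partial>lborel)"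
proof -
  have "integrable lborel (\<lambda>p. indicator (box (a, a') (b, b')) p * k p)"
    by (rule L2_mult_integrable(2)[OF L2_indicator[OF _ emeasure_lborel_box_finite] k]) simp
  then have i: "integrable (lborel \<Otimes>\<^sub>M lborel) (\<lambda>p. indicator (box (a, a') (b, b')) p * k p)" by (simp add: lborel_prod)
  have ind: "indicator (box (a, a') (b, b')) (x, w) = (indicator (box a b) x * indicator (box a' b') w :: complex)" for x w
  proof -
    have "(x, w) \<in> box (a, a') (b, b') \<longleftrightarrow> x \<in> box a b \<and> w \<in> box a' b'"
      by (auto simp: box_def Basis_prod_def ball_Un)
    then show ?thesis by (simp add: indicator_def)
  qed
  have "(\<integral>p. indicator (box (a, a') (b, b')) p * k p \<partial>lborel)
      = (\<integral>x. (\<integral>w. indicator (box (a, a') (b, b')) (x, w) * k (x, w) \<partial>lborel) \<partial>lborel)"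
    unfolding lborel_prod[symmetric] by (rule lborel_pair.integral_fst'[OF i, symmetric])
  also have "\<dots> = (\<integral>x. (\<integral>w. k (x, w) * indicator (box a' b') w \<partial>lborel) * cnj (indicator (box a b) x) \<partial>lborel)"
    unfolding ind by (intro Bochner_Integration.integral_cong) (auto simp: indicator_def mult.commute)
  finally show ?thesis unfolding L2_inner_def kernel_operator_def by simp
qed

text \<open>Pairing the operator with indicators of boxes gives the integrals of the kernel over
  product boxes, and these determine it almost everywhere.\<close>

lemma group_fourier_kernel_unique:
  fixes k k' :: "(real^'d::finite) \<times> (real^'d) \<Rightarrow> complex"
  assumes "group_fourier_kernel N f l k" "group_fourier_kernel N f l k'"
  shows "AE p in lborel. k p = k' p"
proof -
  have L: "k \<in> L2 lborel" "k' \<in> L2 lborel" using assms by (auto simp: group_fourier_kernel_def)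
  have "AE p in lborel. k p - k' p = 0"
  proof (rule L2_AE_zero_if_box_integrals_zero[OF L2_diff[OF L]])
    fix A B :: "(real^'d) \<times> (real^'d)"
    obtain a a' b b' where AB: "A = (a, a')" "B = (b, b')" by (metis surj_pair)
    have ind: "(indicator (box c d) :: real^'d \<Rightarrow> complex) \<in> L2 lborel" for c d
      by (rule L2_indicator[OF _ emeasure_lborel_box_finite]) simp
    have i: "integrable lborel (\<lambda>p. indicator (box A B) p * h p)" if "h \<in> L2 lborel" for h :: "(real^'d) \<times> (real^'d) \<Rightarrow> complex"
      by (rule L2_mult_integrable(2)[OF L2_indicator[OF _ emeasure_lborel_box_finite] that]) simp
    have h: "(\<integral>n. f n * L2_inner lborel (rep N l n (indicator (box a' b'))) (indicator (box a b)) \<partial>haar N)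
        = L2_inner lborel (kernel_operator k0 (indicator (box a' b'))) (indicator (box a b))"
      if "group_fourier_kernel N f l k0" for k0
      using that ind unfolding group_fourier_kernel_def by blast
    have "(\<integral>p. indicator (box A B) p * k p \<partial>lborel) = (\<integral>p. indicator (box A B) p * k' p \<partial>lborel)"
      unfolding AB kernel_operator_indicator[OF L(1), symmetric] kernel_operator_indicator[OF L(2), symmetric]
      using h[OF assms(1)] h[OF assms(2)] by (rule trans[OF sym])
    then show "(\<integral>p. indicator (box A B) p * (k p - k' p) \<partial>lborel) = 0"
      by (simp add: right_diff_distrib i L)
  qed
  then show ?thesis by simp
qed

lemma scales_lborel_AE:
  assumes L: "scales_lborel L D" and Q: "AE x in lborel. Q x"
  shows "AE x in lborel. Q (L x)"
proof -
  have Lm: "L \<in> borel_measurable lborel" and D: "0 < D" using L by (auto simp: scales_lborel_def)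
  have "AE x in density (distr lborel borel L) (\<lambda>_. ennreal D). Q x"
    using Q L unfolding scales_lborel_def by metis
  then have "AE x in distr lborel borel L. Q x" using D by (subst (asm) AE_density) auto
  then show ?thesis by (rule AE_distrD[rotated]) (use L in \<open>simp add: scales_lborel_def\<close>)
qed

lemma L2_norm_eq_if_nn_integral_eq:
  assumes "f \<in> L2 M" "g \<in> borel_measurable M'"
    and "(\<integral>\<^sup>+x. ennreal ((cmod (g x))\<^sup>2) \<partial>M') = (\<integral>\<^sup>+x. ennreal ((cmod (f x))\<^sup>2) \<partial>M)"
  shows "g \<in> L2 M'" "L2_norm M' g = L2_norm M f"
proof -
  show g: "g \<in> L2 M'" by (rule L2I) (use assms nn_integral_L2[OF assms(1)] in auto)
  have "ennreal ((L2_norm M' g)\<^sup>2) = ennreal ((L2_norm M f)\<^sup>2)"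
    using assms(3) by (simp only: nn_integral_L2[OF g] nn_integral_L2[OF assms(1)])
  then have "(L2_norm M' g)\<^sup>2 = (L2_norm M f)\<^sup>2" by (subst (asm) ennreal_inj) auto
  then show "L2_norm M' g = L2_norm M f" by (simp add: power2_eq_iff_nonneg)
qed

lemma L2_converges_cong_AE:
  assumes "\<And>n. f n \<in> borel_measurable M" "\<And>n. g n \<in> borel_measurable M" "h \<in> borel_measurable M"
    and "\<And>n. AE x in M. f n x = g n x"
  shows "L2_converges M f h \<longleftrightarrow> L2_converges M g h"
proof -
  have "L2_norm M (\<lambda>x. f n x - h x) = L2_norm M (\<lambda>x. g n x - h x)" for n
    by (rule L2_norm_cong_AE) (use assms in auto)
  then show ?thesis by (simp add: L2_converges_def)
qed

text \<open>Comparing the squared norms at c = 1, -1, i and -i isolates the real and the imaginary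
  part. The two pairs are related only through norms, which suits a transform given as a relation
  between functions.\<close>

lemma L2_polarization:
  assumes f: "f \<in> L2 M" and g: "g \<in> L2 M" and f': "f' \<in> L2 M'" and g': "g' \<in> L2 M'"
    and eq: "\<And>c. L2_norm M (\<lambda>x. f x + c * g x) = L2_norm M' (\<lambda>x. f' x + c * g' x)"
  shows "L2_inner M f g = L2_inner M' f' g'"
proof -
  have f0: "L2_norm M f = L2_norm M' f'" using eq[of 0] by simp
  have "L2_norm M' (\<lambda>x. c * g' x) = L2_norm M (\<lambda>x. c * g x)" if "L2_norm M g = L2_norm M' g'" for c
    using that by (simp add: L2_norm_scale)
  have *: "2 * Re (cnj c * L2_inner M f g) + (cmod c)\<^sup>2 * (L2_norm M g)\<^sup>2
      = 2 * Re (cnj c * L2_inner M' f' g') + (cmod c)\<^sup>2 * (L2_norm M' g')\<^sup>2" for c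
    using arg_cong[OF eq[of c], of "\<lambda>u. u\<^sup>2"] f0
    by (simp add: L2_norm_add_sq[OF f L2_scale[OF g]] L2_norm_add_sq[OF f' L2_scale[OF g']]
        L2_inner_scale_right L2_norm_scale power_mult_distrib del: of_real_power)
  show ?thesis
    using *[of 1] *[of "-1"] *[of "\<i>"] *[of "-\<i>"] by (simp add: complex_eq_iff)
qed

context adapted_nilpotent_group
begin

lemma borel_field_iff: "borel_measurable (field_measure N) = (borel_measurable borel :: (('k, 'd) coords \<Rightarrow> complex) set)"
  by (rule measurable_cong_sets) simp_all

lemma L2_field_borel: "K \<in> L2 (field_measure N) \<Longrightarrow> K \<in> borel_measurable borel"
  using L2_measurable[of K "field_measure N"] unfolding borel_field_iff .

lemma sigma_finite_plancherel: "sigma_finite_measure (plancherel_measure N)"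
  unfolding plancherel_measure_def by (subst sigma_finite_measure.sigma_finite_iff_density_finite[OF sigma_finite_lborel]) auto

lemma AE_field_iff:
  assumes "{p. Q p} \<in> sets borel"
  shows "(AE p in field_measure N. Q p) \<longleftrightarrow> (AE l in plancherel_measure N. AE p in lborel. Q (l, p))"
proof -
  interpret pf: pair_sigma_finite "plancherel_measure N" "lborel :: ((real^'d) \<times> (real^'d)) measure"
    unfolding pair_sigma_finite_def using sigma_finite_plancherel sigma_finite_lborel by blast
  show ?thesis
  proof
  assume "AE p in field_measure N. Q p"
  then show "AE l in plancherel_measure N. AE p in lborel. Q (l, p)"
    unfolding field_measure_def by (rule pf.AE_pair)
next
  assume a: "AE l in plancherel_measure N. AE p in lborel. Q (l, p)"
  have "{p \<in> space (plancherel_measure N \<Otimes>\<^sub>M lborel). Q p} \<in> sets (plancherel_measure N \<Otimes>\<^sub>M lborel)"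
    using assms sets_field space_field unfolding field_measure_def by simp
  from pf.AE_pair_measure[OF this a] show "AE p in field_measure N. Q p" unfolding field_measure_def .
  qed
qed

text \<open>The weighted integral over each section is finite for almost every \<open>l\<close>, and
  there the weight |det B(l)| is nonzero and can be divided out.\<close>

lemma L2_field_sections:
  assumes K: "K \<in> L2 (field_measure N)"
  shows "AE l in plancherel_measure N. (\<lambda>p. K (l, p)) \<in> L2 lborel"
proof -
  have Km: "K \<in> borel_measurable borel" by (rule L2_field_borel[OF K])
  have m: "(\<lambda>p. ennreal ((cmod (K p))\<^sup>2)) \<in> borel_measurable borel" using Km by measurable
  have "(\<integral>\<^sup>+l. ennreal \<bar>det (Bmat N l)\<bar> * (\<integral>\<^sup>+p. ennreal ((cmod (K (l, p)))\<^sup>2) \<partial>lborel) \<partial>lborel) \<noteq> \<infinity>"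
    unfolding nn_integral_field[OF m, symmetric] nn_integral_L2[OF K] by simp
  then have "AE l in lborel. ennreal \<bar>det (Bmat N l)\<bar> * (\<integral>\<^sup>+p. ennreal ((cmod (K (l, p)))\<^sup>2) \<partial>lborel) \<noteq> \<infinity>"
    using borel_measurable_nn_integral_param(1)[OF m] by (intro nn_integral_PInf_AE) simp_all
  then have "AE l in lborel. (\<lambda>p. K (l, p)) \<in> L2 lborel"
    using AE_regular
  proof eventually_elim
    case (elim l)
    have "(\<integral>\<^sup>+p. ennreal ((cmod (K (l, p)))\<^sup>2) \<partial>lborel) < \<infinity>"
      using elim by (simp add: ennreal_mult_eq_top_iff less_top)
    then show ?case using borel_measurable_section(1)[OF Km, of l] by (intro L2I) auto
  qed
  then show ?thesis unfolding AE_plancherel_eq .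
qed

lemma group_fourier_kernel_ker:
  assumes f1: "integrable (haar N) f" and f2: "f \<in> L2 (haar N)"
  shows "ker (\<lambda>p. f (gcoord p)) \<in> L2 (field_measure N)"
    and "L2_norm (field_measure N) (ker (\<lambda>p. f (gcoord p))) = L2_norm (haar N) f"
    and "AE l in plancherel_measure N. group_fourier_kernel N f l (\<lambda>p. ker (\<lambda>p. f (gcoord p)) (l, p))"
proof -
  have fm: "f \<in> borel_measurable borel" by (rule L2_haar_borel[OF f2])
  have F: "integrable lborel (\<lambda>p. f (gcoord p))" "(\<lambda>p. f (gcoord p)) \<in> L2 lborel"
    using f1 f2 integrable_haar[OF fm] L2_haar_iff by auto
  show k: "ker (\<lambda>p. f (gcoord p)) \<in> L2 (field_measure N)" by (rule L2_ker(1)[OF F])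
  show "L2_norm (field_measure N) (ker (\<lambda>p. f (gcoord p))) = L2_norm (haar N) f"
    using L2_ker(2)[OF F] L2_norm_haar[OF fm] by simp
  show "AE l in plancherel_measure N. group_fourier_kernel N f l (\<lambda>p. ker (\<lambda>p. f (gcoord p)) (l, p))"
    using L2_field_sections[OF k] by eventually_elim (rule group_fourier_ker[OF fm f1])
qed

lemma group_fourier_kernel_AE_ker:
  assumes f1: "integrable (haar N) f" and f2: "f \<in> L2 (haar N)" and K: "K \<in> L2 (field_measure N)"
    and g: "AE l in plancherel_measure N. group_fourier_kernel N f l (\<lambda>p. K (l, p))"
  shows "AE p in field_measure N. K p = ker (\<lambda>p. f (gcoord p)) p"
proof -
  let ?k = "ker (\<lambda>p. f (gcoord p))"
  note k = group_fourier_kernel_ker[OF f1 f2]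
  have [measurable]: "K \<in> borel_measurable borel" "?k \<in> borel_measurable borel"
    using K k(1) by (auto intro: L2_field_borel)
  have "AE l in plancherel_measure N. AE p in lborel. K (l, p) = ?k (l, p)"
    using g k(3) by eventually_elim (rule group_fourier_kernel_unique)
  then show ?thesis by (subst AE_field_iff) measurable
qed

text \<open>By uniqueness of kernels the approximating fields in the definition agree almost
  everywhere with \<open>ker\<close> of the approximating functions, so the transform is the closure
  of an explicit map.\<close>

lemma plancherel_transform_iff:
  "plancherel_transform N f K \<longleftrightarrow> f \<in> L2 (haar N) \<and> K \<in> L2 (field_measure N) \<and>
     (\<exists>fs. (\<forall>n. integrable (haar N) (fs n) \<and> fs n \<in> L2 (haar N)) \<and> L2_converges (haar N) fs f \<and>
        L2_converges (field_measure N) (\<lambda>n. ker (\<lambda>p. fs n (gcoord p))) K)"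
proof
  assume "plancherel_transform N f K"
  then obtain fs Ks where f: "f \<in> L2 (haar N)" and K: "K \<in> L2 (field_measure N)" and
    s: "\<And>n. integrable (haar N) (fs n)" "\<And>n. fs n \<in> L2 (haar N)" "\<And>n. Ks n \<in> L2 (field_measure N)"
      "\<And>n. AE l in plancherel_measure N. group_fourier_kernel N (fs n) l (\<lambda>p. Ks n (l, p))"
      "L2_converges (haar N) fs f" "L2_converges (field_measure N) Ks K"
    unfolding plancherel_transform_def by blast
  have "L2_converges (field_measure N) Ks K \<longleftrightarrow> L2_converges (field_measure N) (\<lambda>n. ker (\<lambda>p. fs n (gcoord p))) K"
  proof (rule L2_converges_cong_AE)
    show "AE p in field_measure N. Ks n p = ker (\<lambda>p. fs n (gcoord p)) p" for n
      by (rule group_fourier_kernel_AE_ker[OF s(1-4)])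
  qed (use K s(3) group_fourier_kernel_ker(1)[OF s(1,2)] in \<open>auto intro: L2_measurable\<close>)
  then show "f \<in> L2 (haar N) \<and> K \<in> L2 (field_measure N) \<and>
     (\<exists>fs. (\<forall>n. integrable (haar N) (fs n) \<and> fs n \<in> L2 (haar N)) \<and> L2_converges (haar N) fs f \<and>
        L2_converges (field_measure N) (\<lambda>n. ker (\<lambda>p. fs n (gcoord p))) K)"
    using f K s by blast
next
  assume a: "f \<in> L2 (haar N) \<and> K \<in> L2 (field_measure N) \<and>
     (\<exists>fs. (\<forall>n. integrable (haar N) (fs n) \<and> fs n \<in> L2 (haar N)) \<and> L2_converges (haar N) fs f \<and>
        L2_converges (field_measure N) (\<lambda>n. ker (\<lambda>p. fs n (gcoord p))) K)"
  then obtain fs where s: "\<And>n. integrable (haar N) (fs n)" "\<And>n. fs n \<in> L2 (haar N)" "L2_converges (haar N) fs f"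
    "L2_converges (field_measure N) (\<lambda>n. ker (\<lambda>p. fs n (gcoord p))) K" by blast
  show "plancherel_transform N f K"
    unfolding plancherel_transform_def
    by (intro conjI exI[of _ fs] exI[of _ "\<lambda>n. ker (\<lambda>p. fs n (gcoord p))"] allI)
      (use a s group_fourier_kernel_ker[OF s(1,2)] in auto)
qed

lemma plancherel_transform_L2:
  assumes "plancherel_transform N f K"
  shows "f \<in> L2 (haar N)" "K \<in> L2 (field_measure N)"
  using assms by (auto simp: plancherel_transform_def)

lemma plancherel_transform_norm:
  assumes "plancherel_transform N f K"
  shows "L2_norm (field_measure N) K = L2_norm (haar N) f"
proof -
  obtain fs where f: "f \<in> L2 (haar N)" and K: "K \<in> L2 (field_measure N)" and
    s: "\<And>n. integrable (haar N) (fs n)" "\<And>n. fs n \<in> L2 (haar N)" "L2_converges (haar N) fs f"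
      "L2_converges (field_measure N) (\<lambda>n. ker (\<lambda>p. fs n (gcoord p))) K"
    using assms unfolding plancherel_transform_iff by blast
  have "(\<lambda>n. L2_norm (field_measure N) (ker (\<lambda>p. fs n (gcoord p)))) \<longlonglongrightarrow> L2_norm (field_measure N) K"
    by (rule L2_norm_limit[OF group_fourier_kernel_ker(1)[OF s(1,2)] K s(4)])
  then have "(\<lambda>n. L2_norm (haar N) (fs n)) \<longlonglongrightarrow> L2_norm (field_measure N) K"
    by (simp add: group_fourier_kernel_ker(2)[OF s(1,2)])
  then show ?thesis by (rule LIMSEQ_unique[OF _ L2_norm_limit[OF s(2) f s(3)]])
qed

text \<open>Only almost everywhere: where a section is not integrable the Fourier integral takes the
  default value 0, and linearity may fail. The exceptional t form a null set, and for each fixed x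
  so do the w with x - w among them.\<close>

lemma ker_linear:
  assumes F: "integrable lborel F" "F \<in> L2 lborel" and G: "integrable lborel G" "G \<in> L2 lborel"
  shows "AE p in field_measure N. ker (\<lambda>p. F p + c * G p) p = ker F p + c * ker G p"
proof -
  have FGm[measurable]: "F \<in> borel_measurable borel" "G \<in> borel_measurable borel"
    using F G by (auto intro: L2_lborel_borel_measurable)
  have H: "(\<lambda>p. F p + c * G p) \<in> borel_measurable borel" by measurable
  have sec: "AE t in lborel. integrable lborel (\<lambda>q. H (reassoc (q, t)))"
    if "integrable lborel H" "H \<in> L2 lborel" for H :: "('k, 'd) coords \<Rightarrow> complex"
  proof -
    have Hm: "H \<in> borel_measurable borel" using that by (intro L2_lborel_borel_measurable)
    have i: "integrable lborel (\<lambda>p. H (reassoc p))" using that integrable_reassoc[OF Hm] by simp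
    have "(\<lambda>p. H (reassoc p)) \<in> L2 lborel"
      by (rule L2_norm_eq_if_nn_integral_eq(1)[OF that(2)])
        (use Hm nn_integral_reassoc[of "\<lambda>p. ennreal ((cmod (H p))\<^sup>2)"] in auto)
    from sections_of_integrable_L2[OF i this] show ?thesis by auto
  qed
  have t: "AE t in lborel. \<forall>\<zeta>. pfourier (\<lambda>p. F p + c * G p) (\<zeta>, t) = pfourier F (\<zeta>, t) + c * pfourier G (\<zeta>, t)"
    using sec[OF F] sec[OF G]
  proof eventually_elim
    case (elim t)
    have i: "integrable lborel (\<lambda>q. H (reassoc (q, t)) * cis (2 * pi * (\<zeta> \<bullet> q)))"
      if "integrable lborel (\<lambda>q. H (reassoc (q, t)))" for H :: "('k, 'd) coords \<Rightarrow> complex" and \<zeta>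
      using that by (rule integrable_mult_bounded[where B=1]) auto
    show ?case
      unfolding pfourier_def fourier_def using i[OF elim(1)] i[OF elim(2)]
      by (simp add: distrib_right mult.assoc)
  qed
  have "AE p in lborel. ker (\<lambda>p. F p + c * G p) (l, p) = ker F (l, p) + c * ker G (l, p)" for l
  proof -
    let ?Q = "\<lambda>p. ker (\<lambda>p. F p + c * G p) (l, p) = ker F (l, p) + c * ker G (l, p)"
    have [measurable]: "(\<lambda>p. ker (\<lambda>p. F p + c * G p) (l, p)) \<in> borel_measurable borel"
      "(\<lambda>p. ker F (l, p)) \<in> borel_measurable borel" "(\<lambda>p. ker G (l, p)) \<in> borel_measurable borel"
      by (rule borel_measurable_section(1)[OF borel_ker]; measurable)+
    have "AE x in lborel. AE w in lborel. ?Q (x, w)"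
    proof (rule AE_I2)
      fix x :: "real^'d"
      show "AE w in lborel. ?Q (x, w)"
        using scales_lborel_AE[OF scales_lborel_reflect[of x] t] by eventually_elim (simp add: ker_eq)
    qed
    moreover have "{p \<in> space (lborel \<Otimes>\<^sub>M lborel). ?Q p} \<in> sets (lborel \<Otimes>\<^sub>M lborel)"
      unfolding lborel_prod by measurable
    ultimately have "AE p in lborel \<Otimes>\<^sub>M lborel. ?Q p" by (intro lborel_pair.AE_pair_measure)
    then show ?thesis by (simp only: lborel_prod)
  qed
  moreover have "{p. ker (\<lambda>p. F p + c * G p) p = ker F p + c * ker G p} \<in> sets borel"
  proof -
    note [measurable] = borel_ker[OF H] borel_ker[OF FGm(1)] borel_ker[OF FGm(2)]
    show ?thesis by measurable
  qed
  ultimately show ?thesis by (simp add: AE_field_iff)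
qed

lemma plancherel_transform_linear:
  assumes "plancherel_transform N f K" "plancherel_transform N g L"
  shows "plancherel_transform N (\<lambda>x. f x + c * g x) (\<lambda>p. K p + c * L p)"
proof -
  obtain fs where f: "f \<in> L2 (haar N)" and K: "K \<in> L2 (field_measure N)" and
    s: "\<And>n. integrable (haar N) (fs n)" "\<And>n. fs n \<in> L2 (haar N)" "L2_converges (haar N) fs f"
      "L2_converges (field_measure N) (\<lambda>n. ker (\<lambda>p. fs n (gcoord p))) K"
    using assms(1) unfolding plancherel_transform_iff by blast
  obtain gs where g: "g \<in> L2 (haar N)" and L: "L \<in> L2 (field_measure N)" and
    r: "\<And>n. integrable (haar N) (gs n)" "\<And>n. gs n \<in> L2 (haar N)" "L2_converges (haar N) gs g"
      "L2_converges (field_measure N) (\<lambda>n. ker (\<lambda>p. gs n (gcoord p))) L"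
    using assms(2) unfolding plancherel_transform_iff by blast
  note ks = group_fourier_kernel_ker(1)[OF s(1,2)] and kr = group_fourier_kernel_ker(1)[OF r(1,2)]
  have h: "integrable (haar N) (\<lambda>x. fs n x + c * gs n x)" "(\<lambda>x. fs n x + c * gs n x) \<in> L2 (haar N)" for n
    using s(1) r(1) by simp (rule L2_add[OF s(2) L2_scale[OF r(2)]])
  have *: "L2_converges (field_measure N) (\<lambda>n p. ker (\<lambda>p. fs n (gcoord p)) p + c * ker (\<lambda>p. gs n (gcoord p)) p) (\<lambda>p. K p + c * L p)"
    by (rule L2_converges_add[OF ks K s(4) L2_scale[OF kr] L2_scale[OF L] L2_converges_scale[OF r(4)]])
  have "L2_converges (field_measure N) (\<lambda>n. ker (\<lambda>p. fs n (gcoord p) + c * gs n (gcoord p))) (\<lambda>p. K p + c * L p)"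
  proof (rule L2_converges_cong_AE[THEN iffD1, OF _ _ _ _ *])
    show "AE p in field_measure N. ker (\<lambda>p. fs n (gcoord p)) p + c * ker (\<lambda>p. gs n (gcoord p)) p
        = ker (\<lambda>p. fs n (gcoord p) + c * gs n (gcoord p)) p" for n
    proof -
      have "integrable lborel (\<lambda>p. fs n (gcoord p))" "(\<lambda>p. fs n (gcoord p)) \<in> L2 lborel"
        "integrable lborel (\<lambda>p. gs n (gcoord p))" "(\<lambda>p. gs n (gcoord p)) \<in> L2 lborel"
        using s(1,2)[of n] r(1,2)[of n] integrable_haar[OF L2_haar_borel[OF s(2)[of n]]]
          integrable_haar[OF L2_haar_borel[OF r(2)[of n]]] L2_haar_iff by auto
      from ker_linear[OF this, of c] show ?thesis by eventually_elim simp
    qed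
    show "(\<lambda>p. ker (\<lambda>p. fs n (gcoord p)) p + c * ker (\<lambda>p. gs n (gcoord p)) p) \<in> borel_measurable (field_measure N)" for n
      by (rule L2_measurable[OF L2_add[OF ks L2_scale[OF kr]]])
    show "ker (\<lambda>p. fs n (gcoord p) + c * gs n (gcoord p)) \<in> borel_measurable (field_measure N)" for n
      by (rule L2_measurable[OF group_fourier_kernel_ker(1)[OF h]])
    show "(\<lambda>p. K p + c * L p) \<in> borel_measurable (field_measure N)" by (rule L2_measurable[OF L2_add[OF K L2_scale[OF L]]])
  qed
  moreover have "L2_converges (haar N) (\<lambda>n x. fs n x + c * gs n x) (\<lambda>x. f x + c * g x)"
    by (rule L2_converges_add[OF s(2) f s(3) L2_scale[OF r(2)] L2_scale[OF g] L2_converges_scale[OF r(3)]])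
  ultimately show ?thesis unfolding plancherel_transform_iff
    using h L2_add[OF f L2_scale[OF g]] L2_add[OF K L2_scale[OF L]]
    by (intro conjI exI[of _ "\<lambda>n x. fs n x + c * gs n x"]) auto
qed

lemma plancherel_transform_inner:
  assumes f: "plancherel_transform N f K" and g: "plancherel_transform N g L"
  shows "L2_inner (haar N) f g = L2_inner (field_measure N) K L"
  using plancherel_transform_norm[OF plancherel_transform_linear[OF f g]] plancherel_transform_L2[OF f] plancherel_transform_L2[OF g]
  by (intro L2_polarization) auto

text \<open>Cutting \<open>f\<close> to coordinate balls, which have finite measure, gives
  integrable approximants; linearity and isometry make their kernels Cauchy.\<close>

lemma plancherel_transform_exists:
  assumes f: "f \<in> L2 (haar N)"
  obtains K where "plancherel_transform N f K"
proof -
  define A where "A n = gcoord_inv -` ball 0 (real n)" for n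
  have A[measurable]: "A n \<in> sets borel" for n unfolding A_def by (rule measurable_sets_borel[OF borel_gcoord_inv]) simp
  define fs where "fs n x = indicator (A n) x * f x" for n x
  have fm[measurable]: "f \<in> borel_measurable borel" by (rule L2_haar_borel[OF f])
  have fs2: "fs n \<in> L2 (haar N)" for n unfolding fs_def[abs_def] by (rule L2_times_indicator(1)[OF f]) simp
  have eA: "emeasure (haar N) (A n) < \<infinity>" for n
  proof -
    have "gcoord -` A n = ball 0 (real n)" by (auto simp: A_def)
    then have "emeasure (haar N) (A n) = emeasure lborel (ball 0 (real n) :: ('k, 'd) coords set)"
      unfolding haar_def by (simp add: emeasure_distr)
    then show ?thesis by (simp only: emeasure_lborel_ball_finite)
  qed
  have fs1: "integrable (haar N) (fs n)" for n
    unfolding fs_def by (rule L2_mult_integrable(2)[OF L2_indicator[OF _ eA] f]) simp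
  have conv: "L2_converges (haar N) fs f"
    unfolding fs_def[abs_def]
  proof (rule L2_converges_truncate[OF f])
    fix x :: 'a
    obtain m :: nat where m: "norm (gcoord_inv x) < real m" using reals_Archimedean2 by blast
    show "\<forall>\<^sub>F n in sequentially. x \<in> A n"
      using eventually_ge_at_top[of m] by eventually_elim (use m in \<open>auto simp: A_def\<close>)
  qed simp
  let ?k = "\<lambda>n. ker (\<lambda>p. fs n (gcoord p))"
  note k = group_fourier_kernel_ker[OF fs1 fs2]
  have diff: "L2_norm (field_measure N) (\<lambda>p. ?k m p - ?k n p) = L2_norm (haar N) (\<lambda>x. fs m x - fs n x)" for m n
  proof -
    \<comment> \<open>A function that is already integrable is its own approximating sequence, with
      transform \<open>ker\<close>.\<close>
    have p: "plancherel_transform N (fs n) (?k n)" for n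
      unfolding plancherel_transform_iff using fs1 fs2 k(1)
      by (intro conjI exI[of _ "\<lambda>_. fs n"]) (auto simp: L2_converges_def L2_norm_def)
    from plancherel_transform_norm[OF plancherel_transform_linear[OF p[of m] p[of n], of "-1"]] show ?thesis by simp
  qed
  have "\<exists>N0. \<forall>m\<ge>N0. \<forall>n\<ge>N0. L2_norm (field_measure N) (\<lambda>p. ?k m p - ?k n p) \<le> e" if "0 < e" for e
  proof -
    have "\<forall>\<^sub>F n in sequentially. L2_norm (haar N) (\<lambda>x. fs n x - f x) < e / 2"
      using conv that unfolding L2_converges_def by (auto dest!: order_tendstoD(2)[of _ _ _ "e/2"])
    then obtain N0 where N0: "\<And>n. n \<ge> N0 \<Longrightarrow> L2_norm (haar N) (\<lambda>x. fs n x - f x) < e / 2"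
      unfolding eventually_sequentially by blast
    have "L2_norm (haar N) (\<lambda>x. fs m x - fs n x) \<le> e" if "m \<ge> N0" "n \<ge> N0" for m n
      using L2_norm_triangle_diff[OF fs2[of m] f fs2[of n]] N0[OF that(1)] N0[OF that(2)] L2_norm_minus[of "haar N" f "fs n"]
      by linarith
    then show ?thesis unfolding diff by blast
  qed
  then obtain K where "K \<in> L2 (field_measure N)" "L2_converges (field_measure N) ?k K"
    using L2_complete[of ?k "field_measure N"] k(1) by blast
  then have "plancherel_transform N f K"
    unfolding plancherel_transform_iff using f fs1 fs2 conv by blast
  then show ?thesis by (rule that)
qed

section \<open>Left translations\<close>

text \<open>The operator \<open>rep\<close> at the group element with coordinates \<open>p\<close>,
  applied to the first variable of each kernel: left multiplication of Hilbert-Schmidt operators, or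
  the tensor product of the representation with the identity.\<close>

definition act :: "('k, 'd) coords \<Rightarrow> (('k, 'd) coords \<Rightarrow> complex) \<Rightarrow> ('k, 'd) coords \<Rightarrow> complex" where
  "act p K q = cis (2 * pi * (fst q \<bullet> fst p)) * cis (2 * pi * (fst (snd q) \<bullet> (Bmat N (fst q) *v fst (snd p))))
     * K (fst q, fst (snd q) - snd (snd p), snd (snd q))"

definition coord_inv :: "('k, 'd) coords \<Rightarrow> ('k, 'd) coords" where
  "coord_inv p = (\<omega> (snd (snd p)) (fst (snd p)) - fst p, - fst (snd p), - snd (snd p))"

lemma gcoord_0: "gcoord 0 = \<one>"
  by (simp add: zero_prod_def gcoord_eq \<omega>.zero_left acoord_Pair linear_0[OF linear_lin_comb] lexp_0)

lemma inv_gcoord_eq: "inv (gcoord p) = gcoord (coord_inv p)"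
proof (rule inv_equality)
  show "gcoord (coord_inv p) \<otimes> gcoord p = \<one>"
    unfolding gcoord_mult gcoord_0[symmetric]
    by (simp add: coord_mult_def coord_inv_def \<omega>.minus_left zero_prod_def)
qed simp_all

lemma left_regular_gcoord: "left_regular N (gcoord p) f (gcoord q) = f (gcoord (coord_mult (coord_inv p) q))"
  by (simp add: left_regular_def inv_gcoord_eq gcoord_mult)

text \<open>Left invariance of the Haar measure in coordinates. The shear moves z by an amount
  depending on y, while (y, t) is translated.\<close>

lemma scales_coord_mult: "scales_lborel (coord_mult p) 1"
proof -
  have "coord_mult p = (\<lambda>q. (fst q + (fst p + \<omega> (snd (snd p)) (fst (snd q))), snd q + snd p))"
    by (auto simp: fun_eq_iff coord_mult_def add_ac prod_eq_iff)
  moreover have "scales_lborel (\<lambda>q :: ('k, 'd) coords. (fst q + (fst p + \<omega> (snd (snd p)) (fst (snd q))), snd q + snd p)) 1"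
    by (rule scales_lborel_skew[of "\<lambda>s. fst p + \<omega> (snd (snd p)) (fst s)"])
      (intro continuous_intros \<omega>.continuous_on)
  ultimately show ?thesis by simp
qed

lemma left_regular_L2:
  assumes f: "f \<in> L2 (haar N)"
  shows "left_regular N x f \<in> L2 (haar N)" "L2_norm (haar N) (left_regular N x f) = L2_norm (haar N) f"
    "integrable (haar N) f \<Longrightarrow> integrable (haar N) (left_regular N x f)"
proof -
  obtain p where x: "x = gcoord p" using gcoord_gcoord_inv[of x] by metis
  let ?T = "coord_mult (coord_inv p)"
  let ?F = "\<lambda>q. f (gcoord q)"
  have F: "?F \<in> L2 lborel" using f L2_haar_iff by simp
  have Fm: "?F \<in> borel_measurable borel" by (rule L2_lborel_borel_measurable[OF F])
  have Tm: "?T \<in> borel_measurable borel" using scales_coord_mult by (simp add: scales_lborel_def)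
  have lr: "left_regular N x f (gcoord q) = ?F (?T q)" for q unfolding x left_regular_gcoord ..
  have m: "(\<lambda>q. ?F (?T q)) \<in> borel_measurable borel" by (rule measurable_compose[OF Tm Fm])
  then have lm: "left_regular N x f \<in> borel_measurable borel"
    using borel_measurable_gcoord_iff[of "left_regular N x f"] by (simp add: lr)
  have e: "(\<integral>\<^sup>+q. ennreal ((cmod (?F (?T q)))\<^sup>2) \<partial>lborel) = (\<integral>\<^sup>+q. ennreal ((cmod (?F q))\<^sup>2) \<partial>lborel)"
    using scales_lborel_nn_integral[OF scales_coord_mult, of "\<lambda>q. ennreal ((cmod (?F q))\<^sup>2)" "coord_inv p"] Fm by simp
  have n: "(\<lambda>q. ?F (?T q)) \<in> L2 lborel" "L2_norm lborel (\<lambda>q. ?F (?T q)) = L2_norm lborel ?F"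
    by (rule L2_norm_eq_if_nn_integral_eq[OF F _ e]; use m in simp)+
  then show "left_regular N x f \<in> L2 (haar N)" unfolding L2_haar_iff lr by blast
  show "L2_norm (haar N) (left_regular N x f) = L2_norm (haar N) f"
    using n(2) L2_norm_haar[OF lm] L2_norm_haar[OF L2_haar_borel[OF f]] by (simp add: lr)
  assume "integrable (haar N) f"
  then have "(\<integral>\<^sup>+q. ennreal (norm (?F q)) \<partial>lborel) < \<infinity>"
    using integrable_haar[OF L2_haar_borel[OF f]] by (simp add: integrable_iff_bounded)
  moreover have "(\<integral>\<^sup>+q. ennreal (norm (?F (?T q))) \<partial>lborel) = (\<integral>\<^sup>+q. ennreal (norm (?F q)) \<partial>lborel)"
    using scales_lborel_nn_integral[OF scales_coord_mult, of "\<lambda>q. ennreal (norm (?F q))" "coord_inv p"] Fm by simp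
  ultimately have "integrable lborel (\<lambda>q. ?F (?T q))" using m by (intro integrableI_bounded) auto
  then show "integrable (haar N) (left_regular N x f)" using integrable_haar[OF lm] by (simp add: lr)
qed

text \<open>A substitution in the (z, y)-integral. The shear of the group law adds to the phase the
  pairing of l with \<open>\<omega>\<close>, which \<open>inner_\<omega>\<close> turns into a
  pairing of t0 with B(l) y; this moves B^T x to B^T (x - t0). The identity holds at every point and
  without integrability, since the substitution preserves measure.\<close>

lemma ker_translate:
  assumes F: "F \<in> borel_measurable borel"
  shows "ker (\<lambda>q. F (coord_mult (coord_inv p) q)) = act p (ker F)"
proof
  fix s :: "('k, 'd) coords"
  obtain l x w where s: "s = (l, x, w)" by (metis surj_pair)
  obtain z0 y0 t0 where p: "p = (z0, y0, t0)" by (metis surj_pair)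
  let ?B = "Bmat N l"
  let ?\<xi> = "transpose ?B *v x"
  \<comment> \<open>The shift of the central coordinate caused by the inverse of \<open>p\<close>,
    as a function of y.\<close>
  define \<phi> where "\<phi> y = \<omega> t0 y0 - z0 + \<omega> (- t0) y" for y
  \<comment> \<open>The integrand rewritten in the new variables, with their shifts undone inside
    the phase.\<close>
  define g where "g q = F (fst q, snd q, x - w - t0) * cis (2 * pi * (l \<bullet> (fst q - \<phi> (snd q + y0)) + ?\<xi> \<bullet> (snd q + y0)))" for q
  have \<phi>c: "continuous_on UNIV \<phi>" unfolding \<phi>_def by (intro continuous_intros \<omega>.continuous_on)
  have gm: "g \<in> borel_measurable borel" unfolding g_def[abs_def]
    by (intro borel_measurable_times borel_compose_continuous[OF F] borel_measurable_cis borel_measurable_continuous_onI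
        continuous_intros continuous_on_compose2[OF \<phi>c] subset_UNIV)
  have "ker (\<lambda>q. F (coord_mult (coord_inv p) q)) s = (\<integral>q. g (fst q + \<phi> (snd q), snd q + - y0) \<partial>lborel)"
    unfolding s ker_def fourier_def g_def p
    by (intro Bochner_Integration.integral_cong refl)
      (simp add: coord_mult_def coord_inv_def \<phi>_def inner_prod_def algebra_simps)
  also have "\<dots> = (\<integral>q. g q \<partial>lborel)"
    using scales_lborel_integral[OF scales_lborel_skew[OF \<phi>c, of "- y0"] gm] by simp
  also have "\<dots> = (\<integral>q. cis (2 * pi * (l \<bullet> z0)) * cis (2 * pi * (x \<bullet> (?B *v y0))) *
      (F (fst q, snd q, x - t0 - w) * cis (2 * pi * ((l, transpose ?B *v (x - t0)) \<bullet> q))) \<partial>lborel)"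
  proof (intro Bochner_Integration.integral_cong refl)
    fix q :: "(real^'k) \<times> (real^'d)"
    have "l \<bullet> (fst q - \<phi> (snd q + y0)) + ?\<xi> \<bullet> (snd q + y0)
        = l \<bullet> fst q + l \<bullet> z0 - t0 \<bullet> (?B *v snd q) + x \<bullet> (?B *v snd q) + x \<bullet> (?B *v y0)"
      unfolding \<phi>_def
      by (simp add: inner_diff_right inner_add_right \<omega>.add_right \<omega>.minus_left inner_\<omega> dot_lmul_matrix
          matrix_vector_right_distrib)
    also have "\<dots> = l \<bullet> z0 + x \<bullet> (?B *v y0) + (l, transpose ?B *v (x - t0)) \<bullet> q"
      by (simp add: inner_prod_def dot_lmul_matrix inner_diff_left)
    finally have e: "l \<bullet> (fst q - \<phi> (snd q + y0)) + ?\<xi> \<bullet> (snd q + y0)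
        = l \<bullet> z0 + x \<bullet> (?B *v y0) + (l, transpose ?B *v (x - t0)) \<bullet> q" .
    show "g q = cis (2 * pi * (l \<bullet> z0)) * cis (2 * pi * (x \<bullet> (?B *v y0))) *
      (F (fst q, snd q, x - t0 - w) * cis (2 * pi * ((l, transpose ?B *v (x - t0)) \<bullet> q)))"
    proof -
      have dd: "x - w - t0 = x - t0 - w" by (simp add: algebra_simps)
      show ?thesis unfolding g_def e dd by (simp add: distrib_left cis_mult[symmetric] mult_ac)
    qed
  qed
  also have "\<dots> = act p (ker F) s"
    unfolding act_def ker_def fourier_def s p by simp
  finally show "ker (\<lambda>q. F (coord_mult (coord_inv p) q)) s = act p (ker F) s" .
qed

lemma act_L2:
  assumes K: "K \<in> L2 (field_measure N)"
  shows "act p K \<in> L2 (field_measure N)" "L2_norm (field_measure N) (act p K) = L2_norm (field_measure N) K"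
proof -
  have Km: "K \<in> borel_measurable borel" by (rule L2_field_borel[OF K])
  have Bc: "continuous_on UNIV (\<lambda>q :: ('k, 'd) coords. fst (snd q) \<bullet> (Bmat N (fst q) *v fst (snd p)))"
  proof -
    have "(\<lambda>q :: ('k, 'd) coords. fst (snd q) \<bullet> (Bmat N (fst q) *v fst (snd p)))
        = (\<lambda>q. - (fst q \<bullet> \<omega> (fst (snd q)) (fst (snd p))))" by (simp add: inner_\<omega>)
    then show ?thesis by (simp only:) (intro continuous_intros \<omega>.continuous_on)
  qed
  have am: "act p K \<in> borel_measurable borel" unfolding act_def[abs_def]
    by (intro borel_measurable_times borel_measurable_cis borel_compose_continuous[OF Km]
        borel_measurable_continuous_onI continuous_intros Bc)
  have m: "(\<lambda>p. ennreal ((cmod (K p))\<^sup>2)) \<in> borel_measurable borel" using Km by measurable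
  have m': "(\<lambda>q. ennreal ((cmod (act p K q))\<^sup>2)) \<in> borel_measurable borel" using am by measurable
  have "(\<integral>\<^sup>+q. ennreal ((cmod (act p K q))\<^sup>2) \<partial>field_measure N) = (\<integral>\<^sup>+q. ennreal ((cmod (K q))\<^sup>2) \<partial>field_measure N)"
    unfolding nn_integral_field[OF m] nn_integral_field[OF m']
  proof (rule nn_integral_cong)
    fix l :: "real^'k"
    have "(\<integral>\<^sup>+q. ennreal ((cmod (K (l, q)))\<^sup>2) \<partial>lborel) = (\<integral>\<^sup>+q. ennreal ((cmod (K (l, q + (- snd (snd p), 0))))\<^sup>2) \<partial>lborel)"
      by (rule nn_integral_translate[OF borel_measurable_section(1)[OF m]])
    also have "\<dots> = (\<integral>\<^sup>+q. ennreal ((cmod (act p K (l, q)))\<^sup>2) \<partial>lborel)"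
      by (intro nn_integral_cong) (auto simp: act_def norm_mult)
    finally show "ennreal \<bar>det (Bmat N l)\<bar> * (\<integral>\<^sup>+q. ennreal ((cmod (act p K (l, q)))\<^sup>2) \<partial>lborel)
        = ennreal \<bar>det (Bmat N l)\<bar> * (\<integral>\<^sup>+q. ennreal ((cmod (K (l, q)))\<^sup>2) \<partial>lborel)" by simp
  qed
  note e = this
  have am': "act p K \<in> borel_measurable (field_measure N)" using am unfolding borel_field_iff .
  show "act p K \<in> L2 (field_measure N)" "L2_norm (field_measure N) (act p K) = L2_norm (field_measure N) K"
    by (rule L2_norm_eq_if_nn_integral_eq[OF K am' e])+
qed

text \<open>The intertwining relation is exact on the integrable approximants, and both translation
  and \<open>act\<close> are isometries, so it passes to the limit.\<close>

lemma plancherel_transform_translate: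
  assumes "plancherel_transform N f K"
  shows "plancherel_transform N (left_regular N (gcoord p) f) (act p K)"
proof -
  obtain fs where f: "f \<in> L2 (haar N)" and K: "K \<in> L2 (field_measure N)" and
    s: "\<And>n. integrable (haar N) (fs n)" "\<And>n. fs n \<in> L2 (haar N)" "L2_converges (haar N) fs f"
      "L2_converges (field_measure N) (\<lambda>n. ker (\<lambda>p. fs n (gcoord p))) K"
    using assms unfolding plancherel_transform_iff by blast
  let ?g = "\<lambda>n. left_regular N (gcoord p) (fs n)"
  have "L2_norm (haar N) (\<lambda>x. ?g n x - left_regular N (gcoord p) f x) = L2_norm (haar N) (\<lambda>x. fs n x - f x)" for n
    using left_regular_L2(2)[OF L2_diff[OF s(2)[of n] f], of "gcoord p"] by (simp add: left_regular_def)
  then have c1: "L2_converges (haar N) ?g (left_regular N (gcoord p) f)"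
    using s(3) by (simp add: L2_converges_def)
  have k: "ker (\<lambda>q. ?g n (gcoord q)) = act p (ker (\<lambda>q. fs n (gcoord q)))" for n
    unfolding left_regular_gcoord
    by (rule ker_translate) (use L2_haar_borel[OF s(2)] borel_measurable_gcoord_iff in blast)
  have "L2_norm (field_measure N) (\<lambda>q. act p (ker (\<lambda>q. fs n (gcoord q))) q - act p K q)
      = L2_norm (field_measure N) (\<lambda>q. ker (\<lambda>q. fs n (gcoord q)) q - K q)" for n
  proof -
    have "(\<lambda>q. act p (ker (\<lambda>q. fs n (gcoord q))) q - act p K q) = act p (\<lambda>q. ker (\<lambda>q. fs n (gcoord q)) q - K q)"
      unfolding act_def right_diff_distrib ..
    then show ?thesis using act_L2(2)[OF L2_diff[OF group_fourier_kernel_ker(1)[OF s(1,2)] K], of p n] by simp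
  qed
  then have c2: "L2_converges (field_measure N) (\<lambda>n. ker (\<lambda>q. ?g n (gcoord q))) (act p K)"
    using s(4) unfolding k by (simp add: L2_converges_def)
  show ?thesis unfolding plancherel_transform_iff
    using left_regular_L2(1)[OF f] left_regular_L2(1,3)[OF s(2)] s(1) act_L2(1)[OF K] c1 c2
    by (intro conjI exI[of _ ?g] allI) auto
qed

end

section \<open>Rank-one fields\<close>

lemma borel_kernel_operator:
  fixes k :: "(real^'d::finite) \<times> (real^'d) \<Rightarrow> complex"
  assumes k: "k \<in> borel_measurable borel" and u: "u \<in> borel_measurable borel"
  shows "kernel_operator k u \<in> borel_measurable borel"
proof -
  have "(\<lambda>p. k p * u (snd p)) \<in> borel_measurable borel"
    by (intro borel_measurable_times k borel_compose_continuous[OF u] continuous_intros)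
  from borel_measurable_integral_param(1)[OF this] show ?thesis unfolding kernel_operator_def[abs_def] by simp
qed

text \<open>Cauchy-Schwarz in w for each x, then integration over x: the Hilbert-Schmidt norm
  dominates the operator norm.\<close>

lemma kernel_operator_bound:
  fixes k :: "(real^'d::finite) \<times> (real^'d) \<Rightarrow> complex"
  assumes k: "k \<in> L2 lborel" and u: "u \<in> L2 lborel"
  shows "(\<integral>\<^sup>+x. ennreal ((cmod (kernel_operator k u x))\<^sup>2) \<partial>lborel) \<le> ennreal ((L2_norm lborel k)\<^sup>2 * (L2_norm lborel u)\<^sup>2)"
proof -
  have km: "k \<in> borel_measurable borel" and um: "u \<in> borel_measurable borel"
    using k u by (auto intro: L2_lborel_borel_measurable)
  have m: "(\<lambda>p. ennreal ((cmod (k p))\<^sup>2)) \<in> borel_measurable borel" using km by measurable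
  have "(\<integral>\<^sup>+x. ennreal ((cmod (kernel_operator k u x))\<^sup>2) \<partial>lborel)
      \<le> (\<integral>\<^sup>+x. (\<integral>\<^sup>+w. ennreal ((cmod (k (x, w)))\<^sup>2) \<partial>lborel) * ennreal ((L2_norm lborel u)\<^sup>2) \<partial>lborel)"
  proof (rule nn_integral_mono)
    fix x :: "real^'d"
    have kx: "(\<lambda>w. k (x, w)) \<in> borel_measurable borel" by (rule borel_measurable_section(1)[OF km])
    have "ennreal (cmod (kernel_operator k u x)) \<le> (\<integral>\<^sup>+w. ennreal (cmod (k (x, w))) * ennreal (cmod (u w)) \<partial>lborel)"
    proof (cases "integrable lborel (\<lambda>w. k (x, w) * u w)")
      case True
      have "ennreal (cmod (kernel_operator k u x)) \<le> (\<integral>\<^sup>+w. ennreal (norm (k (x, w) * u w)) \<partial>lborel)"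
        unfolding kernel_operator_def by (rule integral_norm_bound_ennreal[OF True])
      then show ?thesis by (simp add: norm_mult ennreal_mult)
    \<comment> \<open>Without integrability the integral has the default value 0 and the bound is
      trivial.\<close>
    qed (simp add: kernel_operator_def not_integrable_integral_eq)
    then have "(ennreal (cmod (kernel_operator k u x)))\<^sup>2 \<le> (\<integral>\<^sup>+w. ennreal (cmod (k (x, w))) * ennreal (cmod (u w)) \<partial>lborel)\<^sup>2"
      by (intro power_mono) auto
    also have "\<dots> \<le> (\<integral>\<^sup>+w. (ennreal (cmod (k (x, w))))\<^sup>2 \<partial>lborel) * (\<integral>\<^sup>+w. (ennreal (cmod (u w)))\<^sup>2 \<partial>lborel)"
      using kx um by (intro Cauchy_Schwarz_nn_integral) simp_all
    also have "\<dots> = (\<integral>\<^sup>+w. ennreal ((cmod (k (x, w)))\<^sup>2) \<partial>lborel) * ennreal ((L2_norm lborel u)\<^sup>2)"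
      using nn_integral_L2[OF u] by (simp add: ennreal_power)
    finally show "ennreal ((cmod (kernel_operator k u x))\<^sup>2)
        \<le> (\<integral>\<^sup>+w. ennreal ((cmod (k (x, w)))\<^sup>2) \<partial>lborel) * ennreal ((L2_norm lborel u)\<^sup>2)"
      by (simp add: ennreal_power)
  qed
  also have "\<dots> = (\<integral>\<^sup>+x. (\<integral>\<^sup>+w. ennreal ((cmod (k (x, w)))\<^sup>2) \<partial>lborel) \<partial>lborel) * ennreal ((L2_norm lborel u)\<^sup>2)"
    using borel_measurable_nn_integral_param(1)[OF m] by (intro nn_integral_multc) simp
  also have "\<dots> = ennreal ((L2_norm lborel k)\<^sup>2 * (L2_norm lborel u)\<^sup>2)"
    unfolding nn_integral_lborel_pair(1)[OF m, symmetric] nn_integral_L2[OF k] by (simp add: ennreal_mult)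
  finally show ?thesis .
qed

lemma tensor_apply: "tensor f u p = f (fst p) * cnj (u (snd p))"
  by (simp add: tensor_def split_beta')

lemma nn_integral_tensor:
  assumes f: "f \<in> borel_measurable borel" and u: "u \<in> L2 lborel"
  shows "(\<integral>\<^sup>+p. ennreal ((cmod (tensor f u p))\<^sup>2) \<partial>lborel)
    = (\<integral>\<^sup>+x. ennreal ((cmod (f x))\<^sup>2) \<partial>lborel) * ennreal ((L2_norm lborel u)\<^sup>2)"
proof -
  have um: "u \<in> borel_measurable borel" using u by (rule L2_lborel_borel_measurable)
  have t: "tensor f u \<in> borel_measurable borel"
    unfolding tensor_def split_beta'
    by (intro borel_measurable_times borel_measurable_cnj borel_compose_continuous[OF f] borel_compose_continuous[OF um] continuous_intros)
  then have m: "(\<lambda>p. ennreal ((cmod (tensor f u p))\<^sup>2)) \<in> borel_measurable borel" by measurable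
  have "(\<integral>\<^sup>+p. ennreal ((cmod (tensor f u p))\<^sup>2) \<partial>lborel)
      = (\<integral>\<^sup>+x. (\<integral>\<^sup>+w. ennreal ((cmod (f x))\<^sup>2) * ennreal ((cmod (u w))\<^sup>2) \<partial>lborel) \<partial>lborel)"
    unfolding nn_integral_lborel_pair(1)[OF m]
    by (simp add: tensor_def norm_mult power_mult_distrib ennreal_mult)
  also have "\<dots> = (\<integral>\<^sup>+x. ennreal ((cmod (f x))\<^sup>2) * ennreal ((L2_norm lborel u)\<^sup>2) \<partial>lborel)"
    using um by (simp add: nn_integral_cmult nn_integral_L2[OF u])
  also have "\<dots> = (\<integral>\<^sup>+x. ennreal ((cmod (f x))\<^sup>2) \<partial>lborel) * ennreal ((L2_norm lborel u)\<^sup>2)"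
    using f by (intro nn_integral_multc) simp
  finally show ?thesis .
qed

lemma borel_tensor:
  assumes "f \<in> borel_measurable borel" "u \<in> borel_measurable borel"
  shows "tensor f u \<in> borel_measurable borel"
  unfolding tensor_def split_beta'
  by (intro borel_measurable_times borel_measurable_cnj borel_compose_continuous[OF assms(1)]
      borel_compose_continuous[OF assms(2)] continuous_intros)

lemma L2_tensorI: "f \<in> L2 lborel \<Longrightarrow> u \<in> L2 lborel \<Longrightarrow> tensor f u \<in> L2 lborel"
  by (rule L2I) (simp_all add: nn_integral_tensor borel_tensor L2_lborel_borel_measurable nn_integral_L2 ennreal_mult_less_top)

lemma L2_kernel_operator:
  fixes k :: "(real^'d::finite) \<times> (real^'d) \<Rightarrow> complex"
  assumes k: "k \<in> L2 lborel" and u: "u \<in> L2 lborel"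
  shows "kernel_operator k u \<in> L2 lborel" "L2_norm lborel (kernel_operator k u) \<le> L2_norm lborel k * L2_norm lborel u"
  using L2_norm_leI[of "kernel_operator k u" lborel "L2_norm lborel k * L2_norm lborel u"]
    kernel_operator_bound[OF assms] borel_kernel_operator[OF L2_lborel_borel_measurable[OF k] L2_lborel_borel_measurable[OF u]]
  by (simp_all add: power_mult_distrib)

lemma kernel_operator_linear:
  fixes k k' :: "(real^'d::finite) \<times> (real^'d) \<Rightarrow> complex"
  assumes k: "k \<in> L2 lborel" and k': "k' \<in> L2 lborel" and u: "u \<in> L2 lborel"
  shows "AE x in lborel. kernel_operator (\<lambda>p. k p + c * k' p) u x = kernel_operator k u x + c * kernel_operator k' u x"
proof -
  have sec: "AE x in lborel. (\<lambda>w. h (x, w)) \<in> L2 lborel" if h: "h \<in> L2 lborel" for h :: "(real^'d) \<times> (real^'d) \<Rightarrow> complex"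
  proof -
    have hm: "h \<in> borel_measurable borel" using h by (rule L2_lborel_borel_measurable)
    have m: "(\<lambda>p. ennreal ((cmod (h p))\<^sup>2)) \<in> borel_measurable borel" using hm by measurable
    have "AE x in lborel. (\<integral>\<^sup>+w. ennreal ((cmod (h (x, w)))\<^sup>2) \<partial>lborel) \<noteq> \<infinity>"
      using nn_integral_L2[OF h] borel_measurable_nn_integral_param(1)[OF m] unfolding nn_integral_lborel_pair(1)[OF m]
      by (intro nn_integral_PInf_AE) auto
    then show ?thesis
    proof eventually_elim
      case (elim x)
      then show ?case using borel_measurable_section(1)[OF hm, of x] by (intro L2I) (auto simp: less_top)
    qed
  qed
  show ?thesis using sec[OF k] sec[OF k']
  proof eventually_elim
    case (elim x)
    have "integrable lborel (\<lambda>w. k (x, w) * u w)" "integrable lborel (\<lambda>w. k' (x, w) * u w)"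
      using L2_mult_integrable(2)[OF elim(1) u] L2_mult_integrable(2)[OF elim(2) u] by auto
    then show ?case unfolding kernel_operator_def by (simp add: distrib_right mult.assoc)
  qed
qed

lemma AE_lborel_fst:
  assumes "AE x in lborel. Q x"
  shows "AE p in (lborel :: ('a::euclidean_space \<times> 'b::euclidean_space) measure). Q (fst p)"
proof -
  obtain Z where Z: "Z \<in> null_sets lborel" "{x. \<not> Q x} \<subseteq> Z" using assms by (auto elim!: AE_E simp: null_sets_def)
  have "Z \<times> (UNIV :: 'b set) \<in> null_sets (lborel \<Otimes>\<^sub>M lborel)"
    by (rule lborel.times_in_null_sets1[OF Z(1)]) simp
  then have "AE p in lborel. p \<notin> Z \<times> (UNIV :: 'b set)" unfolding lborel_prod by (rule AE_not_in)
  then show ?thesis by eventually_elim (use Z(2) in auto)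
qed

text \<open>For a unit vector \<open>u\<close> these are the kernels \<open>tensor f u\<close>; the factor \<open>f\<close> is recovered by
  applying the operator to \<open>u\<close>.\<close>

definition rank_one_kernels :: "(real^'d::finite \<Rightarrow> complex) \<Rightarrow> ((real^'d) \<times> (real^'d) \<Rightarrow> complex) set" where
  "rank_one_kernels u = {k \<in> L2 lborel. AE p in lborel. k p = tensor (kernel_operator k u) u p}"

lemma rank_one_kernels_norm:
  assumes k: "k \<in> rank_one_kernels u" and u: "u \<in> L2 lborel"
  shows "(L2_norm lborel k)\<^sup>2 = (L2_norm lborel (kernel_operator k u))\<^sup>2 * (L2_norm lborel u)\<^sup>2"
proof -
  have kL: "k \<in> L2 lborel" and e: "AE p in lborel. k p = tensor (kernel_operator k u) u p"
    using k by (auto simp: rank_one_kernels_def)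
  note v = L2_kernel_operator(1)[OF kL u]
  have "ennreal ((L2_norm lborel k)\<^sup>2) = (\<integral>\<^sup>+p. ennreal ((cmod (tensor (kernel_operator k u) u p))\<^sup>2) \<partial>lborel)"
    unfolding nn_integral_L2[OF kL, symmetric] by (rule nn_integral_cong_AE) (use e in auto)
  also have "\<dots> = ennreal ((L2_norm lborel (kernel_operator k u))\<^sup>2 * (L2_norm lborel u)\<^sup>2)"
    unfolding nn_integral_tensor[OF L2_lborel_borel_measurable[OF v] u] nn_integral_L2[OF v] by (simp add: ennreal_mult)
  finally show ?thesis by (subst (asm) ennreal_inj) auto
qed

text \<open>Sending \<open>k\<close> to \<open>tensor (kernel_operator k u) u\<close> is linear up
  to null sets and, as the norm of \<open>u\<close> is at most 1, a contraction. The set consists of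
  its fixed points, so it is a closed subspace.\<close>

lemma L2_closed_subspace_rank_one_kernels:
  fixes u :: "real^'d::finite \<Rightarrow> complex"
  assumes u: "u \<in> L2 lborel" and n: "L2_norm lborel u \<le> 1"
  shows "L2_closed_subspace lborel (rank_one_kernels u)"
proof -
  let ?T = "\<lambda>k. tensor (kernel_operator k u) u"
  have um: "u \<in> borel_measurable borel" using u by (rule L2_lborel_borel_measurable)
  have TL: "?T k \<in> L2 lborel" and Tn: "L2_norm lborel (?T k) \<le> L2_norm lborel k" if k: "k \<in> L2 lborel" for k
  proof -
    note v = L2_kernel_operator[OF k u]
    show L: "?T k \<in> L2 lborel" by (rule L2_tensorI[OF v(1) u])
    have "(\<integral>\<^sup>+p. ennreal ((cmod (?T k p))\<^sup>2) \<partial>lborel) = ennreal ((L2_norm lborel (kernel_operator k u))\<^sup>2) * ennreal ((L2_norm lborel u)\<^sup>2)"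
      unfolding nn_integral_tensor[OF L2_lborel_borel_measurable[OF v(1)] u] nn_integral_L2[OF v(1)] ..
    also have "\<dots> = ennreal ((L2_norm lborel (kernel_operator k u) * L2_norm lborel u)\<^sup>2)"
      by (simp add: ennreal_mult power_mult_distrib)
    also have "\<dots> \<le> ennreal ((L2_norm lborel k)\<^sup>2)"
    proof (intro ennreal_leI power_mono)
      have "L2_norm lborel (kernel_operator k u) * L2_norm lborel u \<le> L2_norm lborel k * L2_norm lborel u * L2_norm lborel u"
        by (rule mult_right_mono[OF v(2)]) simp
      also have "\<dots> = L2_norm lborel k * (L2_norm lborel u * L2_norm lborel u)" by simp
      also have "\<dots> \<le> L2_norm lborel k * 1" using n by (intro mult_left_mono mult_le_one) auto
      finally show "L2_norm lborel (kernel_operator k u) * L2_norm lborel u \<le> L2_norm lborel k" by simp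
    qed simp
    finally show "L2_norm lborel (?T k) \<le> L2_norm lborel k"
      using L2_norm_leI(2)[OF L2_measurable[OF L], of "L2_norm lborel k"] by simp
  qed
  have lin: "AE p in lborel. ?T (\<lambda>p. k p + c * k' p) p = ?T k p + c * ?T k' p" if "k \<in> L2 lborel" "k' \<in> L2 lborel" for k k' c
    using AE_lborel_fst[OF kernel_operator_linear[OF that u, of c]]
    by eventually_elim (simp add: tensor_def split_beta' distrib_right mult.assoc)
  have comb: "(\<lambda>p. k p + c * k' p) \<in> rank_one_kernels u" if "k \<in> rank_one_kernels u" "k' \<in> rank_one_kernels u" for k k' c
  proof -
    have L: "k \<in> L2 lborel" "k' \<in> L2 lborel" and "AE p in lborel. k p = ?T k p" "AE p in lborel. k' p = ?T k' p"
      using that by (auto simp: rank_one_kernels_def)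
    then have "AE p in lborel. k p + c * k' p = ?T (\<lambda>p. k p + c * k' p) p"
      using lin[OF L, of c] by (auto elim!: eventually_elim2 eventually_rev_mp)
    then show ?thesis using L by (auto simp: rank_one_kernels_def)
  qed
  have z: "(\<lambda>p. 0) \<in> rank_one_kernels u"
    by (auto simp: rank_one_kernels_def kernel_operator_def tensor_def)
  show ?thesis
    unfolding L2_closed_subspace_def
  proof (intro conjI ballI allI impI z)
    show "rank_one_kernels u \<subseteq> L2 lborel" by (auto simp: rank_one_kernels_def)
    show "(\<lambda>x. f x + g x) \<in> rank_one_kernels u" if "f \<in> rank_one_kernels u" "g \<in> rank_one_kernels u" for f g
      using comb[OF that, of 1] by simp
    show "(\<lambda>x. c * f x) \<in> rank_one_kernels u" if "f \<in> rank_one_kernels u" for f c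
      using comb[OF z that, of c] by simp
    fix fs f assume a: "(\<forall>n. fs n \<in> rank_one_kernels u) \<and> f \<in> L2 lborel \<and> L2_converges lborel fs f"
    then have f: "f \<in> L2 lborel" and fs: "\<And>n. fs n \<in> L2 lborel" and fsT: "\<And>n. AE p in lborel. fs n p = ?T (fs n) p"
      and c: "L2_converges lborel fs f" by (auto simp: rank_one_kernels_def)
    have "L2_converges lborel fs (?T f)"
      unfolding L2_converges_def
    proof (rule Lim_null_comparison[OF always_eventually, OF allI])
      fix n
      have d: "(\<lambda>p. fs n p + (-1) * f p) \<in> L2 lborel" by (rule L2_add[OF fs L2_scale[OF f]])
      have "L2_norm lborel (\<lambda>p. fs n p - ?T f p) = L2_norm lborel (?T (\<lambda>p. fs n p + (-1) * f p))"
      proof (rule L2_norm_cong_AE)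
        show "AE p in lborel. fs n p - ?T f p = ?T (\<lambda>p. fs n p + (-1) * f p) p"
          using lin[OF fs f, of n "-1"] fsT[of n] by eventually_elim simp
      qed (use L2_measurable[OF L2_diff[OF fs TL[OF f]]] L2_measurable[OF TL[OF d]] in auto)
      also have "\<dots> \<le> L2_norm lborel (\<lambda>p. fs n p + (-1) * f p)" by (rule Tn[OF d])
      finally show "norm (L2_norm lborel (\<lambda>p. fs n p - ?T f p)) \<le> L2_norm lborel (\<lambda>p. fs n p - f p)" by simp
    qed (use c in \<open>simp add: L2_converges_def\<close>)
    from L2_limit_unique[OF fs f c TL[OF f] this] show "f \<in> rank_one_kernels u"
      using f by (simp add: rank_one_kernels_def)
  qed
qed

text \<open>Applied to \<open>u\<close>, the operator with kernel \<open>tensor f v\<close> returns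
  \<open>f\<close> times the conjugate of \<open>c\<close> times the squared norm of
  \<open>u\<close>. Tensoring with \<open>u\<close> again restores the kernel if the norm is 1, and
  both sides are null if \<open>u\<close> is zero.\<close>

lemma tensor_in_rank_one_kernels:
  fixes u :: "real^'d::finite \<Rightarrow> complex"
  assumes f: "f \<in> L2 lborel" and u: "u \<in> L2 lborel" and n: "L2_norm lborel u = 1 \<or> u = (\<lambda>_. 0)"
    and v: "v \<in> L2 lborel" "AE w in lborel. v w = c * u w"
  shows "tensor f v \<in> rank_one_kernels u"
proof -
  have um: "u \<in> borel_measurable borel" and vm: "v \<in> borel_measurable borel"
    using u v(1) by (auto intro: L2_lborel_borel_measurable)
  have "kernel_operator (tensor f v) u x = f x * (cnj c * complex_of_real ((L2_norm lborel u)\<^sup>2))" for x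
  proof -
    have "kernel_operator (tensor f v) u x = (\<integral>w. f x * (cnj c * (u w * cnj (u w))) \<partial>lborel)"
      unfolding kernel_operator_def tensor_def
    proof (rule integral_cong_AE)
      show "AE w in lborel. (case (x, w) of (x, w) \<Rightarrow> f x * cnj (v w)) * u w = f x * (cnj c * (u w * cnj (u w)))"
        using v(2) by eventually_elim simp
      note [measurable] = um vm
      show "(\<lambda>w. (case (x, w) of (x, w) \<Rightarrow> f x * cnj (v w)) * u w) \<in> borel_measurable lborel"
        unfolding case_prod_conv by measurable
      show "(\<lambda>w. f x * (cnj c * (u w * cnj (u w)))) \<in> borel_measurable lborel" by measurable
    qed
    also have "\<dots> = f x * (cnj c * L2_inner lborel u u)" by (simp add: L2_inner_def)
    finally show ?thesis by (simp add: L2_inner_self)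
  qed
  note e = this
  have "AE p in (lborel :: ((real^'d) \<times> (real^'d)) measure). v (snd p) = c * u (snd p)"
  proof -
    obtain Z where Z: "Z \<in> null_sets lborel" "{x. \<not> (v x = c * u x)} \<subseteq> Z" using v(2) by (auto elim!: AE_E simp: null_sets_def)
    have "(UNIV :: (real^'d) set) \<times> Z \<in> null_sets (lborel \<Otimes>\<^sub>M lborel)"
      by (rule lborel.times_in_null_sets2[OF _ Z(1)]) simp
    then have "AE p in lborel. p \<notin> (UNIV :: (real^'d) set) \<times> Z" unfolding lborel_prod by (rule AE_not_in)
    then show ?thesis by eventually_elim (use Z(2) in auto)
  qed
  then have "AE p in lborel. tensor f v p = tensor (kernel_operator (tensor f v) u) u p"
    by eventually_elim (use n in \<open>auto simp: tensor_apply e\<close>)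
  then show ?thesis using L2_tensorI[OF f v(1)] by (simp add: rank_one_kernels_def)
qed

text \<open>\<open>L2_tensor\<close> is the smallest closed subspace containing the elementary
  tensors, so it is enough that the rank-one kernels form a closed subspace containing them. A fibre
  given by a hull thereby becomes an explicit factorisation.\<close>

lemma L2_tensor_subset_rank_one_kernels:
  fixes u :: "real^'d::finite \<Rightarrow> complex"
  assumes u: "u \<in> L2 lborel" and n: "L2_norm lborel u = 1 \<or> u = (\<lambda>_. 0)"
    and V: "\<And>v. v \<in> V \<Longrightarrow> v \<in> L2 lborel \<and> (\<exists>c. AE w in lborel. v w = c * u w)"
  shows "L2_tensor V \<subseteq> rank_one_kernels u"
  unfolding L2_tensor_def
proof (rule hull_minimal)
  show "{tensor f u |f u. f \<in> L2 lborel \<and> u \<in> V} \<subseteq> rank_one_kernels u"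
    using V tensor_in_rank_one_kernels[OF _ u n] by blast
  have "L2_norm lborel u \<le> 1" using n by (auto simp: L2_norm_def)
  then show "L2_closed_subspace lborel (rank_one_kernels u)" by (rule L2_closed_subspace_rank_one_kernels[OF u])
qed

text \<open>A closed subspace contains every L2 function that is almost everywhere equal to one of
  its elements, since the constant sequence converges to it.\<close>

lemma L2_tensor_memberI:
  assumes f: "f \<in> L2 lborel" and v: "v \<in> V" and k: "k \<in> L2 lborel" "AE p in lborel. k p = tensor f v p"
    and V: "V \<subseteq> L2 lborel"
  shows "k \<in> L2_tensor V"
  unfolding L2_tensor_def hull_def
proof (rule InterI, clarify)
  fix T assume T: "L2_closed_subspace lborel T" "{tensor f u |f u. f \<in> L2 lborel \<and> u \<in> V} \<subseteq> T"
  then have t: "tensor f v \<in> T" using f v by blast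
  have "L2_norm lborel (\<lambda>x. tensor f v x - k x) = L2_norm lborel (\<lambda>x. k x - k x)"
    by (rule L2_norm_cong_AE)
      (use k L2_measurable[OF k(1)] L2_measurable[OF L2_tensorI[OF f]] v V in auto)
  then have "L2_converges lborel (\<lambda>_. tensor f v) k"
    by (simp add: L2_converges_def L2_norm_def)
  then show "k \<in> T" using T(1) t k(1) unfolding L2_closed_subspace_def by (metis (no_types, lifting))
qed

lemma orthogonal_projection_L2: "orthogonal_projection M T \<Longrightarrow> F \<in> L2 M \<Longrightarrow> T F \<in> L2 M"
  by (simp add: orthogonal_projection_def)

lemma orthogonal_projection_scale:
  assumes T: "orthogonal_projection M T" and F: "F \<in> L2 M"
  shows "AE x in M. T (\<lambda>y. a * F y) x = a * T F x"
proof -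
  have "AE x in M. T (\<lambda>y. a * F y + 0 * F y) x = a * T F x + 0 * T F x"
    using T F unfolding orthogonal_projection_def by blast
  then show ?thesis by simp
qed

text \<open>Idempotence and self-adjointness. It expresses the norm of a projected vector by a
  matrix coefficient, so weak measurability of a field of projections makes these norms
  measurable.\<close>

lemma orthogonal_projection_inner_self:
  assumes T: "orthogonal_projection M T" and F: "F \<in> L2 M"
  shows "L2_inner M (T F) F = complex_of_real ((L2_norm M (T F))\<^sup>2)"
proof -
  have TF: "T F \<in> L2 M" "T (T F) \<in> L2 M" using T F by (auto intro: orthogonal_projection_L2)
  have "L2_inner M (T F) (T F) = L2_inner M (T (T F)) F"
    using T F TF unfolding orthogonal_projection_def by metis
  also have "\<dots> = L2_inner M (T F) F"
    using T F TF by (intro L2_inner_cong_AE) (auto simp: orthogonal_projection_def intro: L2_measurable)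
  finally show ?thesis unfolding L2_inner_self ..
qed

section \<open>Measurable choice of a unit vector in the range of each projection\<close>

context adapted_nilpotent_group
begin

text \<open>The representative is a partial sum of an orthonormal expansion whose length is chosen measurably
  in the parameter, so as to converge almost everywhere.\<close>

lemma measurable_section:
  assumes v: "\<And>l. v l \<in> L2 lborel"
    and m: "\<And>F. F \<in> L2 lborel \<Longrightarrow> (\<lambda>l. L2_inner lborel (v l) F) \<in> borel_measurable (borel :: (real^'k) measure)"
    and mn: "(\<lambda>l. (L2_norm lborel (v l))\<^sup>2) \<in> borel_measurable borel"
  obtains V :: "(real^'k) \<times> (real^'d) \<Rightarrow> complex" where "V \<in> borel_measurable borel"
    "\<And>l. AE w in lborel. V (l, w) = v l w"
proof -
  obtain e :: "nat \<Rightarrow> real^'d \<Rightarrow> complex" where e: "\<And>i. e i \<in> L2 lborel"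
    "\<And>i j. L2_inner lborel (e i) (e j) = (if i = j then 1 else 0)"
    "\<And>f. f \<in> L2 lborel \<Longrightarrow> (\<lambda>i. (cmod (L2_inner lborel f (e i)))\<^sup>2) sums (L2_norm lborel f)\<^sup>2"
    by (rule L2_lborel_orthonormal_basis, rule that, assumption+)
  define a where "a i l = L2_inner lborel (v l) (e i)" for i l
  have am[measurable]: "a i \<in> borel_measurable borel" for i unfolding a_def[abs_def] by (rule m[OF e(1)])
  have em: "e i \<in> borel_measurable borel" for i by (rule L2_lborel_borel_measurable[OF e(1)])
  define r where "r j l = (L2_norm lborel (v l))\<^sup>2 - (\<Sum>i<j. (cmod (a i l))\<^sup>2)" for j l
  have rm[measurable]: "r j \<in> borel_measurable borel" for j unfolding r_def[abs_def] using mn by measurable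
  have r: "(L2_norm lborel (\<lambda>w. v l w - (\<Sum>i<j. a i l * e i w)))\<^sup>2 = r j l" for j l
    unfolding r_def by (rule L2_orthonormal_partial_sum[OF e(1,2) v]) (simp add: a_def)
  have rlim: "(\<lambda>j. r j l) \<longlonglongrightarrow> 0" for l
    using tendsto_diff[OF tendsto_const[of "(L2_norm lborel (v l))\<^sup>2"] e(3)[OF v[of l], unfolded sums_def]]
    by (simp add: r_def a_def)
  \<comment> \<open>The least number of terms leaving a remainder of at most (1/2)^(k+1).
    Consecutive approximants then differ by at most (1/2)^k, the rate needed for convergence almost
    everywhere.\<close>
  define n where "n k l = (LEAST j. r j l \<le> ((1/2)^(Suc k))\<^sup>2)" for k l
  have nm[measurable]: "n k \<in> measurable borel (count_space UNIV)" for k unfolding n_def[abs_def] by measurable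
  have nr: "r (n k l) l \<le> ((1/2)^(Suc k))\<^sup>2" for k l
  proof -
    have "\<forall>\<^sub>F j in sequentially. r j l < ((1/2)^(Suc k))\<^sup>2"
      by (rule order_tendstoD(2)[OF rlim]) simp
    then obtain j where "r j l < ((1/2)^(Suc k))\<^sup>2" using eventually_happens'[OF sequentially_bot] by blast
    then show ?thesis unfolding n_def by (intro LeastI[of "\<lambda>j. r j l \<le> ((1/2)^(Suc k))\<^sup>2" j] less_imp_le)
  qed
  define A where "A k p = (\<Sum>i<n k (fst p). a i (fst p) * e i (snd p))" for k and p :: "(real^'k) \<times> (real^'d)"
  have Am: "A k \<in> borel_measurable borel" for k
  proof -
    have f: "(\<lambda>p :: (real^'k) \<times> (real^'d). \<Sum>i<j. a i (fst p) * e i (snd p)) \<in> borel_measurable borel" for j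
      by (intro borel_measurable_sum borel_measurable_times borel_compose_continuous[OF am] borel_compose_continuous[OF em] continuous_intros)
    have g: "(\<lambda>p :: (real^'k) \<times> (real^'d). n k (fst p)) \<in> measurable borel (count_space UNIV)"
      by (rule measurable_compose[OF borel_measurable_continuous_onI nm]) (intro continuous_intros)
    show ?thesis unfolding A_def[abs_def] by (rule measurable_compose_countable[OF f g])
  qed
  have AL: "(\<lambda>w. A k (l, w)) \<in> L2 lborel" for k l
    unfolding A_def fst_conv snd_conv by (rule L2_sum, rule L2_scale, rule e(1))
  have An: "L2_norm lborel (\<lambda>w. v l w - A k (l, w)) \<le> (1/2)^(Suc k)" for k l
  proof (rule power2_le_imp_le)
    show "(L2_norm lborel (\<lambda>w. v l w - A k (l, w)))\<^sup>2 \<le> ((1/2)^(Suc k))\<^sup>2"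
      unfolding A_def fst_conv snd_conv r by (rule nr)
  qed simp
  define V where "V p = lim (\<lambda>k. A k p)" for p
  show ?thesis
  proof (rule that)
    show "V \<in> borel_measurable borel" unfolding V_def[abs_def] using Am by (rule borel_measurable_lim_metric)
    fix l
    have Vm: "(\<lambda>w. V (l, w)) \<in> borel_measurable borel"
      using borel_measurable_section(1)[OF \<open>V \<in> borel_measurable borel\<close>] .
    have "AE w in lborel. convergent (\<lambda>k. A k (l, w))"
    proof (rule L2_fast_AE_convergent[OF AL])
      fix k
      have "L2_norm lborel (\<lambda>w. A (Suc k) (l, w) - A k (l, w))
          \<le> L2_norm lborel (\<lambda>w. A (Suc k) (l, w) - v l w) + L2_norm lborel (\<lambda>w. v l w - A k (l, w))"
        by (rule L2_norm_triangle_diff[OF AL v AL])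
      also have "\<dots> \<le> (1/2)^(Suc (Suc k)) + (1/2)^(Suc k)"
        using An[of l "Suc k"] An[of l k] L2_norm_minus[of lborel "v l" "\<lambda>w. A (Suc k) (l, w)"] by linarith
      also have "\<dots> \<le> (1/2)^k" by simp
      finally show "L2_norm lborel (\<lambda>w. A (Suc k) (l, w) - A k (l, w)) \<le> (1/2)^k" .
    qed
    then have lim: "AE w in lborel. (\<lambda>k. v l w - A k (l, w)) \<longlonglongrightarrow> v l w - V (l, w)"
      by eventually_elim (auto simp: V_def convergent_LIMSEQ_iff intro!: tendsto_intros)
    have vm: "v l \<in> borel_measurable borel" by (rule L2_lborel_borel_measurable[OF v])
    have b: "(\<lambda>w. v l w - V (l, w)) \<in> L2 lborel \<and> L2_norm lborel (\<lambda>w. v l w - V (l, w)) \<le> (1/2)^m" for m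
    proof -
      have "\<forall>\<^sub>F k in sequentially. L2_norm lborel (\<lambda>w. v l w - A k (l, w)) \<le> (1/2)^m"
        using eventually_ge_at_top[of m]
      proof eventually_elim
        case (elim k)
        have "(1/2)^(Suc k) \<le> (1/2 :: real)^m" using elim by (intro power_decreasing) auto
        then show ?case using An[of l k] by linarith
      qed
      from L2_Fatou[OF L2_diff[OF v AL] _ lim this] show ?thesis using vm Vm by simp
    qed
    have "L2_norm lborel (\<lambda>w. v l w - V (l, w)) \<le> 0"
      by (rule LIMSEQ_le_const[OF LIMSEQ_power_zero[of "1/2::real"]]) (use b in auto)
    then have "L2_norm lborel (\<lambda>w. v l w - V (l, w)) = 0" by (simp add: order_antisym)
    from L2_norm_zero_AE[OF _ this] b show "AE w in lborel. V (l, w) = v l w" by auto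
  qed
qed

text \<open>Each projection is applied to a fixed orthonormal basis, and the first nonzero image is
  normalised. Rank at most one makes it span the range; where all images vanish the projection is
  zero and so is the section. The index of the first nonzero image is measurable because the norms
  are.\<close>

lemma measurable_unit_section:
  assumes Q: "measurable_projection_field N Q"
    and rank: "AE l in plancherel_measure N. rank_le_one lborel (Q l)"
  obtains u :: "(real^'k) \<times> (real^'d) \<Rightarrow> complex" where "u \<in> borel_measurable borel"
    "\<And>l. (\<lambda>w. u (l, w)) \<in> L2 lborel"
    "\<And>l. L2_norm lborel (\<lambda>w. u (l, w)) = 1 \<or> (\<lambda>w. u (l, w)) = (\<lambda>_. 0)"
    "AE l in plancherel_measure N. \<exists>F\<in>L2 lborel. AE w in lborel. u (l, w) = Q l F w"
    "AE l in plancherel_measure N. \<forall>F\<in>L2 lborel. \<exists>c. AE w in lborel. Q l F w = c * u (l, w)"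
proof -
  let ?S = "Sigma_set N"
  obtain e :: "nat \<Rightarrow> real^'d \<Rightarrow> complex" where e: "\<And>i. e i \<in> L2 lborel"
    "\<And>i j. L2_inner lborel (e i) (e j) = (if i = j then 1 else 0)"
    "\<And>f. f \<in> L2 lborel \<Longrightarrow> (\<lambda>i. (cmod (L2_inner lborel f (e i)))\<^sup>2) sums (L2_norm lborel f)\<^sup>2"
    by (rule L2_lborel_orthonormal_basis, rule that, assumption+)
  have proj: "orthogonal_projection lborel (Q l)" if "l \<in> ?S" for l
    using Q that by (simp add: measurable_projection_field_def)
  \<comment> \<open>Outside \<open>Sigma_set N\<close> nothing is known about \<open>Q l\<close>;
    the value 0 makes the family measurable everywhere.\<close>
  define v where "v i l = (if l \<in> ?S then Q l (e i) else (\<lambda>_. 0))" for i l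
  have v: "v i l \<in> L2 lborel" for i l
    using proj e(1) by (auto simp: v_def intro: orthogonal_projection_L2)
  have vin: "(\<lambda>l. L2_inner lborel (v i l) F) \<in> borel_measurable borel" if F: "F \<in> L2 lborel" for i F
  proof -
    have "(\<lambda>l. L2_inner lborel (Q l (e i)) F) \<in> borel_measurable (restrict_space borel ?S)"
      using Q e(1) F by (simp add: measurable_projection_field_def)
    then have "(\<lambda>l. indicator ?S l *\<^sub>R L2_inner lborel (Q l (e i)) F) \<in> borel_measurable borel"
      by (subst (asm) borel_measurable_restrict_space_iff) simp_all
    moreover have "(\<lambda>l. indicator ?S l *\<^sub>R L2_inner lborel (Q l (e i)) F) = (\<lambda>l. L2_inner lborel (v i l) F)"
      by (auto simp: fun_eq_iff v_def L2_inner_def indicator_def)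
    ultimately show ?thesis by simp
  qed
  define \<rho> where "\<rho> i l = (L2_norm lborel (v i l))\<^sup>2" for i l
  have \<rho>m[measurable]: "\<rho> i \<in> borel_measurable borel" for i
  proof -
    have "\<rho> i = (\<lambda>l. Re (L2_inner lborel (v i l) (e i)))"
      using orthogonal_projection_inner_self[OF proj e(1)] by (auto simp: fun_eq_iff \<rho>_def v_def L2_norm_def L2_inner_def)
    then show ?thesis using vin[OF e(1)] by simp
  qed
  have "\<exists>V. V \<in> borel_measurable borel \<and> (\<forall>l. AE w in lborel. V (l, w) = v i l w)" for i
    by (rule measurable_section[of "v i", OF v vin]) (use \<rho>m[of i] in \<open>auto simp: \<rho>_def[abs_def]\<close>)
  then obtain V where V: "\<And>i. V i \<in> borel_measurable borel" "\<And>i l. AE w in lborel. V i (l, w) = v i l w" by metis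
  define n where "n l = (LEAST i. \<rho> i l \<noteq> 0)" for l
  have nm[measurable]: "n \<in> measurable borel (count_space UNIV)" unfolding n_def[abs_def] by measurable
  define W where "W = {l. \<exists>i. \<rho> i l \<noteq> 0}"
  have Wm[measurable]: "W \<in> sets borel" unfolding W_def by measurable
  have nW: "\<rho> (n l) l \<noteq> 0" if lW: "l \<in> W" for l
  proof -
    obtain i where "\<rho> i l \<noteq> 0" using lW unfolding W_def by blast
    then show ?thesis unfolding n_def by (rule LeastI[of "\<lambda>i. \<rho> i l \<noteq> 0"])
  qed
  have WS: "l \<in> ?S" if "l \<in> W" for l
    using nW[OF that] by (auto simp: \<rho>_def v_def L2_norm_def split: if_splits)
  define c where "c l = (if l \<in> W then complex_of_real (1 / sqrt (\<rho> (n l) l)) else 0)" for l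
  have cm: "c \<in> borel_measurable borel"
  proof -
    have "(\<lambda>l. \<rho> (n l) l) \<in> borel_measurable borel" by (rule measurable_compose_countable[OF \<rho>m nm])
    then show ?thesis unfolding c_def[abs_def] by measurable
  qed
  define u where "u p = c (fst p) * V (n (fst p)) p" for p
  have um: "u \<in> borel_measurable borel"
  proof -
    have "(\<lambda>p :: (real^'k) \<times> (real^'d). n (fst p)) \<in> measurable borel (count_space UNIV)"
      by (rule measurable_compose[OF borel_measurable_continuous_onI nm]) (intro continuous_intros)
    from measurable_compose_countable[OF V(1) this]
    have "(\<lambda>p. V (n (fst p)) p) \<in> borel_measurable borel" .
    moreover have "(\<lambda>p :: (real^'k) \<times> (real^'d). c (fst p)) \<in> borel_measurable borel"
      by (rule borel_compose_continuous[OF cm]) (intro continuous_intros)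
    ultimately show ?thesis unfolding u_def[abs_def] by simp
  qed
  have uv: "AE w in lborel. c l * v (n l) l w = u (l, w)" for l
    using V(2)[of "n l" l] by eventually_elim (simp add: u_def)
  have us: "(\<lambda>w. u (l, w)) \<in> borel_measurable borel" for l by (rule borel_measurable_section(1)[OF um])
  have uL: "(\<lambda>w. u (l, w)) \<in> L2 lborel" for l
    by (rule L2_cong_AE[OF L2_scale[OF v] _ uv]) (use us in simp)
  have un: "L2_norm lborel (\<lambda>w. u (l, w)) = cmod (c l) * sqrt (\<rho> (n l) l)" for l
  proof -
    have "L2_norm lborel (\<lambda>w. u (l, w)) = L2_norm lborel (\<lambda>w. c l * v (n l) l w)"
      by (rule L2_norm_cong_AE[symmetric]) (use uv us L2_measurable[OF L2_scale[OF v]] in auto)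
    then show ?thesis by (simp add: L2_norm_scale \<rho>_def)
  qed
  have u0: "(\<lambda>w. u (l, w)) = (\<lambda>_. 0)" if "l \<notin> W" for l using that by (simp add: u_def c_def)
  have u1: "L2_norm lborel (\<lambda>w. u (l, w)) = 1" if "l \<in> W" for l
  proof -
    have "0 < \<rho> (n l) l" using nW[OF that] by (simp add: \<rho>_def)
    then show ?thesis unfolding un c_def using that by (simp add: norm_divide)
  qed
  have S: "AE l in plancherel_measure N. l \<in> ?S"
    using AE_regular unfolding AE_plancherel_eq by (simp add: Sigma_set_def)
  show ?thesis
  proof (rule that[OF um uL])
    show "L2_norm lborel (\<lambda>w. u (l, w)) = 1 \<or> (\<lambda>w. u (l, w)) = (\<lambda>_. 0)" for l
      using u0 u1 by (cases "l \<in> W") auto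
    show "AE l in plancherel_measure N. \<exists>F\<in>L2 lborel. AE w in lborel. u (l, w) = Q l F w"
      using S
    proof eventually_elim
      case (elim l)
      have "AE w in lborel. Q l (\<lambda>y. c l * e (n l) y) w = c l * Q l (e (n l)) w"
        by (rule orthogonal_projection_scale[OF proj[OF elim] e(1)])
      then have "AE w in lborel. u (l, w) = Q l (\<lambda>y. c l * e (n l) y) w"
        using uv[of l] by eventually_elim (use elim in \<open>simp add: v_def\<close>)
      then show ?case using L2_scale[OF e(1)] by blast
    qed
    show "AE l in plancherel_measure N. \<forall>F\<in>L2 lborel. \<exists>c. AE w in lborel. Q l F w = c * u (l, w)"
      using S rank
    proof eventually_elim
      case (elim l)
      show ?case
      proof
        fix F :: "real^'d \<Rightarrow> complex" assume F: "F \<in> L2 lborel"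
        have QF: "Q l F \<in> L2 lborel" by (rule orthogonal_projection_L2[OF proj[OF elim(1)] F])
        show "\<exists>c. AE w in lborel. Q l F w = c * u (l, w)"
        proof (cases "l \<in> W")
          case True
          obtain u0 where u0: "u0 \<in> L2 lborel" "\<And>F. F \<in> L2 lborel \<Longrightarrow> \<exists>c. AE x in lborel. Q l F x = c * u0 x"
            using elim(2) unfolding rank_le_one_def by blast
          obtain b where b: "AE x in lborel. Q l F x = b * u0 x" using u0(2)[OF F] by blast
          obtain d where d: "AE x in lborel. Q l (e (n l)) x = d * u0 x" using u0(2)[OF e(1)] by blast
          have ud: "AE w in lborel. u (l, w) = c l * d * u0 w"
            using uv[of l] d by eventually_elim (use elim in \<open>simp add: v_def mult.assoc\<close>)
          have nz: "c l * d \<noteq> 0"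
          proof
            assume cd: "c l * d = 0"
            from ud have "AE w in lborel. u (l, w) = 0" by eventually_elim (simp only: cd mult_zero_left)
            then have "L2_norm lborel (\<lambda>w. u (l, w)) = L2_norm lborel (\<lambda>w :: real^'d. 0)"
              using us[of l] by (intro L2_norm_cong_AE) auto
            then show False using u1[OF True] by (simp add: L2_norm_def)
          qed
          from b ud have "AE w in lborel. Q l F w = b / (c l * d) * u (l, w)"
            by eventually_elim (use nz in simp)
          then show ?thesis by blast
        next
          case False
          \<comment> \<open>Here the projection kills every basis vector; by self-adjointness all
            coefficients of its values vanish, so it is the zero operator.\<close>
          have "L2_inner lborel (Q l F) (e i) = 0" for i
          proof -
            have "L2_norm lborel (Q l (e i)) = 0" using False elim(1) by (auto simp: W_def \<rho>_def v_def)
            moreover have "L2_inner lborel (Q l F) (e i) = L2_inner lborel F (Q l (e i))"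
              using proj[OF elim(1)] F e(1) unfolding orthogonal_projection_def by blast
            ultimately show ?thesis
              using L2_Cauchy_Schwarz[OF F orthogonal_projection_L2[OF proj[OF elim(1)] e(1)], of i] by simp
          qed
          then have "(\<lambda>i::nat. 0) sums (L2_norm lborel (Q l F))\<^sup>2" using e(3)[OF QF] by simp
          then have "L2_norm lborel (Q l F) = 0" using sums_unique2[OF _ sums_zero] by fastforce
          from L2_norm_zero_AE[OF QF this] show ?thesis by (intro exI[of _ 0]) simp
        qed
      qed
    qed
  qed
qed

end

section \<open>The Parseval identity\<close>

text \<open>The passage from nonnegative integrals over counting measure, in which all sums are
  computed, to the unordered sums in \<open>parseval_frame\<close>.\<close>

lemma has_sum_if_nn_integral_count_space:
  fixes f :: "'i \<Rightarrow> real"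
  assumes f: "\<And>i. i \<in> I \<Longrightarrow> 0 \<le> f i" and s: "0 \<le> s"
    and eq: "(\<integral>\<^sup>+i. ennreal (f i) \<partial>count_space I) = ennreal s"
  shows "(f has_sum s) I"
proof -
  have i: "integrable (count_space I) f"
    by (rule integrableI_nonneg) (use f eq in \<open>auto simp: AE_count_space\<close>)
  have "integral\<^sup>L (count_space I) f = s"
    using nn_integral_eq_integral[OF i] f eq s integral_nonneg_AE[of f "count_space I"] by (auto simp: AE_count_space)
  then have "infsetsum f I = s" by (simp add: infsetsum_def)
  moreover have a: "Infinite_Set_Sum.abs_summable_on f I" using i by (simp add: Infinite_Set_Sum.abs_summable_on_def)
  ultimately have "infsum f I = s" using infsetsum_infsum[OF a] by simp
  moreover have "f summable_on I"
    using a by (metis abs_summable_equivalent abs_summable_summable)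
  ultimately show ?thesis using has_sum_infsum by blast
qed

lemma AE_lborel_snd:
  assumes "AE x in lborel. Q x"
  shows "AE p in (lborel :: ('a::euclidean_space \<times> 'b::euclidean_space) measure). Q (snd p)"
proof -
  obtain Z where Z: "Z \<in> null_sets lborel" "{x. \<not> Q x} \<subseteq> Z" using assms by (auto elim!: AE_E simp: null_sets_def)
  have "(UNIV :: 'a set) \<times> Z \<in> null_sets (lborel \<Otimes>\<^sub>M lborel)"
    by (rule lborel.times_in_null_sets2) (use Z in simp_all)
  then have "AE p in lborel. p \<notin> (UNIV :: 'a set) \<times> Z" unfolding lborel_prod by (rule AE_not_in)
  then show ?thesis by eventually_elim (use Z(2) in auto)
qed

lemma L2_inner_tensor:
  fixes h u :: "real^'d::finite \<Rightarrow> complex"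
  assumes k: "k \<in> L2 lborel" and h: "h \<in> L2 lborel" and u: "u \<in> L2 lborel"
  shows "L2_inner lborel k (tensor h u) = L2_inner lborel (kernel_operator k u) h"
proof -
  have i: "integrable (lborel \<Otimes>\<^sub>M lborel) (\<lambda>p. k p * cnj (tensor h u p))"
    unfolding lborel_prod by (rule L2_mult_integrable(1)[OF k L2_tensorI[OF h u]])
  have "(\<integral>p. k p * cnj (tensor h u p) \<partial>(lborel \<Otimes>\<^sub>M lborel))
      = (\<integral>x. (\<integral>w. k (x, w) * cnj (tensor h u (x, w)) \<partial>lborel) \<partial>lborel)"
    by (rule lborel_pair.integral_fst'[OF i, symmetric])
  also have "\<dots> = (\<integral>x. (\<integral>w. (k (x, w) * u w) * cnj (h x) \<partial>lborel) \<partial>lborel)"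
    by (simp add: tensor_apply ac_simps)
  also have "\<dots> = (\<integral>x. kernel_operator k u x * cnj (h x) \<partial>lborel)"
    by (simp add: kernel_operator_def)
  finally show ?thesis by (simp add: L2_inner_def lborel_prod)
qed

lemma norm_integral_cnj:
  fixes h :: "'a \<Rightarrow> complex"
  shows "cmod (\<integral>x. cnj (h x) \<partial>M) = cmod (\<integral>x. h x \<partial>M)"
  by (simp add: integral_cnj)

lemma parseval_scaled_conjugate:
  fixes h :: "'a::euclidean_space \<Rightarrow> complex"
  assumes L: "scales_lborel L D" and L': "L' \<in> borel_measurable borel" "\<And>x. L' (L x) = x" "\<And>x. L (L' x) = x"
    and h: "h \<in> L2 lborel" and v: "\<And>x. L x \<notin> unit_cube \<Longrightarrow> h x = 0"
  shows "ennreal D * (\<integral>\<^sup>+m. ennreal ((cmod (\<integral>x. h x * cis (- (2 * pi * (m \<bullet> L x))) \<partial>lborel))\<^sup>2) \<partial>count_space int_lattice)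
       = ennreal ((L2_norm lborel h)\<^sup>2)"
proof -
  have cL: "(\<lambda>x. cnj (h x)) \<in> L2 lborel" using h by (auto simp: L2_def)
  have "cmod (\<integral>x. h x * cis (- (2 * pi * (m \<bullet> L x))) \<partial>lborel)
      = cmod (\<integral>x. cnj (h x) * cis (2 * pi * (m \<bullet> L x)) \<partial>lborel)" for m
    using norm_integral_cnj[of lborel "\<lambda>x. h x * cis (- (2 * pi * (m \<bullet> L x)))"] by (simp add: cis_cnj)
  moreover have "L2_norm lborel (\<lambda>x. cnj (h x)) = L2_norm lborel h" by (simp add: L2_norm_def)
  ultimately show ?thesis using parseval_scaled[OF L L' cL] v by simp
qed

text \<open>Translating by \<open>c n\<close> costs only a unimodular factor and centres the window.
  Hypothesis \<open>cube\<close> says that B^T maps the support of the window into the unit cube;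
  there the phases become integer characters in B^T x, and |det B| is the Jacobian in the scaled
  Parseval identity. The squared amplitude of the window survives as
  \<open>\<alpha>\<close>.\<close>

lemma gabor_parseval:
  fixes B :: "real^'d^'d" and v :: "real^'d \<Rightarrow> complex"
  assumes B: "det B \<noteq> 0" and v: "v \<in> L2 lborel" and c: "0 < c" and \<alpha>: "0 \<le> \<alpha>"
    and cube: "\<And>x. (1/c) *\<^sub>R x \<in> unit_cube \<Longrightarrow> transpose B *v x \<in> unit_cube"
  defines "f0 \<equiv> \<lambda>x. complex_of_real (sqrt \<alpha>) * indicator unit_cube ((1/c) *\<^sub>R x)"
  shows "(\<integral>\<^sup>+n. (\<integral>\<^sup>+j. ennreal \<bar>det B\<bar> * ennreal ((cmod (\<integral>x. v x * f0 (x - c *\<^sub>R n)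
            * cis (- (2 * pi * (x \<bullet> (B *v j)))) \<partial>lborel))\<^sup>2) \<partial>count_space int_lattice) \<partial>count_space int_lattice)
       = ennreal (\<alpha> * (L2_norm lborel v)\<^sup>2)"
proof -
  have vm[measurable]: "v \<in> borel_measurable borel" by (rule L2_lborel_borel_measurable[OF v])
  have [measurable]: "f0 \<in> borel_measurable borel" unfolding f0_def by measurable
  have L: "scales_lborel ((*v) (transpose B)) \<bar>det B\<bar>" using scales_lborel_matrix[of "transpose B"] B by (simp add: det_transpose)
  obtain B' where B': "B' ** transpose B = mat 1" "transpose B ** B' = mat 1"
    using B invertible_det_nz[of "transpose B"] unfolding invertible_def by (auto simp: det_transpose)
  have dv: "(\<integral>\<^sup>+j. ennreal \<bar>det B\<bar> * ennreal ((cmod (\<integral>x. v x * f0 (x - c *\<^sub>R n)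
            * cis (- (2 * pi * (x \<bullet> (B *v j)))) \<partial>lborel))\<^sup>2) \<partial>count_space int_lattice)
      = ennreal \<alpha> * (\<integral>\<^sup>+x. ennreal ((cmod (v x))\<^sup>2) * indicator unit_cube ((1/c) *\<^sub>R x - n) \<partial>lborel)" for n
  proof -
    define g where "g x = v (x + c *\<^sub>R n) * f0 x" for x
    have g_eq: "g x = complex_of_real (sqrt \<alpha>) * (indicator {x. (1/c) *\<^sub>R x \<in> unit_cube} x * v (x + c *\<^sub>R n))" for x
      by (simp add: g_def f0_def indicator_def)
    have gL: "g \<in> L2 lborel"
      unfolding g_eq[abs_def]
      by (intro L2_scale L2_times_indicator(1) L2_lborel_translate(1)[OF v]) measurable
    have g0: "g x = 0" if "transpose B *v x \<notin> unit_cube" for x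
      using cube[of x] that by (auto simp: g_eq indicator_def)
    have eq: "cmod (\<integral>x. v x * f0 (x - c *\<^sub>R n) * cis (- (2 * pi * (x \<bullet> (B *v j)))) \<partial>lborel)
      = cmod (\<integral>x. g x * cis (- (2 * pi * (j \<bullet> (transpose B *v x)))) \<partial>lborel)" for j
    proof -
      have d: "x \<bullet> (B *v j) = j \<bullet> (transpose B *v x)" for x
        using dot_lmul_matrix[of x B j] by (simp add: inner_commute)
      have "(\<integral>x. v x * f0 (x - c *\<^sub>R n) * cis (- (2 * pi * (x \<bullet> (B *v j)))) \<partial>lborel)
          = (\<integral>x. v (x + c *\<^sub>R n) * f0 (x + c *\<^sub>R n - c *\<^sub>R n) * cis (- (2 * pi * ((x + c *\<^sub>R n) \<bullet> (B *v j)))) \<partial>lborel)"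
        by (rule integral_translate) measurable
      also have "\<dots> = (\<integral>x. g x * cis (- (2 * pi * (x \<bullet> (B *v j)))) * cis (- (2 * pi * ((c *\<^sub>R n) \<bullet> (B *v j)))) \<partial>lborel)"
        by (simp add: g_def inner_add_left distrib_left cis_mult mult.assoc)
      also have "\<dots> = (\<integral>x. g x * cis (- (2 * pi * (j \<bullet> (transpose B *v x)))) \<partial>lborel) * cis (- (2 * pi * ((c *\<^sub>R n) \<bullet> (B *v j))))"
        unfolding d by simp
      finally show ?thesis by (simp add: norm_mult)
    qed
    have "(\<integral>\<^sup>+j. ennreal \<bar>det B\<bar> * ennreal ((cmod (\<integral>x. v x * f0 (x - c *\<^sub>R n)
            * cis (- (2 * pi * (x \<bullet> (B *v j)))) \<partial>lborel))\<^sup>2) \<partial>count_space int_lattice)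
      = ennreal \<bar>det B\<bar> * (\<integral>\<^sup>+j. ennreal ((cmod (\<integral>x. g x * cis (- (2 * pi * (j \<bullet> (transpose B *v x)))) \<partial>lborel))\<^sup>2) \<partial>count_space int_lattice)"
      unfolding eq by (rule nn_integral_cmult) simp
    also have "\<dots> = ennreal ((L2_norm lborel g)\<^sup>2)"
    proof (rule parseval_scaled_conjugate[OF L _ _ _ gL g0])
      show "(*v) B' \<in> borel_measurable borel"
        by (intro borel_measurable_continuous_onI linear_continuous_on) (simp add: linear_linear)
      show "B' *v (transpose B *v x) = x" for x
        by (simp only: matrix_vector_mul_assoc B' matrix_vector_mul_lid)
      show "transpose B *v (B' *v x) = x" for x
        by (simp only: matrix_vector_mul_assoc B' matrix_vector_mul_lid)
    qed
    also have "\<dots> = (\<integral>\<^sup>+x. ennreal ((cmod (g x))\<^sup>2) \<partial>lborel)" by (rule nn_integral_L2[OF gL, symmetric])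
    also have "\<dots> = (\<integral>\<^sup>+x. ennreal \<alpha> * (ennreal ((cmod (v (x + c *\<^sub>R n)))\<^sup>2) * indicator unit_cube ((1/c) *\<^sub>R (x + c *\<^sub>R n) - n)) \<partial>lborel)"
      by (intro nn_integral_cong)
        (use c \<alpha> in \<open>auto simp: g_def f0_def norm_mult power_mult_distrib ennreal_mult indicator_def scaleR_add_right mult.commute\<close>)
    also have "\<dots> = (\<integral>\<^sup>+x. ennreal \<alpha> * (ennreal ((cmod (v x))\<^sup>2) * indicator unit_cube ((1/c) *\<^sub>R x - n)) \<partial>lborel)"
      by (rule nn_integral_translate[symmetric]) measurable
    also have "\<dots> = ennreal \<alpha> * (\<integral>\<^sup>+x. ennreal ((cmod (v x))\<^sup>2) * indicator unit_cube ((1/c) *\<^sub>R x - n) \<partial>lborel)"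
      by (rule nn_integral_cmult) measurable
    finally show ?thesis .
  qed
  have "(\<integral>\<^sup>+n. (\<integral>\<^sup>+j. ennreal \<bar>det B\<bar> * ennreal ((cmod (\<integral>x. v x * f0 (x - c *\<^sub>R n)
            * cis (- (2 * pi * (x \<bullet> (B *v j)))) \<partial>lborel))\<^sup>2) \<partial>count_space int_lattice) \<partial>count_space int_lattice)
    = ennreal \<alpha> * (\<integral>\<^sup>+n. (\<integral>\<^sup>+x. ennreal ((cmod (v x))\<^sup>2) * indicator unit_cube ((1/c) *\<^sub>R x - n) \<partial>lborel) \<partial>count_space int_lattice)"
    unfolding dv by (rule nn_integral_cmult) simp
  also have "\<dots> = ennreal \<alpha> * (\<integral>\<^sup>+x. ennreal ((cmod (v x))\<^sup>2) \<partial>lborel)"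
    by (subst nn_integral_tiling[OF _ c, of "\<lambda>x. ennreal ((cmod (v x))\<^sup>2)"]) simp_all
  also have "\<dots> = ennreal (\<alpha> * (L2_norm lborel v)\<^sup>2)" using \<alpha> by (simp add: nn_integral_L2[OF v] ennreal_mult)
  finally show ?thesis .
qed

text \<open>The vector \<open>u (l, _)\<close> spans the range of the projection at \<open>l\<close>, and \<open>ball 0 R\<close> contains the spectrum.
  The steps \<open>a\<close> (in the center) and \<open>c\<close> (in \<open>M\<close>) are so small that the spectrum and the image of the
  window's support under the transposed \<open>B(l)\<close> fit into the unit cube, where integer characters form
  an orthonormal basis.\<close>

locale gabor_field = adapted_nilpotent_group N P M
  for N :: "('a::t2_space, 'n::euclidean_space, 'k::finite, 'd::finite) based_lie_group" and P M +
  fixes u :: "(real^'k) \<times> (real^'d) \<Rightarrow> complex" and R a c :: real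
  assumes u: "u \<in> borel_measurable borel" "\<And>l. (\<lambda>w. u (l, w)) \<in> L2 lborel"
    and norm_u: "\<And>l. L2_norm lborel (\<lambda>w. u (l, w)) = 1 \<or> (\<lambda>w. u (l, w)) = (\<lambda>_. 0)"
    and a: "0 < a" and c: "0 < c"
    and frequency_cube: "\<And>l :: real^'k. l \<in> ball 0 R \<Longrightarrow> a *\<^sub>R l \<in> unit_cube"
    and space_cube: "\<And>l x. l \<in> ball 0 R \<Longrightarrow> (1/c) *\<^sub>R x \<in> unit_cube \<Longrightarrow> transpose (Bmat N l) *v x \<in> unit_cube"
begin

text \<open>The Jacobian of the dilation by \<open>a\<close> on the frequency space. Parseval in
  \<open>l\<close> leaves this factor on the side of the coefficients; its square root as amplitude
  of the window balances it.\<close>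

definition volume :: real where "volume = a ^ DIM(real^'k)"

definition window :: "real^'d \<Rightarrow> complex" where
  "window x = complex_of_real (sqrt volume) * indicator unit_cube ((1/c) *\<^sub>R x)"

definition generator :: "('k, 'd) coords \<Rightarrow> complex" where
  "generator q = indicator (ball 0 R) (fst q) * tensor window (\<lambda>w. u (fst q, w)) (snd q)"

lemma volume_pos: "0 < volume" by (simp add: volume_def a)

lemma window_L2: "window \<in> L2 lborel"
proof -
  let ?A = "{x :: real^'d. (1/c) *\<^sub>R x \<in> unit_cube}"
  obtain b where b: "\<And>x :: real^'d. x \<in> unit_cube \<Longrightarrow> norm x \<le> b"
    using bounded_unit_cube[where 'a = "real^'d"] unfolding bounded_iff by blast
  have "norm x \<le> c * b" if "x \<in> ?A" for x
    using b[of "(1/c) *\<^sub>R x"] that c by (simp add: field_simps)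
  then have "bounded ?A" unfolding bounded_iff by blast
  then have "emeasure lborel ?A < \<infinity>" by (rule emeasure_bounded_finite)
  moreover have "?A \<in> sets lborel" by measurable
  ultimately have "(\<lambda>x. complex_of_real (sqrt volume) * indicator ?A x) \<in> L2 lborel"
    by (intro L2_scale L2_indicator)
  then show ?thesis by (simp add: window_def[abs_def] indicator_def)
qed

lemma borel_window[measurable]: "window \<in> borel_measurable borel"
  by (rule L2_lborel_borel_measurable[OF window_L2])

lemma borel_generator: "generator \<in> borel_measurable borel"
proof -
  have "(\<lambda>q :: ('k, 'd) coords. window (fst (snd q))) \<in> borel_measurable borel"
    by (rule borel_compose_continuous[OF borel_window]) (intro continuous_intros)
  moreover have "(\<lambda>q :: ('k, 'd) coords. u (fst q, snd (snd q))) \<in> borel_measurable borel"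
    by (rule borel_compose_continuous[OF u(1)]) (intro continuous_intros)
  moreover have "(\<lambda>q :: ('k, 'd) coords. indicator (ball 0 R) (fst q) :: complex) \<in> borel_measurable borel"
    by (rule borel_compose_continuous[where g = "indicator (ball 0 R)"]) (auto intro: continuous_intros borel_measurable_indicator)
  ultimately show ?thesis unfolding generator_def[abs_def] tensor_apply by simp
qed

text \<open>The Plancherel density is continuous, hence bounded on the closed ball, and the vectors
  \<open>u (l, _)\<close> have norm at most 1, so the squared norm is dominated by a multiple of the
  volume of the ball.\<close>

lemma generator_L2: "generator \<in> L2 (field_measure N)"
proof (rule L2I)
  show "generator \<in> borel_measurable (field_measure N)" using borel_generator by simp
  have "compact ((\<lambda>l. det (Bmat N l)) ` cball 0 R)"
    by (intro compact_continuous_image continuous_det_Bmat compact_cball)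
  from compact_imp_bounded[OF this] obtain b where "\<forall>l\<in>cball 0 R. \<bar>det (Bmat N l)\<bar> \<le> b"
    unfolding bounded_iff by auto
  then have b: "\<bar>det (Bmat N l)\<bar> \<le> b" if "l \<in> cball 0 R" for l using that by blast
  have un: "(L2_norm lborel (\<lambda>w. u (l, w)))\<^sup>2 \<le> 1" for l 
  proof -
    have "L2_norm lborel (\<lambda>_ :: real^'d. 0) = 0" by (simp add: L2_norm_def)
    with norm_u[of l] show ?thesis by (elim disjE) simp_all
  qed
  have "(\<integral>\<^sup>+q. ennreal ((cmod (generator q))\<^sup>2) \<partial>field_measure N)
      = (\<integral>\<^sup>+l. ennreal \<bar>det (Bmat N l)\<bar> * (\<integral>\<^sup>+p. ennreal ((cmod (generator (l, p)))\<^sup>2) \<partial>lborel) \<partial>lborel)"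
    using borel_generator by (intro nn_integral_field) simp
  also have "\<dots> \<le> (\<integral>\<^sup>+l. (ennreal b * ennreal ((L2_norm lborel window)\<^sup>2)) * indicator (ball (0 :: real^'k) R) l \<partial>lborel)"
  proof (rule nn_integral_mono)
    fix l :: "real^'k"
    have "(\<integral>\<^sup>+p. ennreal ((cmod (generator (l, p)))\<^sup>2) \<partial>lborel)
        = indicator (ball 0 R) l * (\<integral>\<^sup>+p. ennreal ((cmod (tensor window (\<lambda>w. u (l, w)) p))\<^sup>2) \<partial>lborel)"
      by (simp add: generator_def indicator_def)
    also have "\<dots> \<le> indicator (ball 0 R) l * ennreal ((L2_norm lborel window)\<^sup>2)"
    proof (rule mult_left_mono)
      show "(\<integral>\<^sup>+p. ennreal ((cmod (tensor window (\<lambda>w. u (l, w)) p))\<^sup>2) \<partial>lborel) \<le> ennreal ((L2_norm lborel window)\<^sup>2)"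
        unfolding nn_integral_tensor[OF borel_window u(2)] nn_integral_L2[OF window_L2]
        using un[of l] by (simp add: ennreal_mult[symmetric] mult_left_le ennreal_leI)
    qed simp
    finally have "ennreal \<bar>det (Bmat N l)\<bar> * (\<integral>\<^sup>+p. ennreal ((cmod (generator (l, p)))\<^sup>2) \<partial>lborel)
        \<le> ennreal \<bar>det (Bmat N l)\<bar> * (indicator (ball 0 R) l * ennreal ((L2_norm lborel window)\<^sup>2))"
      by (rule mult_left_mono) simp
    also have "\<dots> \<le> (ennreal b * ennreal ((L2_norm lborel window)\<^sup>2)) * indicator (ball 0 R) l"
      using b[of l] by (auto simp: indicator_def intro!: mult_right_mono ennreal_leI)
    finally show "ennreal \<bar>det (Bmat N l)\<bar> * (\<integral>\<^sup>+p. ennreal ((cmod (generator (l, p)))\<^sup>2) \<partial>lborel)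
        \<le> (ennreal b * ennreal ((L2_norm lborel window)\<^sup>2)) * indicator (ball 0 R) l" .
  qed
  also have "\<dots> = ennreal b * ennreal ((L2_norm lborel window)\<^sup>2) * emeasure lborel (ball (0 :: real^'k) R)"
    by (rule nn_integral_cmult_indicator) simp
  also have "\<dots> < \<infinity>"
    using emeasure_bounded_finite[OF bounded_ball, of "0 :: real^'k" R] by (simp add: ennreal_mult_less_top)
  finally show "(\<integral>\<^sup>+q. ennreal ((cmod (generator q))\<^sup>2) \<partial>field_measure N) < \<infinity>" .
qed

text \<open>The factor v_l of a rank-one kernel, recovered by applying its operator to the unit
  vector u_l.\<close>

definition slice :: "(('k, 'd) coords \<Rightarrow> complex) \<Rightarrow> (real^'k) \<times> (real^'d) \<Rightarrow> complex" where
  "slice K p = kernel_operator (\<lambda>q. K (fst p, q)) (\<lambda>w. u (fst p, w)) (snd p)"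

lemma borel_slice:
  assumes K: "K \<in> borel_measurable borel"
  shows "slice K \<in> borel_measurable borel"
proof -
  have "(\<lambda>q :: ((real^'k) \<times> (real^'d)) \<times> (real^'d). K (fst (fst q), snd (fst q), snd q) * u (fst (fst q), snd q))
      \<in> borel_measurable borel"
    by (intro borel_measurable_times borel_compose_continuous[OF K] borel_compose_continuous[OF u(1)] continuous_intros)
  from borel_measurable_integral_param(1)[OF this] show ?thesis
    unfolding slice_def[abs_def] kernel_operator_def by simp
qed

text \<open>The factor |det B(l)| is the Plancherel density, kept inside the function so that the
  remaining integral over l is an ordinary Fourier integral. The ball comes from the
  generator.\<close>

definition coefficient :: "(('k, 'd) coords \<Rightarrow> complex) \<Rightarrow> real^'d \<Rightarrow> real^'d \<Rightarrow> real^'k \<Rightarrow> complex" where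
  "coefficient K t y l = complex_of_real (\<bar>det (Bmat N l)\<bar> * indicator (ball 0 R) l)
     * (\<integral>x. slice K (l, x) * window (x - t) * cis (- (2 * pi * (x \<bullet> (Bmat N l *v y)))) \<partial>lborel)"

lemma borel_coefficient:
  assumes K: "K \<in> borel_measurable borel"
  shows "coefficient K t y \<in> borel_measurable borel"
proof -
  have c: "(\<lambda>p :: (real^'k) \<times> (real^'d). - (2 * pi * (snd p \<bullet> (Bmat N (fst p) *v y)))) \<in> borel_measurable borel"
  proof -
    have "snd p \<bullet> (Bmat N (fst p) *v y) = - (fst p \<bullet> \<omega> (snd p) y)" for p :: "(real^'k) \<times> (real^'d)"
      by (simp add: inner_\<omega>)
    then show ?thesis
      by (simp only:) (intro borel_measurable_continuous_onI continuous_intros \<omega>.continuous_on)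
  qed
  have w: "(\<lambda>p :: (real^'k) \<times> (real^'d). window (snd p - t)) \<in> borel_measurable borel"
    by (rule borel_compose_continuous[OF borel_window]) (intro continuous_intros)
  have "(\<lambda>p. slice K p * window (snd p - t) * cis (- (2 * pi * (snd p \<bullet> (Bmat N (fst p) *v y)))))
      \<in> borel_measurable borel"
    using borel_slice[OF K] w borel_measurable_cis[OF c] by simp
  from borel_measurable_integral_param(1)[OF this]
  have "(\<lambda>l. \<integral>x. slice K (l, x) * window (x - t) * cis (- (2 * pi * (x \<bullet> (Bmat N l *v y)))) \<partial>lborel)
      \<in> borel_measurable borel" by simp
  moreover have "(\<lambda>l. complex_of_real (\<bar>det (Bmat N l)\<bar> * indicator (ball 0 R) l)) \<in> borel_measurable borel"
  proof -
    have "(indicator (ball 0 R) :: real^'k \<Rightarrow> real) \<in> borel_measurable borel" by (rule borel_measurable_indicator) simp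
    then have "(\<lambda>l. \<bar>det (Bmat N l)\<bar> * indicator (ball 0 R) l) \<in> borel_measurable borel" by simp
    then show ?thesis by (rule measurable_compose) (intro borel_measurable_continuous_onI continuous_intros)
  qed
  ultimately show ?thesis unfolding coefficient_def[abs_def] by (rule borel_measurable_times[rotated])
qed

text \<open>The central coordinate z enters \<open>act\<close> only through a character in l, so
  after integrating out the kernel variables the pairing is a Fourier integral in l. Conjugation in
  the second slot makes all exponents negative.\<close>

lemma inner_act_generator:
  assumes K: "K \<in> L2 (field_measure N)"
  shows "L2_inner (field_measure N) K (act (z, y, t) generator)
    = (\<integral>l. coefficient K t y l * cis (- (2 * pi * (z \<bullet> l))) \<partial>lborel)"
proof -
  let ?A = "act (z, y, t) generator"
  let ?d = "\<lambda>l. \<bar>det (Bmat N l)\<bar>"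
  have A: "?A \<in> L2 (field_measure N)" by (rule act_L2(1)[OF generator_L2])
  have Km: "K \<in> borel_measurable borel" and Am: "?A \<in> borel_measurable borel"
    using L2_field_borel K A by blast+
  have dm: "(\<lambda>p :: ('k, 'd) coords. ?d (fst p)) \<in> borel_measurable borel"
    by (rule borel_compose_continuous[where g = ?d]) (simp, intro continuous_intros)
  have KAm: "(\<lambda>p. K p * cnj (?A p)) \<in> borel_measurable borel" using Km Am by simp
  have i: "integrable (lborel \<Otimes>\<^sub>M lborel) (\<lambda>p. ?d (fst p) *\<^sub>R (K p * cnj (?A p)))"
    using L2_mult_integrable(1)[OF K A] integrable_density[of "\<lambda>p. K p * cnj (?A p)" lborel "\<lambda>p. ?d (fst p)"] KAm dm
    unfolding field_measure_density lborel_prod by simp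
  have "L2_inner (field_measure N) K ?A = (\<integral>p. ?d (fst p) *\<^sub>R (K p * cnj (?A p)) \<partial>(lborel \<Otimes>\<^sub>M lborel))"
    unfolding L2_inner_def field_measure_density lborel_prod
    by (rule integral_density) (use KAm dm in auto)
  also have "\<dots> = (\<integral>l. (\<integral>p. ?d l *\<^sub>R (K (l, p) * cnj (?A (l, p))) \<partial>lborel) \<partial>lborel)"
    using lborel_pair.integral_fst'[OF i] by simp
  also have "\<dots> = (\<integral>l. coefficient K t y l * cis (- (2 * pi * (z \<bullet> l))) \<partial>lborel)"
  proof (rule integral_cong_AE)
    have "(\<lambda>p :: ('k, 'd) coords. ?d (fst p) *\<^sub>R (K p * cnj (?A p))) \<in> borel_measurable borel" using dm KAm by simp
    from borel_measurable_integral_param(1)[OF this]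
    show "(\<lambda>l. \<integral>p. ?d l *\<^sub>R (K (l, p) * cnj (?A (l, p))) \<partial>lborel) \<in> borel_measurable lborel" by simp
    show "(\<lambda>l. coefficient K t y l * cis (- (2 * pi * (z \<bullet> l)))) \<in> borel_measurable lborel"
      using borel_coefficient[OF Km] by measurable
    have "AE l in lborel. (\<lambda>p. K (l, p)) \<in> L2 lborel" using L2_field_sections[OF K] unfolding AE_plancherel_eq .
    then show "AE l in lborel. (\<integral>p. ?d l *\<^sub>R (K (l, p) * cnj (?A (l, p))) \<partial>lborel)
        = coefficient K t y l * cis (- (2 * pi * (z \<bullet> l)))"
    proof eventually_elim
      case (elim l)
      define f where "f x = cis (2 * pi * (x \<bullet> (Bmat N l *v y))) * window (x - t)" for x
      \<comment> \<open>\<open>f\<close> is the window shifted by \<open>t\<close> and modulated by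
        \<open>y\<close>, that is, the image of the window under the representation without its
        central phase; the fibre of the translate is its tensor with
        \<open>u (l, _)\<close>.\<close>
      have fL: "f \<in> L2 lborel"
      proof (rule L2_bound)
        show "(\<lambda>x. window (x + (- t))) \<in> L2 lborel" by (rule L2_lborel_translate(1)[OF window_L2])
        show "f \<in> borel_measurable lborel" unfolding f_def by measurable
      qed (simp add: f_def norm_mult)
      have eq: "?A (l, p) = (cis (2 * pi * (l \<bullet> z)) * indicator (ball 0 R) l) * tensor f (\<lambda>w. u (l, w)) p" for p
        by (simp add: act_def generator_def tensor_apply f_def)
      have "(\<integral>p. ?d l *\<^sub>R (K (l, p) * cnj (?A (l, p))) \<partial>lborel)
        = (\<integral>p. (complex_of_real (?d l * indicator (ball 0 R) l) * cis (- (2 * pi * (l \<bullet> z)))) * (K (l, p) * cnj (tensor f (\<lambda>w. u (l, w)) p)) \<partial>lborel)"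
        unfolding eq by (intro Bochner_Integration.integral_cong) (auto simp: scaleR_conv_of_real cis_cnj indicator_def)
      also have "\<dots> = complex_of_real (?d l * indicator (ball 0 R) l) * cis (- (2 * pi * (l \<bullet> z))) * L2_inner lborel (\<lambda>p. K (l, p)) (tensor f (\<lambda>w. u (l, w)))"
        by (simp add: L2_inner_def)
      also have "L2_inner lborel (\<lambda>p. K (l, p)) (tensor f (\<lambda>w. u (l, w))) = L2_inner lborel (\<lambda>x. slice K (l, x)) f"
        unfolding L2_inner_tensor[OF elim fL u(2)] by (simp add: slice_def[abs_def])
      also have "\<dots> = (\<integral>x. slice K (l, x) * window (x - t) * cis (- (2 * pi * (x \<bullet> (Bmat N l *v y)))) \<partial>lborel)"
        unfolding L2_inner_def
        by (intro Bochner_Integration.integral_cong) (auto simp: f_def window_def cis_cnj indicator_def)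
      finally show ?case by (simp add: coefficient_def inner_commute ac_simps)
    qed
  qed
  finally show ?thesis .
qed

text \<open>For a unit vector the tensor is isometric in its first factor. If the vector is zero,
  the slice vanishes, and so does the kernel almost everywhere, because it is a tensor with
  zero.\<close>

lemma L2_norm_slice:
  assumes "(\<lambda>p. K (l, p)) \<in> rank_one_kernels (\<lambda>w. u (l, w))"
  shows "(\<lambda>x. slice K (l, x)) \<in> L2 lborel"
    and "L2_norm lborel (\<lambda>p. K (l, p)) = L2_norm lborel (\<lambda>x. slice K (l, x))"
proof -
  have K: "(\<lambda>p. K (l, p)) \<in> L2 lborel" using assms by (simp add: rank_one_kernels_def)
  have s: "(\<lambda>x. slice K (l, x)) = kernel_operator (\<lambda>p. K (l, p)) (\<lambda>w. u (l, w))" by (simp add: slice_def)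
  show "(\<lambda>x. slice K (l, x)) \<in> L2 lborel" unfolding s by (rule L2_kernel_operator(1)[OF K u(2)])
  have "(L2_norm lborel (\<lambda>p. K (l, p)))\<^sup>2 = (L2_norm lborel (\<lambda>x. slice K (l, x)))\<^sup>2"
    using norm_u[of l]
  proof
    assume "L2_norm lborel (\<lambda>w. u (l, w)) = 1"
    then show ?thesis unfolding s using rank_one_kernels_norm[OF assms u(2)] by simp
  next
    assume u0: "(\<lambda>w. u (l, w)) = (\<lambda>_. 0)"
    have "L2_norm lborel (\<lambda>_ :: real^'d. 0) = 0" by (simp add: L2_norm_def)
    moreover have "slice K (l, x) = 0" for x unfolding slice_def kernel_operator_def using u0 by (simp add: fun_eq_iff)
    ultimately show ?thesis using rank_one_kernels_norm[OF assms u(2)] u0 by simp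
  qed
  then show "L2_norm lborel (\<lambda>p. K (l, p)) = L2_norm lborel (\<lambda>x. slice K (l, x))"
    by (simp add: L2_norm_def)
qed

text \<open>For fixed l in the ball the sum over translates and modulations is the Gabor identity.
  Outside the ball both sides vanish: the coefficients by the cutoff of the generator, the field by
  the band hypothesis.\<close>

lemma coefficient_energy:
  assumes K: "K \<in> L2 (field_measure N)"
    and rank1: "AE l in plancherel_measure N. (\<lambda>p. K (l, p)) \<in> rank_one_kernels (\<lambda>w. u (l, w))"
    and band: "AE l in plancherel_measure N. l \<notin> ball 0 R \<longrightarrow> (AE p in lborel. K (l, p) = 0)"
  shows "(\<integral>\<^sup>+q. (\<integral>\<^sup>+l. ennreal ((cmod (coefficient K (c *\<^sub>R fst q) (snd q) l))\<^sup>2) \<partial>lborel) \<partial>count_space (int_lattice \<times> int_lattice))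
    = ennreal (volume * (L2_norm (field_measure N) K)\<^sup>2)"
proof -
  have Km: "K \<in> borel_measurable borel" by (rule L2_field_borel[OF K])
  have K2m: "(\<lambda>q. ennreal ((cmod (K q))\<^sup>2)) \<in> borel_measurable borel" using Km by measurable
  let ?h = "\<lambda>q l. ennreal ((cmod (coefficient K (c *\<^sub>R fst q) (snd q) l))\<^sup>2)"
  have hm: "?h q \<in> borel_measurable lborel" for q using borel_coefficient[OF Km] by measurable
  have "(\<integral>\<^sup>+q. (\<integral>\<^sup>+l. ?h q l \<partial>lborel) \<partial>count_space (int_lattice \<times> int_lattice))
      = (\<integral>\<^sup>+l. (\<integral>\<^sup>+q. ?h q l \<partial>count_space (int_lattice \<times> int_lattice)) \<partial>lborel)"
    by (rule nn_integral_count_space_nn_integral[symmetric]) (use hm countable_int_lattice in auto)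
  also have "\<dots> = (\<integral>\<^sup>+l. ennreal volume * (ennreal \<bar>det (Bmat N l)\<bar> * (\<integral>\<^sup>+p. ennreal ((cmod (K (l, p)))\<^sup>2) \<partial>lborel)) \<partial>lborel)"
  proof (rule nn_integral_cong_AE)
    show "AE l in lborel. (\<integral>\<^sup>+q. ?h q l \<partial>count_space (int_lattice \<times> int_lattice))
        = ennreal volume * (ennreal \<bar>det (Bmat N l)\<bar> * (\<integral>\<^sup>+p. ennreal ((cmod (K (l, p)))\<^sup>2) \<partial>lborel))"
      using rank1 band AE_regular unfolding AE_plancherel_eq
    proof eventually_elim
      case (elim l)
      let ?d = "\<bar>det (Bmat N l)\<bar>"
      have KL: "(\<lambda>p. K (l, p)) \<in> L2 lborel" using elim(1) by (simp add: rank_one_kernels_def)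
      show ?case
      proof (cases "l \<in> ball 0 R")
        case True
        let ?F = "\<lambda>n j. \<integral>x. slice K (l, x) * window (x - c *\<^sub>R n) * cis (- (2 * pi * (x \<bullet> (Bmat N l *v j)))) \<partial>lborel"
        \<comment> \<open>The squared density is split: one factor feeds
          \<open>gabor_parseval\<close>, the other becomes the density of the Plancherel
          measure.\<close>
        have h: "?h (n, j) l = ennreal ?d * (ennreal ?d * ennreal ((cmod (?F n j))\<^sup>2))" for n j
          using True unfolding coefficient_def fst_conv snd_conv
          by (simp add: norm_mult power_mult_distrib ennreal_mult[symmetric] power2_eq_square mult.assoc)
        have "(\<integral>\<^sup>+q. ?h q l \<partial>count_space (int_lattice \<times> int_lattice))
            = (\<integral>\<^sup>+n. (\<integral>\<^sup>+j. ennreal ?d * (ennreal ?d * ennreal ((cmod (?F n j))\<^sup>2)) \<partial>count_space int_lattice) \<partial>count_space int_lattice)"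
          unfolding nn_integral_count_space_Times h ..
        also have "\<dots> = ennreal ?d * (\<integral>\<^sup>+n. (\<integral>\<^sup>+j. ennreal ?d * ennreal ((cmod (?F n j))\<^sup>2) \<partial>count_space int_lattice) \<partial>count_space int_lattice)"
          by (simp add: nn_integral_cmult)
        also have "\<dots> = ennreal ?d * ennreal (volume * (L2_norm lborel (\<lambda>x. slice K (l, x)))\<^sup>2)"
          unfolding window_def
          by (subst gabor_parseval[OF elim(3) L2_norm_slice(1)[OF elim(1)] c _ space_cube[OF True]])
            (use volume_pos in auto)
        also have "\<dots> = ennreal volume * (ennreal ?d * (\<integral>\<^sup>+p. ennreal ((cmod (K (l, p)))\<^sup>2) \<partial>lborel))"
          using volume_pos by (simp add: nn_integral_L2[OF KL] L2_norm_slice(2)[where K = K and l = l, OF elim(1)] ennreal_mult mult.left_commute)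
        finally show ?thesis .
      next
        case False
        then have "AE p in lborel. ennreal ((cmod (K (l, p)))\<^sup>2) = 0" using elim(2) by auto
        then have "(\<integral>\<^sup>+p. ennreal ((cmod (K (l, p)))\<^sup>2) \<partial>lborel) = (\<integral>\<^sup>+p. 0 \<partial>(lborel :: ((real^'d) \<times> (real^'d)) measure))"
          by (rule nn_integral_cong_AE)
        then show ?thesis using False by (simp add: coefficient_def)
      qed
    qed
  qed
  also have "\<dots> = ennreal volume * (\<integral>\<^sup>+l. ennreal \<bar>det (Bmat N l)\<bar> * (\<integral>\<^sup>+p. ennreal ((cmod (K (l, p)))\<^sup>2) \<partial>lborel) \<partial>lborel)"
    using borel_measurable_nn_integral_param(1)[OF K2m] by (intro nn_integral_cmult) simp
  also have "\<dots> = ennreal volume * (\<integral>\<^sup>+q. ennreal ((cmod (K q))\<^sup>2) \<partial>field_measure N)"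
    by (simp add: nn_integral_field[OF K2m])
  also have "\<dots> = ennreal (volume * (L2_norm (field_measure N) K)\<^sup>2)"
    using volume_pos by (simp add: nn_integral_L2[OF K] ennreal_mult)
  finally show ?thesis .
qed

text \<open>The finite total energy bounds each single term, so every coefficient function is in L2
  and Parseval in l applies to it. The factor \<open>volume\<close> then appears on both sides and
  cancels.\<close>

lemma frame_identity:
  assumes K: "K \<in> L2 (field_measure N)"
    and rank1: "AE l in plancherel_measure N. (\<lambda>p. K (l, p)) \<in> rank_one_kernels (\<lambda>w. u (l, w))"
    and band: "AE l in plancherel_measure N. l \<notin> ball 0 R \<longrightarrow> (AE p in lborel. K (l, p) = 0)"
  shows "(\<integral>\<^sup>+(q, m). ennreal ((cmod (L2_inner (field_measure N) K (act (a *\<^sub>R m, snd q, c *\<^sub>R fst q) generator)))\<^sup>2)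
      \<partial>count_space ((int_lattice \<times> int_lattice) \<times> int_lattice)) = ennreal ((L2_norm (field_measure N) K)\<^sup>2)"
proof -
  note energy = coefficient_energy[OF assms]
  have Km: "K \<in> borel_measurable borel" by (rule L2_field_borel[OF K])
  let ?S = "\<lambda>q m. ennreal ((cmod (L2_inner (field_measure N) K (act (a *\<^sub>R m, snd q, c *\<^sub>R fst q) generator)))\<^sup>2)"
  have L: "scales_lborel (\<lambda>l :: real^'k. a *\<^sub>R l) volume" unfolding volume_def by (rule scales_lborel_scaleR[OF a])
  have inner_sum: "ennreal volume * (\<integral>\<^sup>+m. ?S q m \<partial>count_space int_lattice)
      = (\<integral>\<^sup>+l. ennreal ((cmod (coefficient K (c *\<^sub>R fst q) (snd q) l))\<^sup>2) \<partial>lborel)"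
    if q: "q \<in> int_lattice \<times> int_lattice" for q
  proof -
    let ?h = "coefficient K (c *\<^sub>R fst q) (snd q)"
    have hL: "?h \<in> L2 lborel"
    proof (rule L2I)
      show "?h \<in> borel_measurable lborel" using borel_coefficient[OF Km] by simp
      have "(\<integral>\<^sup>+l. ennreal ((cmod (?h l))\<^sup>2) \<partial>lborel) \<le> ennreal (volume * (L2_norm (field_measure N) K)\<^sup>2)"
        unfolding energy[symmetric]
        using nn_integral_ge_point[OF q, of "\<lambda>q. \<integral>\<^sup>+l. ennreal ((cmod (coefficient K (c *\<^sub>R fst q) (snd q) l))\<^sup>2) \<partial>lborel"] .
      also have "\<dots> < \<infinity>" by simp
      finally show "(\<integral>\<^sup>+l. ennreal ((cmod (?h l))\<^sup>2) \<partial>lborel) < \<infinity>" .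
    qed
    have "ennreal volume * (\<integral>\<^sup>+m. ennreal ((cmod (\<integral>l. ?h l * cis (- (2 * pi * (m \<bullet> (a *\<^sub>R l)))) \<partial>lborel))\<^sup>2) \<partial>count_space int_lattice)
        = ennreal ((L2_norm lborel ?h)\<^sup>2)"
    proof (rule parseval_scaled_conjugate[OF L _ _ _ hL])
      show "(\<lambda>l :: real^'k. (1/a) *\<^sub>R l) \<in> borel_measurable borel" by measurable
      show "(1/a) *\<^sub>R a *\<^sub>R l = l" "a *\<^sub>R (1/a) *\<^sub>R l = l" for l :: "real^'k" using a by simp_all
      show "?h l = 0" if "a *\<^sub>R l \<notin> unit_cube" for l
        using frequency_cube[of l] that by (auto simp: coefficient_def indicator_def)
    qed
    then show ?thesis by (simp add: inner_act_generator[OF K] nn_integral_L2[OF hL])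
  qed
  have "ennreal volume * (\<integral>\<^sup>+(q, m). ?S q m \<partial>count_space ((int_lattice \<times> int_lattice) \<times> int_lattice))
      = (\<integral>\<^sup>+q. ennreal volume * (\<integral>\<^sup>+m. ?S q m \<partial>count_space int_lattice) \<partial>count_space (int_lattice \<times> int_lattice))"
    by (simp add: nn_integral_count_space_Times nn_integral_cmult)
  also have "\<dots> = (\<integral>\<^sup>+q. (\<integral>\<^sup>+l. ennreal ((cmod (coefficient K (c *\<^sub>R fst q) (snd q) l))\<^sup>2) \<partial>lborel) \<partial>count_space (int_lattice \<times> int_lattice))"
    by (intro nn_integral_cong inner_sum) simp
  also have "\<dots> = ennreal volume * ennreal ((L2_norm (field_measure N) K)\<^sup>2)"
    using energy volume_pos by (simp add: ennreal_mult)
  finally show ?thesis using volume_pos by (simp add: ennreal_mult_cancel_left)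
qed

end

section \<open>The quasi-lattice, and the transport of the frame identity to the group\<close>

lemma unit_cubeI: "norm x < 1/2 \<Longrightarrow> x \<in> unit_cube"
  unfolding unit_cube_def
proof clarify
  fix b :: 'a assume "norm x < 1/2" "b \<in> Basis"
  then show "- 1/2 \<le> x \<bullet> b \<and> x \<bullet> b < 1/2" using Basis_le_norm[of b x] by linarith
qed

context adapted_nilpotent_group
begin

lemma coord_mult_triple: "coord_mult (z, y, t) (z', y', t') = (z + z' + \<omega> t y', y + y', t + t')"
  by (simp add: coord_mult_def)

text \<open>The tile is the image of a box with sides \<open>a\<close>, 1 and \<open>c\<close> in
  the three blocks of coordinates. The lattice point for a given element is found by triangular
  elimination: t and y are rounded independently, and z is rounded after the resulting shear has
  been subtracted. The tiles are disjoint, not merely almost disjoint.\<close>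

lemma quasi_lattice_gcoord:
  fixes a c :: real
  assumes a: "0 < a" and c: "0 < c"
  shows "quasi_lattice N ((\<lambda>(q, m). gcoord (a *\<^sub>R m, snd q, c *\<^sub>R fst q)) ` ((int_lattice \<times> int_lattice) \<times> int_lattice))"
proof -
  let ?I = "(int_lattice \<times> int_lattice) \<times> int_lattice :: (((real^'d) \<times> (real^'d)) \<times> (real^'k)) set"
  let ?\<pi> = "\<lambda>(q, m). gcoord (a *\<^sub>R m, snd q, c *\<^sub>R fst q)"
  define D :: "('k, 'd) coords set" where
    "D = {p. (1/a) *\<^sub>R fst p \<in> unit_cube \<and> fst (snd p) \<in> unit_cube \<and> (1/c) *\<^sub>R snd (snd p) \<in> unit_cube}"
  define C where "C = gcoord ` D"
  have C: "C = gcoord_inv -` D" 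
  proof (intro equalityI subsetI)
    fix x assume "x \<in> gcoord_inv -` D"
    then show "x \<in> C" unfolding C_def using gcoord_gcoord_inv[of x] by (metis image_eqI vimageE)
  qed (auto simp: C_def)
  have cube: "T -` unit_cube \<in> sets borel" if "continuous_on UNIV T" for T :: "('k, 'd) coords \<Rightarrow> 'b::euclidean_space"
    using measurable_sets_borel[OF borel_measurable_continuous_onI[OF that] borel_unit_cube] by simp
  have "D = (\<lambda>p. (1/a) *\<^sub>R fst p) -` unit_cube \<inter> (\<lambda>p. fst (snd p)) -` unit_cube \<inter> (\<lambda>p. (1/c) *\<^sub>R snd (snd p)) -` unit_cube"
    by (auto simp: D_def)
  then have "D \<in> sets borel" by (simp only:) (intro sets.Int cube continuous_intros)
  then have Cb: "C \<in> sets borel" unfolding C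
    using measurable_sets_borel[OF borel_gcoord_inv] by simp
  have "bounded D"
  proof -
    have b: "bounded {x :: 'b::euclidean_space. (1/r) *\<^sub>R x \<in> unit_cube}" if "0 < r" for r :: real
    proof -
      have "{x :: 'b. (1/r) *\<^sub>R x \<in> unit_cube} \<subseteq> (\<lambda>x. r *\<^sub>R x) ` unit_cube"
        using that by (auto simp: image_iff intro!: bexI[of _ "(1/r) *\<^sub>R x" for x])
      then show ?thesis by (rule bounded_subset[OF bounded_scaling[OF bounded_unit_cube]])
    qed
    have "D \<subseteq> {x. (1/a) *\<^sub>R x \<in> unit_cube} \<times> unit_cube \<times> {x. (1/c) *\<^sub>R x \<in> unit_cube}" by (auto simp: D_def)
    then show ?thesis
      by (rule bounded_subset[rotated]) (intro bounded_Times b a c bounded_unit_cube)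
  qed
  then have K: "compact (gcoord ` closure D)"
    by (intro compact_continuous_image continuous_gcoord) (simp add: compact_closure)
  have "closure C \<subseteq> gcoord ` closure D"
    by (rule closure_minimal[OF _ compact_imp_closed[OF K]]) (use closure_subset[of D] in \<open>auto simp: C_def\<close>)
  then have Cc: "compact (closure C)"
    using compact_Int_closed[OF K closed_closure[of C]] by (simp add: Int_absorb1)
  \<comment> \<open>Membership in a translate of the tile determines all three lattice vectors; read
    from right to left it gives the covering, from left to right the disjointness.\<close>
  have mem: "gcoord (z, y, t) \<in> (\<lambda>x. ?\<pi> (q, m) \<otimes> x) ` C \<longleftrightarrow>
      fst q = nearest_lattice_point ((1/c) *\<^sub>R t) \<and> snd q = nearest_lattice_point y \<and>
      m = nearest_lattice_point ((1/a) *\<^sub>R (z - \<omega> (c *\<^sub>R fst q) (y - snd q)))"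
    if q: "(q, m) \<in> ?I" for z y t q m
  proof -
    let ?d = "(z - a *\<^sub>R m - \<omega> (c *\<^sub>R fst q) (y - snd q), y - snd q, t - c *\<^sub>R fst q)"
    have "coord_mult (a *\<^sub>R m, snd q, c *\<^sub>R fst q) d = (z, y, t) \<longleftrightarrow> d = ?d" for d
      by (cases d) (auto simp: coord_mult_triple)
    then have "gcoord (z, y, t) = ?\<pi> (q, m) \<otimes> gcoord d \<longleftrightarrow> d = ?d" for d
      using bij_gcoord unfolding case_prod_conv gcoord_mult by (metis gcoord_inv_gcoord)
    then have "gcoord (z, y, t) \<in> (\<lambda>x. ?\<pi> (q, m) \<otimes> x) ` C \<longleftrightarrow> ?d \<in> D"
      unfolding C_def by (auto simp: image_iff)
    also have "\<dots> \<longleftrightarrow> (1/a) *\<^sub>R (z - \<omega> (c *\<^sub>R fst q) (y - snd q)) - m \<in> unit_cube \<and> y - snd q \<in> unit_cube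
        \<and> (1/c) *\<^sub>R t - fst q \<in> unit_cube"
    proof -
      have "(1/a) *\<^sub>R (z - a *\<^sub>R m - \<omega> (c *\<^sub>R fst q) (y - snd q)) = (1/a) *\<^sub>R (z - \<omega> (c *\<^sub>R fst q) (y - snd q)) - m"
        "(1/c) *\<^sub>R (t - c *\<^sub>R fst q) = (1/c) *\<^sub>R t - fst q"
        using a c by (simp_all add: algebra_simps)
      then show ?thesis by (simp add: D_def)
    qed
    finally show ?thesis using q by (auto simp: diff_in_unit_cube_iff)
  qed
  show ?thesis
    unfolding quasi_lattice_def carrier_UNIV
  proof (intro conjI exI[of _ C] ballI impI)
    show "countable (?\<pi> ` ?I)" by (intro countable_image countable_SIGMA countable_int_lattice)
    show "(\<Union>\<gamma>\<in>?\<pi> ` ?I. (\<lambda>x. \<gamma> \<otimes> x) ` C) = UNIV"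
    proof (rule UNIV_eq_I[symmetric])
      fix x
      obtain z y t where x: "x = gcoord (z, y, t)" by (metis gcoord_gcoord_inv prod_cases3)
      define q where "q = (nearest_lattice_point ((1/c) *\<^sub>R t), nearest_lattice_point y)"
      define m where "m = nearest_lattice_point ((1/a) *\<^sub>R (z - \<omega> (c *\<^sub>R fst q) (y - snd q)))"
      have "(q, m) \<in> ?I" by (simp add: q_def m_def nearest_lattice_point)
      moreover from mem[OF this] have "x \<in> (\<lambda>x. ?\<pi> (q, m) \<otimes> x) ` C" unfolding x by (simp add: q_def m_def)
      ultimately show "x \<in> (\<Union>\<gamma>\<in>?\<pi> ` ?I. (\<lambda>x. \<gamma> \<otimes> x) ` C)" by blast
    qed
    fix \<gamma> \<gamma>' assume "\<gamma> \<in> ?\<pi> ` ?I" "\<gamma>' \<in> ?\<pi> ` ?I" and ne: "\<gamma> \<noteq> \<gamma>'"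
    then obtain q m q' m' where q: "(q, m) \<in> ?I" "(q', m') \<in> ?I" "\<gamma> = ?\<pi> (q, m)" "\<gamma>' = ?\<pi> (q', m')" by blast
    have "x \<notin> (\<lambda>x. \<gamma> \<otimes> x) ` C \<inter> (\<lambda>x. \<gamma>' \<otimes> x) ` C" for x
    proof
      obtain z y t where x: "x = gcoord (z, y, t)" by (metis gcoord_gcoord_inv prod_cases3)
      assume "x \<in> (\<lambda>x. \<gamma> \<otimes> x) ` C \<inter> (\<lambda>x. \<gamma>' \<otimes> x) ` C"
      then have "gcoord (z, y, t) \<in> (\<lambda>x. ?\<pi> (q, m) \<otimes> x) ` C" "gcoord (z, y, t) \<in> (\<lambda>x. ?\<pi> (q', m') \<otimes> x) ` C"
        unfolding q(3,4) x by blast+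
      then have "q = q'" "m = m'" unfolding mem[OF q(1)] mem[OF q(2)] by (auto simp: prod_eq_iff)
      then show False using ne q(3,4) by simp
    qed
    then have "(\<lambda>x. \<gamma> \<otimes> x) ` C \<inter> (\<lambda>x. \<gamma>' \<otimes> x) ` C = {}" by blast
    then show "(\<lambda>x. \<gamma> \<otimes> x) ` C \<inter> (\<lambda>x. \<gamma>' \<otimes> x) ` C \<in> null_sets (haar N)" by simp
  qed (use Cb Cc in auto)
qed

text \<open>The squared norm of B^T x is minus the pairing of l with
  \<open>\<omega> x (B^T x)\<close>, so boundedness of \<open>\<omega>\<close> gives a bound linear
  in both l and x. Linearity in l makes it uniform on the spectrum.\<close>

lemma norm_Bmat_bound:
  obtains b where "0 \<le> b" "\<And>l x. norm (transpose (Bmat N l) *v x) \<le> b * norm l * norm x"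
proof -
  obtain b where b: "0 \<le> b" "\<And>t y. norm (\<omega> t y) \<le> norm t * norm y * b" using \<omega>.nonneg_bounded by blast
  show ?thesis
  proof (rule that[OF b(1)])
    fix l :: "real^'k" and x :: "real^'d"
    let ?y = "transpose (Bmat N l) *v x"
    have "norm ?y * norm ?y = ?y \<bullet> ?y" by (metis power2_norm_eq_inner power2_eq_square)
    also have "\<dots> = x \<bullet> (Bmat N l *v ?y)" by (simp add: dot_lmul_matrix)
    also have "\<dots> = - (l \<bullet> \<omega> x ?y)" by (simp add: inner_\<omega>)
    also have "\<dots> \<le> norm l * norm (\<omega> x ?y)" using Cauchy_Schwarz_ineq2[of l "\<omega> x ?y"] by linarith
    also have "\<dots> \<le> norm l * (norm x * norm ?y * b)" by (intro mult_left_mono b) simp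
    finally have "norm ?y * norm ?y \<le> (b * norm l * norm x) * norm ?y" by (simp add: mult.assoc mult.left_commute mult.commute)
    then show "norm ?y \<le> b * norm l * norm x"
      using b(1) by (cases "norm ?y = 0") (simp_all add: mult_le_cancel_right)
  qed
qed

end

context gabor_field
begin

lemma inj_lattice_points: "inj_on (\<lambda>(q, m). gcoord (a *\<^sub>R m, snd q, c *\<^sub>R fst q)) A"
proof (rule inj_onI)
  fix p r assume "(\<lambda>(q, m). gcoord (a *\<^sub>R m, snd q, c *\<^sub>R fst q)) p = (\<lambda>(q, m). gcoord (a *\<^sub>R m, snd q, c *\<^sub>R fst q)) r"
  then have "gcoord (a *\<^sub>R snd p, snd (fst p), c *\<^sub>R fst (fst p)) = gcoord (a *\<^sub>R snd r, snd (fst r), c *\<^sub>R fst (fst r))"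
    by (simp add: split_beta)
  then have "(a *\<^sub>R snd p, snd (fst p), c *\<^sub>R fst (fst p)) = (a *\<^sub>R snd r, snd (fst r), c *\<^sub>R fst (fst r))"
    by (metis gcoord_inv_gcoord)
  then show "p = r" using a c by (simp add: prod_eq_iff)
qed

text \<open>Inner products and norms are carried to the Plancherel side, where left translation is
  \<open>act\<close>; injectivity of the parametrisation turns the sum over index triples into a sum
  over the set of group elements.\<close>

lemma parseval_frame_generator:
  assumes H: "H \<subseteq> L2 (haar N)" "left_invariant N H"
    and rank1: "\<And>f K. f \<in> H \<Longrightarrow> plancherel_transform N f K \<Longrightarrow>
      AE l in plancherel_measure N. (\<lambda>p. K (l, p)) \<in> rank_one_kernels (\<lambda>w. u (l, w))"
    and band: "\<And>f K. f \<in> H \<Longrightarrow> plancherel_transform N f K \<Longrightarrow>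
      AE l in plancherel_measure N. l \<notin> ball 0 R \<longrightarrow> (AE p in lborel. K (l, p) = 0)"
    and \<phi>: "\<phi> \<in> H" "plancherel_transform N \<phi> generator"
  shows "parseval_frame (haar N) H ((\<lambda>(q, m). gcoord (a *\<^sub>R m, snd q, c *\<^sub>R fst q)) ` ((int_lattice \<times> int_lattice) \<times> int_lattice))
    (\<lambda>\<gamma>. left_regular N \<gamma> \<phi>)"
  unfolding parseval_frame_def
proof (intro conjI ballI)
  let ?I = "(int_lattice \<times> int_lattice) \<times> int_lattice :: (((real^'d) \<times> (real^'d)) \<times> (real^'k)) set"
  let ?\<pi> = "\<lambda>(q, m). gcoord (a *\<^sub>R m, snd q, c *\<^sub>R fst q)"
  show "countable (?\<pi> ` ?I)" by (intro countable_image countable_SIGMA countable_int_lattice)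
  show "left_regular N \<gamma> \<phi> \<in> H" for \<gamma> using H(2) \<phi>(1) by (simp add: left_invariant_def)
  fix g assume g: "g \<in> H"
  then obtain K where K: "plancherel_transform N g K" using plancherel_transform_exists H(1) by blast
  have KL: "K \<in> L2 (field_measure N)" by (rule plancherel_transform_L2(2)[OF K])
  have inner: "L2_inner (haar N) g (left_regular N (?\<pi> (q, m)) \<phi>)
      = L2_inner (field_measure N) K (act (a *\<^sub>R m, snd q, c *\<^sub>R fst q) generator)" for q m
    unfolding case_prod_conv by (rule plancherel_transform_inner[OF K plancherel_transform_translate[OF \<phi>(2)]])
  have "(\<integral>\<^sup>+r. ennreal ((cmod (L2_inner (haar N) g (left_regular N (?\<pi> r) \<phi>)))\<^sup>2) \<partial>count_space ?I)
      = ennreal ((L2_norm (haar N) g)\<^sup>2)"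
    using frame_identity[OF KL rank1[OF g K] band[OF g K]] plancherel_transform_norm[OF K]
    by (simp add: inner[unfolded case_prod_conv] split_beta')
  then have "((\<lambda>r. (cmod (L2_inner (haar N) g (left_regular N (?\<pi> r) \<phi>)))\<^sup>2) has_sum (L2_norm (haar N) g)\<^sup>2) ?I"
    by (intro has_sum_if_nn_integral_count_space) auto
  then show "((\<lambda>\<gamma>. (cmod (L2_inner (haar N) g (left_regular N \<gamma> \<phi>)))\<^sup>2) has_sum (L2_norm (haar N) g)\<^sup>2) (?\<pi> ` ?I)"
    unfolding has_sum_reindex[OF inj_lattice_points] o_def .
qed

end

section \<open>From the projection fields of H to the Parseval frame\<close>

context adapted_nilpotent_group
begin

text \<open>Multiplicity-freeness and bounded spectrum each supply a projection field of their own.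
  The set \<open>A\<close> and the vectors \<open>u\<close> are parameters so that the lemma serves
  both: all frequencies with the spanning vectors for the one, the frequencies outside the spectrum
  with the zero vector for the other. The two fields are never compared.\<close>

lemma spectral_field_fibers:
  assumes Q: "spectral_field N H Q" and f: "f \<in> H" "plancherel_transform N f K"
    and u: "\<And>l. (\<lambda>w. u (l, w)) \<in> L2 lborel"
      "\<And>l. L2_norm lborel (\<lambda>w. u (l, w)) = 1 \<or> (\<lambda>w. u (l, w)) = (\<lambda>_. 0)"
    and Qu: "AE l in plancherel_measure N. l \<in> A \<longrightarrow> (\<forall>F\<in>L2 lborel. \<exists>c. AE w in lborel. Q l F w = c * u (l, w))"
  shows "AE l in plancherel_measure N. l \<in> A \<longrightarrow> (\<lambda>p. K (l, p)) \<in> rank_one_kernels (\<lambda>w. u (l, w))"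
proof -
  have proj: "orthogonal_projection lborel (Q l)" if "l \<in> Sigma_set N" for l
    using Q that by (simp add: spectral_field_def measurable_projection_field_def)
  have "K \<in> {K. \<exists>f\<in>H. plancherel_transform N f K}" using f by blast
  then have "AE l in plancherel_measure N. (\<lambda>p. K (l, p)) \<in> L2_tensor (Q l ` L2 lborel)"
    using Q unfolding spectral_field_def by simp
  moreover have "AE l in plancherel_measure N. l \<in> Sigma_set N"
    using AE_regular unfolding AE_plancherel_eq by (simp add: Sigma_set_def)
  ultimately show ?thesis
    using Qu
  proof eventually_elim
    case (elim l)
    show ?case
    proof
      assume "l \<in> A"
      then have "L2_tensor (Q l ` L2 lborel) \<subseteq> rank_one_kernels (\<lambda>w. u (l, w))"
        using elim(3) orthogonal_projection_L2[OF proj[OF elim(2)]]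
        by (intro L2_tensor_subset_rank_one_kernels u) auto
      then show "(\<lambda>p. K (l, p)) \<in> rank_one_kernels (\<lambda>w. u (l, w))" using elim(1) by blast
    qed
  qed
qed

theorem exists_parseval_frame:
  assumes H: "L2_closed_subspace (haar N) H" "left_invariant N H"
    and mf: "multiplicity_free N H" and bs: "bounded_spectrum N H"
  shows "\<exists>\<Gamma> \<phi>. quasi_lattice N \<Gamma> \<and> \<phi> \<in> H \<and> parseval_frame (haar N) H \<Gamma> (\<lambda>\<gamma>. left_regular N \<gamma> \<phi>)"
proof -
  obtain Q where Q: "spectral_field N H Q" and rank: "AE l in plancherel_measure N. rank_le_one lborel (Q l)"
    using mf unfolding multiplicity_free_def by blast
  obtain Q' E where Q': "spectral_field N H Q'" and E: "bounded E"
    "AE l in plancherel_measure N. l \<notin> E \<longrightarrow> zero_operator lborel (Q' l)"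
    using bs unfolding bounded_spectrum_def by blast
  obtain R where R: "0 < R" "E \<subseteq> ball 0 R"
    using bounded_subset_ballD[OF E(1), of 0] by blast
  have proj: "orthogonal_projection lborel (Q l)" if "l \<in> Sigma_set N" for l
    using Q that by (simp add: spectral_field_def measurable_projection_field_def)
  have regular: "AE l in plancherel_measure N. l \<in> Sigma_set N"
    using AE_regular unfolding AE_plancherel_eq by (simp add: Sigma_set_def)
  have mp: "measurable_projection_field N Q" using Q by (simp add: spectral_field_def)
  obtain u :: "(real^'k) \<times> (real^'d) \<Rightarrow> complex" where u: "u \<in> borel_measurable borel"
    "\<And>l. (\<lambda>w. u (l, w)) \<in> L2 lborel"
    "\<And>l. L2_norm lborel (\<lambda>w. u (l, w)) = 1 \<or> (\<lambda>w. u (l, w)) = (\<lambda>_. 0)"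
    and uQ: "AE l in plancherel_measure N. \<exists>F\<in>L2 lborel. AE w in lborel. u (l, w) = Q l F w"
    and Qu: "AE l in plancherel_measure N. \<forall>F\<in>L2 lborel. \<exists>c. AE w in lborel. Q l F w = c * u (l, w)"
    by (rule measurable_unit_section[OF mp rank], rule that, assumption+)
  obtain \<beta> where \<beta>: "0 \<le> \<beta>" "\<And>l x. norm (transpose (Bmat N l) *v x) \<le> \<beta> * norm l * norm x"
    using norm_Bmat_bound by blast
  obtain b where b: "\<And>x :: real^'d. x \<in> unit_cube \<Longrightarrow> norm x \<le> b"
    using bounded_unit_cube[where 'a = "real^'d"] unfolding bounded_iff by blast
  have "(0 :: real^'d) \<in> unit_cube" by (rule unit_cubeI) simp
  from b[OF this] have b0: "0 \<le> b" by simp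
  \<comment> \<open>On the ball the norm of \<open>a l\<close> is then below R / (2 (R + 1)), hence
    below 1/2, which places it in the unit cube.\<close>
  define a where "a = 1 / (2 * (R + 1))"
  \<comment> \<open>On the support of the window the norm of x is at most \<open>c b\<close>, so B^T
    x has norm at most \<open>\<beta> R b c\<close>, which this choice makes smaller than 1/2; the
    added 1 keeps the denominator positive.\<close>
  define c where "c = 1 / (2 * (\<beta> * R * b + 1))"
  have a: "0 < a" using R by (simp add: a_def)
  have c: "0 < c" using R b0 \<beta>(1) by (simp add: c_def add_nonneg_pos)
  interpret gabor_field N P M u R a c
  proof unfold_locales
    show "a *\<^sub>R l \<in> unit_cube" if "l \<in> ball 0 R" for l :: "real^'k"
    proof (rule unit_cubeI)
      have "norm (a *\<^sub>R l) < a * R" using that a by simp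
      also have "\<dots> < 1/2" using R by (simp add: a_def field_simps)
      finally show "norm (a *\<^sub>R l) < 1/2" .
    qed
    show "transpose (Bmat N l) *v x \<in> unit_cube" if l: "l \<in> ball 0 R" and x: "(1/c) *\<^sub>R x \<in> unit_cube" for l x
    proof (rule unit_cubeI)
      have "norm x \<le> c * b" using b[OF x] c by (simp add: field_simps)
      then have "\<beta> * norm l * norm x \<le> \<beta> * R * (c * b)"
        using l \<beta>(1) R(1) by (intro mult_mono) auto
      also have "\<dots> < 1/2"
      proof -
        have "0 \<le> \<beta> * R * b" using \<beta>(1) R(1) b0 by simp
        then have "(\<beta> * R * b) / (2 * (\<beta> * R * b + 1)) < 1/2" by (simp add: divide_simps)
        then show ?thesis by (simp add: c_def field_simps)
      qed
      finally show "norm (transpose (Bmat N l) *v x) < 1/2" using \<beta>(2)[of l x] by linarith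
    qed
  qed (use u a c in auto)
  have "AE l in plancherel_measure N. (\<lambda>p. generator (l, p)) \<in> L2_tensor (Q l ` L2 lborel)"
    using uQ regular L2_field_sections[OF generator_L2]
  proof eventually_elim
    case (elim l)
    obtain F where F: "F \<in> L2 lborel" "AE w in lborel. u (l, w) = Q l F w" using elim(1) by blast
    show ?case
    \<comment> \<open>The fibre of the generator is an elementary tensor whose second factor is, up
      to a null set, a value of the projection; the cutoff to the ball is put into the first
      factor.\<close>
    proof (rule L2_tensor_memberI[OF L2_scale[OF window_L2] imageI[OF F(1)] elim(3)])
      show "AE p in lborel. generator (l, p) = tensor (\<lambda>x. indicator (ball 0 R) l * window x) (Q l F) p"
        using AE_lborel_snd[OF F(2)] by eventually_elim (simp add: generator_def tensor_apply)
      show "Q l ` L2 lborel \<subseteq> L2 lborel" using orthogonal_projection_L2[OF proj[OF elim(2)]] by blast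
    qed
  qed
  \<comment> \<open>Here the generator is realised as a transform: the image of H contains every L2
    field whose fibres lie in the prescribed tensor spaces.\<close>
  then have "generator \<in> {K. \<exists>f\<in>H. plancherel_transform N f K}"
    using Q generator_L2 unfolding spectral_field_def by simp
  then obtain \<phi> where \<phi>: "\<phi> \<in> H" "plancherel_transform N \<phi> generator" by blast
  have "parseval_frame (haar N) H ((\<lambda>(q, m). gcoord (a *\<^sub>R m, snd q, c *\<^sub>R fst q)) ` ((int_lattice \<times> int_lattice) \<times> int_lattice))
    (\<lambda>\<gamma>. left_regular N \<gamma> \<phi>)"
  proof (rule parseval_frame_generator[OF _ H(2) _ _ \<phi>])
    show "H \<subseteq> L2 (haar N)" using H(1) by (simp add: L2_closed_subspace_def)
    fix f K assume f: "f \<in> H" "plancherel_transform N f K"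
    show "AE l in plancherel_measure N. (\<lambda>p. K (l, p)) \<in> rank_one_kernels (\<lambda>w. u (l, w))"
      using spectral_field_fibers[OF Q f u(2) norm_u, of UNIV] Qu by simp
    \<comment> \<open>Outside the spectrum the values of the second field are multiples of the zero
      vector, and a rank-one kernel over the zero vector vanishes almost everywhere.\<close>
    have "AE l in plancherel_measure N. l \<in> - E \<longrightarrow> (\<forall>F\<in>L2 lborel. \<exists>c. AE w in lborel. Q' l F w = c * 0)"
      using E(2) by eventually_elim (auto simp: zero_operator_def)
    then have "AE l in plancherel_measure N. l \<in> - E \<longrightarrow> (\<lambda>p. K (l, p)) \<in> rank_one_kernels (\<lambda>w. 0)"
      by (intro spectral_field_fibers[OF Q' f, where u = "\<lambda>_. 0"] L2_zero) auto
    then show "AE l in plancherel_measure N. l \<notin> ball 0 R \<longrightarrow> (AE p in lborel. K (l, p) = 0)"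
      by eventually_elim (use R(2) in \<open>auto simp: rank_one_kernels_def tensor_apply\<close>)
  qed
  then show ?thesis using quasi_lattice_gcoord[OF a c] \<phi>(1) by blast
qed

end

theorem theorem1:
  fixes N :: "('a::t2_space, 'n::euclidean_space, 'k::finite, 'd::finite) based_lie_group"
    and P M :: "'a set"
    and H :: "('a \<Rightarrow> complex) set"
  assumes "two_step_nilpotent_lie_group N"
    and "connected (UNIV :: 'a set)" and "simply_connected (UNIV :: 'a set)"
    and "semidirect_product N P M"
    and "maximal_commutative_normal N P" and "group_center N \<subseteq> P"
    and "commutative_set N M" and "acts_nontrivially N M P"
    and "connected P" and "simply_connected P"
    and "connected M" and "simply_connected M"
    and "dim (lie_algebra_of N P) - dim (lie_algebra_of N (group_center N))
           = dim (lie_algebra_of N M)"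
    and "adapted_basis N P M"
    and "square_integrable_mod_center N"
    and "L2_closed_subspace (haar N) H" and "left_invariant N H"
    and "multiplicity_free N H" and "bounded_spectrum N H"
  shows "\<exists>\<Gamma> \<phi>. quasi_lattice N \<Gamma> \<and> \<phi> \<in> H \<and>
           parseval_frame (haar N) H \<Gamma> (\<lambda>\<gamma>. left_regular N \<gamma> \<phi>)"
proof -
  interpret two_step_nilpotent_lie_group N by fact
  interpret adapted_nilpotent_group N P M
    by unfold_locales (use assms in \<open>auto simp: maximal_commutative_normal_def\<close>)
  show ?thesis by (rule exists_parseval_frame) fact+
qed

end
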